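(* Let $\tilde\omega_j>0$ ($j=2,\dots,p$) be damping parameters satisfying $\tilde\omega_j\,\rho(\tilde{\mathbb{D}}_j^{-1}\tilde{\mathbb{A}}_j)\le 1$ and $\tilde\omega_j\approx(p+1)^{-1}$. With the inherited bilinear forms, the $W$-cycle $p$-multigrid algorithm at level $k$ converges if $m\gtrsim p^2k^{-1}$: there exist constants $C_0,C>0$ with $C/C_0<1$, independent of $h$ and of the polynomial degrees $k,p$, such that for every $k\in\{2,\dots,p\}$ and every number of smoothing steps $m\ge C_0\,p^2k^{-1}$, $$\|\tilde{\mathbb{E}}^{\rm W}_{k,m}\mathbf{g}_k\|_{\tilde{\mathbb{A}}_k,1}\le C\,\frac{p^2}{k\,m}\,\|\mathbf{g}_k\|_{\tilde{\mathbb{A}}_k,1}\qquad\forall\,\mathbf{g}_k\in\mathbb{R}^{N_hN_k}.$$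
   Context: Setting. $\Omega\subset\mathbb{R}^d$ is an axis-parallel open rectangular box, $\mathcal{T}_h$ a uniform Cartesian mesh of $\Omega$ by $N_h$ cubes (intervals/squares if $d=1,2$) of edge length $h$, and $\mathcal{F}_h$ the set of all interior and boundary faces. For $T\in\mathcal{T}_h$ with affine map $\boldsymbol{F}_T:[-1,1]^d\to T$ and $\boldsymbol\sigma\in\mathbb{N}^d$ let $\Psi_T^{\boldsymbol\sigma}(\boldsymbol{x})=\prod_{i=1}^d l_{\sigma_i}(\xi_i)$, $\boldsymbol\xi=\boldsymbol{F}_T^{-1}(\boldsymbol{x})$, where $l_n$ is the Legendre polynomial of degree $n$ with $l_n(1)=1$; $\Psi_T^{\boldsymbol\sigma}$ is extended by zero outside $T$. $U_k(\mathcal{T}_h)=\mathrm{span}\{\Psi_T^{\boldsymbol\sigma}:\|\boldsymbol\sigma\|_\infty\le k,\ T\in\mathcal{T}_h\}$ is the broken space of polynomials of degree $\le k$ in each variable; $N_k=(k+1)^d$. Levels are $k=1,\dots,p$. A function $v_k\in U_k(\mathcal{T}_h)$ is identified with its coefficient vector $\mathbf{v}_k\in\mathbb{R}^{N_hN_k}$ in this basis. On an interior face $F=T_1\cap T_2$: $\{\!\{u\}\!\}=\frac12(u|_{T_1}+u|_{T_2})$, $[\![u]\!]=u|_{T_1}-u|_{T_2}$, and $\boldsymbol{n}$ is the unit normal from $T_1$ to $T_2$ (fixed orientation); on a boundary face $\{\!\{u\}\!\}=[\![u]\!]=u$ and $\boldsymbol{n}$ is the outward unit normal. On the finest level $p$,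 $$\mathcal{A}_p(u,v)=\sum_{T}\int_T\nabla u\cdot\nabla v-\sum_{F\in\mathcal{F}_h}\int_F\{\!\{\nabla u\}\!\}\cdot\boldsymbol{n}\,[\![v]\!]-\sum_{F\in\mathcal{F}_h}\int_F\{\!\{\nabla v\}\!\}\cdot\boldsymbol{n}\,[\![u]\!]+\sum_{F\in\mathcal{F}_h}\frac{\alpha_0p^2}{h}\int_F[\![u]\!][\![v]\!],$$ where $\alpha_0>0$ is a fixed constant, large enough that $\mathcal{A}_p$ is coercive and continuous on $U_p(\mathcal{T}_h)$, uniformly in $h$ and $p$, in the norm $\|v\|_{1,p,h}^2=\sum_T\|\nabla v\|_{L^2(T)}^2+\frac{p^2}{h}\sum_F\|[\![v]\!]\|_{L^2(F)}^2$. Inherited forms: $\tilde{\mathcal{A}}_p=\mathcal{A}_p$ and, for $k<p$, $\tilde{\mathcal{A}}_k(v_k,w_k)=\tilde{\mathcal{A}}_{k+1}(v_k,w_k)$ for $v_k,w_k\in U_k(\mathcal{T}_h)\subset U_{k+1}(\mathcal{T}_h)$ (i.e. the restriction of $\mathcal{A}_p$ to $U_k(\mathcal{T}_h)$). The symmetric positive definite matrix $\tilde{\mathbb{A}}_k$ is defined by $\mathbf{v}_k^\top\tilde{\mathbb{A}}_k\mathbf{w}_k=\tilde{\mathcal{A}}_k(v_k,w_k)$; $\tilde{\mathbb{D}}_k$ is its diagonal part; $\|\mathbf{v}\|_{\tilde{\mathbb{A}}_k,s}^2=\mathbf{v}^\top\tilde{\mathbb{A}}_k^s\mathbf{v}$;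 $\rho$ is the spectral radius. $\mathbb{P}_{k-1}^k$ is the matrix of the natural injection $U_{k-1}(\mathcal{T}_h)\hookrightarrow U_k(\mathcal{T}_h)$ and $\mathbb{R}_k^{k-1}=(\mathbb{P}_{k-1}^k)^\top$. Constants ($x\lesssim y$ means $x\le Cy$; $x\approx y$ means $cy\le x\le Cy$) are independent of the mesh size $h$ and of the polynomial degrees (they may depend on $d,\Omega,\alpha_0$, and on the constants in other $\approx$ hypotheses). Smoother. $m$ steps of the fourth-kind Chebyshev iteration for $\tilde{\mathbb{A}}_k\mathbf{z}_k=\mathbf{f}_k$ from $\mathbf{z}_k^0$: $\mathbf{w}^0=\mathbf{0}$, $\mathbf{w}^i=\frac{2i-3}{2i+1}\mathbf{w}^{i-1}+\frac{8i-4}{2i+1}\tilde\omega_k\tilde{\mathbb{D}}_k^{-1}(\mathbf{f}_k-\tilde{\mathbb{A}}_k\mathbf{z}_k^{i-1})$, $\mathbf{z}_k^i=\mathbf{z}_k^{i-1}+\mathbf{w}^i$, $i=1,\dots,m$. Equivalently $\mathbf{z}_k^m-\mathbf{z}_k=P_m(\tilde\omega_k\tilde{\mathbb{D}}_k^{-1}\tilde{\mathbb{A}}_k)(\mathbf{z}_k^0-\mathbf{z}_k)$, with $P_0=1$, $P_1(x)=1-\frac43x$, $P_i(x)=\frac{4i-2}{2i+1}(1-2x)P_{i-1}(x)-\frac{2i-3}{2i+1}P_{i-2}(x)$ for $i\ge2$. $W$-cycle. At level $1$ solve exactly with $\tilde{\mathbb{A}}_1$. At level $k\ge2$: $m$ smoothing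 steps; restrict the residual by $\mathbb{R}_k^{k-1}$; apply the level-$(k-1)$ $W$-cycle twice to the residual equation with matrix $\tilde{\mathbb{A}}_{k-1}$ (first with zero initial guess, then with the first result as initial guess); add the prolongation by $\mathbb{P}_{k-1}^k$ of the result; $m$ smoothing steps. Its error propagation matrix $\tilde{\mathbb{E}}^{\rm W}_{k,m}$ (mapping initial error to final error) is given by $\tilde{\mathbb{E}}^{\rm W}_{1,m}=0$ and, with $\tilde{\mathbb{G}}=P_m(\tilde\omega_k\tilde{\mathbb{D}}_k^{-1}\tilde{\mathbb{A}}_k)$, $$\tilde{\mathbb{E}}^{\rm W}_{k,m}=\tilde{\mathbb{G}}\big[\tilde{\mathbb{A}}_k^{-1}-\mathbb{P}_{k-1}^k\big(\mathbb{I}_{k-1}-(\tilde{\mathbb{E}}^{\rm W}_{k-1,m})^2\big)\tilde{\mathbb{A}}_{k-1}^{-1}\mathbb{R}_k^{k-1}\big]\tilde{\mathbb{A}}_k\tilde{\mathbb{G}}.$$ *)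

theory Defs
  imports
    "HOL-Analysis.Analysis"
    "Jordan_Normal_Form.Spectral_Radius"
    "Jordan_Normal_Form.Gauss_Jordan_Elimination"
begin

(* From here on "$" and the bullet refer to real^'d; coefficient vectors only use scalar_prod. *)
no_notation vec_index (infixl "$" 100)
no_notation scalar_prod (infix "\<bullet>" 70)

section \<open>Cartesian meshes\<close>

text \<open>
  \<^emph>\<open>cells_along M i\<close> is the number of cells in coordinate direction \<^emph>\<open>i\<close>. The cells are named by
  multi-indices \<^emph>\<open>T\<close> with \<^emph>\<open>T i < cells_along M i\<close>.
\<close>

record ('d::finite) cartesian_mesh =
  origin :: "real ^ 'd"
  edge :: real
  cells_along :: "'d \<Rightarrow> nat"

definition uniform_mesh_of :: "(real ^ 'd::finite) set \<Rightarrow> 'd cartesian_mesh \<Rightarrow> bool" where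
  "uniform_mesh_of \<Omega> M \<longleftrightarrow> edge M > 0 \<and> (\<forall>i. cells_along M i > 0) \<and>
     \<Omega> = box (origin M) (\<chi> i. origin M $ i + edge M * real (cells_along M i))"

definition cells :: "'d::finite cartesian_mesh \<Rightarrow> ('d \<Rightarrow> nat) set" where
  "cells M = {T. \<forall>i. T i < cells_along M i}"

definition cell_set :: "'d::finite cartesian_mesh \<Rightarrow> ('d \<Rightarrow> nat) \<Rightarrow> (real ^ 'd) set" where
  "cell_set M T = cbox (\<chi> i. origin M $ i + edge M * real (T i))
                       (\<chi> i. origin M $ i + edge M * (real (T i) + 1))"

text \<open>The inverse of the affine map from the reference cube \<^emph>\<open>[-1,1]^d\<close> onto the cell \<^emph>\<open>T\<close>.\<close>

definition to_reference :: "'d::finite cartesian_mesh \<Rightarrow> ('d \<Rightarrow> nat) \<Rightarrow> real ^ 'd \<Rightarrow> real ^ 'd" where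
  "to_reference M T x = (\<chi> i. 2 * (x $ i - origin M $ i - edge M * real (T i)) / edge M - 1)"

text \<open>
  The pair \<^emph>\<open>(i, c)\<close> names the face orthogonal to the \<^emph>\<open>i\<close>-th coordinate direction which lies between
  the cells \<^emph>\<open>c(i := c i - 1)\<close> and \<^emph>\<open>c\<close>. It is a boundary face, having only one of these two
  neighbours, iff \<^emph>\<open>c i = 0\<close> or \<^emph>\<open>c i = cells_along M i\<close>.
\<close>

definition faces :: "'d::finite cartesian_mesh \<Rightarrow> ('d \<times> ('d \<Rightarrow> nat)) set" where
  "faces M = {(i, c). c i \<le> cells_along M i \<and> (\<forall>j. j \<noteq> i \<longrightarrow> c j < cells_along M j)}"

text \<open>
  Integration over a face with respect to the \<^emph>\<open>(d-1)\<close>-dimensional Lebesgue measure in the coordinates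
  other than \<^emph>\<open>i\<close>. For \<^emph>\<open>d = 1\<close> the product measure over the empty index set is a unit point mass, so
  the integral is the evaluation at the node.
\<close>

definition face_integral ::
  "'d::finite cartesian_mesh \<Rightarrow> 'd \<times> ('d \<Rightarrow> nat) \<Rightarrow> (real ^ 'd \<Rightarrow> real) \<Rightarrow> real" where
  "face_integral M F f = (case F of (i, c) \<Rightarrow>
     set_lebesgue_integral (PiM (UNIV - {i}) (\<lambda>_. lborel))
       (PiE (UNIV - {i}) (\<lambda>j. {origin M $ j + edge M * real (c j) ..
                               origin M $ j + edge M * (real (c j) + 1)}))
       (\<lambda>y. f (\<chi> j. if j = i then origin M $ i + edge M * real (c i) else y j)))"

section \<open>Broken polynomial spaces\<close>

text \<open>
  A broken function \<^emph>\<open>u\<close> is given by its restrictions: \<^emph>\<open>u T\<close> is the restriction of \<^emph>\<open>u\<close> to the closed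
  cell \<^emph>\<open>T\<close>, represented by a smooth function on the whole of \<^emph>\<open>R^d\<close> (a polynomial, for the spaces
  below). Thus \<^emph>\<open>u T\<close> and its gradient also provide the traces from \<^emph>\<open>T\<close> on the faces of \<^emph>\<open>T\<close>.
\<close>

type_synonym 'd broken = "('d \<Rightarrow> nat) \<Rightarrow> real ^ 'd \<Rightarrow> real"

text \<open>Legendre polynomials, by Rodrigues' formula; the value at 1 is 1.\<close>

definition legendre :: "nat \<Rightarrow> real poly" where
  "legendre n = Polynomial.smult (1 / (2 ^ n * fact n)) ((pderiv ^^ n) ([:-1, 0, 1:] ^ n))"

definition basis_fun ::
  "'d::finite cartesian_mesh \<Rightarrow> ('d \<Rightarrow> nat) \<times> ('d \<Rightarrow> nat) \<Rightarrow> 'd broken" where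
  "basis_fun M b = (case b of (T, \<sigma>) \<Rightarrow> (\<lambda>T' x.
     if T' = T then (\<Prod>i\<in>UNIV. poly (legendre (\<sigma> i)) (to_reference M T x $ i)) else 0))"

definition basis_index ::
  "'d::finite cartesian_mesh \<Rightarrow> nat \<Rightarrow> (('d \<Rightarrow> nat) \<times> ('d \<Rightarrow> nat)) set" where
  "basis_index M k = cells M \<times> {\<sigma>. \<forall>i. \<sigma> i \<le> k}"

definition broken_space :: "'d::finite cartesian_mesh \<Rightarrow> nat \<Rightarrow> 'd broken set" where
  "broken_space M k =
     {u. \<exists>\<gamma>. u = (\<lambda>T x. \<Sum>b\<in>basis_index M k. \<gamma> b * basis_fun M b T x)}"

section \<open>The interior penalty form\<close>

definition gradient :: "(real ^ 'd::finite \<Rightarrow> real) \<Rightarrow> real ^ 'd \<Rightarrow> real ^ 'd" where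
  "gradient f x = (THE D. GDERIV f x :> D)"

definition face_normal :: "'d \<times> ('d \<Rightarrow> nat) \<Rightarrow> real ^ 'd::finite" where
  "face_normal F = (case F of (i, c) \<Rightarrow> if c i = 0 then - axis i 1 else axis i 1)"

text \<open>
  \<^emph>\<open>g T\<close> stands for the trace from the cell \<^emph>\<open>T\<close>. On an interior face, \<^emph>\<open>T1 = c(i := c i - 1)\<close> and
  \<^emph>\<open>T2 = c\<close>, in accordance with the normal above.
\<close>

definition face_average ::
  "'d::finite cartesian_mesh \<Rightarrow> 'd \<times> ('d \<Rightarrow> nat) \<Rightarrow> (('d \<Rightarrow> nat) \<Rightarrow> 'v) \<Rightarrow> 'v::real_vector" where
  "face_average M F g = (case F of (i, c) \<Rightarrow>
     if c i = 0 then g c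
     else if c i = cells_along M i then g (c(i := c i - 1))
     else (1/2) *\<^sub>R (g (c(i := c i - 1)) + g c))"

definition face_jump ::
  "'d::finite cartesian_mesh \<Rightarrow> 'd \<times> ('d \<Rightarrow> nat) \<Rightarrow> (('d \<Rightarrow> nat) \<Rightarrow> real) \<Rightarrow> real" where
  "face_jump M F g = (case F of (i, c) \<Rightarrow>
     if c i = 0 then g c
     else if c i = cells_along M i then g (c(i := c i - 1))
     else g (c(i := c i - 1)) - g c)"

definition dg_form ::
  "'d::finite cartesian_mesh \<Rightarrow> real \<Rightarrow> nat \<Rightarrow> 'd broken \<Rightarrow> 'd broken \<Rightarrow> real" where
  "dg_form M \<alpha> p u v =
     (\<Sum>T\<in>cells M. set_lebesgue_integral lborel (cell_set M T)
        (\<lambda>x. gradient (u T) x \<bullet> gradient (v T) x))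
   - (\<Sum>F\<in>faces M. face_integral M F (\<lambda>x.
        (face_average M F (\<lambda>T. gradient (u T) x) \<bullet> face_normal F) * face_jump M F (\<lambda>T. v T x)))
   - (\<Sum>F\<in>faces M. face_integral M F (\<lambda>x.
        (face_average M F (\<lambda>T. gradient (v T) x) \<bullet> face_normal F) * face_jump M F (\<lambda>T. u T x)))
   + (\<Sum>F\<in>faces M. \<alpha> * (real p)\<^sup>2 / edge M * face_integral M F (\<lambda>x.
        face_jump M F (\<lambda>T. u T x) * face_jump M F (\<lambda>T. v T x)))"

definition dg_norm :: "'d::finite cartesian_mesh \<Rightarrow> nat \<Rightarrow> 'd broken \<Rightarrow> real" where
  "dg_norm M p v = sqrt (
     (\<Sum>T\<in>cells M. set_lebesgue_integral lborel (cell_set M T) (\<lambda>x. (norm (gradient (v T) x))\<^sup>2))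
   + (real p)\<^sup>2 / edge M *
     (\<Sum>F\<in>faces M. face_integral M F (\<lambda>x. (face_jump M F (\<lambda>T. v T x))\<^sup>2)))"

text \<open>Coercivity and continuity, uniformly over all uniform meshes of \<^emph>\<open>\<Omega>\<close> and all degrees.\<close>

definition uniformly_stable :: "(real ^ 'd::finite) set \<Rightarrow> real \<Rightarrow> bool" where
  "uniformly_stable \<Omega> \<alpha> \<longleftrightarrow> (\<exists>c_coer > 0. \<exists>c_cont > 0. \<forall>M p. uniform_mesh_of \<Omega> M \<longrightarrow> p \<ge> 1 \<longrightarrow>
     (\<forall>v\<in>broken_space M p. dg_form M \<alpha> p v v \<ge> c_coer * (dg_norm M p v)\<^sup>2) \<and>
     (\<forall>u\<in>broken_space M p. \<forall>v\<in>broken_space M p.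
        \<bar>dg_form M \<alpha> p u v\<bar> \<le> c_cont * dg_norm M p u * dg_norm M p v))"

section \<open>Matrices\<close>

definition level_dim :: "'d::finite cartesian_mesh \<Rightarrow> nat \<Rightarrow> nat" where
  "level_dim M k = card (cells M) * (k + 1) ^ CARD('d)"

text \<open>An ordering \<^emph>\<open>e k\<close> of the basis of each of the levels \<^emph>\<open>k = 1, ..., p\<close>.\<close>

definition basis_orderings ::
  "'d::finite cartesian_mesh \<Rightarrow> nat \<Rightarrow> (nat \<Rightarrow> nat \<Rightarrow> ('d \<Rightarrow> nat) \<times> ('d \<Rightarrow> nat)) \<Rightarrow> bool" where
  "basis_orderings M p e \<longleftrightarrow> (\<forall>k\<in>{1..p}. bij_betw (e k) {..<level_dim M k} (basis_index M k))"

text \<open>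
  The inherited form of level \<^emph>\<open>k\<close> is the finest form \<^emph>\<open>dg_form M \<alpha> p\<close>, with the degree \<^emph>\<open>p\<close> in the
  penalty, restricted to the space of degree \<^emph>\<open>k\<close>.
\<close>

definition inherited_mat ::
  "'d::finite cartesian_mesh \<Rightarrow> real \<Rightarrow> nat \<Rightarrow> (nat \<Rightarrow> nat \<Rightarrow> ('d \<Rightarrow> nat) \<times> ('d \<Rightarrow> nat))
    \<Rightarrow> nat \<Rightarrow> real mat" where
  "inherited_mat M \<alpha> p e k = mat (level_dim M k) (level_dim M k)
     (\<lambda>(r, s). dg_form M \<alpha> p (basis_fun M (e k r)) (basis_fun M (e k s)))"

definition diag_part :: "real mat \<Rightarrow> real mat" where
  "diag_part A = mat_diag (dim_row A) (\<lambda>r. A $$ (r, r))"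

definition inv_mat :: "real mat \<Rightarrow> real mat" where
  "inv_mat A = the (mat_inverse A)"

definition spec_radius :: "real mat \<Rightarrow> real" where
  "spec_radius A = spectral_radius (map_mat complex_of_real A)"

definition power_norm :: "real mat \<Rightarrow> nat \<Rightarrow> real vec \<Rightarrow> real" where
  "power_norm A s v = sqrt (scalar_prod v ((A ^\<^sub>m s) *\<^sub>v v))"

text \<open>
  The matrix of the injection of the space of level \<^emph>\<open>k - 1\<close> into that of level \<^emph>\<open>k\<close>: the bases are
  hierarchical, so each basis function of level \<^emph>\<open>k - 1\<close> is mapped to the same one of level \<^emph>\<open>k\<close>.
\<close>

definition prolongation ::
  "'d::finite cartesian_mesh \<Rightarrow> (nat \<Rightarrow> nat \<Rightarrow> ('d \<Rightarrow> nat) \<times> ('d \<Rightarrow> nat)) \<Rightarrow> nat \<Rightarrow> real mat" where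
  "prolongation M e k = mat (level_dim M k) (level_dim M (k - 1))
     (\<lambda>(r, s). if e k r = e (k - 1) s then 1 else 0)"

section \<open>Smoother and W-cycle\<close>

text \<open>Residual polynomials of the fourth-kind Chebyshev iteration.\<close>

fun cheb4 :: "nat \<Rightarrow> real poly" where
  "cheb4 0 = 1"
| "cheb4 (Suc 0) = [:1, - 4/3:]"
| "cheb4 (Suc (Suc n)) = (let i = real (n + 2) in
     Polynomial.smult ((4 * i - 2) / (2 * i + 1)) ([:1, -2:] * cheb4 (Suc n))
   - Polynomial.smult ((2 * i - 3) / (2 * i + 1)) (cheb4 n))"

definition poly_at_mat :: "real poly \<Rightarrow> real mat \<Rightarrow> real mat" where
  "poly_at_mat q X = mat (dim_row X) (dim_row X)
     (\<lambda>(r, s). \<Sum>l\<le>Polynomial.degree q. Polynomial.coeff q l * (X ^\<^sub>m l) $$ (r, s))"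

definition smoother ::
  "'d::finite cartesian_mesh \<Rightarrow> real \<Rightarrow> nat \<Rightarrow> (nat \<Rightarrow> nat \<Rightarrow> ('d \<Rightarrow> nat) \<times> ('d \<Rightarrow> nat))
    \<Rightarrow> (nat \<Rightarrow> real) \<Rightarrow> nat \<Rightarrow> nat \<Rightarrow> real mat" where
  "smoother M \<alpha> p e \<omega> m k =
     poly_at_mat (cheb4 m)
       (\<omega> k \<cdot>\<^sub>m (inv_mat (diag_part (inherited_mat M \<alpha> p e k)) * inherited_mat M \<alpha> p e k))"

text \<open>
  The error propagation matrix of the W-cycle with exact solution at level 1. (Level 0 does not
  occur; its value is irrelevant.)
\<close>

primrec W_error ::
  "'d::finite cartesian_mesh \<Rightarrow> real \<Rightarrow> nat \<Rightarrow> (nat \<Rightarrow> nat \<Rightarrow> ('d \<Rightarrow> nat) \<times> ('d \<Rightarrow> nat))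
    \<Rightarrow> (nat \<Rightarrow> real) \<Rightarrow> nat \<Rightarrow> nat \<Rightarrow> real mat" where
  "W_error M \<alpha> p e \<omega> m 0 = 0\<^sub>m (level_dim M 0) (level_dim M 0)"
| "W_error M \<alpha> p e \<omega> m (Suc k) =
    (if k = 0 then 0\<^sub>m (level_dim M 1) (level_dim M 1) else
     (let A = inherited_mat M \<alpha> p e (Suc k);
          A' = inherited_mat M \<alpha> p e k;
          G = smoother M \<alpha> p e \<omega> m (Suc k);
          P = prolongation M e (Suc k)
      in G * (inv_mat A
              - P * (1\<^sub>m (level_dim M k) - W_error M \<alpha> p e \<omega> m k ^\<^sub>m 2) * inv_mat A' * P\<^sup>T)
           * A * G))"

end

theory Submission
  imports Defs
begin

text \<open>
  The contraction number \<open>\<gamma>\<^sub>k\<close> of the W-cycle in the energy norm satisfies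
  \<open>\<gamma>\<^sub>k \<le> \<tau> + (1 - \<tau>) \<gamma>\<^sub>k\<^sub>-\<^sub>1\<^sup>2\<close>, where \<open>\<tau>\<close> bounds the squared energy of the smoothed part of the error which
  is \<open>A\<close>-orthogonal to the coarse space. The fourth-kind Chebyshev polynomials satisfy
  \<open>P\<^sub>m(x)\<^sup>2 (1 + (2m + 1)\<^sup>2 x / 18) \<le> 1\<close> on \<open>[0, 1]\<close>, so \<open>\<tau> \<le> B / (B + k)\<close> with \<open>B = O(p\<^sup>3 / m\<^sup>2)\<close>, as soon as the
  diagonal part \<open>D\<close> of the matrix \<open>A\<close> of level \<open>k\<close> satisfies \<open>D \<le> O(p\<^sup>2 / k) A\<close> on that complement. For
  \<open>k \<ge> 400 B\<close> the recursion yields \<open>\<gamma>\<^sub>k \<le> 16 B / k = O((p\<^sup>2 / (k m))\<^sup>2)\<close>.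

  Inverse estimates give \<open>D \<le> O(p\<^sup>2 k / h\<^sup>2)\<close> relative to the mean square norm, so what is needed is
  \<open>|w| \<le> O(h / k) |w|\<^sub>A\<close> for \<open>w\<close> in the complement. In the Legendre basis the form is a
  sum of one-dimensional forms, each acting in one direction. A single one need not be coercive, but it
  satisfies a Garding inequality, by testing the full form with products with quadratic bubbles. For the
  one-dimensional forms the solution of the continuous dual problem is piecewise polynomial, and truncating
  the Legendre series of its derivative approximates it to the optimal order in \<open>h\<close> and \<open>k\<close>. The
  resulting approximation operators are tensorized, and duality yields the estimate.
\<close>

subsection \<open>Chebyshev polynomials of the fourth kind\<close>

text \<open>The hypothesis m >= C0 p^2 / k makes B / j small only at the target level j = k; on the
  levels below, B / j may be large. No bound C p^2 / (j m) with a value below 1 is available there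
  to start an induction, and a perturbation of the two-grid method breaks down. What saves the
  argument is that the factor \<open>\<tau>\<close> stays below 1 for every B and that the W-cycle
  inherits the square of the coarse contraction number: in the variable gamma / (1 - gamma) each
  level halves what it receives, up to a factor 1 + B / j, so the bad coarse levels are forgotten
  before level k.

  The same uniformity is required of the approximation property, which must hold for all h and k,
  whereas the Garding term can be absorbed only for small h / k. If h / k is bounded below, positive
  definiteness of the full form already gives an estimate of the right order.

  The constants come from B = K p^3 / m^2: with C0^2 = 400 K the hypothesis and k <= p give 400 B <=
  k, and one factor p / m <= 1 / C0 is given away to turn 16 B / k into C p^2 / (k m). Hence C = 16
  K / C0 and C / C0 = 1 / 25.\<close>

lemma sin_sum_sq3:
  fixes a b c :: real shows "(sin (a + b + c))\<^sup>2 \<le> 3 * ((sin a)\<^sup>2 + (sin b)\<^sup>2 + (sin c)\<^sup>2)"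
proof -
  have s2: "\<bar>sin (x + y)\<bar> \<le> \<bar>sin x\<bar> + \<bar>sin y\<bar>" for x y :: real
  proof -
    have "\<bar>sin (x + y)\<bar> \<le> \<bar>sin x * cos y\<bar> + \<bar>cos x * sin y\<bar>"
      unfolding sin_add by (rule abs_triangle_ineq)
    also have "\<dots> \<le> \<bar>sin x\<bar> * 1 + 1 * \<bar>sin y\<bar>"
      unfolding abs_mult by (intro add_mono mult_mono) (auto simp: abs_cos_le_one)
    finally show ?thesis by simp
  qed
  have "\<bar>sin (a + b + c)\<bar> \<le> \<bar>sin a\<bar> + \<bar>sin b\<bar> + \<bar>sin c\<bar>"
    using s2[of "a + b" c] s2[of a b] by linarith
  then have "\<bar>sin (a + b + c)\<bar>\<^sup>2 \<le> (\<bar>sin a\<bar> + \<bar>sin b\<bar> + \<bar>sin c\<bar>)\<^sup>2"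
    by (intro power_mono) auto
  also have "\<dots> \<le> 3 * (\<bar>sin a\<bar>\<^sup>2 + \<bar>sin b\<bar>\<^sup>2 + \<bar>sin c\<bar>\<^sup>2)"
  proof -
    have "3 * (x\<^sup>2 + y\<^sup>2 + z\<^sup>2) - (x + y + z)\<^sup>2 = (x - y)\<^sup>2 + (y - z)\<^sup>2 + (x - z)\<^sup>2" for x y z :: real
      by (simp add: power2_eq_square algebra_simps)
    then show ?thesis by (metis add_nonneg_nonneg diff_ge_0_iff_ge zero_le_power2)
  qed
  finally show ?thesis by simp
qed

text \<open>Under x = sin^2 \<phi> the recurrence, multiplied by 2 i + 1, is the addition theorem
  sin (a + 2 \<phi>) + sin (a - 2 \<phi>) = 2 cos (2 \<phi>) sin a. Its weights 4 i - 2 and 2 i - 3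
  are twice the previous odd number and the one before it, so the quantities (2 i + 1) P_i satisfy a
  recurrence with constant coefficients.\<close>

lemma cheb4_closed_form:
  "real (2 * m + 1) * poly (cheb4 m) ((sin \<phi>)\<^sup>2) * sin \<phi> = sin (real (2 * m + 1) * \<phi>)"
proof (induction m rule: cheb4.induct)
  case 1
  then show ?case by simp
next
  case 2
  have "sin (2 * \<phi> + \<phi>) = 3 * sin \<phi> - 4 * sin \<phi> ^ 3"
  proof -
    have "cos \<phi> * cos \<phi> = 1 - (sin \<phi>)\<^sup>2" by (simp add: cos_squared_eq[of \<phi>, unfolded power2_eq_square] power2_eq_square)
    then have "2 * sin \<phi> * cos \<phi> * cos \<phi> = 2 * sin \<phi> * (1 - (sin \<phi>)\<^sup>2)" by (simp add: mult.assoc)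
    then show ?thesis unfolding sin_add sin_double cos_double_sin
      by (simp add: power2_eq_square power3_eq_cube algebra_simps)
  qed
  then show ?case by (simp add: power2_eq_square power3_eq_cube algebra_simps)
next
  case (3 n)
  let ?x = "(sin \<phi>)\<^sup>2"
  let ?i = "real (n + 2)"
  have rec: "(2 * ?i + 1) * poly (cheb4 (n + 2)) ?x =
      2 * (1 - 2 * ?x) * (real (2 * Suc n + 1) * poly (cheb4 (Suc n)) ?x) - real (2 * n + 1) * poly (cheb4 n) ?x"
  proof -
    have "poly (cheb4 (n + 2)) ?x = ((4 * ?i - 2) / (2 * ?i + 1)) * ((1 - 2 * ?x) * poly (cheb4 (Suc n)) ?x)
        - ((2 * ?i - 3) / (2 * ?i + 1)) * poly (cheb4 n) ?x"
      by (simp add: Let_def algebra_simps)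
    moreover have "2 * ?i + 1 \<noteq> 0" by simp
    ultimately have "(2 * ?i + 1) * poly (cheb4 (n + 2)) ?x = (4 * ?i - 2) * ((1 - 2 * ?x) * poly (cheb4 (Suc n)) ?x)
        - (2 * ?i - 3) * poly (cheb4 n) ?x"
      by (simp add: right_diff_distrib mult.assoc[symmetric] del: of_nat_add)
    then show ?thesis by (simp add: algebra_simps)
  qed
  have c: "1 - 2 * ?x = cos (2 * \<phi>)" by (simp add: cos_double_sin)
  have "real (2 * (n + 2) + 1) * poly (cheb4 (n + 2)) ?x * sin \<phi> =
     2 * cos (2 * \<phi>) * (real (2 * Suc n + 1) * poly (cheb4 (Suc n)) ?x * sin \<phi>) - real (2 * n + 1) * poly (cheb4 n) ?x * sin \<phi>"
    using arg_cong[OF rec, of "\<lambda>z. z * sin \<phi>"] c by (simp add: algebra_simps)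
  also have "\<dots> = 2 * cos (2 * \<phi>) * sin (real (2 * Suc n + 1) * \<phi>) - sin (real (2 * n + 1) * \<phi>)"
    using 3 by simp
  also have "\<dots> = sin (real (2 * (n + 2) + 1) * \<phi>)"
  proof -
    let ?a = "real (2 * Suc n + 1) * \<phi>"
    have "sin (?a + 2 * \<phi>) + sin (?a - 2 * \<phi>) = 2 * cos (2 * \<phi>) * sin ?a"
      by (simp add: sin_add sin_diff)
    moreover have "?a + 2 * \<phi> = real (2 * (n + 2) + 1) * \<phi>" "?a - 2 * \<phi> = real (2 * n + 1) * \<phi>"
      by (simp_all add: algebra_simps)
    ultimately show ?thesis by simp
  qed
  finally show ?case by (simp del: cheb4.simps)
qed

text \<open>With the closed form this exhibits 1 - P_m as a sum of squares: (2 m + 1) (1 - P_m) = 4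
  times the sum. A lower bound for the sum therefore keeps P_m away from 1.\<close>

lemma sin_odd_multiple_sum:
  "sin (real (2 * m + 1) * \<phi>) = sin \<phi> * (real (2 * m + 1) - 4 * (\<Sum>j\<in>{1..m}. (sin (real j * \<phi>))\<^sup>2))"
proof (induction m)
  case 0
  then show ?case by simp
next
  case (Suc m)
  have "sin (real (2 * Suc m + 1) * \<phi>) - sin (real (2 * m + 1) * \<phi>) = 2 * sin \<phi> * cos (2 * (real (Suc m) * \<phi>))"
  proof -
    let ?a = "2 * (real (Suc m) * \<phi>)"
    have "sin (?a + \<phi>) - sin (?a - \<phi>) = 2 * sin \<phi> * cos ?a" by (simp add: sin_add sin_diff)
    moreover have "?a + \<phi> = real (2 * Suc m + 1) * \<phi>" "?a - \<phi> = real (2 * m + 1) * \<phi>"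
      by (simp_all add: algebra_simps)
    ultimately show ?thesis by simp
  qed
  also have "cos (2 * (real (Suc m) * \<phi>)) = 1 - 2 * (sin (real (Suc m) * \<phi>))\<^sup>2"
    by (rule cos_double_sin)
  finally show ?case using Suc by (simp add: algebra_simps)
qed

text \<open>Averaging over j of the splitting (2 m + 1) \<phi> = j \<phi> + (m + 1 - j) \<phi> + m
  \<phi>. The reflection of j reproduces the same sum, and the left-over term m \<phi> is itself
  averaged by m \<phi> = j \<phi> + (m - j) \<phi>, at the price of 6 sums. Thus 24 = 3 (1 + 1 +
  6).\<close>

lemma sum_sin_sq_ge:
  "real m * (sin (real (2 * m + 1) * \<phi>))\<^sup>2 \<le> 24 * (\<Sum>j\<in>{1..m}. (sin (real j * \<phi>))\<^sup>2)"
proof -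
  let ?s = "\<lambda>j. (sin (real j * \<phi>))\<^sup>2"
  let ?S = "\<Sum>j\<in>{1..m}. ?s j"
  have refl: "(\<Sum>j\<in>{1..m}. ?s (m + 1 - j)) = ?S"
    using sum.atLeastAtMost_rev[of ?s 1 m] by (simp add: add.commute)
  have refl0: "(\<Sum>j\<in>{1..m}. ?s (m - j)) \<le> ?S"
  proof -
    have "(\<Sum>j\<in>{1..m}. ?s (m - j)) = (\<Sum>j\<in>{0..<m}. ?s j)"
      by (rule sum.reindex_bij_witness[of _ "\<lambda>j. m - j" "\<lambda>j. m - j"]) auto
    also have "\<dots> \<le> (\<Sum>j\<in>insert 0 {1..m}. ?s j)" by (rule sum_mono2) auto
    also have "\<dots> = ?S" by simp
    finally show ?thesis .
  qed
  have "real m * ?s m = (\<Sum>j\<in>{1..m}. ?s m)" by simp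
  also have "\<dots> \<le> (\<Sum>j\<in>{1..m}. 3 * (?s j + ?s (m - j)))"
  proof (rule sum_mono)
    fix j assume "j \<in> {1..m}"
    then have "real m * \<phi> = real j * \<phi> + real (m - j) * \<phi> + 0" by (simp add: of_nat_diff algebra_simps)
    then show "?s m \<le> 3 * (?s j + ?s (m - j))" using sin_sum_sq3[of "real j * \<phi>" "real (m - j) * \<phi>" 0] by simp
  qed
  also have "\<dots> = 3 * (?S + (\<Sum>j\<in>{1..m}. ?s (m - j)))" by (simp add: sum_distrib_left[symmetric] sum.distrib)
  finally have A: "real m * ?s m \<le> 6 * ?S" using refl0 by simp
  have "real m * (sin (real (2 * m + 1) * \<phi>))\<^sup>2 = (\<Sum>j\<in>{1..m}. (sin (real (2 * m + 1) * \<phi>))\<^sup>2)" by simp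
  also have "\<dots> \<le> (\<Sum>j\<in>{1..m}. 3 * (?s j + ?s (m + 1 - j) + ?s m))"
  proof (rule sum_mono)
    fix j assume "j \<in> {1..m}"
    then have "real (2 * m + 1) * \<phi> = real j * \<phi> + real (m + 1 - j) * \<phi> + real m * \<phi>"
      by (simp add: of_nat_diff algebra_simps)
    then show "(sin (real (2 * m + 1) * \<phi>))\<^sup>2 \<le> 3 * (?s j + ?s (m + 1 - j) + ?s m)" using sin_sum_sq3 by metis
  qed
  also have "\<dots> = 3 * ((\<Sum>j\<in>{1..m}. ?s j) + (\<Sum>j\<in>{1..m}. ?s (m + 1 - j)) + (\<Sum>j\<in>{1..m}. ?s m))"
    by (simp only: sum_distrib_left[symmetric] sum.distrib)
  also have "\<dots> \<le> 3 * (?S + ?S + 6 * ?S)" unfolding refl using A by simp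
  finally show ?thesis by simp
qed

text \<open>The bound is sharp in order both for \<open>x\<close> near 0 and for \<open>x\<close> of order 1, which is what the
  contraction factors on the coarse levels, with few effective smoothing steps, require.\<close>

lemma cheb4_bound:
  assumes "0 \<le> x" "x \<le> 1" "m \<ge> 1"
  shows "(poly (cheb4 m) x)\<^sup>2 * (1 + 1/18 * (real (2 * m + 1))\<^sup>2 * x) \<le> 1"
proof (cases "x = 0")
  case True
  have "poly (cheb4 m) 0 = 1"
  proof (induction m rule: cheb4.induct)
    case (3 n)
    have "(4 * real (n + 2) - 2) / (2 * real (n + 2) + 1) - (2 * real (n + 2) - 3) / (2 * real (n + 2) + 1) = 1"
      by (simp add: diff_divide_distrib[symmetric])
    then show ?case using 3 by (simp add: Let_def)
  qed auto
  then show ?thesis using True by simp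
next
  case False
  define \<phi> where "\<phi> = arcsin (sqrt x)"
  define N where "N = real (2 * m + 1)"
  define P where "P = poly (cheb4 m) x"
  have sx: "0 < sqrt x" "sqrt x \<le> 1" using assms False by auto
  have \<phi>: "sin \<phi> = sqrt x" unfolding \<phi>_def by (rule sin_arcsin) (use sx in linarith)+
  have x: "x = (sin \<phi>)\<^sup>2" using \<phi> assms by simp
  have Ppos: "N * P * sin \<phi> = sin (N * \<phi>)" using cheb4_closed_form[of m \<phi>] x unfolding P_def N_def by simp
  have "arcsin 0 < arcsin (sqrt x)" using sx by (intro arcsin_less_arcsin) auto
  moreover have "-1 \<le> sqrt x" using sx by linarith
  ultimately have \<phi>0: "0 < \<phi>" "\<phi> \<le> pi / 2" unfolding \<phi>_def using arcsin_ubound[OF _ sx(2)] by simp_all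
  have N: "N \<ge> 3" using assms unfolding N_def by simp
  let ?S = "\<Sum>j\<in>{1..m}. (sin (real j * \<phi>))\<^sup>2"
  have "N * P = N - 4 * ?S"
    using sin_odd_multiple_sum[of m \<phi>] Ppos \<phi> sx unfolding N_def[symmetric] by simp
  then have P1: "N * (1 - P) = 4 * ?S" by (simp add: algebra_simps)
  have "N * (sin (N * \<phi>))\<^sup>2 \<le> 3 * (real m * (sin (N * \<phi>))\<^sup>2)"
    unfolding N_def using assms(3) by (simp add: mult.assoc[symmetric] mult_right_mono)
  also have "\<dots> \<le> 72 * ?S" using sum_sin_sq_ge[of m \<phi>] unfolding N_def by simp
  also have "72 * ?S = N * (18 * (1 - P))" using P1 by (simp only: mult.left_commute[of N])
  finally have "N * (sin (N * \<phi>))\<^sup>2 \<le> N * (18 * (1 - P))" .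
  then have 1: "(sin (N * \<phi>))\<^sup>2 \<le> 18 * (1 - P)" using N by simp
  have s1: "(sin (N * \<phi>))\<^sup>2 \<le> 1" by (simp add: abs_square_le_1)
  \<comment> \<open>This is the claim, since sin^2 (N \<phi>) = N^2 P^2 x. For P >= 0 it suffices
    that P^2 <= P. For P < 0 the sine of N \<phi> is negative, so N \<phi> exceeds pi; the chord
    below the sine on [0, pi/2] then gives N sin \<phi> > 2 and hence |P| <= 1/2.\<close>
  have "P\<^sup>2 \<le> 1 - 1/18 * (sin (N * \<phi>))\<^sup>2"
  proof (cases "P \<ge> 0")
    case True
    have "P \<le> 1" using order_trans[OF zero_le_power2 1] by simp
    then have "P\<^sup>2 \<le> P" using True by (simp add: power2_eq_square mult_left_le)
    then show ?thesis using 1 by simp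
  next
    case False
    have "sin (N * \<phi>) < 0" using Ppos False N \<phi> sx by (smt (verit) mult_neg_pos mult_pos_neg)
    then have "N * \<phi> > pi" using sin_ge_zero[of "N * \<phi>"] \<phi>0 N by (smt (verit) mult_nonneg_nonneg)
    have "2 / pi * \<phi> \<le> sin \<phi>"
    proof -
      have "concave_on {0..pi/2} sin"
      proof (rule f''_le0_imp_concave[where f' = cos and f'' = "\<lambda>x. - sin x"])
        fix y :: real assume "y \<in> {0..pi/2}"
        then show "- sin y \<le> 0" using sin_ge_zero[of y] by auto
      qed (auto intro!: derivative_eq_intros)
      then have "(1 - 2 / pi * \<phi>) * sin 0 + (2 / pi * \<phi>) * sin (pi / 2)
         \<le> sin ((1 - 2 / pi * \<phi>) *\<^sub>R 0 + (2 / pi * \<phi>) *\<^sub>R (pi / 2))"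
        by (intro concave_onD) (use \<phi>0 in \<open>auto simp: field_simps\<close>)
      then show ?thesis by simp
    qed
    then have "N * sin \<phi> \<ge> N * (2 / pi * \<phi>)" using N by (intro mult_left_mono) auto
    moreover have "N * (2 / pi * \<phi>) > 2" using \<open>N * \<phi> > pi\<close> by (simp add: field_simps)
    ultimately have N2: "N * sin \<phi> > 2" by linarith
    have "\<bar>P\<bar> * \<bar>N * sin \<phi>\<bar> = \<bar>sin (N * \<phi>)\<bar>" unfolding abs_mult[symmetric] Ppos[symmetric] by (simp add: ac_simps)
    then have "\<bar>P\<bar> * (N * sin \<phi>) = \<bar>sin (N * \<phi>)\<bar>" using N2 by simp
    then have "\<bar>P\<bar> * (N * sin \<phi>) \<le> 1" by simp
    moreover have "\<bar>P\<bar> * 2 \<le> \<bar>P\<bar> * (N * sin \<phi>)" using N2 by (intro mult_left_mono) auto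
    ultimately have "\<bar>P\<bar> \<le> 1/2" by linarith
    then have "\<bar>P\<bar>\<^sup>2 \<le> (1/2)\<^sup>2" by (intro power_mono) auto
    then show ?thesis using s1 by (simp add: power2_eq_square)
  qed
  moreover have "(sin (N * \<phi>))\<^sup>2 = P\<^sup>2 * N\<^sup>2 * x" unfolding Ppos[symmetric] x by (simp add: power_mult_distrib)
  ultimately show ?thesis unfolding P_def N_def by (simp add: algebra_simps)
qed

text \<open>Equality in the W-cycle recursion
  \<open>\<tau> + (1 - \<tau>) * \<gamma>\<^sup>2\<close> with \<open>\<tau> = B / (B + j)\<close>.
  The value 0 at level 1 is the exact solve there; level 0 is a dummy.\<close>

primrec contraction :: "real \<Rightarrow> nat \<Rightarrow> real" where
  "contraction B 0 = 0"
| "contraction B (Suc j) = (if j = 0 then 0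
     else (B + real (Suc j) * (contraction B j)\<^sup>2) / (B + real (Suc j)))"

lemma contraction_range:
  assumes "B \<ge> 0" shows "0 \<le> contraction B j \<and> contraction B j < 1"
proof (induction j)
  case (Suc j)
  have "(contraction B j)\<^sup>2 < 1" using Suc by (simp add: abs_square_less_1)
  then have "real (Suc j) * (contraction B j)\<^sup>2 < real (Suc j) * 1"
    by (intro mult_strict_left_mono) auto
  then show ?case using assms by (auto simp: divide_less_eq)
qed simp

text \<open>In the variable \<open>v = \<gamma> / (1 - \<gamma>)\<close> the quadratic recursion for the contraction numbers
  \<open>\<gamma>\<close> is dominated by a linear one.\<close>

lemma contraction_odds_step:
  assumes "B \<ge> 0" "j \<ge> 1"
  defines "v \<equiv> \<lambda>j. contraction B j / (1 - contraction B j)"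
  shows "v (Suc j) \<le> (1 + B / real (Suc j)) / 2 * v j + B / real (Suc j)"
proof -
  define g where "g = contraction B j"
  define i where "i = real (Suc j)"
  have i: "i > 0" unfolding i_def by simp
  have g: "0 \<le> g" "g < 1" using contraction_range[OF assms(1)] unfolding g_def by auto
  have g2: "1 - g\<^sup>2 > 0" using g by (simp add: abs_square_less_1)
  \<comment> \<open>The gain of the second coarse cycle: squaring g multiplies g / (1 - g) by g / (1
    + g), which is at most 1/2 however close g is to 1.\<close>
  have w: "g\<^sup>2 / (1 - g\<^sup>2) \<le> (g / (1 - g)) / 2"
  proof -
    have "1 - g\<^sup>2 = (1 - g) * (1 + g)" by (simp add: power2_eq_square algebra_simps)
    then have "g\<^sup>2 / (1 - g\<^sup>2) = (g / (1 - g)) * (g / (1 + g))" by (simp add: power2_eq_square)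
    also have "\<dots> \<le> (g / (1 - g)) * (1 / 2)" using g by (intro mult_left_mono) (auto simp: field_simps)
    finally show ?thesis by simp
  qed
  have c: "contraction B (Suc j) = (B + i * g\<^sup>2) / (B + i)" using assms(2) unfolding g_def i_def by simp
  have "1 - contraction B (Suc j) = i * (1 - g\<^sup>2) / (B + i)" unfolding c using assms(1) i by (simp add: field_simps)
  then have "v (Suc j) = (B + i * g\<^sup>2) / (i * (1 - g\<^sup>2))" unfolding v_def c using assms(1) i by simp
  also have "\<dots> = B / i * (1 + g\<^sup>2 / (1 - g\<^sup>2)) + g\<^sup>2 / (1 - g\<^sup>2)"
  proof -
    have e: "1 + g\<^sup>2 / (1 - g\<^sup>2) = 1 / (1 - g\<^sup>2)" using g2 by (simp add: field_simps)
    show ?thesis unfolding e using i by (simp add: add_divide_distrib)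
  qed
  also have "\<dots> \<le> B / i * (1 + (g / (1 - g)) / 2) + (g / (1 - g)) / 2"
    using w assms(1) i by (intro add_mono mult_left_mono) auto
  also have "\<dots> = (1 + B / i) / 2 * v j + B / i"
  proof -
    have "B / i * (1 + y / 2) + y / 2 = (1 + B / i) / 2 * y + B / i" for y using i by (simp add: field_simps)
    then show ?thesis unfolding v_def g_def .
  qed
  finally show ?thesis unfolding i_def .
qed

lemma sqrt_diff_times_sum:
  assumes "a \<ge> 0" "b \<ge> 0" shows "(sqrt a - sqrt b) * (sqrt a + sqrt b) = a - b"
  using assms by (simp add: algebra_simps)

text \<open>Bounds the growth factor of one level by an exponential that telescopes over the levels.
  The simpler exp (B / j) would accumulate like (k / i) ^ B, which for i = 1 and B proportional to k
  eventually outgrows the damping 2 ^ (k - i); the square root makes the exponent from i to k at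
  most proportional to sqrt (B / k) (k - i).\<close>

lemma one_plus_le_exp_sqrt:
  assumes "B \<ge> 0"
  shows "1 + B / real (Suc j) \<le> exp (4 * sqrt B * (sqrt (real (Suc j)) - sqrt (real j)))"
proof -
  let ?s = "sqrt (real (Suc j))" and ?r = "sqrt (real j)"
  let ?y = "sqrt B / ?s"
  have y: "0 \<le> ?y" "?y\<^sup>2 = B / real (Suc j)" using assms by (auto simp: power_divide)
  have "1 + y\<^sup>2 \<le> (1 + y)\<^sup>2" if "y \<ge> 0" for y :: real using that by (simp add: power2_sum)
  then have "1 + ?y\<^sup>2 \<le> (1 + ?y)\<^sup>2" using y(1) .
  also have "\<dots> \<le> (exp ?y)\<^sup>2" using y(1) by (intro power_mono exp_ge_add_one_self) auto
  also have "\<dots> = exp (2 * ?y)" by (simp only: exp_double)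
  also have "\<dots> \<le> exp (4 * sqrt B * (?s - ?r))"
  proof -
    have s: "0 < ?s" "0 \<le> ?r" "?r \<le> ?s" by auto
    have "(?s - ?r) * (?s + ?r) = 1" using sqrt_diff_times_sum[of "real (Suc j)" "real j"] by simp
    then have "?s - ?r = 1 / (?s + ?r)" by (rule eq_divide_imp[rotated]) (use s in linarith)
    also have "\<dots> \<ge> 1 / (2 * ?s)" by (rule divide_left_mono) (use s in \<open>auto intro!: mult_pos_pos add_pos_nonneg\<close>)
    finally have "4 * sqrt B * (1 / (2 * ?s)) \<le> 4 * sqrt B * (?s - ?r)" using assms by (intro mult_left_mono) auto
    then show ?thesis by simp
  qed
  finally show ?thesis using y(2) by simp
qed

lemma arith_geom_sum_three_quarters:
  "(\<Sum>l<n. real (Suc l) * (3/4) ^ l) = 16 - (16 + 4 * real n) * (3/4) ^ n"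
proof (induction n)
  case (Suc n)
  have "16 - (16 + 4 * real n) * y + real (Suc n) * y = 16 - (16 + 4 * real (Suc n)) * (3/4 * y)" for y :: real
    by (simp add: algebra_simps)
  then show ?case using Suc by simp
qed simp

lemma contraction_bound:
  assumes "B \<ge> 0" "k \<ge> 1" "400 * B \<le> real k"
  shows "contraction B k \<le> 16 * B / real k"
proof -
  define v where "v = (\<lambda>j. contraction B j / (1 - contraction B j))"
  \<comment> \<open>Variation of constants for the linear recursion: the source B / i of level i
    arrives at level j damped by one half per level and amplified by the telescoped growth
    factors.\<close>
  define w where "w = (\<lambda>j. \<Sum>i\<in>{1..j}. B / real i * (1/2) ^ (j - i) * exp (4 * sqrt B * (sqrt (real j) - sqrt (real i))))"
  have w0: "w j \<ge> 0" for j unfolding w_def using assms(1) by (intro sum_nonneg) auto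
  have wS: "w (Suc j) = B / real (Suc j) + 1/2 * exp (4 * sqrt B * (sqrt (real (Suc j)) - sqrt (real j))) * w j" for j
  proof -
    have "w (Suc j) = (\<Sum>i\<in>{1..j}. B / real i * (1/2) ^ (Suc j - i) * exp (4 * sqrt B * (sqrt (real (Suc j)) - sqrt (real i)))) + B / real (Suc j)"
      unfolding w_def by (subst atLeastAtMostSuc_conv) auto
    also have "(\<Sum>i\<in>{1..j}. B / real i * (1/2) ^ (Suc j - i) * exp (4 * sqrt B * (sqrt (real (Suc j)) - sqrt (real i))))
       = 1/2 * exp (4 * sqrt B * (sqrt (real (Suc j)) - sqrt (real j))) * w j"
      unfolding w_def sum_distrib_left
    proof (rule sum.cong[OF refl])
      fix i assume "i \<in> {1..j}"
      then have 1: "(1/2::real) ^ (Suc j - i) = 1/2 * (1/2) ^ (j - i)" by (simp add: Suc_diff_le)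
      have 2: "exp (4 * sqrt B * (sqrt (real (Suc j)) - sqrt (real i))) =
        exp (4 * sqrt B * (sqrt (real (Suc j)) - sqrt (real j))) * exp (4 * sqrt B * (sqrt (real j) - sqrt (real i)))"
        by (simp add: exp_add[symmetric] algebra_simps)
      show "B / real i * (1/2) ^ (Suc j - i) * exp (4 * sqrt B * (sqrt (real (Suc j)) - sqrt (real i))) =
         1/2 * exp (4 * sqrt B * (sqrt (real (Suc j)) - sqrt (real j))) * (B / real i * (1/2) ^ (j - i) * exp (4 * sqrt B * (sqrt (real j) - sqrt (real i))))"
        unfolding 1 2 by (simp only: ac_simps)
    qed
    finally show ?thesis by simp
  qed
  have vw: "v (Suc j) \<le> w (Suc j)" for j
  proof (induction j)
    case 0
    then show ?case using w0[of "Suc 0"] by (simp add: v_def)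
  next
    case (Suc j)
    let ?i = "Suc (Suc j)"
    have v0: "0 \<le> v (Suc j)" unfolding v_def using contraction_range[OF assms(1)] by (metis diff_ge_0_iff_ge divide_nonneg_nonneg less_imp_le)
    have "v ?i \<le> (1 + B / real ?i) / 2 * v (Suc j) + B / real ?i"
      unfolding v_def by (rule contraction_odds_step) (use assms in auto)
    also have "\<dots> \<le> exp (4 * sqrt B * (sqrt (real ?i) - sqrt (real (Suc j)))) / 2 * w (Suc j) + B / real ?i"
      using Suc v0 by (intro add_mono mult_mono divide_right_mono one_plus_le_exp_sqrt[OF assms(1)]) auto
    finally show ?case unfolding wS[of "Suc j"] by simp
  qed
  have "contraction B k \<le> v k"
  proof -
    have g: "0 \<le> contraction B k" "contraction B k < 1" using contraction_range[OF assms(1)] by auto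
    then have "contraction B k * (1 - contraction B k) \<le> contraction B k" by (intro mult_left_le) auto
    then show ?thesis unfolding v_def using g by (simp add: pos_le_divide_eq)
  qed
  also have "v k \<le> w k" using vw[of "k - 1"] assms(2) by simp
  also have "w k \<le> (\<Sum>i\<in>{1..k}. B / real k * (real (Suc (k - i)) * (3/4) ^ (k - i)))"
    unfolding w_def
  proof (rule sum_mono)
    fix i assume i: "i \<in> {1..k}"
    have "k - i + i = k" "i \<ge> 1" using i by auto
    then obtain l where l: "k = i + l" by (metis add.commute)
    have s0: "0 < sqrt (real k)" using assms(2) by simp
    have "(sqrt (real k) - sqrt (real i)) * sqrt (real k) \<le> (sqrt (real k) - sqrt (real i)) * (sqrt (real k) + sqrt (real i))"
      using i by (intro mult_left_mono) auto
    also have "\<dots> = real l" using l by (subst sqrt_diff_times_sum) auto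
    finally have "sqrt (real k) - sqrt (real i) \<le> real l / sqrt (real k)" using s0 by (simp add: pos_le_divide_eq)
    then have "4 * sqrt B * (sqrt (real k) - sqrt (real i)) \<le> 4 * sqrt B * (real l / sqrt (real k))"
      using assms(1) by (intro mult_left_mono) auto
    also have "\<dots> = 4 * sqrt (B / real k) * real l" by (simp add: real_sqrt_divide)
    \<comment> \<open>Here 400 B <= k enters: the growth over l levels is at most exp (l / 5) <=
      (3/2) ^ l, which still leaves the ratio 3/4 against the damping 1/2.\<close>
    also have "\<dots> \<le> 4 * (1/20) * real l"
    proof -
      have "B / real k \<le> (1/20)\<^sup>2" using assms by (simp add: field_simps power2_eq_square)
      then have "sqrt (B / real k) \<le> 1/20" by (intro real_le_lsqrt) auto
      then show ?thesis by (intro mult_right_mono) auto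
    qed
    finally have "exp (4 * sqrt B * (sqrt (real k) - sqrt (real i))) \<le> exp (1/5 * real l)" by simp
    also have "\<dots> = exp (1/5) ^ l" by (metis exp_of_nat_mult mult.commute)
    also have "\<dots> \<le> (3/2) ^ l" using exp_bound[of "1/5"] by (intro power_mono) (auto simp: power2_eq_square)
    finally have e: "exp (4 * sqrt B * (sqrt (real k) - sqrt (real i))) \<le> (3/2) ^ l" .
    \<comment> \<open>Sources on coarse levels are larger than B / k only by the factor k / i <= l +
      1, which the geometric decay in l absorbs. The resulting series sums to at most 16.\<close>
    have q: "B / real i \<le> B / real k * real (Suc l)"
    proof -
      have "real k \<le> real (Suc l) * real i"
      proof -
        have "i + l \<le> Suc l * i" using \<open>i \<ge> 1\<close> by (cases i) auto
        then show ?thesis unfolding l by (metis of_nat_le_iff of_nat_mult)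
      qed
      then have "B * real k \<le> B * (real (Suc l) * real i)" using assms(1) by (rule mult_left_mono)
      then show ?thesis using \<open>i \<ge> 1\<close> assms(2) by (simp add: field_simps)
    qed
    have "B / real i * (1/2) ^ (k - i) * exp (4 * sqrt B * (sqrt (real k) - sqrt (real i)))
      \<le> (B / real k * real (Suc l)) * (1/2) ^ (k - i) * (3/2) ^ l"
      using q e assms by (intro mult_mono) auto
    also have "\<dots> = B / real k * (real (Suc (k - i)) * (3/4) ^ (k - i))"
      using l by (simp add: power_mult_distrib[symmetric] mult.assoc)
    finally show "B / real i * (1/2) ^ (k - i) * exp (4 * sqrt B * (sqrt (real k) - sqrt (real i)))
      \<le> B / real k * (real (Suc (k - i)) * (3/4) ^ (k - i))" .
  qed
  also have "\<dots> = B / real k * (\<Sum>i\<in>{1..k}. real (Suc (k - i)) * (3/4) ^ (k - i))"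
    by (simp only: sum_distrib_left)
  also have "(\<Sum>i\<in>{1..k}. real (Suc (k - i)) * (3/4) ^ (k - i)) = (\<Sum>l<k. real (Suc l) * (3/4) ^ l)"
    by (rule sum.reindex_bij_witness[of _ "\<lambda>l. k - l" "\<lambda>i. k - i"]) auto
  finally have "contraction B k \<le> B / real k * (\<Sum>l<k. real (Suc l) * (3/4) ^ l)" .
  also have "\<dots> \<le> B / real k * 16"
    unfolding arith_geom_sum_three_quarters using assms by (intro mult_left_mono) auto
  finally show ?thesis by (simp add: mult.commute)
qed

subsection \<open>Real symmetric matrices\<close>

text \<open>Vectors and matrices are functions on an arbitrary finite index set, so that one
  spectral theorem serves the numbered matrices of the levels, the pairs of cell and degree on a
  line, and the tensor grid.\<close>

definition inner_on :: "'a set \<Rightarrow> ('a \<Rightarrow> real) \<Rightarrow> ('a \<Rightarrow> real) \<Rightarrow> real" where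
  "inner_on I u v = (\<Sum>i\<in>I. u i * v i)"

definition mat_app :: "'a set \<Rightarrow> ('a \<Rightarrow> 'a \<Rightarrow> real) \<Rightarrow> ('a \<Rightarrow> real) \<Rightarrow> 'a \<Rightarrow> real" where
  "mat_app I a u i = (\<Sum>j\<in>I. a i j * u j)"

lemma inner_on_commute: "inner_on I u v = inner_on I v u"
  unfolding inner_on_def by (simp add: mult.commute)

lemma inner_on_add: "inner_on I (\<lambda>i. u i + v i) w = inner_on I u w + inner_on I v w"
  "inner_on I w (\<lambda>i. u i + v i) = inner_on I w u + inner_on I w v"
  unfolding inner_on_def by (simp_all add: algebra_simps sum.distrib)

lemma inner_on_diff: "inner_on I (\<lambda>i. u i - v i) w = inner_on I u w - inner_on I v w"
  "inner_on I w (\<lambda>i. u i - v i) = inner_on I w u - inner_on I w v"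
  unfolding inner_on_def by (simp_all add: algebra_simps sum_subtractf)

lemma inner_on_scale: "inner_on I (\<lambda>i. c * u i) w = c * inner_on I u w"
  "inner_on I w (\<lambda>i. c * u i) = c * inner_on I w u"
  unfolding inner_on_def by (simp_all add: sum_distrib_left algebra_simps)

lemma inner_on_sum: "inner_on I (\<lambda>i. \<Sum>s\<in>S. u s i) w = (\<Sum>s\<in>S. inner_on I (u s) w)"
  "inner_on I w (\<lambda>i. \<Sum>s\<in>S. u s i) = (\<Sum>s\<in>S. inner_on I w (u s))"
proof -
  show "inner_on I (\<lambda>i. \<Sum>s\<in>S. u s i) w = (\<Sum>s\<in>S. inner_on I (u s) w)"
    unfolding inner_on_def sum_distrib_right by (rule sum.swap)
  then show "inner_on I w (\<lambda>i. \<Sum>s\<in>S. u s i) = (\<Sum>s\<in>S. inner_on I w (u s))"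
    by (simp add: inner_on_commute)
qed

lemma inner_on_cong: "(\<And>i. i \<in> I \<Longrightarrow> u i = u' i) \<Longrightarrow> (\<And>i. i \<in> I \<Longrightarrow> v i = v' i) \<Longrightarrow> inner_on I u v = inner_on I u' v'"
  unfolding inner_on_def by (auto intro!: sum.cong)

lemma inner_on_nonneg: "0 \<le> inner_on I u u"
  unfolding inner_on_def by (intro sum_nonneg) auto

lemma inner_on_eq_0: "finite I \<Longrightarrow> inner_on I u u = 0 \<longleftrightarrow> (\<forall>i\<in>I. u i = 0)"
  unfolding inner_on_def by (subst sum_nonneg_eq_0_iff) auto

lemma mat_app_add: "mat_app I a (\<lambda>i. u i + v i) i = mat_app I a u i + mat_app I a v i"
  unfolding mat_app_def by (simp add: algebra_simps sum.distrib)

lemma mat_app_diff: "mat_app I a (\<lambda>i. u i - v i) i = mat_app I a u i - mat_app I a v i"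
  unfolding mat_app_def by (simp add: algebra_simps sum_subtractf)

lemma mat_app_scale: "mat_app I a (\<lambda>i. c * u i) i = c * mat_app I a u i"
  unfolding mat_app_def by (simp add: algebra_simps sum_distrib_left)

lemma mat_app_cong: "(\<And>i. i \<in> I \<Longrightarrow> u i = u' i) \<Longrightarrow> mat_app I a u i = mat_app I a u' i"
  unfolding mat_app_def by (auto intro!: sum.cong)

lemma mat_app_transpose:
  "inner_on I u (mat_app I a v) = inner_on I (mat_app I (\<lambda>i j. a j i) u) v"
proof -
  have "inner_on I u (mat_app I a v) = (\<Sum>i\<in>I. \<Sum>j\<in>I. u i * (a i j * v j))"
    unfolding inner_on_def mat_app_def sum_distrib_left ..
  also have "\<dots> = (\<Sum>j\<in>I. \<Sum>i\<in>I. u i * (a i j * v j))" by (rule sum.swap)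
  also have "\<dots> = inner_on I (mat_app I (\<lambda>i j. a j i) u) v"
    unfolding inner_on_def mat_app_def sum_distrib_right by (simp add: ac_simps)
  finally show ?thesis .
qed

lemma mat_app_symmetric:
  assumes "\<And>i j. i \<in> I \<Longrightarrow> j \<in> I \<Longrightarrow> a i j = a j i"
  shows "inner_on I u (mat_app I a v) = inner_on I (mat_app I a u) v"
  unfolding mat_app_transpose
  by (rule inner_on_cong) (auto simp: mat_app_def assms intro!: sum.cong)

lemma inner_on_Cauchy_Schwarz: "(inner_on I u v)\<^sup>2 \<le> inner_on I u u * inner_on I v v"
  using Cauchy_Schwarz_ineq_sum[of u v I] unfolding inner_on_def by (simp add: power2_eq_square)

text \<open>Dimension count by a trace: if every vector orthogonal to the r given ones vanished, the
  residuals of all unit vectors under the projection would vanish, and the trace of the projection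
  would be both \<open>card I\<close> and r.\<close>

lemma orthonormal_extend:
  assumes fin: "finite I" and r: "r < card I"
    and on: "\<And>s t. s < r \<Longrightarrow> t < r \<Longrightarrow> inner_on I (\<phi> s) (\<phi> t) = (if s = t then 1 else 0)"
  shows "\<exists>x. inner_on I x x > 0 \<and> (\<forall>s<r. inner_on I (\<phi> s) x = 0) \<and> (\<forall>i. i \<notin> I \<longrightarrow> x i = 0)"
proof (rule ccontr)
  assume neg: "\<not> ?thesis"
  define e where "e m = (\<lambda>i. if i = m then 1 else (0::real))" for m :: 'a
  define y where "y m = (\<lambda>i. if i \<in> I then e m i - (\<Sum>s<r. \<phi> s m * \<phi> s i) else 0)" for m
  have ye: "inner_on I w (y m) = inner_on I w (\<lambda>i. e m i - (\<Sum>s<r. \<phi> s m * \<phi> s i))" for w m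
    by (rule inner_on_cong) (auto simp: y_def)
  have ie: "inner_on I w (e m) = w m" if "m \<in> I" for w m
    unfolding inner_on_def e_def using fin that by (simp add: if_distrib cong: if_cong)
  have orth: "inner_on I (\<phi> t) (y m) = 0" if "t < r" "m \<in> I" for t m
  proof -
    have "inner_on I (\<phi> t) (y m) = \<phi> t m - (\<Sum>s<r. \<phi> s m * inner_on I (\<phi> t) (\<phi> s))"
      unfolding ye inner_on_diff inner_on_sum inner_on_scale ie[OF that(2)] ..
    also have "(\<Sum>s<r. \<phi> s m * inner_on I (\<phi> t) (\<phi> s)) = (\<Sum>s<r. if t = s then \<phi> s m else 0)"
      by (rule sum.cong) (use that on in auto)
    finally show ?thesis using that by simp
  qed
  have "inner_on I (y m) (y m) = 0" if "m \<in> I" for m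
  proof -
    have "\<not> inner_on I (y m) (y m) > 0" using neg orth[OF _ that] by (auto simp: y_def)
    then show ?thesis using inner_on_nonneg[of I "y m"] by linarith
  qed
  then have y0: "y m i = 0" if "m \<in> I" "i \<in> I" for m i using that inner_on_eq_0[OF fin] by blast
  have "real (card I) = (\<Sum>m\<in>I. e m m)" by (simp add: e_def)
  also have "\<dots> = (\<Sum>m\<in>I. \<Sum>s<r. \<phi> s m * \<phi> s m)"
  proof (rule sum.cong[OF refl])
    fix m assume "m \<in> I"
    then show "e m m = (\<Sum>s<r. \<phi> s m * \<phi> s m)" using y0[of m m] by (simp add: y_def)
  qed
  also have "\<dots> = (\<Sum>s<r. inner_on I (\<phi> s) (\<phi> s))" unfolding inner_on_def by (rule sum.swap)
  also have "\<dots> = real r" using on by simp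
  finally show False using r by simp
qed

text \<open>A maximizer of the Rayleigh quotient on the unit sphere of the orthogonal complement.
  Symmetry keeps the residual y of the eigenvalue equation in that complement, so it is an
  admissible direction of variation.\<close>

lemma eigenvector_step:
  fixes a :: "'a \<Rightarrow> 'a \<Rightarrow> real"
  assumes fin: "finite I" and r: "r < card I"
    and sym: "\<And>i j. i \<in> I \<Longrightarrow> j \<in> I \<Longrightarrow> a i j = a j i"
    and on: "\<And>s t. s < r \<Longrightarrow> t < r \<Longrightarrow> inner_on I (\<phi> s) (\<phi> t) = (if s = t then 1 else 0)"
    and ev: "\<And>s i. s < r \<Longrightarrow> i \<in> I \<Longrightarrow> mat_app I a (\<phi> s) i = \<mu> s * \<phi> s i"
  shows "\<exists>x l. inner_on I x x = 1 \<and> (\<forall>s<r. inner_on I (\<phi> s) x = 0) \<and> (\<forall>i\<in>I. mat_app I a x i = l * x i)"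
proof -
  define f where "f x = inner_on I x (mat_app I a x)" for x
  define V where "V = {x. (\<forall>s<r. inner_on I (\<phi> s) x = 0) \<and> (\<forall>i. i \<notin> I \<longrightarrow> x i = 0)}"
  \<comment> \<open>Coordinates outside \<open>I\<close> are pinned to 0, so the sphere is compact
    in the product topology even if the index type is infinite.\<close>
  define box where "box = (PiE UNIV (\<lambda>i. if i \<in> I then {-1..1} else {0::real}) :: ('a \<Rightarrow> real) set)"
  define K where "K = box \<inter> ({x. inner_on I x x = 1} \<inter> (\<Inter>s\<in>{..<r}. {x. inner_on I (\<phi> s) x = 0}))"
  have cont: "continuous_on UNIV (\<lambda>x. inner_on I (g x) (h x))"
    if "\<And>i. continuous_on UNIV (\<lambda>x. g x i)" "\<And>i. continuous_on UNIV (\<lambda>x. h x i)"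
    for g h :: "('a \<Rightarrow> real) \<Rightarrow> 'a \<Rightarrow> real"
    unfolding inner_on_def by (intro continuous_intros that)
  have cc: "continuous_on UNIV (\<lambda>x :: 'a \<Rightarrow> real. x i)" for i by (rule continuous_on_product_coordinates)
  have contf: "continuous_on UNIV f"
    unfolding f_def mat_app_def by (intro cont continuous_intros cc)
  have "compact box"
  proof -
    have "compactin (product_topology (\<lambda>i. euclidean) UNIV) box"
      unfolding box_def compactin_PiE by (auto simp: compactin_euclidean_iff)
    then show ?thesis by (simp add: euclidean_product_topology compactin_euclidean_iff)
  qed
  moreover have "closed ({x. inner_on I x x = 1} \<inter> (\<Inter>s\<in>{..<r}. {x. inner_on I (\<phi> s) x = 0}))"
    by (intro closed_Int closed_INT ballI closed_Collect_eq cont cc continuous_intros)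
  ultimately have cK: "compact K" unfolding K_def by (rule compact_Int_closed)
  have KI: "x \<in> K" if "x \<in> V" "inner_on I x x = 1" for x
  proof -
    have "x i \<in> {-1..1}" if "i \<in> I" for i
    proof -
      have "x i * x i \<le> inner_on I x x" unfolding inner_on_def
        using fin that by (intro member_le_sum) auto
      then have "(x i)\<^sup>2 \<le> 1" using \<open>inner_on I x x = 1\<close> by (simp add: power2_eq_square)
      then have "\<bar>x i\<bar> \<le> 1" by (simp add: abs_square_le_1)
      then show ?thesis by auto
    qed
    then show ?thesis using that unfolding K_def V_def box_def by auto
  qed
  have norm: "(\<lambda>i. (1 / sqrt (inner_on I x x)) * x i) \<in> K" if "x \<in> V" "inner_on I x x > 0" for x
  proof (rule KI)
    show "(\<lambda>i. (1 / sqrt (inner_on I x x)) * x i) \<in> V" using that(1) unfolding V_def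
      by (auto simp: inner_on_scale simp del: times_divide_eq_left)
    show "inner_on I (\<lambda>i. (1 / sqrt (inner_on I x x)) * x i) (\<lambda>i. (1 / sqrt (inner_on I x x)) * x i) = 1"
      unfolding inner_on_scale using that(2) by (simp add: field_simps)
  qed
  obtain x0 where "x0 \<in> V" "inner_on I x0 x0 > 0"
    using orthonormal_extend[OF fin r on] unfolding V_def by auto
  then have "K \<noteq> {}" using norm by blast
  then obtain x where xK: "x \<in> K" and max: "\<And>y. y \<in> K \<Longrightarrow> f y \<le> f x"
    using continuous_attains_sup[OF cK _ continuous_on_subset[OF contf subset_UNIV]] by blast
  have x1: "inner_on I x x = 1" and xV: "x \<in> V" using xK unfolding K_def V_def box_def by (auto simp: PiE_iff split: if_splits)
  define l where "l = f x"
  have ray: "f z \<le> l * inner_on I z z" if "z \<in> V" for z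
  proof (cases "inner_on I z z = 0")
    case True
    then have z0: "\<And>i. i \<in> I \<Longrightarrow> z i = 0" using inner_on_eq_0[OF fin] by blast
    have "f z = inner_on I (\<lambda>_. 0) (mat_app I a z)" unfolding f_def by (rule inner_on_cong) (auto simp: z0)
    then show ?thesis using True by (simp add: inner_on_def)
  next
    case False
    then have pos: "inner_on I z z > 0" using inner_on_nonneg[of I z] by linarith
    have "f (\<lambda>i. (1 / sqrt (inner_on I z z)) * z i) \<le> l" unfolding l_def by (intro max norm that pos)
    also have "f (\<lambda>i. (1 / sqrt (inner_on I z z)) * z i) = f z / inner_on I z z"
      unfolding f_def mat_app_scale[abs_def] inner_on_scale using pos by (simp add: field_simps)
    finally show ?thesis using pos by (simp add: pos_divide_le_eq)
  qed
  define y where "y = (\<lambda>i. if i \<in> I then mat_app I a x i - l * x i else 0)"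
  have ye: "inner_on I w y = inner_on I w (\<lambda>i. mat_app I a x i - l * x i)" for w
    by (rule inner_on_cong) (auto simp: y_def)
  have yV: "y \<in> V"
  proof -
    have "inner_on I (\<phi> s) y = 0" if "s < r" for s
    proof -
      have "inner_on I (\<phi> s) (mat_app I a x) = inner_on I (mat_app I a (\<phi> s)) x"
        by (rule mat_app_symmetric[OF sym])
      also have "\<dots> = inner_on I (\<lambda>i. \<mu> s * \<phi> s i) x" by (rule inner_on_cong) (use ev that in auto)
      also have "\<dots> = 0" unfolding inner_on_scale using xV that unfolding V_def by simp
      finally show ?thesis unfolding ye inner_on_diff inner_on_scale using xV that unfolding V_def by simp
    qed
    then show ?thesis unfolding V_def y_def by auto
  qed
  have xy: "inner_on I x y = 0" unfolding ye inner_on_diff inner_on_scale x1 l_def f_def by simp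
  have yAx: "inner_on I y (mat_app I a x) = inner_on I y y"
  proof -
    have "inner_on I y (mat_app I a x) = inner_on I y (\<lambda>i. y i + l * x i)"
      by (rule inner_on_cong) (auto simp: y_def)
    also have "\<dots> = inner_on I y y" unfolding inner_on_add inner_on_scale using xy by (simp add: inner_on_commute)
    finally show ?thesis .
  qed
  \<comment> \<open>Comparing x with x + t y: the gain is linear in t with coefficient 2 |y|^2, the
    loss quadratic. A small positive t forces y = 0.\<close>
  have key: "2 * t * inner_on I y y \<le> t\<^sup>2 * (l * inner_on I y y - f y)" for t
  proof -
    let ?z = "\<lambda>i. x i + t * y i"
    have "?z \<in> V" using xV yV unfolding V_def by (auto simp: inner_on_add inner_on_scale)
    from ray[OF this] have "f ?z \<le> l * inner_on I ?z ?z" .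
    moreover have "inner_on I ?z ?z = 1 + t\<^sup>2 * inner_on I y y"
      unfolding inner_on_add inner_on_scale using xy x1 by (simp add: inner_on_commute power2_eq_square)
    moreover have "f ?z = l + 2 * t * inner_on I y y + t\<^sup>2 * f y"
    proof -
      have "mat_app I a ?z = (\<lambda>i. mat_app I a x i + t * mat_app I a y i)"
        by (simp add: fun_eq_iff mat_app_add mat_app_scale)
      moreover have "inner_on I x (mat_app I a y) = inner_on I y y"
        using mat_app_symmetric[OF sym, where u = x and v = y] yAx by (simp add: inner_on_commute)
      ultimately show ?thesis unfolding f_def l_def inner_on_add inner_on_scale
        using yAx by (simp add: inner_on_add inner_on_scale power2_eq_square algebra_simps)
    qed
    ultimately show ?thesis by (simp add: algebra_simps)
  qed
  have "inner_on I y y = 0"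
  proof (rule ccontr)
    assume "inner_on I y y \<noteq> 0"
    then have N: "inner_on I y y > 0" using inner_on_nonneg[of I y] by linarith
    define c where "c = \<bar>l * inner_on I y y - f y\<bar> + 1"
    define t where "t = inner_on I y y / c"
    have c: "c > 0" "l * inner_on I y y - f y \<le> c" unfolding c_def by auto
    have t: "t > 0" using N c unfolding t_def by simp
    have "2 * t * inner_on I y y \<le> t\<^sup>2 * c" using key[of t] c t by (smt (verit) mult_left_mono zero_le_power2)
    also have "t\<^sup>2 * c = t * inner_on I y y" using c unfolding t_def by (simp add: power2_eq_square)
    finally show False using N t by simp
  qed
  then have "\<forall>i\<in>I. y i = 0" using inner_on_eq_0[OF fin] by blast
  then have "\<forall>i\<in>I. mat_app I a x i = l * x i" unfolding y_def by auto
  then show ?thesis using x1 xV unfolding V_def by blast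
qed

lemma orthonormal_eigenvectors:
  fixes a :: "'a \<Rightarrow> 'a \<Rightarrow> real"
  assumes fin: "finite I" and sym: "\<And>i j. i \<in> I \<Longrightarrow> j \<in> I \<Longrightarrow> a i j = a j i"
  shows "r \<le> card I \<Longrightarrow> \<exists>\<phi> \<mu>. (\<forall>s<r. \<forall>t<r. inner_on I (\<phi> s) (\<phi> t) = (if s = t then 1 else 0)) \<and>
     (\<forall>s<r. \<forall>i\<in>I. mat_app I a (\<phi> s) i = \<mu> s * \<phi> s i)"
proof (induction r)
  case 0
  then show ?case by simp
next
  case (Suc r)
  then obtain \<phi> \<mu> where on: "\<forall>s<r. \<forall>t<r. inner_on I (\<phi> s) (\<phi> t) = (if s = t then 1 else 0)"
    and ev: "\<forall>s<r. \<forall>i\<in>I. mat_app I a (\<phi> s) i = \<mu> s * \<phi> s i" by auto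
  obtain x l where x: "inner_on I x x = 1" "\<forall>s<r. inner_on I (\<phi> s) x = 0" "\<forall>i\<in>I. mat_app I a x i = l * x i"
    using eigenvector_step[where a = a and I = I and r = r and \<phi> = \<phi> and \<mu> = \<mu>] fin sym Suc.prems on ev by auto
  have "\<forall>s<Suc r. \<forall>t<Suc r. inner_on I ((\<phi>(r := x)) s) ((\<phi>(r := x)) t) = (if s = t then 1 else 0)"
    using on x by (auto simp: less_Suc_eq inner_on_commute)
  moreover have "\<forall>s<Suc r. \<forall>i\<in>I. mat_app I a ((\<phi>(r := x)) s) i = (\<mu>(r := l)) s * (\<phi>(r := x)) s i"
    using ev x by (auto simp: less_Suc_eq)
  ultimately show ?case by blast
qed

text \<open>The same trace argument: the squared residuals of the unit vectors are nonnegative and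
  their sum is \<open>card I\<close> minus the sum of the squared norms of the \<phi>, that is
  0.\<close>

lemma orthonormal_complete:
  assumes fin: "finite I"
    and on: "\<And>s t. s < card I \<Longrightarrow> t < card I \<Longrightarrow> inner_on I (\<phi> s) (\<phi> t) = (if s = t then 1 else 0)"
    and i: "i \<in> I"
  shows "u i = (\<Sum>s<card I. inner_on I (\<phi> s) u * \<phi> s i)"
proof -
  define e where "e m = (\<lambda>i. if i = m then 1 else (0::real))" for m :: 'a
  define y where "y m = (\<lambda>i. e m i - (\<Sum>s<card I. \<phi> s m * \<phi> s i))" for m
  have ie: "inner_on I w (e m) = w m" if "m \<in> I" for w m
    unfolding inner_on_def e_def using fin that by (simp add: if_distrib cong: if_cong)
  have orth: "inner_on I (\<phi> t) (y m) = 0" if "t < card I" "m \<in> I" for t m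
  proof -
    have "inner_on I (\<phi> t) (y m) = \<phi> t m - (\<Sum>s<card I. \<phi> s m * inner_on I (\<phi> t) (\<phi> s))"
      unfolding y_def inner_on_diff inner_on_sum inner_on_scale ie[OF that(2)] ..
    also have "(\<Sum>s<card I. \<phi> s m * inner_on I (\<phi> t) (\<phi> s)) = (\<Sum>s<card I. if t = s then \<phi> s m else 0)"
      by (rule sum.cong) (use that on in auto)
    finally show ?thesis using that by simp
  qed
  have yy: "inner_on I (y m) (y m) = 1 - (\<Sum>s<card I. \<phi> s m * \<phi> s m)" if "m \<in> I" for m
  proof -
    have "inner_on I (y m) (y m) = inner_on I (y m) (e m) - (\<Sum>s<card I. \<phi> s m * inner_on I (y m) (\<phi> s))"
      by (subst (2) y_def) (simp only: inner_on_diff inner_on_sum inner_on_scale)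
    also have "(\<Sum>s<card I. \<phi> s m * inner_on I (y m) (\<phi> s)) = 0"
      using orth that by (auto simp: inner_on_commute intro!: sum.neutral)
    finally show ?thesis using ie[OF that, of "y m"] by (simp add: y_def e_def)
  qed
  have "(\<Sum>m\<in>I. inner_on I (y m) (y m)) = real (card I) - (\<Sum>m\<in>I. \<Sum>s<card I. \<phi> s m * \<phi> s m)"
    using yy by (simp add: sum_subtractf)
  also have "(\<Sum>m\<in>I. \<Sum>s<card I. \<phi> s m * \<phi> s m) = (\<Sum>s<card I. inner_on I (\<phi> s) (\<phi> s))"
    unfolding inner_on_def by (rule sum.swap)
  also have "\<dots> = real (card I)" using on by simp
  finally have "(\<Sum>m\<in>I. inner_on I (y m) (y m)) = 0" by simp
  then have "inner_on I (y m) (y m) = 0" if "m \<in> I" for m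
    using fin that inner_on_nonneg by (subst (asm) sum_nonneg_eq_0_iff) auto
  then have y0: "y m i = 0" if "m \<in> I" for m using inner_on_eq_0[OF fin] that i by blast
  have "u i = inner_on I u (e i)" using ie[OF i] by simp
  also have "\<dots> = inner_on I u (\<lambda>m. \<Sum>s<card I. \<phi> s i * \<phi> s m)"
  proof (rule inner_on_cong)
    fix m assume "m \<in> I"
    have "e i m = e m i" by (simp add: e_def)
    then show "e i m = (\<Sum>s<card I. \<phi> s i * \<phi> s m)" using y0[OF \<open>m \<in> I\<close>] by (simp add: y_def mult.commute)
  qed simp
  also have "\<dots> = (\<Sum>s<card I. inner_on I (\<phi> s) u * \<phi> s i)"
    unfolding inner_on_sum inner_on_scale by (simp add: inner_on_commute mult.commute)
  finally show ?thesis .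
qed

theorem spectral_theorem_symmetric:
  fixes a :: "'a \<Rightarrow> 'a \<Rightarrow> real"
  assumes "finite I" "\<And>i j. i \<in> I \<Longrightarrow> j \<in> I \<Longrightarrow> a i j = a j i"
  obtains \<phi> :: "nat \<Rightarrow> 'a \<Rightarrow> real" and \<mu> where
    "\<And>s t. s < card I \<Longrightarrow> t < card I \<Longrightarrow> inner_on I (\<phi> s) (\<phi> t) = (if s = t then 1 else 0)"
    "\<And>s i. s < card I \<Longrightarrow> i \<in> I \<Longrightarrow> mat_app I a (\<phi> s) i = \<mu> s * \<phi> s i"
    "\<And>u i. i \<in> I \<Longrightarrow> u i = (\<Sum>s<card I. inner_on I (\<phi> s) u * \<phi> s i)"
proof -
  obtain \<phi> \<mu> where on: "\<forall>s<card I. \<forall>t<card I. inner_on I (\<phi> s) (\<phi> t) = (if s = t then 1 else 0)"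
    and ev: "\<forall>s<card I. \<forall>i\<in>I. mat_app I a (\<phi> s) i = \<mu> s * \<phi> s i"
    using orthonormal_eigenvectors[of I a "card I", OF assms(1) _ order_refl] assms(2) by blast
  show ?thesis
    by (rule that[of \<phi> \<mu>]) (use on ev orthonormal_complete[OF assms(1), of \<phi>] in auto)
qed

subsection \<open>Smoothing and W-cycle in the energy norm\<close>

definition mform :: "real mat \<Rightarrow> real vec \<Rightarrow> real vec \<Rightarrow> real" where
  "mform A x y = scalar_prod x (A *\<^sub>v y)"

definition spd :: "nat \<Rightarrow> real mat \<Rightarrow> bool" where
  "spd n A \<longleftrightarrow> A \<in> carrier_mat n n \<and> (\<forall>i<n. \<forall>j<n. A $$ (i, j) = A $$ (j, i)) \<and>
     (\<forall>v\<in>carrier_vec n. v \<noteq> 0\<^sub>v n \<longrightarrow> mform A v v > 0)"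

lemma scalar_prod_inner_on:
  "x \<in> carrier_vec n \<Longrightarrow> y \<in> carrier_vec n \<Longrightarrow> scalar_prod x y = inner_on {..<n} (vec_index x) (vec_index y)"
  by (simp add: scalar_prod_def inner_on_def atLeast0LessThan)

lemma mult_mat_vec_index_sum:
  assumes "M \<in> carrier_mat nr nc" "v \<in> carrier_vec nc" "i < nr"
  shows "vec_index (M *\<^sub>v v) i = (\<Sum>j<nc. M $$ (i, j) * vec_index v j)"
  using assms by (auto simp: scalar_prod_def atLeast0LessThan intro!: sum.cong)

lemma mult_mat_vec_mat_app:
  "A \<in> carrier_mat n n \<Longrightarrow> y \<in> carrier_vec n \<Longrightarrow> i < n \<Longrightarrow>
     vec_index (A *\<^sub>v y) i = mat_app {..<n} (\<lambda>i j. A $$ (i, j)) (vec_index y) i"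
  by (simp add: scalar_prod_def mat_app_def atLeast0LessThan)

lemma mform_inner_on:
  assumes "A \<in> carrier_mat n n" "x \<in> carrier_vec n" "y \<in> carrier_vec n"
  shows "mform A x y = inner_on {..<n} (vec_index x) (mat_app {..<n} (\<lambda>i j. A $$ (i, j)) (vec_index y))"
proof -
  have "mform A x y = inner_on {..<n} (vec_index x) (vec_index (A *\<^sub>v y))"
    unfolding mform_def by (rule scalar_prod_inner_on) (use assms in auto)
  also have "\<dots> = inner_on {..<n} (vec_index x) (mat_app {..<n} (\<lambda>i j. A $$ (i, j)) (vec_index y))"
    by (rule inner_on_cong) (use assms in \<open>auto simp: mult_mat_vec_mat_app simp del: index_mult_mat_vec\<close>)
  finally show ?thesis .
qed

lemma mform_add:
  assumes "A \<in> carrier_mat n n" "x \<in> carrier_vec n" "y \<in> carrier_vec n" "z \<in> carrier_vec n"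
  shows "mform A (x + y) z = mform A x z + mform A y z" "mform A z (x + y) = mform A z x + mform A z y"
  unfolding mform_def using assms
  by (simp_all add: add_scalar_prod_distrib[of _ n] mult_add_distrib_mat_vec[of _ n n] scalar_prod_add_distrib[of _ n])

lemma mform_diff:
  assumes "A \<in> carrier_mat n n" "x \<in> carrier_vec n" "y \<in> carrier_vec n" "z \<in> carrier_vec n"
  shows "mform A (x - y) z = mform A x z - mform A y z" "mform A z (x - y) = mform A z x - mform A z y"
proof -
  have "mform A (x - y + y) z = mform A (x - y) z + mform A y z" by (rule mform_add) (use assms in auto)
  moreover have "x - y + y = x" using assms by (intro eq_vecI) auto
  ultimately show "mform A (x - y) z = mform A x z - mform A y z" by simp
  have "mform A z (x - y + y) = mform A z (x - y) + mform A z y" by (rule mform_add) (use assms in auto)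
  then show "mform A z (x - y) = mform A z x - mform A z y" using \<open>x - y + y = x\<close> by simp
qed

lemma mform_smult:
  assumes "A \<in> carrier_mat n n" "x \<in> carrier_vec n" "z \<in> carrier_vec n"
  shows "mform A (c \<cdot>\<^sub>v x) z = c * mform A x z" "mform A z (c \<cdot>\<^sub>v x) = c * mform A z x"
  unfolding mform_def using assms by (simp_all add: mult_mat_vec[of _ n n])

lemma spd_carrier: "spd n A \<Longrightarrow> A \<in> carrier_mat n n"
  unfolding spd_def by simp

lemma mform_commute:
  assumes "spd n A" "x \<in> carrier_vec n" "y \<in> carrier_vec n"
  shows "mform A x y = mform A y x"
proof -
  have "mform A x y = inner_on {..<n} (mat_app {..<n} (\<lambda>i j. A $$ (i, j)) (vec_index x)) (vec_index y)"
    unfolding mform_inner_on[OF spd_carrier[OF assms(1)] assms(2,3)]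
    by (rule mat_app_symmetric) (use assms(1) in \<open>auto simp: spd_def\<close>)
  then show ?thesis unfolding mform_inner_on[OF spd_carrier[OF assms(1)] assms(3,2)] by (simp add: inner_on_commute)
qed

lemma mform_nonneg:
  assumes "spd n A" "x \<in> carrier_vec n" shows "0 \<le> mform A x x"
proof (cases "x = 0\<^sub>v n")
  case True
  have "mform A x x = 0" unfolding True mform_def scalar_prod_def using spd_carrier[OF assms(1)]
    by (auto intro!: sum.neutral)
  then show ?thesis by simp
next
  case False
  then show ?thesis using assms unfolding spd_def by (simp add: less_imp_le)
qed

lemma mform_Cauchy_Schwarz:
  assumes "spd n A" "x \<in> carrier_vec n" "y \<in> carrier_vec n"
  shows "\<bar>mform A x y\<bar> \<le> sqrt (mform A x x) * sqrt (mform A y y)"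
proof -
  note c = spd_carrier[OF assms(1)]
  let ?t = "mform A y y" and ?s = "mform A x y"
  let ?z = "?t \<cdot>\<^sub>v x - ?s \<cdot>\<^sub>v y"
  have yx: "mform A y x = ?s" using mform_commute[OF assms] by simp
  have "0 \<le> mform A ?z ?z" by (rule mform_nonneg[OF assms(1)]) (use assms in auto)
  also have "mform A ?z ?z = ?t * (?t * mform A x x - ?s\<^sup>2)"
    using assms c by (simp add: mform_diff[of _ n] mform_smult[of _ n] yx power2_eq_square algebra_simps)
  finally have z: "0 \<le> ?t * (?t * mform A x x - ?s\<^sup>2)" .
  have "?s\<^sup>2 \<le> mform A x x * ?t"
  proof (cases "y = 0\<^sub>v n")
    case True
    have "y = 0 \<cdot>\<^sub>v y" unfolding True by (intro eq_vecI) auto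
    then have "?s = 0 * ?s" using mform_smult(2)[OF c assms(3,2), of 0] by simp
    then show ?thesis using mform_nonneg[OF assms(1)] assms by simp
  next
    case False
    then have "?t > 0" using assms unfolding spd_def by simp
    then show ?thesis using z by (simp add: zero_le_mult_iff mult.commute)
  qed
  then have "sqrt (?s\<^sup>2) \<le> sqrt (mform A x x * ?t)" by (rule real_sqrt_le_mono)
  then show ?thesis by (simp add: real_sqrt_mult)
qed

lemma spd_inv_mat:
  assumes "spd n A"
  shows "inv_mat A \<in> carrier_mat n n \<and> A * inv_mat A = 1\<^sub>m n \<and> inv_mat A * A = 1\<^sub>m n"
proof -
  note c = spd_carrier[OF assms]
  have "\<not> (\<exists>v. v \<in> carrier_vec n \<and> v \<noteq> 0\<^sub>v n \<and> A *\<^sub>v v = 0\<^sub>v n)"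
  proof
    assume "\<exists>v. v \<in> carrier_vec n \<and> v \<noteq> 0\<^sub>v n \<and> A *\<^sub>v v = 0\<^sub>v n"
    then obtain v where v: "v \<in> carrier_vec n" "v \<noteq> 0\<^sub>v n" "A *\<^sub>v v = 0\<^sub>v n" by blast
    have "mform A v v = 0" unfolding mform_def v(3) using v(1) by simp
    then show False using assms v unfolding spd_def by auto
  qed
  then have "Determinant.det A \<noteq> 0" using det_0_iff_vec_prod_zero_field[OF c] by simp
  then have "A \<in> Units (ring_mat TYPE(real) n ())" by (rule det_non_zero_imp_unit[OF c])
  then obtain B where B: "mat_inverse A = Some B" using mat_inverse(1)[OF c, of "()"] by (cases "mat_inverse A") auto
  then show ?thesis using mat_inverse(2)[OF c B] unfolding inv_mat_def by simp
qed

lemma mform_unit_vec: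
  assumes "A \<in> carrier_mat n n" "i < n" shows "mform A (unit_vec n i) (unit_vec n i) = A $$ (i, i)"
proof -
  have "mform A (unit_vec n i) (unit_vec n i) = vec_index (A *\<^sub>v unit_vec n i) i"
    unfolding mform_def using assms by (subst scalar_prod_left_unit[of _ n]) auto
  also have "\<dots> = A $$ (i, i)" using assms by (simp add: scalar_prod_right_unit)
  finally show ?thesis .
qed

lemma spd_diag_pos:
  assumes "spd n A" "i < n" shows "A $$ (i, i) > 0"
proof -
  have "mform A (unit_vec n i) (unit_vec n i) > 0" using assms unfolding spd_def by simp
  then show ?thesis using mform_unit_vec[OF spd_carrier[OF assms(1)] assms(2)] by simp
qed

lemma mform_diag_part:
  assumes "A \<in> carrier_mat n n" "x \<in> carrier_vec n" "y \<in> carrier_vec n"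
  shows "mform (diag_part A) x y = (\<Sum>i<n. A $$ (i, i) * vec_index x i * vec_index y i)"
proof -
  have d: "diag_part A \<in> carrier_mat n n" using assms unfolding diag_part_def by simp
  show ?thesis unfolding mform_inner_on[OF d assms(2,3)] inner_on_def
  proof (rule sum.cong[OF refl])
    fix i assume i: "i \<in> {..<n}"
    have "mat_app {..<n} (\<lambda>i j. diag_part A $$ (i, j)) (vec_index y) i = (\<Sum>j<n. if j = i then A $$ (i, i) * vec_index y i else 0)"
      unfolding mat_app_def by (rule sum.cong) (use i assms in \<open>auto simp: diag_part_def mat_diag_def\<close>)
    then show "vec_index x i * mat_app {..<n} (\<lambda>i j. diag_part A $$ (i, j)) (vec_index y) i = A $$ (i, i) * vec_index x i * vec_index y i"
      using i by simp
  qed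
qed

lemma spd_diag_part:
  assumes "spd n A" shows "spd n (diag_part A)"
  unfolding spd_def
proof (intro conjI ballI impI allI)
  show "diag_part A \<in> carrier_mat n n" using spd_carrier[OF assms] unfolding diag_part_def by simp
  fix i j assume "i < n" "j < n"
  then show "diag_part A $$ (i, j) = diag_part A $$ (j, i)"
    using spd_carrier[OF assms] unfolding diag_part_def mat_diag_def by auto
next
  fix v :: "real vec" assume v: "v \<in> carrier_vec n" "v \<noteq> 0\<^sub>v n"
  then obtain i where i: "i < n" "vec_index v i \<noteq> 0" by (metis carrier_vecD eq_vecI index_zero_vec(1) index_zero_vec(2))
  have "0 < A $$ (i, i) * vec_index v i * vec_index v i"
    using spd_diag_pos[OF assms i(1)] i(2) by (auto simp: mult.assoc zero_less_mult_iff)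
  also have "\<dots> \<le> (\<Sum>i<n. A $$ (i, i) * vec_index v i * vec_index v i)"
    by (rule member_le_sum) (use i spd_diag_pos[OF assms] in \<open>auto simp: mult.assoc less_imp_le\<close>)
  finally show "mform (diag_part A) v v > 0" using mform_diag_part[OF spd_carrier[OF assms] v(1) v(1)] by simp
qed

lemma poly_at_mat_eigenvector:
  assumes X: "X \<in> carrier_mat n n" and v: "v \<in> carrier_vec n" and ev: "X *\<^sub>v v = \<mu> \<cdot>\<^sub>v v"
  shows "poly_at_mat q X *\<^sub>v v = poly q \<mu> \<cdot>\<^sub>v v"
proof -
  have pow: "X ^\<^sub>m l *\<^sub>v v = \<mu> ^ l \<cdot>\<^sub>v v" for l
  proof (induction l)
    case (Suc l)
    have "X ^\<^sub>m Suc l *\<^sub>v v = X ^\<^sub>m l *\<^sub>v (X *\<^sub>v v)" using X v by (simp add: assoc_mult_mat_vec[of _ n n _ n])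
    also have "\<dots> = \<mu> \<cdot>\<^sub>v (X ^\<^sub>m l *\<^sub>v v)" unfolding ev using X v by (intro mult_mat_vec) auto
    finally show ?case unfolding Suc by (simp add: smult_smult_assoc)
  qed (use X v in auto)
  show ?thesis
  proof (rule eq_vecI)
    fix i assume "i < dim_vec (poly q \<mu> \<cdot>\<^sub>v v)"
    then have i: "i < n" using v by simp
    have "vec_index (poly_at_mat q X *\<^sub>v v) i = (\<Sum>j<n. (\<Sum>l\<le>Polynomial.degree q. Polynomial.coeff q l * (X ^\<^sub>m l) $$ (i, j)) * vec_index v j)"
      using X v i by (simp add: poly_at_mat_def scalar_prod_def atLeast0LessThan)
    also have "\<dots> = (\<Sum>l\<le>Polynomial.degree q. Polynomial.coeff q l * (\<Sum>j<n. (X ^\<^sub>m l) $$ (i, j) * vec_index v j))"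
      unfolding sum_distrib_right sum_distrib_left by (subst sum.swap) (simp add: mult.assoc)
    also have "\<dots> = (\<Sum>l\<le>Polynomial.degree q. Polynomial.coeff q l * vec_index (X ^\<^sub>m l *\<^sub>v v) i)"
    proof -
      have "X ^\<^sub>m l \<in> carrier_mat n n" for l using X by simp
      then show ?thesis by (simp add: mult_mat_vec_index_sum[OF _ v i] del: index_mult_mat_vec)
    qed
    also have "\<dots> = poly q \<mu> * vec_index v i" unfolding pow using v i by (simp add: poly_altdef sum_distrib_right mult.assoc)
    finally show "vec_index (poly_at_mat q X *\<^sub>v v) i = vec_index (poly q \<mu> \<cdot>\<^sub>v v) i" using i v by simp
  qed (use X v in \<open>auto simp: poly_at_mat_def\<close>)
qed

lemma spec_radius_ge:
  assumes X: "X \<in> carrier_mat n n" and v: "v \<in> carrier_vec n" "v \<noteq> 0\<^sub>v n" and ev: "X *\<^sub>v v = \<mu> \<cdot>\<^sub>v v"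
  shows "\<bar>\<mu>\<bar> \<le> spec_radius X"
proof -
  have n: "n > 0" using v by (cases n) auto
  have "eigenvalue X \<mu>" unfolding eigenvalue_def eigenvector_def using X v ev by auto
  then have "eigenvalue (map_mat complex_of_real X) (complex_of_real \<mu>)"
    by (rule of_real_hom.eigenvalue_hom[OF X])
  then have "cmod (complex_of_real \<mu>) \<in> cmod ` spectrum (map_mat complex_of_real X)"
    unfolding spectrum_def by blast
  then have "cmod (complex_of_real \<mu>) \<le> spectral_radius (map_mat complex_of_real X)"
    by (rule spectral_radius_mem_max(2)[OF _ n, rotated]) (use X in auto)
  then show ?thesis unfolding spec_radius_def by simp
qed

text \<open>D^-1 A is not symmetric, but it is similar to the symmetric matrix D^(-1/2) A D^(-1/2),
  whose entries are \<open>a i j\<close>. Its eigenvectors, scaled back by D^(-1/2), diagonalize the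
  forms of A and D simultaneously, and \<open>c s\<close> are the coefficients in that
  basis.\<close>

lemma jacobi_diagonalization:
  assumes A: "spd n A"
  obtains c :: "nat \<Rightarrow> real vec \<Rightarrow> real" and \<mu> where
    "\<And>s. s < n \<Longrightarrow> 0 < \<mu> s \<and> \<mu> s \<le> spec_radius (inv_mat (diag_part A) * A)"
    "\<And>x y. x \<in> carrier_vec n \<Longrightarrow> y \<in> carrier_vec n \<Longrightarrow> mform A x y = (\<Sum>s<n. \<mu> s * (c s x * c s y))"
    "\<And>x y. x \<in> carrier_vec n \<Longrightarrow> y \<in> carrier_vec n \<Longrightarrow> mform (diag_part A) x y = (\<Sum>s<n. c s x * c s y)"
    "\<And>q \<omega> x s. x \<in> carrier_vec n \<Longrightarrow> s < n \<Longrightarrow>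
       c s (poly_at_mat q (\<omega> \<cdot>\<^sub>m (inv_mat (diag_part A) * A)) *\<^sub>v x) = poly q (\<omega> * \<mu> s) * c s x"
proof -
  note cA = spd_carrier[OF A]
  define D where "D = diag_part A"
  have D: "spd n D" unfolding D_def by (rule spd_diag_part[OF A])
  note cD = spd_carrier[OF D]
  define d where "d i = A $$ (i, i)" for i
  have d: "d i > 0" if "i < n" for i using spd_diag_pos[OF A that] unfolding d_def .
  define r where "r i = sqrt (d i)" for i
  have r: "r i > 0" "r i * r i = d i" if "i < n" for i using d[OF that] unfolding r_def by auto
  define a where "a i j = A $$ (i, j) / (r i * r j)" for i j
  have sym: "a i j = a j i" if "i \<in> {..<n}" "j \<in> {..<n}" for i j
    using A that unfolding spd_def a_def by (simp add: mult.commute)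
  obtain \<phi> \<mu> where
    on: "\<And>s t. s < n \<Longrightarrow> t < n \<Longrightarrow> inner_on {..<n} (\<phi> s) (\<phi> t) = (if s = t then 1 else 0)"
    and ev: "\<And>s i. s < n \<Longrightarrow> i \<in> {..<n} \<Longrightarrow> mat_app {..<n} a (\<phi> s) i = \<mu> s * \<phi> s i"
    and complete: "\<And>u i. i \<in> {..<n} \<Longrightarrow> u i = (\<Sum>s<n. inner_on {..<n} (\<phi> s) u * \<phi> s i)"
    using spectral_theorem_symmetric[of "{..<n}" a, OF _ sym] by auto
  define \<psi> where "\<psi> s = vec n (\<lambda>i. \<phi> s i / r i)" for s
  define c where "c s x = inner_on {..<n} (\<phi> s) (\<lambda>i. r i * vec_index x i)" for s and x :: "real vec"
  have \<psi>: "\<psi> s \<in> carrier_vec n" "\<And>i. i < n \<Longrightarrow> vec_index (\<psi> s) i = \<phi> s i / r i" for s unfolding \<psi>_def by auto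
  have expand: "vec_index x i = (\<Sum>s<n. c s x * vec_index (\<psi> s) i)" if "i < n" for x i
  proof -
    have "r i * vec_index x i = (\<Sum>s<n. c s x * \<phi> s i)"
      unfolding c_def using complete[of i "\<lambda>i. r i * vec_index x i"] that by simp
    then have "vec_index x i = (\<Sum>s<n. c s x * \<phi> s i) / r i" using r(1)[OF that] by (simp add: field_simps)
    then show ?thesis unfolding sum_divide_distrib \<psi>(2)[OF that] by simp
  qed
  have Dform: "mform D x y = (\<Sum>s<n. c s x * c s y)" if "x \<in> carrier_vec n" "y \<in> carrier_vec n" for x y
  proof -
    have "mform D x y = (\<Sum>i<n. d i * vec_index x i * vec_index y i)"
      unfolding D_def mform_diag_part[OF cA that] d_def ..
    also have "\<dots> = inner_on {..<n} (\<lambda>i. r i * vec_index x i) (\<lambda>i. r i * vec_index y i)"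
      unfolding inner_on_def by (rule sum.cong) (auto simp: r(2)[symmetric] ac_simps)
    also have "\<dots> = inner_on {..<n} (\<lambda>i. \<Sum>s<n. c s x * \<phi> s i) (\<lambda>i. r i * vec_index y i)"
      by (rule inner_on_cong) (use complete[of _ "\<lambda>i. r i * vec_index x i"] in \<open>auto simp: c_def\<close>)
    also have "\<dots> = (\<Sum>s<n. c s x * c s y)" unfolding inner_on_sum inner_on_scale c_def ..
    finally show ?thesis .
  qed
  have Aev: "vec_index (A *\<^sub>v \<psi> s) i = \<mu> s * d i * vec_index (\<psi> s) i" if "s < n" "i < n" for s i
  proof -
    have "vec_index (A *\<^sub>v \<psi> s) i = (\<Sum>j<n. A $$ (i, j) * (\<phi> s j / r j))"
      unfolding mult_mat_vec_index_sum[OF cA \<psi>(1) that(2)] using \<psi>(2) by (auto intro!: sum.cong)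
    also have "\<dots> = r i * mat_app {..<n} a (\<phi> s) i" unfolding mat_app_def a_def sum_distrib_left
      by (rule sum.cong) (use r(1)[OF that(2)] in \<open>auto simp: field_simps\<close>)
    also have "\<dots> = r i * (\<mu> s * \<phi> s i)" using ev[of s i] that by simp
    also have "\<dots> = \<mu> s * d i * vec_index (\<psi> s) i" unfolding \<psi>(2)[OF that(2)] using r[OF that(2)] by (simp add: field_simps)
    finally show ?thesis .
  qed
  have Dv: "vec_index (D *\<^sub>v x) i = d i * vec_index x i" if "x \<in> carrier_vec n" "i < n" for x i
  proof -
    have "vec_index (D *\<^sub>v x) i = (\<Sum>j<n. (if j = i then d i * vec_index x i else 0))"
      unfolding mult_mat_vec_index_sum[OF cD that]
      by (rule sum.cong[OF refl]) (use that cA in \<open>auto simp: D_def diag_part_def mat_diag_def d_def\<close>)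
    then show ?thesis using that by simp
  qed
  have AD: "A *\<^sub>v \<psi> s = \<mu> s \<cdot>\<^sub>v (D *\<^sub>v \<psi> s)" if "s < n" for s
    by (rule eq_vecI) (use Aev[OF that] Dv[OF \<psi>(1)] cA cD in \<open>auto simp del: index_mult_mat_vec\<close>)
  define X where "X = inv_mat D * A"
  note iD = spd_inv_mat[OF D]
  have cX: "X \<in> carrier_mat n n" unfolding X_def using iD cA by auto
  have Xev: "X *\<^sub>v \<psi> s = \<mu> s \<cdot>\<^sub>v \<psi> s" if "s < n" for s
  proof -
    have "X *\<^sub>v \<psi> s = inv_mat D *\<^sub>v (A *\<^sub>v \<psi> s)" unfolding X_def using iD cA \<psi>(1) by (simp add: assoc_mult_mat_vec[of _ n n _ n])
    also have "\<dots> = \<mu> s \<cdot>\<^sub>v (inv_mat D *\<^sub>v (D *\<^sub>v \<psi> s))" unfolding AD[OF that] using iD cD \<psi>(1) by (intro mult_mat_vec) auto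
    also have "inv_mat D *\<^sub>v (D *\<^sub>v \<psi> s) = (inv_mat D * D) *\<^sub>v \<psi> s" using iD cD \<psi>(1) by (intro assoc_mult_mat_vec[symmetric]) auto
    finally show ?thesis using iD \<psi>(1) by simp
  qed
  have c\<psi>: "c t (\<psi> s) = (if s = t then 1 else 0)" if "s < n" "t < n" for s t
  proof -
    have "c t (\<psi> s) = inner_on {..<n} (\<phi> t) (\<phi> s)" unfolding c_def
      by (rule inner_on_cong) (auto simp: \<psi>(2), metis less_irrefl r(1))
    then show ?thesis using on that by auto
  qed
  have \<psi>0: "\<psi> s \<noteq> 0\<^sub>v n" if "s < n" for s
  proof
    assume "\<psi> s = 0\<^sub>v n"
    then have "c s (\<psi> s) = 0" unfolding c_def inner_on_def by (auto intro!: sum.neutral)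
    then show False using c\<psi>[OF that that] by simp
  qed
  have Aform: "mform A x y = (\<Sum>s<n. \<mu> s * (c s x * c s y))" if x: "x \<in> carrier_vec n" and y: "y \<in> carrier_vec n" for x y
  proof -
    have Ay: "vec_index (A *\<^sub>v y) i = (\<Sum>s<n. c s y * vec_index (A *\<^sub>v \<psi> s) i)" if "i < n" for i
    proof -
      have "vec_index (A *\<^sub>v y) i = (\<Sum>j<n. A $$ (i, j) * (\<Sum>s<n. c s y * vec_index (\<psi> s) j))"
        unfolding mult_mat_vec_index_sum[OF cA y that] using expand[of _ y] by (auto intro!: sum.cong)
      also have "\<dots> = (\<Sum>s<n. c s y * (\<Sum>j<n. A $$ (i, j) * vec_index (\<psi> s) j))"
        unfolding sum_distrib_left by (subst sum.swap) (simp add: ac_simps)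
      also have "\<dots> = (\<Sum>s<n. c s y * vec_index (A *\<^sub>v \<psi> s) i)"
        unfolding mult_mat_vec_index_sum[OF cA \<psi>(1) that] ..
      finally show ?thesis .
    qed
    have "mform A x y = (\<Sum>i<n. vec_index x i * vec_index (A *\<^sub>v y) i)"
      unfolding mform_def using cA x y by (simp add: scalar_prod_def atLeast0LessThan)
    also have "\<dots> = (\<Sum>i<n. \<Sum>s<n. \<mu> s * c s y * (d i * vec_index (\<psi> s) i * vec_index x i))"
      using Ay Aev by (simp add: sum_distrib_left ac_simps)
    also have "\<dots> = (\<Sum>s<n. \<mu> s * c s y * (\<Sum>i<n. d i * vec_index (\<psi> s) i * vec_index x i))"
      unfolding sum_distrib_left by (rule sum.swap)
    also have "\<dots> = (\<Sum>s<n. \<mu> s * (c s x * c s y))"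
    proof (rule sum.cong[OF refl])
      fix s assume "s \<in> {..<n}"
      then have "(\<Sum>i<n. d i * vec_index (\<psi> s) i * vec_index x i) = c s x"
        unfolding c_def inner_on_def by (intro sum.cong) (use r(1) in \<open>auto simp: \<psi>(2) r(2)[symmetric]\<close>)
      then show "\<mu> s * c s y * (\<Sum>i<n. d i * vec_index (\<psi> s) i * vec_index x i) = \<mu> s * (c s x * c s y)" by simp
    qed
    finally show ?thesis .
  qed
  have \<mu>: "0 < \<mu> s \<and> \<mu> s \<le> spec_radius X" if "s < n" for s
  proof
    have "mform A (\<psi> s) (\<psi> s) = (\<Sum>t<n. if t = s then \<mu> s else 0)"
      unfolding Aform[OF \<psi>(1) \<psi>(1)] by (rule sum.cong) (use c\<psi> that in auto)
    then show "0 < \<mu> s" using A \<psi>(1) \<psi>0[OF that] that unfolding spd_def by force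
    show "\<mu> s \<le> spec_radius X" using spec_radius_ge[OF cX \<psi>(1) \<psi>0[OF that] Xev[OF that]] by simp
  qed
  have G: "c s (poly_at_mat q (\<omega> \<cdot>\<^sub>m X) *\<^sub>v x) = poly q (\<omega> * \<mu> s) * c s x"
    if x: "x \<in> carrier_vec n" and s: "s < n" for q \<omega> x s
  proof -
    let ?G = "poly_at_mat q (\<omega> \<cdot>\<^sub>m X)"
    have cG: "?G \<in> carrier_mat n n" unfolding poly_at_mat_def using cX by simp
    have G\<psi>: "?G *\<^sub>v \<psi> t = poly q (\<omega> * \<mu> t) \<cdot>\<^sub>v \<psi> t" if "t < n" for t
    proof (rule poly_at_mat_eigenvector[of _ n])
      show "(\<omega> \<cdot>\<^sub>m X) *\<^sub>v \<psi> t = \<omega> * \<mu> t \<cdot>\<^sub>v \<psi> t"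
      proof -
        have "(\<omega> \<cdot>\<^sub>m X) *\<^sub>v \<psi> t = \<omega> \<cdot>\<^sub>v (X *\<^sub>v \<psi> t)"
        proof (rule eq_vecI)
          fix i assume "i < dim_vec (\<omega> \<cdot>\<^sub>v (X *\<^sub>v \<psi> t))"
          then have i: "i < n" using cX by simp
          have "\<omega> \<cdot>\<^sub>m X \<in> carrier_mat n n" using cX by simp
          then have "vec_index ((\<omega> \<cdot>\<^sub>m X) *\<^sub>v \<psi> t) i = (\<Sum>j<n. \<omega> * (X $$ (i, j) * vec_index (\<psi> t) j))"
            by (subst mult_mat_vec_index_sum[OF _ \<psi>(1) i]) (use cX i in \<open>auto intro!: sum.cong\<close>)
          then show "vec_index ((\<omega> \<cdot>\<^sub>m X) *\<^sub>v \<psi> t) i = vec_index (\<omega> \<cdot>\<^sub>v (X *\<^sub>v \<psi> t)) i"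
            using i cX by (simp add: mult_mat_vec_index_sum[OF cX \<psi>(1) i] sum_distrib_left del: index_mult_mat_vec)
        qed (use cX in auto)
        then show ?thesis using Xev[OF that] by (simp add: smult_smult_assoc)
      qed
    qed (use cX \<psi>(1) in auto)
    have Gx: "vec_index (?G *\<^sub>v x) i = (\<Sum>t<n. c t x * (poly q (\<omega> * \<mu> t) * vec_index (\<psi> t) i))" if "i < n" for i
    proof -
      have "vec_index (?G *\<^sub>v x) i = (\<Sum>j<n. ?G $$ (i, j) * (\<Sum>t<n. c t x * vec_index (\<psi> t) j))"
        unfolding mult_mat_vec_index_sum[OF cG x that] using expand[of _ x] by (auto intro!: sum.cong)
      also have "\<dots> = (\<Sum>t<n. c t x * (\<Sum>j<n. ?G $$ (i, j) * vec_index (\<psi> t) j))"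
        unfolding sum_distrib_left by (subst sum.swap) (simp add: ac_simps)
      also have "\<dots> = (\<Sum>t<n. c t x * vec_index (?G *\<^sub>v \<psi> t) i)"
        unfolding mult_mat_vec_index_sum[OF cG \<psi>(1) that] ..
      also have "\<dots> = (\<Sum>t<n. c t x * (poly q (\<omega> * \<mu> t) * vec_index (\<psi> t) i))"
        using G\<psi> carrier_vecD[OF \<psi>(1)] that by (intro sum.cong) (auto simp del: index_mult_mat_vec)
      finally show ?thesis .
    qed
    have "c s (?G *\<^sub>v x) = inner_on {..<n} (\<phi> s) (\<lambda>i. \<Sum>t<n. c t x * poly q (\<omega> * \<mu> t) * (r i * vec_index (\<psi> t) i))"
      unfolding c_def[of s "?G *\<^sub>v x"] by (rule inner_on_cong) (auto simp: Gx sum_distrib_left ac_simps)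
    also have "\<dots> = (\<Sum>t<n. c t x * poly q (\<omega> * \<mu> t) * c s (\<psi> t))"
      unfolding inner_on_sum inner_on_scale c_def[of s "\<psi> _"] ..
    also have "\<dots> = (\<Sum>t<n. if t = s then poly q (\<omega> * \<mu> s) * c s x else 0)"
      by (rule sum.cong) (use c\<psi> s in auto)
    finally show ?thesis using s by simp
  qed
  show ?thesis
    by (rule that[of \<mu> c]) (use \<mu> Aform Dform G in \<open>auto simp: X_def D_def\<close>)
qed

text \<open>The concavity of \<open>t \<mapsto> t / (t + q)\<close> in \<open>t = 1 / \<mu>\<close> turns the approximation property
  \<open>\<Sum> c\<^sup>2 \<le> \<kappa> \<Sum> \<mu> c\<^sup>2\<close> into a bound which stays below 1 no matter how large \<open>\<kappa>\<close> is.\<close>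

lemma smoothed_energy_sum:
  fixes \<mu> c g :: "nat \<Rightarrow> real"
  assumes \<mu>: "\<And>s. s < n \<Longrightarrow> \<mu> s > 0" and q: "q \<ge> 0" and \<kappa>: "\<kappa> > 0"
    and g: "\<And>s. s < n \<Longrightarrow> (g s)\<^sup>2 * (1 + q * \<mu> s) \<le> 1"
    and approx: "(\<Sum>s<n. (c s)\<^sup>2) \<le> \<kappa> * (\<Sum>s<n. \<mu> s * (c s)\<^sup>2)"
  shows "(\<Sum>s<n. \<mu> s * (g s * c s)\<^sup>2) \<le> \<kappa> / (\<kappa> + q) * (\<Sum>s<n. \<mu> s * (c s)\<^sup>2)"
proof -
  have t: "\<mu> s * (g s * c s)\<^sup>2 \<le> \<kappa> / (\<kappa> + q) * (\<mu> s * (c s)\<^sup>2) + q / (\<kappa> + q)\<^sup>2 * ((c s)\<^sup>2 - \<kappa> * (\<mu> s * (c s)\<^sup>2))"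
    if s: "s < n" for s
  proof -
    define m where "m = \<mu> s"
    have m: "m > 0" using \<mu>[OF s] unfolding m_def .
    have pos: "1 + q * m > 0" "\<kappa> + q > 0" using m q \<kappa> by (auto intro: add_pos_nonneg)
    have "(g s)\<^sup>2 \<le> 1 / (1 + q * m)" using g[OF s] pos unfolding m_def by (simp add: pos_le_divide_eq)
    then have "m * (g s)\<^sup>2 \<le> m / (1 + q * m)" using mult_left_mono[of _ _ m] m by fastforce
    \<comment> \<open>The tangent of t / (t + q) at t = \<kappa>, multiplied by m = 1 / t. After
      clearing denominators the difference is q (1 - \<kappa> m)^2.\<close>
    also have "\<dots> \<le> \<kappa> / (\<kappa> + q) * m + q / (\<kappa> + q)\<^sup>2 * (1 - \<kappa> * m)"
    proof -
      have "(\<kappa> / (\<kappa> + q) * m + q / (\<kappa> + q)\<^sup>2 * (1 - \<kappa> * m)) * ((\<kappa> + q)\<^sup>2 * (1 + q * m)) - m * (\<kappa> + q)\<^sup>2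
        = q * (1 - \<kappa> * m)\<^sup>2"
      proof -
        have "(\<kappa> / (\<kappa> + q) * m + q / (\<kappa> + q)\<^sup>2 * (1 - \<kappa> * m)) * (\<kappa> + q)\<^sup>2 = \<kappa> * m * (\<kappa> + q) + q * (1 - \<kappa> * m)"
        proof -
          have "\<kappa> / (\<kappa> + q) * m * (\<kappa> + q)\<^sup>2 = \<kappa> * m * (\<kappa> + q)" using pos by (simp add: power2_eq_square)
          moreover have "q / (\<kappa> + q)\<^sup>2 * (1 - \<kappa> * m) * (\<kappa> + q)\<^sup>2 = q * (1 - \<kappa> * m)" using pos by simp
          ultimately show ?thesis by (simp only: distrib_right)
        qed
        then have "(\<kappa> / (\<kappa> + q) * m + q / (\<kappa> + q)\<^sup>2 * (1 - \<kappa> * m)) * ((\<kappa> + q)\<^sup>2 * (1 + q * m))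
          = (\<kappa> * m * (\<kappa> + q) + q * (1 - \<kappa> * m)) * (1 + q * m)" by (metis mult.assoc)
        then show ?thesis by (simp add: power2_eq_square algebra_simps)
      qed
      moreover have "0 \<le> q * (1 - \<kappa> * m)\<^sup>2" using q by simp
      ultimately have "m * (\<kappa> + q)\<^sup>2 \<le> (\<kappa> / (\<kappa> + q) * m + q / (\<kappa> + q)\<^sup>2 * (1 - \<kappa> * m)) * (1 + q * m) * (\<kappa> + q)\<^sup>2"
        by (simp add: mult.assoc mult.commute[of "1 + q * m"])
      then have "m \<le> (\<kappa> / (\<kappa> + q) * m + q / (\<kappa> + q)\<^sup>2 * (1 - \<kappa> * m)) * (1 + q * m)"
        by (rule mult_right_le_imp_le) (use pos in simp)
      then show ?thesis using pos by (simp add: pos_divide_le_eq)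
    qed
    finally have "m * (g s)\<^sup>2 * (c s)\<^sup>2 \<le> (\<kappa> / (\<kappa> + q) * m + q / (\<kappa> + q)\<^sup>2 * (1 - \<kappa> * m)) * (c s)\<^sup>2"
      by (rule mult_right_mono) simp
    then show ?thesis unfolding m_def by (simp only: power_mult_distrib algebra_simps)
  qed
  have "(\<Sum>s<n. \<mu> s * (g s * c s)\<^sup>2) \<le> (\<Sum>s<n. \<kappa> / (\<kappa> + q) * (\<mu> s * (c s)\<^sup>2) + q / (\<kappa> + q)\<^sup>2 * ((c s)\<^sup>2 - \<kappa> * (\<mu> s * (c s)\<^sup>2)))"
    by (intro sum_mono t) auto
  also have "\<dots> = \<kappa> / (\<kappa> + q) * (\<Sum>s<n. \<mu> s * (c s)\<^sup>2) + q / (\<kappa> + q)\<^sup>2 * ((\<Sum>s<n. (c s)\<^sup>2) - \<kappa> * (\<Sum>s<n. \<mu> s * (c s)\<^sup>2))"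
    by (simp only: sum.distrib sum_subtractf sum_distrib_left[symmetric])
  also have "\<dots> \<le> \<kappa> / (\<kappa> + q) * (\<Sum>s<n. \<mu> s * (c s)\<^sup>2)"
  proof -
    have "q / (\<kappa> + q)\<^sup>2 * ((\<Sum>s<n. (c s)\<^sup>2) - \<kappa> * (\<Sum>s<n. \<mu> s * (c s)\<^sup>2)) \<le> 0"
      using approx q by (intro mult_nonneg_nonpos) auto
    then show ?thesis by linarith
  qed
  finally show ?thesis .
qed

text \<open>Everything is read off componentwise in the simultaneous eigenbasis, where G multiplies
  by P_m (\<omega> \<mu>). The damping condition is what puts \<omega> \<mu> into [0, 1]. The last
  property combines smoothing and approximation into one factor that is at most 1 for every
  \<kappa>.\<close>

lemma chebyshev_smoother:
  assumes A: "spd n A" and \<omega>: "\<omega> > 0" "\<omega> * spec_radius (inv_mat (diag_part A) * A) \<le> 1" and m: "m \<ge> 1"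
  defines "G \<equiv> poly_at_mat (cheb4 m) (\<omega> \<cdot>\<^sub>m (inv_mat (diag_part A) * A))"
  shows "G \<in> carrier_mat n n"
    and "\<And>x y. x \<in> carrier_vec n \<Longrightarrow> y \<in> carrier_vec n \<Longrightarrow> mform A (G *\<^sub>v x) y = mform A x (G *\<^sub>v y)"
    and "\<And>x. x \<in> carrier_vec n \<Longrightarrow> mform A (G *\<^sub>v x) (G *\<^sub>v x) \<le> mform A x x"
    and "\<And>x \<kappa>. x \<in> carrier_vec n \<Longrightarrow> \<kappa> > 0 \<Longrightarrow> mform (diag_part A) x x \<le> \<kappa> * mform A x x \<Longrightarrow>
      mform A (G *\<^sub>v x) (G *\<^sub>v x) \<le> \<kappa> / (\<kappa> + (real (2 * m + 1))\<^sup>2 * \<omega> / 18) * mform A x x"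
proof -
  obtain \<mu> c where \<mu>: "\<And>s. s < n \<Longrightarrow> 0 < \<mu> s \<and> \<mu> s \<le> spec_radius (inv_mat (diag_part A) * A)"
    and Af: "\<And>x y. x \<in> carrier_vec n \<Longrightarrow> y \<in> carrier_vec n \<Longrightarrow> mform A x y = (\<Sum>s<n. \<mu> s * (c s x * c s y))"
    and Df: "\<And>x y. x \<in> carrier_vec n \<Longrightarrow> y \<in> carrier_vec n \<Longrightarrow> mform (diag_part A) x y = (\<Sum>s<n. c s x * c s y)"
    and Gc: "\<And>q \<omega> x s. x \<in> carrier_vec n \<Longrightarrow> s < n \<Longrightarrow>
       c s (poly_at_mat q (\<omega> \<cdot>\<^sub>m (inv_mat (diag_part A) * A)) *\<^sub>v x) = poly q (\<omega> * \<mu> s) * c s x"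
    by (rule jacobi_diagonalization[OF A], rule that, assumption+)
  define g where "g s = poly (cheb4 m) (\<omega> * \<mu> s)" for s
  have Gs: "c s (G *\<^sub>v x) = g s * c s x" if "x \<in> carrier_vec n" "s < n" for x s
    unfolding G_def g_def by (rule Gc[OF that])
  have "inv_mat (diag_part A) * A \<in> carrier_mat n n" "dim_row (inv_mat (diag_part A)) = n"
    using spd_inv_mat[OF spd_diag_part[OF A]] spd_carrier[OF A] by auto
  then show cG: "G \<in> carrier_mat n n" unfolding G_def poly_at_mat_def by (simp add: carrier_matD)
  then have Gv: "G *\<^sub>v x \<in> carrier_vec n" if "x \<in> carrier_vec n" for x using that by simp
  show "mform A (G *\<^sub>v x) y = mform A x (G *\<^sub>v y)" if "x \<in> carrier_vec n" "y \<in> carrier_vec n" for x y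
    using that by (simp add: Af Gv Gs ac_simps)
  have x1: "0 \<le> \<omega> * \<mu> s" "\<omega> * \<mu> s \<le> 1" if "s < n" for s
  proof -
    show "0 \<le> \<omega> * \<mu> s" using \<mu>[OF that] \<omega>(1) by simp
    have "\<omega> * \<mu> s \<le> \<omega> * spec_radius (inv_mat (diag_part A) * A)" using \<mu>[OF that] \<omega>(1) by simp
    then show "\<omega> * \<mu> s \<le> 1" using \<omega>(2) by simp
  qed
  let ?q = "(real (2 * m + 1))\<^sup>2 * \<omega> / 18"
  have q0: "?q \<ge> 0" using \<omega>(1) by simp
  have gb: "(g s)\<^sup>2 * (1 + ?q * \<mu> s) \<le> 1" if "s < n" for s
    using cheb4_bound[OF x1[OF that] m] unfolding g_def by (simp add: algebra_simps)
  have g1: "(g s)\<^sup>2 \<le> 1" if "s < n" for s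
  proof -
    have "(g s)\<^sup>2 * 1 \<le> (g s)\<^sup>2 * (1 + ?q * \<mu> s)" using \<mu>[OF that] q0 by (intro mult_left_mono) auto
    then show ?thesis using gb[OF that] by simp
  qed
  have GG: "mform A (G *\<^sub>v x) (G *\<^sub>v x) = (\<Sum>s<n. \<mu> s * (g s * c s x)\<^sup>2)"
    and AA: "mform A x x = (\<Sum>s<n. \<mu> s * (c s x)\<^sup>2)" if "x \<in> carrier_vec n" for x
    using that by (simp_all add: Af Gv Gs power2_eq_square)
  show "mform A (G *\<^sub>v x) (G *\<^sub>v x) \<le> mform A x x" if x: "x \<in> carrier_vec n" for x
    unfolding GG[OF x] AA[OF x]
  proof (rule sum_mono)
    fix s assume "s \<in> {..<n}"
    then have "(g s)\<^sup>2 * (c s x)\<^sup>2 \<le> 1 * (c s x)\<^sup>2" "0 < \<mu> s"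
      using \<mu> mult_right_mono[OF g1[of s], of "(c s x)\<^sup>2"] by auto
    then show "\<mu> s * (g s * c s x)\<^sup>2 \<le> \<mu> s * (c s x)\<^sup>2" by (simp add: power_mult_distrib)
  qed
  show "mform A (G *\<^sub>v x) (G *\<^sub>v x) \<le> \<kappa> / (\<kappa> + ?q) * mform A x x"
    if x: "x \<in> carrier_vec n" and \<kappa>: "\<kappa> > 0" and D: "mform (diag_part A) x x \<le> \<kappa> * mform A x x" for x \<kappa>
    unfolding GG[OF x] AA[OF x]
  proof (rule smoothed_energy_sum[OF _ q0 \<kappa> gb])
    show "(\<Sum>s<n. (c s x)\<^sup>2) \<le> \<kappa> * (\<Sum>s<n. \<mu> s * (c s x)\<^sup>2)"
      using D unfolding AA[OF x] Df[OF x x] by (simp add: power2_eq_square)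
  qed (use \<mu> in auto)
qed

text \<open>Testing with an arbitrary \<open>f\<close> and moving the post-smoother to the other side splits the energy
  inner product along the \<open>A\<close>-orthogonal decomposition into the coarse space and its complement; this
  gives a better recursion for the contraction numbers than the triangle inequality.\<close>

lemma two_term_Cauchy_Schwarz:
  fixes a b c d \<beta> X Y \<tau> :: real
  assumes "0 \<le> \<beta>" "\<beta> \<le> 1" "a\<^sup>2 + c\<^sup>2 \<le> X\<^sup>2" "b\<^sup>2 + d\<^sup>2 \<le> Y\<^sup>2" "a\<^sup>2 \<le> \<tau> * X\<^sup>2" "b\<^sup>2 \<le> \<tau> * Y\<^sup>2"
    "0 \<le> X" "0 \<le> Y" "0 \<le> \<tau>" "\<tau> \<le> 1"
  shows "a * b + \<beta> * (c * d) \<le> (\<tau> + (1 - \<tau>) * \<beta>) * (X * Y)"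
proof -
  let ?\<gamma> = "\<tau> + (1 - \<tau>) * \<beta>"
  have \<gamma>: "0 \<le> ?\<gamma>" using assms by simp
  have one: "a\<^sup>2 + \<beta> * c\<^sup>2 \<le> ?\<gamma> * X\<^sup>2" if "a\<^sup>2 + c\<^sup>2 \<le> X\<^sup>2" "a\<^sup>2 \<le> \<tau> * X\<^sup>2" for a c X
  proof -
    have "\<beta> * (a\<^sup>2 + c\<^sup>2) \<le> \<beta> * X\<^sup>2" "(1 - \<beta>) * a\<^sup>2 \<le> (1 - \<beta>) * (\<tau> * X\<^sup>2)"
      using that assms(1,2) by (auto intro!: mult_left_mono)
    then show ?thesis by (simp add: algebra_simps)
  qed
  have "(a * b + \<beta> * (c * d))\<^sup>2 \<le> (a\<^sup>2 + \<beta> * c\<^sup>2) * (b\<^sup>2 + \<beta> * d\<^sup>2)"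
  proof -
    have "(a\<^sup>2 + \<beta> * c\<^sup>2) * (b\<^sup>2 + \<beta> * d\<^sup>2) - (a * b + \<beta> * (c * d))\<^sup>2 = \<beta> * (a * d - b * c)\<^sup>2"
      by (simp add: power2_eq_square algebra_simps)
    then show ?thesis using assms(1) by (metis diff_ge_0_iff_ge mult_nonneg_nonneg zero_le_power2)
  qed
  also have "\<dots> \<le> (?\<gamma> * X\<^sup>2) * (?\<gamma> * Y\<^sup>2)"
    by (intro mult_mono one assms) (use \<gamma> assms in auto)
  also have "\<dots> = (?\<gamma> * (X * Y))\<^sup>2" by (simp add: power_mult_distrib power2_eq_square)
  finally show ?thesis by (rule power2_le_imp_le) (use \<gamma> assms in simp)
qed

text \<open>\<open>P *\<^sub>v u x\<close> is the A-orthogonal projection of x onto the coarse space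
  and \<open>w x\<close> its complement. An exact coarse solve leaves w x; two inexact cycles add
  back P E'^2 u x. With x = G g and y = G f, testing E g with f gives A(w x, w y) + A'(E'^2 u x, u
  y).\<close>

lemma W_cycle_step:
  assumes A: "spd n A" and A': "spd n' A'" and P: "P \<in> carrier_mat n n'" and Gal: "A' = P\<^sup>T * (A * P)"
    and G: "G \<in> carrier_mat n n" and E': "E' \<in> carrier_mat n' n'"
    and Gsym: "\<And>x y. x \<in> carrier_vec n \<Longrightarrow> y \<in> carrier_vec n \<Longrightarrow> mform A (G *\<^sub>v x) y = mform A x (G *\<^sub>v y)"
    and Gle: "\<And>x. x \<in> carrier_vec n \<Longrightarrow> mform A (G *\<^sub>v x) (G *\<^sub>v x) \<le> mform A x x"
    and Gfine: "\<And>x. x \<in> carrier_vec n \<Longrightarrow> (\<And>z. z \<in> carrier_vec n' \<Longrightarrow> mform A x (P *\<^sub>v z) = 0) \<Longrightarrow>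
       mform A (G *\<^sub>v x) (G *\<^sub>v x) \<le> \<tau> * mform A x x"
    and \<tau>: "0 \<le> \<tau>" "\<tau> \<le> 1" and \<gamma>: "0 \<le> \<gamma>" "\<gamma> \<le> 1"
    and E'le: "\<And>x. x \<in> carrier_vec n' \<Longrightarrow> sqrt (mform A' (E' *\<^sub>v x) (E' *\<^sub>v x)) \<le> \<gamma> * sqrt (mform A' x x)"
    and g: "g \<in> carrier_vec n"
  defines "E \<equiv> G * (inv_mat A - P * (1\<^sub>m n' - E' ^\<^sub>m 2) * inv_mat A' * P\<^sup>T) * A * G"
  shows "sqrt (mform A (E *\<^sub>v g) (E *\<^sub>v g)) \<le> (\<tau> + (1 - \<tau>) * \<gamma>\<^sup>2) * sqrt (mform A g g)"
proof -
  note cA = spd_carrier[OF A] and cA' = spd_carrier[OF A']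
  note iA = spd_inv_mat[OF A] and iA' = spd_inv_mat[OF A']
  have PT: "P\<^sup>T \<in> carrier_mat n' n" using P by simp
  define u where "u x = inv_mat A' *\<^sub>v (P\<^sup>T *\<^sub>v (A *\<^sub>v x))" for x
  define w where "w x = x - P *\<^sub>v u x" for x
  have cu: "u x \<in> carrier_vec n'" if "x \<in> carrier_vec n" for x
    unfolding u_def using iA' PT cA that by (meson mult_mat_vec_carrier)
  have cw: "w x \<in> carrier_vec n" if "x \<in> carrier_vec n" for x
    unfolding w_def using cu[OF that] P that by simp
  have PA: "mform A x (P *\<^sub>v z) = scalar_prod (P\<^sup>T *\<^sub>v (A *\<^sub>v x)) z" if "x \<in> carrier_vec n" "z \<in> carrier_vec n'" for x z
  proof -
    have Pz: "P *\<^sub>v z \<in> carrier_vec n" and Ax: "A *\<^sub>v x \<in> carrier_vec n" using P cA that by auto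
    have "mform A x (P *\<^sub>v z) = mform A (P *\<^sub>v z) x" by (rule mform_commute[OF A that(1) Pz])
    also have "\<dots> = scalar_prod (A *\<^sub>v x) (P *\<^sub>v z)" unfolding mform_def by (rule comm_scalar_prod[OF Pz Ax])
    also have "\<dots> = scalar_prod (P\<^sup>T *\<^sub>v (A *\<^sub>v x)) z"
      by (rule transpose_vec_mult_scalar[OF P that(2) Ax, symmetric])
    finally show ?thesis .
  qed
  have A'v: "A' *\<^sub>v z = P\<^sup>T *\<^sub>v (A *\<^sub>v (P *\<^sub>v z))" if "z \<in> carrier_vec n'" for z
    unfolding Gal using PT cA P that by (simp add: assoc_mult_mat_vec[of _ n' n _ n'] assoc_mult_mat_vec[of _ n n _ n'])
  have A'form: "mform A (P *\<^sub>v y) (P *\<^sub>v z) = mform A' y z" if "y \<in> carrier_vec n'" "z \<in> carrier_vec n'" for y z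
  proof -
    have "mform A (P *\<^sub>v y) (P *\<^sub>v z) = scalar_prod (A' *\<^sub>v y) z"
      unfolding A'v[OF that(1)] by (rule PA) (use P that in auto)
    also have "\<dots> = mform A' z y" unfolding mform_def by (rule comm_scalar_prod) (use cA' that in auto)
    finally show ?thesis using mform_commute[OF A' that] by simp
  qed
  have A'u: "A' *\<^sub>v u x = P\<^sup>T *\<^sub>v (A *\<^sub>v x)" if "x \<in> carrier_vec n" for x
  proof -
    have v: "P\<^sup>T *\<^sub>v (A *\<^sub>v x) \<in> carrier_vec n'" using PT cA that by (meson mult_mat_vec_carrier)
    have "A' *\<^sub>v u x = (A' * inv_mat A') *\<^sub>v (P\<^sup>T *\<^sub>v (A *\<^sub>v x))"
      unfolding u_def by (rule assoc_mult_mat_vec[symmetric]) (use cA' iA' v in auto)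
    then show ?thesis using iA' v by simp
  qed
  have orth: "mform A (w x) (P *\<^sub>v z) = 0" if "x \<in> carrier_vec n" "z \<in> carrier_vec n'" for x z
  proof -
    have "mform A (w x) (P *\<^sub>v z) = mform A x (P *\<^sub>v z) - mform A (P *\<^sub>v u x) (P *\<^sub>v z)"
      unfolding w_def by (rule mform_diff[OF cA]) (use that P cu in auto)
    also have "mform A x (P *\<^sub>v z) = scalar_prod (A' *\<^sub>v u x) z" unfolding A'u[OF that(1)] by (rule PA[OF that])
    also have "\<dots> = mform A' z (u x)" unfolding mform_def by (rule comm_scalar_prod) (use cA' that cu in auto)
    finally show ?thesis using A'form[OF cu[OF that(1)] that(2)] mform_commute[OF A' cu[OF that(1)] that(2)] by simp
  qed
  have split: "mform A x (P *\<^sub>v z) = mform A' (u x) z" if "x \<in> carrier_vec n" "z \<in> carrier_vec n'" for x z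
  proof -
    have "mform A (w x + P *\<^sub>v u x) (P *\<^sub>v z) = mform A (w x) (P *\<^sub>v z) + mform A (P *\<^sub>v u x) (P *\<^sub>v z)"
      by (rule mform_add[OF cA]) (use that P cu cw in auto)
    moreover have "w x + P *\<^sub>v u x = x" unfolding w_def using that P cu by (intro eq_vecI) auto
    ultimately show ?thesis using orth[OF that] A'form[OF cu[OF that(1)] that(2)] by simp
  qed
  have pyth: "mform A x y = mform A (w x) (w y) + mform A' (u x) (u y)" if "x \<in> carrier_vec n" "y \<in> carrier_vec n" for x y
  proof -
    have y: "w y + P *\<^sub>v u y = y" unfolding w_def using that P cu by (intro eq_vecI) auto
    have "mform A x y = mform A x (w y) + mform A x (P *\<^sub>v u y)"
      using mform_add(2)[OF cA cw[OF that(2)] _ that(1), of "P *\<^sub>v u y"] y P cu[OF that(2)] by simp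
    moreover have "mform A x (w y) = mform A (w x) (w y)"
    proof -
      have "mform A (w x + P *\<^sub>v u x) (w y) = mform A (w x) (w y) + mform A (P *\<^sub>v u x) (w y)"
        by (rule mform_add[OF cA]) (use that P cu cw in auto)
      moreover have "mform A (P *\<^sub>v u x) (w y) = mform A (w y) (P *\<^sub>v u x)"
        by (rule mform_commute[OF A]) (use that P cu cw in auto)
      moreover have "w x + P *\<^sub>v u x = x" unfolding w_def using that P cu by (intro eq_vecI) auto
      ultimately show ?thesis using orth[OF that(2) cu[OF that(1)]] by simp
    qed
    ultimately show ?thesis using split[OF that(1) cu[OF that(2)]] by simp
  qed
  define x where "x = G *\<^sub>v g"
  have cx: "x \<in> carrier_vec n" unfolding x_def using G g by simp
  define s where "s = E' *\<^sub>v (E' *\<^sub>v u x)"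
  have cs: "s \<in> carrier_vec n'" unfolding s_def using E' cu[OF cx] by simp
  have Eg: "E *\<^sub>v g = G *\<^sub>v (w x + P *\<^sub>v s)"
  proof -
    have cM: "P * (1\<^sub>m n' - E' ^\<^sub>m 2) * inv_mat A' * P\<^sup>T \<in> carrier_mat n n" using P E' iA' PT by auto
    then have cN: "inv_mat A - P * (1\<^sub>m n' - E' ^\<^sub>m 2) * inv_mat A' * P\<^sup>T \<in> carrier_mat n n" using iA by (intro minus_carrier_mat) auto
    have E2: "E' ^\<^sub>m 2 = E' * E'" using E' by (simp add: numeral_2_eq_2)
    have Ax: "A *\<^sub>v x \<in> carrier_vec n" using cA cx by simp
    have "E *\<^sub>v g = G *\<^sub>v ((inv_mat A - P * (1\<^sub>m n' - E' ^\<^sub>m 2) * inv_mat A' * P\<^sup>T) *\<^sub>v (A *\<^sub>v x))"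
    proof -
      have "E *\<^sub>v g = (G * (inv_mat A - P * (1\<^sub>m n' - E' ^\<^sub>m 2) * inv_mat A' * P\<^sup>T) * A) *\<^sub>v x"
        unfolding E_def x_def by (rule assoc_mult_mat_vec[where ?n\<^sub>1.0 = n]) (use G cN cA g in \<open>auto intro!: mult_carrier_mat\<close>)
      also have "\<dots> = (G * (inv_mat A - P * (1\<^sub>m n' - E' ^\<^sub>m 2) * inv_mat A' * P\<^sup>T)) *\<^sub>v (A *\<^sub>v x)"
        by (rule assoc_mult_mat_vec[where ?n\<^sub>1.0 = n]) (use G cN cA cx in \<open>auto intro!: mult_carrier_mat\<close>)
      also have "\<dots> = G *\<^sub>v ((inv_mat A - P * (1\<^sub>m n' - E' ^\<^sub>m 2) * inv_mat A' * P\<^sup>T) *\<^sub>v (A *\<^sub>v x))"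
        by (rule assoc_mult_mat_vec) (use G cN Ax in auto)
      finally show ?thesis .
    qed
    also have "(inv_mat A - P * (1\<^sub>m n' - E' ^\<^sub>m 2) * inv_mat A' * P\<^sup>T) *\<^sub>v (A *\<^sub>v x)
      = inv_mat A *\<^sub>v (A *\<^sub>v x) - (P * (1\<^sub>m n' - E' ^\<^sub>m 2) * inv_mat A' * P\<^sup>T) *\<^sub>v (A *\<^sub>v x)"
      by (rule minus_mult_distrib_mat_vec) (use iA cM Ax in auto)
    also have "inv_mat A *\<^sub>v (A *\<^sub>v x) = x"
    proof -
      have "inv_mat A *\<^sub>v (A *\<^sub>v x) = (inv_mat A * A) *\<^sub>v x"
        by (rule assoc_mult_mat_vec[symmetric]) (use iA cA cx in auto)
      then show ?thesis using iA cx by simp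
    qed
    also have "(P * (1\<^sub>m n' - E' ^\<^sub>m 2) * inv_mat A' * P\<^sup>T) *\<^sub>v (A *\<^sub>v x) = P *\<^sub>v (u x - s)"
    proof -
      have v: "P\<^sup>T *\<^sub>v (A *\<^sub>v x) \<in> carrier_vec n'" using PT Ax by (meson mult_mat_vec_carrier)
      have "(P * (1\<^sub>m n' - E' ^\<^sub>m 2) * inv_mat A' * P\<^sup>T) *\<^sub>v (A *\<^sub>v x)
        = (P * (1\<^sub>m n' - E' ^\<^sub>m 2) * inv_mat A') *\<^sub>v (P\<^sup>T *\<^sub>v (A *\<^sub>v x))"
        by (rule assoc_mult_mat_vec) (use P E' iA' PT Ax in auto)
      also have "\<dots> = (P * (1\<^sub>m n' - E' ^\<^sub>m 2)) *\<^sub>v u x"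
        unfolding u_def by (rule assoc_mult_mat_vec) (use P E' iA' v in auto)
      also have "\<dots> = P *\<^sub>v ((1\<^sub>m n' - E' ^\<^sub>m 2) *\<^sub>v u x)"
        by (rule assoc_mult_mat_vec) (use P E' cu[OF cx] in auto)
      also have "(1\<^sub>m n' - E' ^\<^sub>m 2) *\<^sub>v u x = 1\<^sub>m n' *\<^sub>v u x - E' ^\<^sub>m 2 *\<^sub>v u x"
        by (rule minus_mult_distrib_mat_vec) (use E' cu[OF cx] in auto)
      also have "\<dots> = u x - s" unfolding s_def E2
        using cu[OF cx] assoc_mult_mat_vec[OF E' E' cu[OF cx]] by simp
      finally show ?thesis .
    qed
    also have "x - P *\<^sub>v (u x - s) = w x + P *\<^sub>v s"
    proof -
      have "P *\<^sub>v (u x - s) = P *\<^sub>v u x - P *\<^sub>v s" by (rule mult_minus_distrib_mat_vec) (use P cu[OF cx] cs in auto)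
      then show ?thesis unfolding w_def using cx P cu[OF cx] cs by (intro eq_vecI) auto
    qed
    finally show ?thesis .
  qed
  have ms: "sqrt (mform A' s s) \<le> \<gamma>\<^sup>2 * sqrt (mform A' (u x) (u x))"
  proof -
    have "sqrt (mform A' s s) \<le> \<gamma> * sqrt (mform A' (E' *\<^sub>v u x) (E' *\<^sub>v u x))"
      unfolding s_def by (rule E'le) (use E' cu[OF cx] in auto)
    also have "\<dots> \<le> \<gamma> * (\<gamma> * sqrt (mform A' (u x) (u x)))" using E'le[OF cu[OF cx]] \<gamma> by (intro mult_left_mono) auto
    finally show ?thesis by (simp add: power2_eq_square mult.assoc)
  qed
  \<comment> \<open>\<open>Gfine\<close> bounds the smoothed version of a fine vector, but the fine
    part of a smoothed vector is needed. The two maps are adjoint in the energy inner product, so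
    they have the same norm.\<close>
  have wle: "mform A (w (G *\<^sub>v f)) (w (G *\<^sub>v f)) \<le> \<tau> * mform A f f" if f: "f \<in> carrier_vec n" for f
  proof -
    define v where "v = w (G *\<^sub>v f)"
    have cGf: "G *\<^sub>v f \<in> carrier_vec n" using G f by simp
    have cv: "v \<in> carrier_vec n" unfolding v_def using cw[OF cGf] .
    have cGv: "G *\<^sub>v v \<in> carrier_vec n" using G cv by simp
    define V where "V = sqrt (mform A v v)"
    define F where "F = sqrt (mform A f f)"
    have V: "0 \<le> V" "V\<^sup>2 = mform A v v" and F: "0 \<le> F" "F\<^sup>2 = mform A f f"
      unfolding V_def F_def using mform_nonneg[OF A] cv f by auto
    have vo: "mform A v (P *\<^sub>v z) = 0" if "z \<in> carrier_vec n'" for z unfolding v_def by (rule orth[OF cGf that])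
    have "mform A v v = mform A v (G *\<^sub>v f)"
    proof -
      have "mform A v (v + P *\<^sub>v u (G *\<^sub>v f)) = mform A v v + mform A v (P *\<^sub>v u (G *\<^sub>v f))"
        by (rule mform_add[OF cA]) (use cv cu[OF cGf] P in auto)
      moreover have "v + P *\<^sub>v u (G *\<^sub>v f) = G *\<^sub>v f" 
      proof -
        have "a - b + b = a" if "a \<in> carrier_vec n" "b \<in> carrier_vec n" for a b :: "real vec"
          using that by (intro eq_vecI) auto
        then show ?thesis unfolding v_def w_def using cGf P cu[OF cGf] by simp
      qed
      ultimately show ?thesis using vo[OF cu[OF cGf]] by simp
    qed
    also have "\<dots> = mform A (G *\<^sub>v v) f" using Gsym[OF cv f] by simp
    also have "\<dots> \<le> sqrt (mform A (G *\<^sub>v v) (G *\<^sub>v v)) * F"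
      using mform_Cauchy_Schwarz[OF A cGv f] unfolding F_def by linarith
    also have "\<dots> \<le> sqrt (\<tau> * mform A v v) * F"
      using Gfine[OF cv vo] F by (intro mult_right_mono real_sqrt_le_mono) auto
    also have "\<dots> = sqrt \<tau> * V * F" unfolding V_def by (simp add: real_sqrt_mult)
    finally have "V * V \<le> V * (sqrt \<tau> * F)" using V by (simp add: power2_eq_square ac_simps)
    then have "V \<le> sqrt \<tau> * F" using V F \<tau> by (cases "V = 0") auto
    then have "V\<^sup>2 \<le> (sqrt \<tau> * F)\<^sup>2" using V by (intro power_mono) auto
    then show ?thesis using \<tau> by (simp add: power_mult_distrib F(2) V(2) v_def)
  qed
  have key: "mform A (E *\<^sub>v g) f \<le> (\<tau> + (1 - \<tau>) * \<gamma>\<^sup>2) * (sqrt (mform A g g) * sqrt (mform A f f))"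
    if f: "f \<in> carrier_vec n" for f
  proof -
    define y where "y = G *\<^sub>v f"
    have cy: "y \<in> carrier_vec n" unfolding y_def using G f by simp
    have cwp: "w x + P *\<^sub>v s \<in> carrier_vec n" using cw[OF cx] P cs by simp
    have "mform A (E *\<^sub>v g) f = mform A (w x + P *\<^sub>v s) y" unfolding Eg y_def by (rule Gsym[OF cwp f])
    also have "\<dots> = mform A (w x) y + mform A (P *\<^sub>v s) y"
      by (rule mform_add[OF cA]) (use cw[OF cx] P cs cy in auto)
    also have "mform A (P *\<^sub>v s) y = mform A' (u y) s"
      using mform_commute[OF A, of "P *\<^sub>v s" y] P cs cy split[OF cy cs] by simp
    also have "mform A (w x) y = mform A (w x) (w y)"
    proof -
      have "mform A (w x) (w y + P *\<^sub>v u y) = mform A (w x) (w y) + mform A (w x) (P *\<^sub>v u y)"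
        by (rule mform_add[OF cA]) (use cw cx cy P cu in auto)
      moreover have "w y + P *\<^sub>v u y = y" unfolding w_def using cy P cu[OF cy] by (intro eq_vecI) auto
      ultimately show ?thesis using orth[OF cx cu[OF cy]] by simp
    qed
    also have "mform A (w x) (w y) + mform A' (u y) s
      \<le> sqrt (mform A (w x) (w x)) * sqrt (mform A (w y) (w y)) + sqrt (mform A' (u y) (u y)) * sqrt (mform A' s s)"
      using mform_Cauchy_Schwarz[OF A cw[OF cx] cw[OF cy]] mform_Cauchy_Schwarz[OF A' cu[OF cy] cs] by linarith
    also have "\<dots> \<le> sqrt (mform A (w x) (w x)) * sqrt (mform A (w y) (w y)) +
       sqrt (mform A' (u y) (u y)) * (\<gamma>\<^sup>2 * sqrt (mform A' (u x) (u x)))"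
      using ms mform_nonneg[OF A' cu[OF cy]] by (intro add_mono mult_left_mono order_refl) auto
    also have "\<dots> = sqrt (mform A (w x) (w x)) * sqrt (mform A (w y) (w y)) +
       \<gamma>\<^sup>2 * (sqrt (mform A' (u x) (u x)) * sqrt (mform A' (u y) (u y)))" by (simp add: ac_simps)
    also have "\<dots> \<le> (\<tau> + (1 - \<tau>) * \<gamma>\<^sup>2) * (sqrt (mform A g g) * sqrt (mform A f f))"
    proof (rule two_term_Cauchy_Schwarz)
      have sq: "(sqrt (mform A v v))\<^sup>2 = mform A v v" if "v \<in> carrier_vec n" for v using mform_nonneg[OF A that] by simp
      have sq': "(sqrt (mform A' v v))\<^sup>2 = mform A' v v" if "v \<in> carrier_vec n'" for v using mform_nonneg[OF A' that] by simp
      show "(sqrt (mform A (w x) (w x)))\<^sup>2 + (sqrt (mform A' (u x) (u x)))\<^sup>2 \<le> (sqrt (mform A g g))\<^sup>2"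
        unfolding sq[OF cw[OF cx]] sq'[OF cu[OF cx]] sq[OF g] pyth[OF cx cx, symmetric] unfolding x_def by (rule Gle[OF g])
      show "(sqrt (mform A (w y) (w y)))\<^sup>2 + (sqrt (mform A' (u y) (u y)))\<^sup>2 \<le> (sqrt (mform A f f))\<^sup>2"
        unfolding sq[OF cw[OF cy]] sq'[OF cu[OF cy]] sq[OF f] pyth[OF cy cy, symmetric] unfolding y_def by (rule Gle[OF f])
      show "(sqrt (mform A (w x) (w x)))\<^sup>2 \<le> \<tau> * (sqrt (mform A g g))\<^sup>2"
        unfolding sq[OF cw[OF cx]] sq[OF g] unfolding x_def by (rule wle[OF g])
      show "(sqrt (mform A (w y) (w y)))\<^sup>2 \<le> \<tau> * (sqrt (mform A f f))\<^sup>2"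
        unfolding sq[OF cw[OF cy]] sq[OF f] unfolding y_def by (rule wle[OF f])
    qed (use \<tau> \<gamma> mform_nonneg[OF A] f g in \<open>auto simp: power_le_one\<close>)
    finally show ?thesis .
  qed
  have cEg: "E *\<^sub>v g \<in> carrier_vec n" unfolding Eg using G cw[OF cx] P cs by simp
  define V where "V = sqrt (mform A (E *\<^sub>v g) (E *\<^sub>v g))"
  have V: "0 \<le> V" "V * V = mform A (E *\<^sub>v g) (E *\<^sub>v g)" unfolding V_def using mform_nonneg[OF A cEg] by auto
  have "V * V \<le> V * ((\<tau> + (1 - \<tau>) * \<gamma>\<^sup>2) * sqrt (mform A g g))"
    using key[OF cEg] unfolding V(2) V_def[symmetric] by (simp add: ac_simps)
  moreover have "0 \<le> (\<tau> + (1 - \<tau>) * \<gamma>\<^sup>2) * sqrt (mform A g g)" using \<tau> \<gamma> mform_nonneg[OF A g] by simp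
  ultimately show ?thesis using V(1) mult_left_le_imp_le[of V V] unfolding V_def[symmetric] by (cases "V = 0") auto
qed

section \<open>Euclidean norms on finite index sets\<close>

definition nrm :: "'a set \<Rightarrow> ('a \<Rightarrow> real) \<Rightarrow> real" where
  "nrm I u = sqrt (inner_on I u u)"

lemma nrm_nonneg: "0 \<le> nrm I u"
  unfolding nrm_def using inner_on_nonneg by simp

lemma nrm_sq: "(nrm I u)\<^sup>2 = inner_on I u u"
  unfolding nrm_def using inner_on_nonneg by simp

lemma inner_on_le_nrm: "inner_on I u v \<le> nrm I u * nrm I v"
proof -
  have "(inner_on I u v)\<^sup>2 \<le> (nrm I u * nrm I v)\<^sup>2"
    using inner_on_Cauchy_Schwarz[of I u v] by (simp add: power_mult_distrib nrm_sq)
  then show ?thesis by (rule power2_le_imp_le) (simp add: nrm_nonneg)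
qed

lemma nrm_add: "nrm I (\<lambda>i. u i + v i) \<le> nrm I u + nrm I v"
proof (rule power2_le_imp_le)
  have "(nrm I (\<lambda>i. u i + v i))\<^sup>2 = (nrm I u)\<^sup>2 + 2 * inner_on I u v + (nrm I v)\<^sup>2"
    unfolding nrm_sq inner_on_add by (simp add: inner_on_commute)
  also have "\<dots> \<le> (nrm I u)\<^sup>2 + 2 * (nrm I u * nrm I v) + (nrm I v)\<^sup>2"
    using inner_on_le_nrm[of I u v] by simp
  also have "\<dots> = (nrm I u + nrm I v)\<^sup>2" by (simp add: power2_sum)
  finally show "(nrm I (\<lambda>i. u i + v i))\<^sup>2 \<le> (nrm I u + nrm I v)\<^sup>2" .
qed (simp add: nrm_nonneg)

lemma nrm_scale: "nrm I (\<lambda>i. c * u i) = \<bar>c\<bar> * nrm I u"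
  unfolding nrm_def inner_on_scale by (simp add: real_sqrt_mult mult.assoc[symmetric])

lemma nrm_cong: "(\<And>i. i \<in> I \<Longrightarrow> u i = v i) \<Longrightarrow> nrm I u = nrm I v"
  unfolding nrm_def by (metis inner_on_cong)

lemma nrm_diff: "nrm I (\<lambda>i. u i - v i) \<le> nrm I u + nrm I v"
  using nrm_add[of I u "\<lambda>i. - 1 * v i"] by (simp only: nrm_scale) simp

subsection \<open>Regularized coarse approximation in one direction\<close>

text \<open>Precomposing the approximation \<open>J0\<close>, which is only accurate relative to \<open>S u\<close>, with the
  resolvent \<open>(1 + \<delta>\<^sup>2 S)\<^sup>-\<^sup>1\<close> makes it stable in the mean square and energy norms, so that it can be
  tensorized.\<close>

lemma regularized_approximation:
  fixes S0 J0 :: "'a \<Rightarrow> 'a \<Rightarrow> real"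
  assumes fin: "finite I" and sym: "\<And>i j. i \<in> I \<Longrightarrow> j \<in> I \<Longrightarrow> S0 i j = S0 j i"
    and C0: "C0 \<ge> 0" and K1: "K1 \<ge> 0" and \<delta>: "0 < \<delta>" "\<delta> \<le> 1"
    and ge1: "\<And>u. inner_on I u u \<le> inner_on I u (mat_app I S0 u) + C0 * inner_on I u u"
    and approx0: "\<And>u. nrm I (\<lambda>i. u i - mat_app I J0 u i) \<le> K1 * \<delta>\<^sup>2 * nrm I (mat_app I S0 u)"
    and approx1: "\<And>u. let y = \<lambda>i. u i - mat_app I J0 u i in
        inner_on I y (mat_app I S0 y) \<le> (K1 * \<delta> * nrm I (mat_app I S0 u))\<^sup>2"
  defines "C \<equiv> 2 + K1 * (1 + C0)\<^sup>2"
  shows "\<exists>B R. (\<forall>i\<in>I. \<forall>j\<in>I. B i j = B j i) \<and>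
    (\<forall>u. \<forall>i\<in>I. mat_app I B (mat_app I B u) i = mat_app I S0 u i + C0 * u i) \<and>
    (\<forall>u. nrm I (mat_app I J0 (mat_app I R u)) \<le> C * nrm I u) \<and>
    (\<forall>u. nrm I (mat_app I B (mat_app I J0 (mat_app I R u))) \<le> C * nrm I (mat_app I B u)) \<and>
    (\<forall>u. nrm I (\<lambda>i. u i - mat_app I J0 (mat_app I R u) i) \<le> C * \<delta> * nrm I (mat_app I B u)) \<and>
    (\<forall>u. nrm I (mat_app I B (\<lambda>i. u i - mat_app I J0 (mat_app I R u) i)) \<le> C * \<delta> * nrm I (mat_app I B (mat_app I B u)))"
proof -
  \<comment> \<open>The shift makes S >= 1 by \<open>ge1\<close>, so that below its square root B
    and the resolvent R exist as functions of the eigenvalues, and |u| <= |S u|.\<close>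
  define S where "S i j = S0 i j + (if i = j then C0 else 0)" for i j
  have Sapp: "mat_app I S u i = mat_app I S0 u i + C0 * u i" if "i \<in> I" for u i
    unfolding mat_app_def S_def using fin that by (simp add: distrib_right sum.distrib if_distrib[of "\<lambda>z. z * _"] cong: if_cong)
  have symS: "S i j = S j i" if "i \<in> I" "j \<in> I" for i j using sym[OF that] unfolding S_def by auto
  obtain \<phi> \<mu> where
    on: "\<And>s t. s < card I \<Longrightarrow> t < card I \<Longrightarrow> inner_on I (\<phi> s) (\<phi> t) = (if s = t then 1 else 0)"
    and ev: "\<And>s i. s < card I \<Longrightarrow> i \<in> I \<Longrightarrow> mat_app I S (\<phi> s) i = \<mu> s * \<phi> s i"
    and complete: "\<And>u i. i \<in> I \<Longrightarrow> u i = (\<Sum>s<card I. inner_on I (\<phi> s) u * \<phi> s i)"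
    using spectral_theorem_symmetric[of I S, OF fin symS] by blast
  have \<mu>1: "\<mu> s \<ge> 1" if "s < card I" for s
  proof -
    have "inner_on I (\<phi> s) (mat_app I S (\<phi> s)) = inner_on I (\<phi> s) (\<lambda>i. mat_app I S0 (\<phi> s) i + C0 * \<phi> s i)"
      by (rule inner_on_cong) (auto simp: Sapp)
    then have "inner_on I (\<phi> s) (mat_app I S (\<phi> s)) \<ge> inner_on I (\<phi> s) (\<phi> s)"
      using ge1[of "\<phi> s"] by (simp add: inner_on_add inner_on_scale)
    moreover have "inner_on I (\<phi> s) (mat_app I S (\<phi> s)) = inner_on I (\<phi> s) (\<lambda>i. \<mu> s * \<phi> s i)"
      by (rule inner_on_cong) (auto simp: ev that)
    ultimately show ?thesis using on[OF that that] by (simp add: inner_on_scale)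
  qed
  define F where "F f = (\<lambda>i j. \<Sum>s<card I. f s * (\<phi> s i * \<phi> s j))" for f :: "nat \<Rightarrow> real"
  have Fapp: "mat_app I (F f) u i = (\<Sum>s<card I. f s * inner_on I (\<phi> s) u * \<phi> s i)" for f u i
  proof -
    have "mat_app I (F f) u i = (\<Sum>j\<in>I. \<Sum>s<card I. f s * (\<phi> s j * u j) * \<phi> s i)"
      unfolding mat_app_def F_def sum_distrib_right by (simp add: ac_simps)
    also have "\<dots> = (\<Sum>s<card I. \<Sum>j\<in>I. f s * (\<phi> s j * u j) * \<phi> s i)" by (rule sum.swap)
    finally show ?thesis unfolding inner_on_def sum_distrib_left sum_distrib_right .
  qed
  have coef: "inner_on I (\<phi> t) (mat_app I (F f) u) = f t * inner_on I (\<phi> t) u" if "t < card I" for t f u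
  proof -
    have "inner_on I (\<phi> t) (mat_app I (F f) u) = inner_on I (\<phi> t) (\<lambda>i. \<Sum>s<card I. f s * inner_on I (\<phi> s) u * \<phi> s i)"
      by (simp add: Fapp[abs_def])
    also have "\<dots> = (\<Sum>s<card I. if s = t then f t * inner_on I (\<phi> t) u else 0)"
      unfolding inner_on_sum inner_on_scale by (rule sum.cong) (use on that in auto)
    finally show ?thesis using that by simp
  qed
  have parseval: "inner_on I u u = (\<Sum>s<card I. (inner_on I (\<phi> s) u)\<^sup>2)" for u
  proof -
    have "inner_on I u u = inner_on I (\<lambda>i. \<Sum>s<card I. inner_on I (\<phi> s) u * \<phi> s i) u"
      by (rule inner_on_cong) (use complete in auto)
    then show ?thesis unfolding inner_on_sum inner_on_scale by (simp add: power2_eq_square)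
  qed
  have nle: "nrm I u \<le> r * nrm I v"
    if "r \<ge> 0" "\<And>s. s < card I \<Longrightarrow> \<bar>inner_on I (\<phi> s) u\<bar> \<le> r * \<bar>inner_on I (\<phi> s) v\<bar>" for u v r
  proof (rule power2_le_imp_le)
    have "inner_on I u u \<le> r\<^sup>2 * inner_on I v v" unfolding parseval sum_distrib_left
    proof (rule sum_mono)
      fix s assume "s \<in> {..<card I}"
      then have "\<bar>inner_on I (\<phi> s) u\<bar>\<^sup>2 \<le> (r * \<bar>inner_on I (\<phi> s) v\<bar>)\<^sup>2" using that by (intro power_mono) auto
      then show "(inner_on I (\<phi> s) u)\<^sup>2 \<le> r\<^sup>2 * (inner_on I (\<phi> s) v)\<^sup>2" by (simp add: power_mult_distrib)
    qed
    then show "(nrm I u)\<^sup>2 \<le> (r * nrm I v)\<^sup>2" by (simp add: nrm_sq power_mult_distrib)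
  qed (simp add: that(1) nrm_nonneg)
  define B where "B = F (\<lambda>s. sqrt (\<mu> s))"
  define R where "R = F (\<lambda>s. 1 / (1 + \<delta>\<^sup>2 * \<mu> s))"
  have eqI: "u i = v i" if "i \<in> I" "\<And>s. s < card I \<Longrightarrow> inner_on I (\<phi> s) u = inner_on I (\<phi> s) v" for u v i
  proof -
    have "u i = (\<Sum>s<card I. inner_on I (\<phi> s) u * \<phi> s i)" by (rule complete[OF that(1)])
    also have "\<dots> = (\<Sum>s<card I. inner_on I (\<phi> s) v * \<phi> s i)" using that(2) by simp
    also have "\<dots> = v i" by (rule complete[OF that(1), symmetric])
    finally show ?thesis .
  qed
  have Scoef: "inner_on I (\<phi> s) (mat_app I S u) = \<mu> s * inner_on I (\<phi> s) u" if "s < card I" for s u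
  proof -
    have "inner_on I (\<phi> s) (mat_app I S u) = inner_on I (mat_app I S (\<phi> s)) u" by (rule mat_app_symmetric[OF symS])
    also have "\<dots> = inner_on I (\<lambda>i. \<mu> s * \<phi> s i) u" by (rule inner_on_cong) (auto simp: ev that)
    finally show ?thesis by (simp add: inner_on_scale)
  qed
  have Bsym: "B i j = B j i" for i j unfolding B_def F_def by (simp add: mult.commute)
  have BB: "mat_app I B (mat_app I B u) i = mat_app I S u i" if "i \<in> I" for u i
  proof (rule eqI[OF that])
    fix s assume s: "s < card I"
    then have "sqrt (\<mu> s) * sqrt (\<mu> s) = \<mu> s" using \<mu>1[OF s] by simp
    then show "inner_on I (\<phi> s) (mat_app I B (mat_app I B u)) = inner_on I (\<phi> s) (mat_app I S u)"
      unfolding B_def coef[OF s] Scoef[OF s] by (simp add: mult.assoc[symmetric])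
  qed
  have BBn: "nrm I (mat_app I B (mat_app I B u)) = nrm I (mat_app I S u)" for u by (rule nrm_cong) (rule BB)
  have Bform: "(nrm I (mat_app I B u))\<^sup>2 = inner_on I u (mat_app I S0 u) + C0 * inner_on I u u" for u
  proof -
    have "(nrm I (mat_app I B u))\<^sup>2 = inner_on I u (mat_app I B (mat_app I B u))"
      unfolding nrm_sq using mat_app_symmetric[of I B u "mat_app I B u"] Bsym by simp
    also have "\<dots> = inner_on I u (\<lambda>i. mat_app I S0 u i + C0 * u i)" by (rule inner_on_cong) (auto simp: BB Sapp)
    finally show ?thesis by (simp add: inner_on_add inner_on_scale)
  qed
  define M where "M = 1 + C0"
  have M: "M \<ge> 1" unfolding M_def using C0 by simp
  have S0le: "nrm I (mat_app I S0 u) \<le> M * nrm I (mat_app I S u)" for u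
  proof -
    have "nrm I (mat_app I S0 u) = nrm I (\<lambda>i. mat_app I S u i - C0 * u i)" by (rule nrm_cong) (simp add: Sapp)
    also have "\<dots> \<le> nrm I (mat_app I S u) + C0 * nrm I u" using nrm_diff[of I "mat_app I S u" "\<lambda>i. C0 * u i"] C0 by (simp add: nrm_scale)
    also have "\<dots> \<le> nrm I (mat_app I S u) + C0 * (1 * nrm I (mat_app I S u))"
    proof (intro add_left_mono mult_left_mono C0)
      show "nrm I u \<le> 1 * nrm I (mat_app I S u)"
    proof (rule nle)
      fix s assume s: "s < card I"
      have "1 * \<bar>inner_on I (\<phi> s) u\<bar> \<le> \<mu> s * \<bar>inner_on I (\<phi> s) u\<bar>" by (intro mult_right_mono \<mu>1 s) simp
      then show "\<bar>inner_on I (\<phi> s) u\<bar> \<le> 1 * \<bar>inner_on I (\<phi> s) (mat_app I S u)\<bar>"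
        unfolding Scoef[OF s] using \<mu>1[OF s] by (simp add: abs_mult)
    qed simp
    qed
    finally show ?thesis unfolding M_def by (simp add: algebra_simps)
  qed
  \<comment> \<open>The error splits into the regularization error d = u - R u and the approximation
    error y of R u. The latter is controlled by S R u, and the resolvent supplies the missing
    smoothness: \<delta>^2 |S R u| <= |u| and \<delta> |S R u| <= |B u|.\<close>
  define v where "v u = mat_app I R u" for u
  define y where "y u = (\<lambda>i. v u i - mat_app I J0 (v u) i)" for u
  define d where "d u = (\<lambda>i. u i - v u i)" for u
  have vc: "inner_on I (\<phi> s) (v u) = inner_on I (\<phi> s) u / (1 + \<delta>\<^sup>2 * \<mu> s)" if "s < card I" for s u
    unfolding v_def R_def coef[OF that] by simp
  have pos: "1 + \<delta>\<^sup>2 * \<mu> s > 0" "\<delta>\<^sup>2 * \<mu> s \<ge> 0" "\<mu> s \<ge> 0" if "s < card I" for s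
    using \<mu>1[OF that] by (auto intro!: add_pos_nonneg)
  have dc: "inner_on I (\<phi> s) (d u) = \<delta>\<^sup>2 * \<mu> s * inner_on I (\<phi> s) u / (1 + \<delta>\<^sup>2 * \<mu> s)" if "s < card I" for s u
    unfolding d_def inner_on_diff vc[OF that] using pos[OF that] by (simp add: field_simps)
  have Bc: "inner_on I (\<phi> s) (mat_app I B u) = sqrt (\<mu> s) * inner_on I (\<phi> s) u" if "s < card I" for s u
    unfolding B_def coef[OF that] ..
  have bound: "\<bar>a * x / (1 + t)\<bar> \<le> b * \<bar>x\<bar>" if "0 \<le> a" "0 \<le> t" "a \<le> b * (1 + t)" for a b t x :: real
  proof -
    have "\<bar>a * x / (1 + t)\<bar> = a / (1 + t) * \<bar>x\<bar>" using that by (simp add: abs_mult)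
    also have "\<dots> \<le> b * \<bar>x\<bar>" using that by (intro mult_right_mono) (auto simp: pos_divide_le_eq)
    finally show ?thesis .
  qed
  have sq: "\<delta> * sqrt (\<mu> s) \<le> 1 + \<delta>\<^sup>2 * \<mu> s" if "s < card I" for s
  proof -
    have "(\<delta> * sqrt (\<mu> s))\<^sup>2 = \<delta>\<^sup>2 * \<mu> s" using pos[OF that] by (simp add: power_mult_distrib)
    moreover have "2 * (\<delta> * sqrt (\<mu> s)) \<le> 1 + (\<delta> * sqrt (\<mu> s))\<^sup>2" using sum_squares_bound[of 1 "\<delta> * sqrt (\<mu> s)"] by simp
    moreover have "0 \<le> \<delta> * sqrt (\<mu> s)" using \<delta> pos[OF that] by simp
    ultimately show ?thesis by linarith
  qed
  have \<mu>q: "sqrt (\<mu> s) * sqrt (\<mu> s) = \<mu> s" if "s < card I" for s using pos[OF that] by simp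
  have d1: "nrm I (d u) \<le> 1 * nrm I u" for u
  proof (rule nle)
    fix s assume s: "s < card I"
    show "\<bar>inner_on I (\<phi> s) (d u)\<bar> \<le> 1 * \<bar>inner_on I (\<phi> s) u\<bar>" unfolding dc[OF s] using pos[OF s] by (intro bound) auto
  qed simp
  have d2: "nrm I (d u) \<le> \<delta> * nrm I (mat_app I B u)" for u
  proof (rule nle)
    fix s assume s: "s < card I"
    have "\<delta>\<^sup>2 * \<mu> s = \<delta> * (\<delta> * sqrt (\<mu> s)) * sqrt (\<mu> s)" using \<mu>q[OF s] by (simp add: power2_eq_square ac_simps)
    also have "\<dots> \<le> \<delta> * (1 + \<delta>\<^sup>2 * \<mu> s) * sqrt (\<mu> s)" using sq[OF s] \<delta> pos[OF s] by (intro mult_right_mono mult_left_mono) auto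
    finally have "\<bar>\<delta>\<^sup>2 * \<mu> s * inner_on I (\<phi> s) u / (1 + \<delta>\<^sup>2 * \<mu> s)\<bar> \<le> \<delta> * sqrt (\<mu> s) * \<bar>inner_on I (\<phi> s) u\<bar>"
      using pos[OF s] by (intro bound) (auto simp: ac_simps)
    then show "\<bar>inner_on I (\<phi> s) (d u)\<bar> \<le> \<delta> * \<bar>inner_on I (\<phi> s) (mat_app I B u)\<bar>"
      unfolding dc[OF s] Bc[OF s] using pos[OF s] by (simp add: abs_mult mult.assoc)
  qed (use \<delta> in simp)
  have d3: "nrm I (mat_app I B (d u)) \<le> 1 * nrm I (mat_app I B u)" for u
  proof (rule nle)
    fix s assume s: "s < card I"
    have "\<bar>inner_on I (\<phi> s) (d u)\<bar> \<le> 1 * \<bar>inner_on I (\<phi> s) u\<bar>" unfolding dc[OF s] using pos[OF s] by (intro bound) auto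
    then have "sqrt (\<mu> s) * \<bar>inner_on I (\<phi> s) (d u)\<bar> \<le> sqrt (\<mu> s) * (1 * \<bar>inner_on I (\<phi> s) u\<bar>)" using pos[OF s] by (intro mult_left_mono) auto
    then show "\<bar>inner_on I (\<phi> s) (mat_app I B (d u))\<bar> \<le> 1 * \<bar>inner_on I (\<phi> s) (mat_app I B u)\<bar>"
      unfolding Bc[OF s] using pos[OF s] by (simp add: abs_mult)
  qed simp
  have d4: "nrm I (mat_app I B (d u)) \<le> \<delta> * nrm I (mat_app I S u)" for u
  proof -
    have "d (mat_app I B u) i = mat_app I B (d u) i" if "i \<in> I" for i
      by (rule eqI[OF that]) (simp add: dc Bc)
    then have "nrm I (mat_app I B (d u)) = nrm I (d (mat_app I B u))" by (metis nrm_cong)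
    then show ?thesis using d2[of "mat_app I B u"] by (simp add: BBn)
  qed
  have s1: "\<delta>\<^sup>2 * nrm I (mat_app I S (v u)) \<le> nrm I u" for u
  proof -
    have "d u i = \<delta>\<^sup>2 * mat_app I S (v u) i" if "i \<in> I" for i
      by (rule eqI[OF that]) (simp add: dc inner_on_scale Scoef vc)
    then have "nrm I (d u) = nrm I (\<lambda>i. \<delta>\<^sup>2 * mat_app I S (v u) i)" by (metis nrm_cong)
    then show ?thesis using d1[of u] by (simp add: nrm_scale)
  qed
  have s2: "\<delta> * nrm I (mat_app I S (v u)) \<le> nrm I (mat_app I B u)" for u
  proof -
    have "d u i = \<delta>\<^sup>2 * mat_app I S (v u) i" if "i \<in> I" for i
      by (rule eqI[OF that]) (simp add: dc inner_on_scale Scoef vc)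
    then have "nrm I (d u) = nrm I (\<lambda>i. \<delta>\<^sup>2 * mat_app I S (v u) i)" by (metis nrm_cong)
    then have "\<delta> * (\<delta> * nrm I (mat_app I S (v u))) \<le> \<delta> * nrm I (mat_app I B u)"
      using d2[of u] by (simp add: nrm_scale power2_eq_square mult.assoc)
    then show ?thesis using \<delta> by simp
  qed
  have s3: "nrm I (mat_app I S (v u)) \<le> 1 * nrm I (mat_app I S u)" for u
  proof (rule nle)
    fix s assume s: "s < card I"
    show "\<bar>inner_on I (\<phi> s) (mat_app I S (v u))\<bar> \<le> 1 * \<bar>inner_on I (\<phi> s) (mat_app I S u)\<bar>"
      unfolding Scoef[OF s] vc[OF s]
      using bound[of 1 "\<delta>\<^sup>2 * \<mu> s" 1 "\<mu> s * inner_on I (\<phi> s) u"] pos[OF s] by simp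
  qed simp
  have y0: "nrm I (y u) \<le> K1 * M * \<delta>\<^sup>2 * nrm I (mat_app I S (v u))" for u
  proof -
    have "nrm I (y u) \<le> K1 * \<delta>\<^sup>2 * nrm I (mat_app I S0 (v u))" unfolding y_def by (rule approx0)
    also have "\<dots> \<le> K1 * \<delta>\<^sup>2 * (M * nrm I (mat_app I S (v u)))" by (intro mult_left_mono S0le) (use K1 in auto)
    finally show ?thesis by (simp add: ac_simps)
  qed
  have y1: "nrm I (mat_app I B (y u)) \<le> K1 * M\<^sup>2 * \<delta> * nrm I (mat_app I S (v u))" for u
  proof (rule power2_le_imp_le)
    let ?n = "nrm I (mat_app I S0 (v u))"
    have "(nrm I (mat_app I B (y u)))\<^sup>2 \<le> (K1 * \<delta> * ?n)\<^sup>2 + C0 * (K1 * \<delta>\<^sup>2 * ?n)\<^sup>2"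
      unfolding Bform
    proof (intro add_mono mult_left_mono)
      show "inner_on I (y u) (mat_app I S0 (y u)) \<le> (K1 * \<delta> * ?n)\<^sup>2" using approx1[of "v u"] unfolding Let_def y_def .
      show "inner_on I (y u) (y u) \<le> (K1 * \<delta>\<^sup>2 * ?n)\<^sup>2" unfolding nrm_sq[symmetric]
        by (intro power_mono nrm_nonneg) (simp add: y_def approx0)
    qed (use C0 in auto)
    also have "\<dots> = (K1 * \<delta> * ?n)\<^sup>2 * (1 + C0 * \<delta>\<^sup>2)" by (simp add: power_mult_distrib power2_eq_square algebra_simps)
    also have "\<dots> \<le> (K1 * \<delta> * (M * nrm I (mat_app I S (v u))))\<^sup>2 * M\<^sup>2"
    proof (rule mult_mono)
      have "1 + C0 * \<delta>\<^sup>2 \<le> 1 + C0 * 1" using C0 \<delta> by (intro add_left_mono mult_left_mono) (auto simp: power_le_one)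
      also have "\<dots> = M * 1" unfolding M_def by simp
      also have "\<dots> \<le> M * M" using M by (intro mult_left_mono) auto
      finally show "1 + C0 * \<delta>\<^sup>2 \<le> M\<^sup>2" by (simp add: power2_eq_square)
      have "K1 * \<delta> * ?n \<le> K1 * \<delta> * (M * nrm I (mat_app I S (v u)))"
        using S0le[of "v u"] K1 \<delta> by (intro mult_left_mono) auto
      moreover have "0 \<le> K1 * \<delta> * ?n" using K1 \<delta> by (simp add: nrm_nonneg)
      ultimately show "(K1 * \<delta> * ?n)\<^sup>2 \<le> (K1 * \<delta> * (M * nrm I (mat_app I S (v u))))\<^sup>2" by (intro power_mono)
    qed (use C0 in auto)
    also have "\<dots> = (K1 * M\<^sup>2 * \<delta> * nrm I (mat_app I S (v u)))\<^sup>2" by (simp add: power_mult_distrib power2_eq_square ac_simps)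
    finally show "(nrm I (mat_app I B (y u)))\<^sup>2 \<le> (K1 * M\<^sup>2 * \<delta> * nrm I (mat_app I S (v u)))\<^sup>2" .
  qed (use K1 M \<delta> in \<open>simp add: nrm_nonneg\<close>)
  have C: "C = 2 + K1 * M\<^sup>2" unfolding C_def M_def ..
  have MM: "K1 * M \<le> K1 * M\<^sup>2" using M K1 by (intro mult_left_mono) (auto simp: power2_eq_square)
  define e where "e u = (\<lambda>i. u i - mat_app I J0 (v u) i)" for u
  have e: "e u = (\<lambda>i. d u i + y u i)" for u unfolding e_def d_def y_def by auto
  have Be: "mat_app I B (e u) = (\<lambda>i. mat_app I B (d u) i + mat_app I B (y u) i)" for u
    unfolding e by (rule ext) (rule mat_app_add)
  have KM: "K1 * M * r \<le> K1 * M\<^sup>2 * r" if "r \<ge> 0" for r using MM that by (rule mult_right_mono)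
  have e1: "nrm I (e u) \<le> (1 + K1 * M\<^sup>2) * nrm I u" for u
  proof -
    have "nrm I (e u) \<le> nrm I (d u) + nrm I (y u)" unfolding e by (rule nrm_add)
    also have "\<dots> \<le> nrm I u + K1 * M * (\<delta>\<^sup>2 * nrm I (mat_app I S (v u)))" using d1[of u] y0[of u] by (simp add: mult.assoc)
    also have "\<dots> \<le> nrm I u + K1 * M * nrm I u" using s1[of u] K1 M by (intro add_left_mono mult_left_mono) auto
    also have "\<dots> \<le> (1 + K1 * M\<^sup>2) * nrm I u" using KM[OF nrm_nonneg] by (simp add: distrib_right)
    finally show ?thesis .
  qed
  have e2: "nrm I (e u) \<le> C * \<delta> * nrm I (mat_app I B u)" for u
  proof -
    have "nrm I (e u) \<le> nrm I (d u) + nrm I (y u)" unfolding e by (rule nrm_add)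
    also have "\<dots> \<le> \<delta> * nrm I (mat_app I B u) + K1 * M * \<delta> * (\<delta> * nrm I (mat_app I S (v u)))" using d2[of u] y0[of u] by (simp add: ac_simps power2_eq_square)
    also have "\<dots> \<le> \<delta> * nrm I (mat_app I B u) + K1 * M * \<delta> * nrm I (mat_app I B u)" using s2[of u] K1 M \<delta> by (intro add_left_mono mult_left_mono) auto
    also have "\<dots> = \<delta> * nrm I (mat_app I B u) + K1 * M * (\<delta> * nrm I (mat_app I B u))" by simp
    also have "\<dots> \<le> \<delta> * nrm I (mat_app I B u) + K1 * M\<^sup>2 * (\<delta> * nrm I (mat_app I B u))"
      by (intro add_left_mono KM) (use \<delta> in \<open>simp add: nrm_nonneg\<close>)
    also have "\<dots> \<le> C * \<delta> * nrm I (mat_app I B u)" unfolding C using \<delta> nrm_nonneg[of I "mat_app I B u"] by (simp add: distrib_right mult.assoc)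
    finally show ?thesis .
  qed
  have e3: "nrm I (mat_app I B (e u)) \<le> (1 + K1 * M\<^sup>2) * nrm I (mat_app I B u)" for u
  proof -
    have "nrm I (mat_app I B (e u)) \<le> nrm I (mat_app I B (d u)) + nrm I (mat_app I B (y u))" unfolding Be by (rule nrm_add)
    also have "\<dots> \<le> nrm I (mat_app I B u) + K1 * M\<^sup>2 * (\<delta> * nrm I (mat_app I S (v u)))" using d3[of u] y1[of u] by (simp add: mult.assoc)
    also have "\<dots> \<le> nrm I (mat_app I B u) + K1 * M\<^sup>2 * nrm I (mat_app I B u)" using s2[of u] K1 by (intro add_left_mono mult_left_mono) auto
    finally show ?thesis by (simp add: distrib_right)
  qed
  have e4: "nrm I (mat_app I B (e u)) \<le> C * \<delta> * nrm I (mat_app I B (mat_app I B u))" for u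
  proof -
    have "nrm I (mat_app I B (e u)) \<le> nrm I (mat_app I B (d u)) + nrm I (mat_app I B (y u))" unfolding Be by (rule nrm_add)
    also have "\<dots> \<le> \<delta> * nrm I (mat_app I S u) + K1 * M\<^sup>2 * \<delta> * nrm I (mat_app I S (v u))" using d4[of u] y1[of u] by (simp add: mult.assoc)
    also have "\<dots> \<le> \<delta> * nrm I (mat_app I S u) + K1 * M\<^sup>2 * \<delta> * nrm I (mat_app I S u)" using s3[of u] K1 \<delta> by (intro add_left_mono mult_left_mono) auto
    also have "\<dots> \<le> C * \<delta> * nrm I (mat_app I S u)" unfolding C using \<delta> nrm_nonneg[of I "mat_app I S u"] by (simp add: distrib_right mult.assoc)
    finally show ?thesis by (simp add: BBn)
  qed
  have J: "mat_app I J0 (v u) = (\<lambda>i. u i - e u i)" for u unfolding e_def by auto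
  have j1: "nrm I (mat_app I J0 (v u)) \<le> C * nrm I u" for u
    unfolding J using nrm_diff[of I u "e u"] e1[of u] unfolding C by (simp add: distrib_right)
  have j2: "nrm I (mat_app I B (mat_app I J0 (v u))) \<le> C * nrm I (mat_app I B u)" for u
  proof -
    have "mat_app I B (mat_app I J0 (v u)) = (\<lambda>i. mat_app I B u i - mat_app I B (e u) i)"
      unfolding J by (rule ext) (rule mat_app_diff)
    then show ?thesis using nrm_diff[of I "mat_app I B u" "mat_app I B (e u)"] e3[of u] unfolding C by (simp add: distrib_right)
  qed
  show ?thesis
    by (rule exI[of _ B], rule exI[of _ R])
      (use Bsym BB Sapp j1 j2 e2 e4 in \<open>auto simp: v_def[symmetric] e_def[symmetric]\<close>)
qed

subsection \<open>Tensor products\<close>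

text \<open>The Kronecker product with \<open>T\<close> in position i and the identity in all other
  positions.\<close>

definition lift :: "('d \<Rightarrow> 'a set) \<Rightarrow> 'd \<Rightarrow> ('a \<Rightarrow> 'a \<Rightarrow> real) \<Rightarrow> (('d \<Rightarrow> 'a) \<Rightarrow> real) \<Rightarrow> ('d \<Rightarrow> 'a) \<Rightarrow> real" where
  "lift I i T f n = (\<Sum>m\<in>I i. T (n i) m * f (n(i := m)))"

definition grid :: "('d \<Rightarrow> 'a set) \<Rightarrow> ('d \<Rightarrow> 'a) set" where
  "grid I = {n. \<forall>i. n i \<in> I i}"

lemma grid_PiE: "grid I = PiE UNIV I"
  unfolding grid_def by auto

lemma finite_grid: "(\<And>i. finite (I i)) \<Longrightarrow> finite (grid (I :: 'd::finite \<Rightarrow> 'a set))"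
  unfolding grid_PiE by (intro finite_PiE) auto

lemma grid_upd: "n \<in> grid I \<Longrightarrow> m \<in> I i \<Longrightarrow> n(i := m) \<in> grid I"
  unfolding grid_def by auto

text \<open>Exchanging the i-th coordinate of n with m is an involution of the pairs. This is the
  form of Fubini used throughout: the slices in direction i are indexed by all grid points, each
  slice being counted \<open>card (I i)\<close> times, and no grid over the remaining directions has
  to be formed.\<close>

lemma sum_grid_swap:
  "(\<Sum>n\<in>grid I. \<Sum>m\<in>I i. F n m) = (\<Sum>n\<in>grid I. \<Sum>m\<in>I i. F (n(i := m)) (n i))"
proof -
  have "(\<Sum>(n, m)\<in>grid I \<times> I i. F n m) = (\<Sum>(n, m)\<in>grid I \<times> I i. F (n(i := m)) (n i))"
    by (rule sum.reindex_bij_witness[of _ "\<lambda>(n, m). (n(i := m), n i)" "\<lambda>(n, m). (n(i := m), n i)"])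
      (auto simp: grid_def)
  then show ?thesis by (simp add: sum.cartesian_product)
qed

lemma sum_grid_slices:
  "(\<Sum>n\<in>grid I. \<Sum>m\<in>I i. F (n(i := m))) = real (card (I i)) * (\<Sum>n\<in>grid I. F n)"
  using sum_grid_swap[of "\<lambda>n m. F n" I i] by (simp add: sum_distrib_left)

lemma sum_grid_slice_mono:
  fixes F G :: "('d::finite \<Rightarrow> 'a) \<Rightarrow> real"
  assumes fin: "finite (I i)" and le: "\<And>n. n \<in> grid I \<Longrightarrow> (\<Sum>m\<in>I i. F (n(i := m))) \<le> (\<Sum>m\<in>I i. G (n(i := m)))"
  shows "(\<Sum>n\<in>grid I. F n) \<le> (\<Sum>n\<in>grid I. G n)"
proof (cases "I i = {}")
  case True
  then have "grid I = {}" unfolding grid_def by auto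
  then show ?thesis by simp
next
  case False
  then have "real (card (I i)) > 0" using fin by (simp add: card_gt_0_iff)
  moreover have "real (card (I i)) * (\<Sum>n\<in>grid I. F n) \<le> real (card (I i)) * (\<Sum>n\<in>grid I. G n)"
    unfolding sum_grid_slices[symmetric] by (intro sum_mono le)
  ultimately show ?thesis by simp
qed

lemma lift_slice: "lift I i T f (n(i := k)) = mat_app (I i) T (\<lambda>m. f (n(i := m))) k"
  unfolding lift_def mat_app_def by simp

lemma lift_slice_mat_app: "lift I i T f n = mat_app (I i) T (\<lambda>m. f (n(i := m))) (n i)"
  unfolding lift_def mat_app_def by simp

lemma lift_add: "lift I i T (\<lambda>n. f n + g n) n = lift I i T f n + lift I i T g n"
  unfolding lift_slice_mat_app by (rule mat_app_add)

lemma lift_diff: "lift I i T (\<lambda>n. f n - g n) n = lift I i T f n - lift I i T g n"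
  unfolding lift_slice_mat_app by (rule mat_app_diff)

lemma lift_symmetric:
  assumes "\<And>x y. x \<in> I i \<Longrightarrow> y \<in> I i \<Longrightarrow> T x y = T y x"
  shows "inner_on (grid I) f (lift I i T g) = inner_on (grid I) (lift I i T f) g"
proof -
  have "inner_on (grid I) f (lift I i T g) = (\<Sum>n\<in>grid I. \<Sum>m\<in>I i. f n * T (n i) m * g (n(i := m)))"
    unfolding inner_on_def lift_def by (simp add: sum_distrib_left mult.assoc)
  also have "\<dots> = (\<Sum>n\<in>grid I. \<Sum>m\<in>I i. f (n(i := m)) * T m (n i) * g n)"
    by (subst sum_grid_swap) simp
  also have "\<dots> = inner_on (grid I) (lift I i T f) g"
    unfolding inner_on_def lift_def sum_distrib_right
    by (intro sum.cong refl) (use assms in \<open>auto simp: grid_def ac_simps\<close>)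
  finally show ?thesis .
qed

lemma lift_commute:
  assumes "i \<noteq> j" shows "lift I i T (lift I j U f) n = lift I j U (lift I i T f) n"
proof -
  have "lift I i T (lift I j U f) n = (\<Sum>m\<in>I i. \<Sum>k\<in>I j. T (n i) m * (U (n j) k * f (n(i := m, j := k))))"
    unfolding lift_def using assms by (simp add: sum_distrib_left)
  also have "\<dots> = (\<Sum>k\<in>I j. \<Sum>m\<in>I i. T (n i) m * (U (n j) k * f (n(i := m, j := k))))" by (rule sum.swap)
  also have "\<dots> = lift I j U (lift I i T f) n"
    unfolding lift_def using assms by (simp add: sum_distrib_left fun_upd_twist[OF assms] ac_simps)
  finally show ?thesis .
qed

lemma nrm_lift_le:
  fixes f g :: "('d::finite \<Rightarrow> 'a) \<Rightarrow> real"
  assumes fin: "finite (I i)" and c: "c \<ge> 0"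
    and le: "\<And>n. n \<in> grid I \<Longrightarrow> nrm (I i) (\<lambda>m. f (n(i := m))) \<le> c * nrm (I i) (\<lambda>m. g (n(i := m)))"
  shows "nrm (grid I) f \<le> c * nrm (grid I) g"
proof (rule power2_le_imp_le)
  have "(\<Sum>n\<in>grid I. f n * f n) \<le> (\<Sum>n\<in>grid I. c\<^sup>2 * (g n * g n))"
  proof (rule sum_grid_slice_mono[where I = I, OF fin])
    fix n assume n: "n \<in> grid I"
    have "(nrm (I i) (\<lambda>m. f (n(i := m))))\<^sup>2 \<le> (c * nrm (I i) (\<lambda>m. g (n(i := m))))\<^sup>2"
      by (intro power_mono le n nrm_nonneg)
    then show "(\<Sum>m\<in>I i. f (n(i := m)) * f (n(i := m))) \<le> (\<Sum>m\<in>I i. c\<^sup>2 * (g (n(i := m)) * g (n(i := m))))"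
      unfolding power_mult_distrib nrm_sq unfolding inner_on_def by (simp add: sum_distrib_left)
  qed
  then show "(nrm (grid I) f)\<^sup>2 \<le> (c * nrm (grid I) g)\<^sup>2"
    unfolding power_mult_distrib nrm_sq unfolding inner_on_def by (simp add: sum_distrib_left)
qed (use c nrm_nonneg[of "grid I" g] in simp)

text \<open>Approximants in the single directions, composed one after the other, give an approximant in the
  tensor product space; \<open>H i\<close> are the indices which are to be removed in direction \<open>i\<close>.\<close>

lemma tensor_approximation:
  fixes I :: "'d::finite \<Rightarrow> 'a set" and B J :: "'d \<Rightarrow> 'a \<Rightarrow> 'a \<Rightarrow> real" and z :: "('d \<Rightarrow> 'a) \<Rightarrow> real"
  assumes fin: "\<And>i. finite (I i)" and C: "C \<ge> 1" and \<delta>: "\<delta> \<ge> 0" and R: "R \<ge> 0"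
    and j1: "\<And>i u. nrm (I i) (mat_app (I i) (J i) u) \<le> C * nrm (I i) u"
    and j2: "\<And>i u. nrm (I i) (mat_app (I i) (B i) (mat_app (I i) (J i) u)) \<le> C * nrm (I i) (mat_app (I i) (B i) u)"
    and j3: "\<And>i u. nrm (I i) (\<lambda>m. u m - mat_app (I i) (J i) u m) \<le> C * \<delta> * nrm (I i) (mat_app (I i) (B i) u)"
    and j4: "\<And>i u. nrm (I i) (mat_app (I i) (B i) (\<lambda>m. u m - mat_app (I i) (J i) u m)) \<le>
       C * \<delta> * nrm (I i) (mat_app (I i) (B i) (mat_app (I i) (B i) u))"
    and H: "\<And>i m k. m \<in> H i \<Longrightarrow> J i m k = 0"
    and z: "\<And>l i. nrm (grid I) (lift I l (B l) (lift I i (B i) z)) \<le> R"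
  shows "\<exists>g. (\<forall>l. nrm (grid I) (lift I l (B l) (\<lambda>n. z n - g n)) \<le> real CARD('d) * C ^ CARD('d) * \<delta> * R)
     \<and> (\<forall>n. (\<exists>i. n i \<in> H i) \<longrightarrow> g n = 0)"
proof -
  have K: "finite (grid I)" using fin by (rule finite_grid)
  \<comment> \<open>In the same direction this is \<open>j4\<close>; in a different one B l commutes
    past J i and \<open>j3\<close> applies. Either way the bound is a second order quantity B l B i
    z, which is why mixed terms are included in \<open>z\<close>.\<close>
  have one: "nrm (grid I) (lift I l (B l) (\<lambda>n. z n - lift I i (J i) z n)) \<le> C * \<delta> * R" for l i
  proof (cases "l = i")
    case True
    have "nrm (grid I) (lift I i (B i) (\<lambda>n. z n - lift I i (J i) z n)) \<le> (C * \<delta>) * nrm (grid I) (lift I i (B i) (lift I i (B i) z))"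
    proof (rule nrm_lift_le[where i = i and I = I, OF fin])
      fix n
      show "nrm (I i) (\<lambda>m. lift I i (B i) (\<lambda>n. z n - lift I i (J i) z n) (n(i := m)))
        \<le> C * \<delta> * nrm (I i) (\<lambda>m. lift I i (B i) (lift I i (B i) z) (n(i := m)))"
        unfolding lift_slice using j4[of i "\<lambda>m. z (n(i := m))"] by simp
    qed (use C \<delta> in simp)
    also have "\<dots> \<le> C * \<delta> * R" using z[of i i] C \<delta> by (intro mult_left_mono) auto
    finally show ?thesis unfolding True .
  next
    case False
    have "lift I l (B l) (\<lambda>n. z n - lift I i (J i) z n) = (\<lambda>n. lift I l (B l) z n - lift I i (J i) (lift I l (B l) z) n)"
      by (rule ext) (simp only: lift_diff lift_commute[OF False])
    then have "nrm (grid I) (lift I l (B l) (\<lambda>n. z n - lift I i (J i) z n))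
      = nrm (grid I) (\<lambda>n. lift I l (B l) z n - lift I i (J i) (lift I l (B l) z) n)" by simp
    also have "\<dots> \<le> (C * \<delta>) * nrm (grid I) (lift I i (B i) (lift I l (B l) z))"
    proof (rule nrm_lift_le[where i = i and I = I, OF fin])
      fix n
      show "nrm (I i) (\<lambda>m. lift I l (B l) z (n(i := m)) - lift I i (J i) (lift I l (B l) z) (n(i := m)))
        \<le> C * \<delta> * nrm (I i) (\<lambda>m. lift I i (B i) (lift I l (B l) z) (n(i := m)))"
        unfolding lift_slice[of I i] by (rule j3)
    qed (use C \<delta> in simp)
    also have "\<dots> \<le> C * \<delta> * R" using z[of i l] C \<delta> by (intro mult_left_mono) auto
    finally show ?thesis .
  qed
  have stable: "nrm (grid I) (lift I l (B l) (lift I i (J i) y)) \<le> C * nrm (grid I) (lift I l (B l) y)" for l i y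
  proof (cases "l = i")
    case True
    show ?thesis unfolding True
    proof (rule nrm_lift_le[where i = i and I = I, OF fin])
      fix n
      show "nrm (I i) (\<lambda>m. lift I i (B i) (lift I i (J i) y) (n(i := m)))
        \<le> C * nrm (I i) (\<lambda>m. lift I i (B i) y (n(i := m)))"
        unfolding lift_slice by (rule j2)
    qed (use C in simp)
  next
    case False
    have "nrm (grid I) (lift I i (J i) (lift I l (B l) y)) \<le> C * nrm (grid I) (lift I l (B l) y)"
    proof (rule nrm_lift_le[where i = i and I = I, OF fin])
      fix n
      show "nrm (I i) (\<lambda>m. lift I i (J i) (lift I l (B l) y) (n(i := m)))
        \<le> C * nrm (I i) (\<lambda>m. lift I l (B l) y (n(i := m)))"
        unfolding lift_slice[of I i] by (rule j1)
    qed (use C in simp)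
    moreover have "lift I l (B l) (lift I i (J i) y) = lift I i (J i) (lift I l (B l) y)"
      by (rule ext) (rule lift_commute[OF False])
    ultimately show ?thesis by simp
  qed
  \<comment> \<open>One approximation operator per listed direction. The error telescopes by z - J G
    = (z - J z) + J (z - G), and each later operator costs only its stability constant C.\<close>
  define G where "G ds = foldr (\<lambda>i. lift I i (J i)) ds z" for ds
  have main: "nrm (grid I) (lift I l (B l) (\<lambda>n. z n - G ds n)) \<le> real (length ds) * C ^ length ds * \<delta> * R" for l ds
  proof (induction ds)
    case Nil
    have "lift I l (B l) (\<lambda>n. z n - G [] n) = (\<lambda>n. 0)" unfolding G_def lift_def by auto
    then show ?case by (simp add: nrm_def inner_on_def)
  next
    case (Cons i ds)
    let ?e = "\<lambda>n. z n - G ds n"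
    have "lift I l (B l) (\<lambda>n. z n - G (i # ds) n)
      = (\<lambda>n. lift I l (B l) (\<lambda>n. z n - lift I i (J i) z n) n + lift I l (B l) (lift I i (J i) ?e) n)"
    proof
      fix n
      have "(\<lambda>n. z n - G (i # ds) n) = (\<lambda>n. (z n - lift I i (J i) z n) + lift I i (J i) ?e n)"
        by (rule ext) (simp add: G_def lift_diff)
      then show "lift I l (B l) (\<lambda>n. z n - G (i # ds) n) n
        = lift I l (B l) (\<lambda>n. z n - lift I i (J i) z n) n + lift I l (B l) (lift I i (J i) ?e) n"
        by (simp only: lift_add)
    qed
    then have "nrm (grid I) (lift I l (B l) (\<lambda>n. z n - G (i # ds) n))
      \<le> nrm (grid I) (lift I l (B l) (\<lambda>n. z n - lift I i (J i) z n)) + nrm (grid I) (lift I l (B l) (lift I i (J i) ?e))"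
      by (simp only: nrm_add)
    also have "\<dots> \<le> C * \<delta> * R + C * nrm (grid I) (lift I l (B l) ?e)" using one[of l i] stable[of l i ?e] by simp
    also have "\<dots> \<le> C * \<delta> * R + C * (real (length ds) * C ^ length ds * \<delta> * R)"
      using Cons C by (intro add_left_mono mult_left_mono) auto
    also have "\<dots> \<le> C * C ^ length ds * \<delta> * R + C * (real (length ds) * C ^ length ds * \<delta> * R)"
    proof -
      have "C * 1 \<le> C * C ^ length ds" using C by (intro mult_left_mono one_le_power) auto
      then have "C * (\<delta> * R) \<le> C * C ^ length ds * (\<delta> * R)" using \<delta> R by (intro mult_right_mono) auto
      then show ?thesis by (simp add: mult.assoc)
    qed
    also have "\<dots> = real (length (i # ds)) * C ^ length (i # ds) * \<delta> * R" by (simp add: algebra_simps)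
    finally show ?case .
  qed
  have zero: "\<forall>n. (\<exists>i\<in>set ds. n i \<in> H i) \<longrightarrow> G ds n = 0" for ds
  proof (induction ds)
    case (Cons i ds)
    show ?case
    proof (intro allI impI)
      fix n assume "\<exists>j\<in>set (i # ds). n j \<in> H j"
      then consider "n i \<in> H i" | j where "j \<in> set ds" "n j \<in> H j" "j \<noteq> i" by auto
      then show "G (i # ds) n = 0"
      proof cases
        case 1
        then show ?thesis by (simp add: G_def lift_def H)
      next
        case 2
        then have "\<exists>j\<in>set ds. (n(i := m)) j \<in> H j" for m by auto
        then have "G ds (n(i := m)) = 0" for m using Cons by blast
        then show ?thesis by (simp add: G_def lift_def)
      qed
    qed
  qed (simp add: G_def)
  obtain ds where ds: "set ds = (UNIV :: 'd set)" "length ds = CARD('d)"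
    using finite_distinct_list[of "UNIV :: 'd set"] distinct_card by fastforce
  show ?thesis
    by (rule exI[of _ "G ds"]) (use main[of _ ds] zero[of ds] ds in auto)
qed

text \<open>The discrete counterpart of bounding all second derivatives by the Laplacian on a box.
  The B in different directions commute and are symmetric, so each cross term of the squared sum
  equals |B_j B_k z|^2 and cannot cancel another one.\<close>

lemma mixed_regularity:
  fixes I :: "'d::finite \<Rightarrow> 'a set" and B :: "'d \<Rightarrow> 'a \<Rightarrow> 'a \<Rightarrow> real"
  assumes sym: "\<And>i x y. x \<in> I i \<Longrightarrow> y \<in> I i \<Longrightarrow> B i x y = B i y x"
  shows "nrm (grid I) (lift I l (B l) (lift I i (B i) z))
     \<le> nrm (grid I) (\<lambda>n. \<Sum>j\<in>UNIV. lift I j (B j) (lift I j (B j) z) n)"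
proof -
  let ?L = "\<lambda>j. lift I j (B j)"
  have mix: "inner_on (grid I) (?L j (?L j z)) (?L k (?L k z)) = (nrm (grid I) (?L j (?L k z)))\<^sup>2" for j k
  proof -
    have c: "?L j (?L k f) = ?L k (?L j f)" for f
    proof (cases "j = k")
      case False
      show ?thesis by (rule ext) (rule lift_commute[OF False])
    qed simp
    have "inner_on (grid I) (?L j (?L j z)) (?L k (?L k z)) = inner_on (grid I) (?L j z) (?L j (?L k (?L k z)))"
      by (rule lift_symmetric[OF sym, symmetric])
    also have "\<dots> = inner_on (grid I) (?L j z) (?L k (?L j (?L k z)))" by (simp only: c)
    also have "\<dots> = inner_on (grid I) (?L k (?L j z)) (?L j (?L k z))" by (rule lift_symmetric[OF sym])
    also have "?L k (?L j z) = ?L j (?L k z)" by (rule c[symmetric])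
    finally show ?thesis unfolding nrm_sq .
  qed
  have "(nrm (grid I) (?L l (?L i z)))\<^sup>2 \<le> (\<Sum>k\<in>UNIV. (nrm (grid I) (?L l (?L k z)))\<^sup>2)"
    using member_le_sum[of i UNIV "\<lambda>k. (nrm (grid I) (?L l (?L k z)))\<^sup>2"] by simp
  also have "\<dots> \<le> (\<Sum>j\<in>UNIV. \<Sum>k\<in>UNIV. (nrm (grid I) (?L j (?L k z)))\<^sup>2)"
    using member_le_sum[of l UNIV "\<lambda>j. \<Sum>k\<in>UNIV. (nrm (grid I) (?L j (?L k z)))\<^sup>2"] by (simp add: sum_nonneg)
  also have "\<dots> = (nrm (grid I) (\<lambda>n. \<Sum>j\<in>UNIV. ?L j (?L j z) n))\<^sup>2"
    unfolding nrm_sq[of _ "\<lambda>n. \<Sum>j\<in>UNIV. ?L j (?L j z) n"] inner_on_sum mix ..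
  finally show ?thesis by (rule power2_le_imp_le) (simp add: nrm_nonneg)
qed

section \<open>Solvability and duality on the tensor grid\<close>

lemma positive_definite_solve:
  fixes a :: "'a \<Rightarrow> 'a \<Rightarrow> real"
  assumes fin: "finite I" and sym: "\<And>i j. i \<in> I \<Longrightarrow> j \<in> I \<Longrightarrow> a i j = a j i" and c: "c > 0"
    and pd: "\<And>u. c * inner_on I u u \<le> inner_on I u (mat_app I a u)"
  shows "\<exists>z. \<forall>i\<in>I. mat_app I a z i = w i"
proof -
  obtain \<phi> \<mu> where
    on: "\<And>s t. s < card I \<Longrightarrow> t < card I \<Longrightarrow> inner_on I (\<phi> s) (\<phi> t) = (if s = t then 1 else 0)"
    and ev: "\<And>s i. s < card I \<Longrightarrow> i \<in> I \<Longrightarrow> mat_app I a (\<phi> s) i = \<mu> s * \<phi> s i"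
    and complete: "\<And>u i. i \<in> I \<Longrightarrow> u i = (\<Sum>s<card I. inner_on I (\<phi> s) u * \<phi> s i)"
    using spectral_theorem_symmetric[of I a, OF fin sym] by blast
  have \<mu>: "\<mu> s > 0" if "s < card I" for s
  proof -
    have "c \<le> inner_on I (\<phi> s) (mat_app I a (\<phi> s))" using pd[of "\<phi> s"] on[OF that that] by simp
    also have "\<dots> = inner_on I (\<phi> s) (\<lambda>i. \<mu> s * \<phi> s i)" by (rule inner_on_cong) (auto simp: ev that)
    finally show ?thesis using on[OF that that] c by (simp add: inner_on_scale)
  qed
  define z where "z i = (\<Sum>s<card I. inner_on I (\<phi> s) w / \<mu> s * \<phi> s i)" for i
  have "mat_app I a z i = w i" if i: "i \<in> I" for i
  proof -
    have "mat_app I a z i = (\<Sum>s<card I. inner_on I (\<phi> s) w / \<mu> s * mat_app I a (\<phi> s) i)"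
      unfolding mat_app_def z_def sum_distrib_left by (subst sum.swap) (simp add: ac_simps)
    also have "\<dots> = (\<Sum>s<card I. inner_on I (\<phi> s) w * \<phi> s i)"
    proof (rule sum.cong[OF refl])
      fix s assume "s \<in> {..<card I}"
      then show "inner_on I (\<phi> s) w / \<mu> s * mat_app I a (\<phi> s) i = inner_on I (\<phi> s) w * \<phi> s i"
        using ev[of s i] i \<mu>[of s] by simp
    qed
    also have "\<dots> = w i" by (rule complete[OF i, symmetric])
    finally show ?thesis .
  qed
  then show ?thesis by blast
qed

text \<open>Formulated for the three numbers only, so that it applies alike to the tensor form and
  to sums of integrals of polynomials. If \<open>yy\<close> vanishes, a large t shows that
  \<open>xy\<close> is not positive.\<close>

lemma psd_Cauchy_Schwarz:
  fixes q :: "'v \<Rightarrow> 'v \<Rightarrow> real"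
  assumes qq: "\<And>t. 0 \<le> xx - 2 * t * xy + t\<^sup>2 * yy" and yy: "0 \<le> (yy :: real)" and xx: "0 \<le> xx"
  shows "xy \<le> sqrt xx * sqrt yy"
proof (cases "yy = 0")
  case True
  have "xy \<le> 0"
  proof (rule ccontr)
    assume "\<not> xy \<le> 0"
    then have "xx - 2 * ((xx + 1) / xy) * xy < 0" using xx by simp
    then show False using qq[of "(xx + 1) / xy"] True by simp
  qed
  then show ?thesis using True by simp
next
  case False
  then have p: "yy > 0" using yy by simp
  have "0 \<le> xx - 2 * (xy / yy) * xy + (xy / yy)\<^sup>2 * yy" by (rule qq)
  also have "\<dots> = xx - xy\<^sup>2 / yy" using p by (simp add: power2_eq_square field_simps)
  finally have "xy\<^sup>2 \<le> xx * yy" using p by (simp add: pos_divide_le_eq)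
  then have "sqrt (xy\<^sup>2) \<le> sqrt (xx * yy)" by (rule real_sqrt_le_mono)
  then show ?thesis by (simp add: real_sqrt_mult)
qed

text \<open>The duality argument: the discrete solution \<open>z\<close> of the problem with right-hand side \<open>w\<close> is regular,
  hence well approximated by the coarse space, to which \<open>w\<close> is orthogonal.\<close>

lemma tensor_duality:
  fixes I :: "'d::finite \<Rightarrow> 'a set" and S0 B J :: "'d \<Rightarrow> 'a \<Rightarrow> 'a \<Rightarrow> real" and w :: "('d \<Rightarrow> 'a) \<Rightarrow> real"
  defines "a \<equiv> \<lambda>f g. inner_on (grid I) f (\<lambda>n. \<Sum>l\<in>UNIV. lift I l (S0 l) g n)"
  assumes fin: "\<And>i. finite (I i)" and C: "C \<ge> 1" and \<delta>: "\<delta> \<ge> 0" and C0: "C0 \<ge> 0" and cP: "cP > 0"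
    and symS: "\<And>i x y. x \<in> I i \<Longrightarrow> y \<in> I i \<Longrightarrow> S0 i x y = S0 i y x"
    and symB: "\<And>i x y. x \<in> I i \<Longrightarrow> y \<in> I i \<Longrightarrow> B i x y = B i y x"
    and BB: "\<And>i u m. m \<in> I i \<Longrightarrow> mat_app (I i) (B i) (mat_app (I i) (B i) u) m = mat_app (I i) (S0 i) u m + C0 * u m"
    and j1: "\<And>i u. nrm (I i) (mat_app (I i) (J i) u) \<le> C * nrm (I i) u"
    and j2: "\<And>i u. nrm (I i) (mat_app (I i) (B i) (mat_app (I i) (J i) u)) \<le> C * nrm (I i) (mat_app (I i) (B i) u)"
    and j3: "\<And>i u. nrm (I i) (\<lambda>m. u m - mat_app (I i) (J i) u m) \<le> C * \<delta> * nrm (I i) (mat_app (I i) (B i) u)"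
    and j4: "\<And>i u. nrm (I i) (mat_app (I i) (B i) (\<lambda>m. u m - mat_app (I i) (J i) u m)) \<le>
       C * \<delta> * nrm (I i) (mat_app (I i) (B i) (mat_app (I i) (B i) u))"
    and H: "\<And>i m k. m \<in> H i \<Longrightarrow> J i m k = 0"
    and pd: "\<And>f. cP * inner_on (grid I) f f \<le> a f f"
    and w: "\<And>g. (\<forall>n. (\<exists>i. n i \<in> H i) \<longrightarrow> g n = 0) \<Longrightarrow> a w g = 0"
  shows "nrm (grid I) w \<le> (real CARD('d))\<^sup>2 * C ^ CARD('d) * (1 + real CARD('d) * C0 / cP) * \<delta> * sqrt (a w w)"
proof -
  let ?K = "grid I" and ?d = "real CARD('d)"
  have K: "finite ?K" using fin by (rule finite_grid)
  define A where "A g n = (\<Sum>l\<in>UNIV. lift I l (S0 l) g n)" for g n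
  have a: "a f g = inner_on ?K f (A g)" for f g unfolding a_def A_def ..
  have a_sum: "a f g = (\<Sum>l\<in>UNIV. inner_on ?K f (lift I l (S0 l) g))" for f g
    unfolding a_def inner_on_sum ..
  have symA: "a f g = a g f" for f g
    unfolding a_sum 
    by (rule sum.cong[OF refl], subst lift_symmetric[OF symS]) (simp_all add: inner_on_commute)
  obtain z where z: "\<And>n. n \<in> ?K \<Longrightarrow> A z n = w n"
  proof -
    \<comment> \<open>The sum of lifts as one matrix on the grid: entry (n, n') receives a
      contribution from direction l only if n and n' agree in all other directions. This form is
      required to solve for z.\<close>
    define M where "M n n' = (\<Sum>l\<in>UNIV. if \<forall>j. j \<noteq> l \<longrightarrow> n' j = n j then S0 l (n l) (n' l) else 0)" for n n' :: "'d \<Rightarrow> 'a"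
    have M: "mat_app ?K M f n = A f n" if n: "n \<in> ?K" for f n
    proof -
      have "mat_app ?K M f n = (\<Sum>l\<in>UNIV. \<Sum>n'\<in>?K. if \<forall>j. j \<noteq> l \<longrightarrow> n' j = n j then S0 l (n l) (n' l) * f n' else 0)"
        unfolding mat_app_def M_def sum_distrib_right by (subst sum.swap) (intro sum.cong refl, auto)
      also have "\<dots> = A f n" unfolding A_def
      proof (rule sum.cong[OF refl])
        fix l :: 'd
        have "(\<Sum>n'\<in>?K. if \<forall>j. j \<noteq> l \<longrightarrow> n' j = n j then S0 l (n l) (n' l) * f n' else 0)
          = (\<Sum>n'\<in>{n'\<in>?K. \<forall>j. j \<noteq> l \<longrightarrow> n' j = n j}. S0 l (n l) (n' l) * f n')"
          using K by (simp add: sum.If_cases Int_def)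
        also have "\<dots> = lift I l (S0 l) f n" unfolding lift_def
          by (rule sum.reindex_bij_witness[of _ "\<lambda>m. n(l := m)" "\<lambda>n'. n' l"])
            (use n in \<open>auto simp: grid_def fun_eq_iff intro!: arg_cong[where f = f]\<close>)
        finally show "(\<Sum>n'\<in>?K. if \<forall>j. j \<noteq> l \<longrightarrow> n' j = n j then S0 l (n l) (n' l) * f n' else 0) = lift I l (S0 l) f n" .
      qed
      finally show ?thesis .
    qed
    have "\<exists>z. \<forall>n\<in>?K. mat_app ?K M z n = w n"
    proof (rule positive_definite_solve[OF K _ cP])
      fix n n' assume "n \<in> ?K" "n' \<in> ?K"
      then show "M n n' = M n' n" unfolding M_def
        by (intro sum.cong refl) (auto simp: grid_def symS)
    next
      fix f
      have "a f f = inner_on ?K f (mat_app ?K M f)" unfolding a by (rule inner_on_cong) (auto simp: M)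
      then show "cP * inner_on ?K f f \<le> inner_on ?K f (mat_app ?K M f)" using pd[of f] by simp
    qed
    then obtain z where "\<And>n. n \<in> ?K \<Longrightarrow> mat_app ?K M z n = w n" by blast
    then show ?thesis using M by (intro that[of z]) auto
  qed
  have aw: "a f z = inner_on ?K f w" for f unfolding a by (rule inner_on_cong) (auto simp: z)
  have z_le: "cP * nrm ?K z \<le> nrm ?K w"
  proof -
    have "cP * (nrm ?K z)\<^sup>2 \<le> a z z" unfolding nrm_sq by (rule pd)
    also have "\<dots> \<le> nrm ?K z * nrm ?K w" unfolding aw by (rule inner_on_le_nrm)
    finally have "nrm ?K z * (cP * nrm ?K z) \<le> nrm ?K z * nrm ?K w" by (simp add: power2_eq_square ac_simps)
    then show ?thesis using nrm_nonneg[of ?K z] nrm_nonneg[of ?K w] by (cases "nrm ?K z = 0") auto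
  qed
  define R where "R = nrm ?K (\<lambda>n. \<Sum>j\<in>UNIV. lift I j (B j) (lift I j (B j) z) n)"
  have BBl: "lift I j (B j) (lift I j (B j) f) n = lift I j (S0 j) f n + C0 * f n" if "n \<in> ?K" for j f n
    unfolding lift_slice_mat_app[of I j "B j" "lift I j (B j) f"] lift_slice
    unfolding lift_slice_mat_app using BB[of "n j" j "\<lambda>m. f (n(j := m))"] that by (simp add: grid_def)
  \<comment> \<open>Discrete elliptic regularity: since B^2 = S0 + C0 in each direction, the sum of
    all B^2 z is w + d C0 z, and z is bounded by w through positive definiteness.\<close>
  have R: "R \<le> (1 + ?d * C0 / cP) * nrm ?K w"
  proof -
    have "R = nrm ?K (\<lambda>n. w n + ?d * C0 * z n)" unfolding R_def
    proof (rule nrm_cong)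
      fix n assume n: "n \<in> ?K"
      show "(\<Sum>j\<in>UNIV. lift I j (B j) (lift I j (B j) z) n) = w n + ?d * C0 * z n"
        using z[OF n] unfolding A_def by (simp add: BBl[OF n] sum.distrib)
    qed
    also have "\<dots> \<le> nrm ?K w + ?d * C0 * nrm ?K z"
      using nrm_add[of ?K w "\<lambda>n. ?d * C0 * z n"] C0 by (simp add: nrm_scale)
    also have "\<dots> \<le> nrm ?K w + ?d * C0 * (nrm ?K w / cP)"
      using z_le cP C0 by (intro add_left_mono mult_left_mono) (auto simp: pos_le_divide_eq mult.commute)
    finally show ?thesis by (simp add: algebra_simps)
  qed
  obtain g where g1: "\<And>l. nrm ?K (lift I l (B l) (\<lambda>n. z n - g n)) \<le> ?d * C ^ CARD('d) * \<delta> * R"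
    and g2: "\<forall>n. (\<exists>i. n i \<in> H i) \<longrightarrow> g n = 0"
  proof -
    have "\<exists>g. (\<forall>l. nrm ?K (lift I l (B l) (\<lambda>n. z n - g n)) \<le> ?d * C ^ CARD('d) * \<delta> * R)
       \<and> (\<forall>n. (\<exists>i. n i \<in> H i) \<longrightarrow> g n = 0)"
      by (rule tensor_approximation[OF fin C \<delta> _ j1 j2 j3 j4 H])
        (use mixed_regularity[where I = I and B = B and z = z, OF symB] nrm_nonneg in \<open>auto simp: R_def\<close>)
    then show ?thesis using that by blast
  qed
  define e where "e n = z n - g n" for n
  define r where "r = ?d * C ^ CARD('d) * \<delta> * R"
  have r0: "0 \<le> r" using g1 nrm_nonneg unfolding r_def by (meson order_trans)
  have A_diff: "A (\<lambda>n. f n - h n) n = A f n - A h n" for f h n unfolding A_def by (simp add: lift_diff sum_subtractf)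
  have ae: "a e e \<le> (?d * r)\<^sup>2"
  proof -
    have "inner_on ?K e (lift I l (S0 l) e) \<le> r\<^sup>2" for l
    proof -
      have "(nrm ?K (lift I l (B l) e))\<^sup>2 = inner_on ?K e (lift I l (B l) (lift I l (B l) e))"
        unfolding nrm_sq by (rule lift_symmetric[OF symB, symmetric])
      also have "\<dots> = inner_on ?K e (\<lambda>n. lift I l (S0 l) e n + C0 * e n)"
        by (rule inner_on_cong) (auto simp: BBl)
      also have "\<dots> = inner_on ?K e (lift I l (S0 l) e) + C0 * inner_on ?K e e" by (simp add: inner_on_add inner_on_scale)
      finally have "inner_on ?K e (lift I l (S0 l) e) \<le> (nrm ?K (lift I l (B l) e))\<^sup>2" using C0 inner_on_nonneg[of ?K e] by simp
      also have "\<dots> \<le> r\<^sup>2" using g1[of l] unfolding e_def r_def by (intro power_mono nrm_nonneg) simp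
      finally show ?thesis .
    qed
    then have "a e e \<le> (\<Sum>l\<in>(UNIV :: 'd set). r\<^sup>2)" unfolding a_sum by (intro sum_mono)
    also have "\<dots> = ?d * r\<^sup>2" by simp
    also have "\<dots> \<le> ?d\<^sup>2 * r\<^sup>2"
    proof (rule mult_right_mono)
      have "1 \<le> ?d" by (simp add: Suc_le_eq)
      then show "?d \<le> ?d\<^sup>2" by (simp add: power2_eq_square)
    qed simp
    finally show ?thesis by (simp add: power_mult_distrib)
  qed
  have a0: "0 \<le> a f f" for f using pd[of f] cP inner_on_nonneg[of ?K f] by (meson mult_nonneg_nonneg less_imp_le order_trans)
  have "(nrm ?K w)\<^sup>2 = a w z" unfolding nrm_sq aw ..
  \<comment> \<open>The orthogonality of w to the coarse space is used here: g vanishes at all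
    removed indices, so z may be replaced by its approximation error.\<close>
  also have "\<dots> = a w e"
  proof -
    have "a w e = a w z - a w g" unfolding a e_def A_diff[abs_def] inner_on_diff ..
    then show ?thesis using w[OF g2] by simp
  qed
  also have "\<dots> \<le> sqrt (a w w) * sqrt (a e e)"
  proof (rule psd_Cauchy_Schwarz[OF _ a0 a0])
    fix t :: real
    have scale: "A (\<lambda>n. t * f n) n = t * A f n" for f n
      unfolding A_def lift_def by (simp add: sum_distrib_left ac_simps)
    have "0 \<le> a (\<lambda>n. w n - t * e n) (\<lambda>n. w n - t * e n)" by (rule a0)
    also have "\<dots> = a w w - t * a w e - t * a e w + t * (t * a e e)"
      unfolding a A_diff[abs_def] scale inner_on_diff inner_on_scale by (simp add: algebra_simps)
    finally show "0 \<le> a w w - 2 * t * a w e + t\<^sup>2 * a e e" using symA[of e w] by (simp add: power2_eq_square)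
  qed
  also have "\<dots> \<le> sqrt (a w w) * (?d * r)"
  proof (rule mult_left_mono)
    have "sqrt (a e e) \<le> sqrt ((?d * r)\<^sup>2)" using ae by (rule real_sqrt_le_mono)
    then show "sqrt (a e e) \<le> ?d * r" using r0 by simp
  qed (simp add: a0)
  also have "\<dots> \<le> sqrt (a w w) * (?d * (?d * C ^ CARD('d) * \<delta> * ((1 + ?d * C0 / cP) * nrm ?K w)))"
    unfolding r_def using R C \<delta> a0 by (intro mult_left_mono) auto
  finally have "nrm ?K w * nrm ?K w \<le> nrm ?K w * (?d\<^sup>2 * C ^ CARD('d) * (1 + ?d * C0 / cP) * \<delta> * sqrt (a w w))"
    by (simp add: power2_eq_square ac_simps)
  moreover have "0 \<le> ?d\<^sup>2 * C ^ CARD('d) * (1 + ?d * C0 / cP) * \<delta> * sqrt (a w w)"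
    using C C0 cP \<delta> a0 by simp
  ultimately show ?thesis using nrm_nonneg[of ?K w] mult_left_le_imp_le[of "nrm ?K w" "nrm ?K w"]
    by (cases "nrm ?K w = 0") auto
qed

section \<open>Integration of polynomials over [-1, 1]\<close>

lemma real_poly_eqI: "(\<And>x. poly p x = poly q x) \<Longrightarrow> p = (q :: real poly)"
  using poly_eq_poly_eq_iff[of p q] by (simp add: fun_eq_iff)

text \<open>An algebraic antiderivative. The analysis on a line is done with it, by polynomial
  identities; Lebesgue integration enters only when products of such polynomials are integrated over
  cells and faces.\<close>

definition anti :: "real poly \<Rightarrow> real poly" where
  "anti p = (\<Sum>i\<le>Polynomial.degree p. Polynomial.monom (Polynomial.coeff p i / real (Suc i)) (Suc i))"

definition pint :: "real poly \<Rightarrow> real" where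
  "pint p = poly (anti p) 1 - poly (anti p) (-1)"

lemma pderiv_anti: "pderiv (anti p) = p"
proof -
  have "pderiv (anti p) = (\<Sum>i\<le>Polynomial.degree p. Polynomial.monom (Polynomial.coeff p i) i)"
    unfolding anti_def higher_pderiv_sum[of 1, simplified] by (auto simp: pderiv_monom intro!: sum.cong)
  then show ?thesis by (simp add: poly_as_sum_of_monoms)
qed

lemma poly_diff_of_pderiv_eq:
  fixes p q :: "real poly"
  assumes "pderiv p = pderiv q" shows "poly p x - poly p y = poly q x - poly q y"
proof -
  have "Polynomial.degree (p - q) = 0" using assms by (simp add: pderiv_eq_0_iff[symmetric] pderiv_diff)
  then obtain c where "p - q = [:c:]" by (rule degree_eq_zeroE)
  then have "poly (p - q) x = poly (p - q) y" by simp
  then show ?thesis by simp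
qed

lemma pint_pderiv: "pint (pderiv q) = poly q 1 - poly q (-1)"
  unfolding pint_def by (rule poly_diff_of_pderiv_eq) (simp add: pderiv_anti)

lemma pint_add: "pint (p + q) = pint p + pint q"
proof -
  have "pint (pderiv (anti p + anti q)) = pint p + pint q" unfolding pint_pderiv by (simp add: pint_def)
  then show ?thesis by (simp add: pderiv_add pderiv_anti)
qed

lemma pint_smult: "pint (Polynomial.smult c p) = c * pint p"
proof -
  have "pint (pderiv (Polynomial.smult c (anti p))) = c * pint p" unfolding pint_pderiv by (simp add: pint_def algebra_simps)
  then show ?thesis by (simp add: pderiv_smult pderiv_anti)
qed

lemma pint_diff: "pint (p - q) = pint p - pint q"
  using pint_add[of p "Polynomial.smult (-1) q"] by (simp add: pint_smult[of "-1", simplified])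

lemma pint_0 [simp]: "pint 0 = 0"
  using pint_smult[of 0 0] by simp

lemma pint_sum: "pint (\<Sum>i\<in>A. f i) = (\<Sum>i\<in>A. pint (f i))"
  by (induction A rule: infinite_finite_induct) (auto simp: pint_add)

lemma pint_nonneg:
  assumes "\<And>x. -1 \<le> x \<Longrightarrow> x \<le> 1 \<Longrightarrow> 0 \<le> poly p x" shows "0 \<le> pint p"
proof -
  have "poly (anti p) (-1) \<le> poly (anti p) 1"
    by (rule DERIV_nonneg_imp_nondecreasing)
      (use assms poly_DERIV[of "anti p"] in \<open>auto simp: pderiv_anti\<close>)
  then show ?thesis unfolding pint_def by simp
qed

lemma pint_sq_nonneg: "0 \<le> pint (p * p)"
  by (rule pint_nonneg) simp

lemma pint_by_parts: "pint (pderiv p * q) = poly p 1 * poly q 1 - poly p (-1) * poly q (-1) - pint (p * pderiv q)"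
proof -
  have "pint (pderiv (p * q)) = pint (p * pderiv q) + pint (pderiv p * q)"
    by (simp add: pderiv_mult pint_add mult.commute add.commute)
  then show ?thesis by (simp add: pint_pderiv)
qed

lemma sum_pint_Cauchy_Schwarz:
  "(\<Sum>t\<in>A. pint (f t * g t)) \<le> sqrt (\<Sum>t\<in>A. pint (f t * f t)) * sqrt (\<Sum>t\<in>A. pint (g t * g t))"
proof (rule psd_Cauchy_Schwarz)
  fix c :: real
  have "0 \<le> (\<Sum>t\<in>A. pint ((f t - Polynomial.smult c (g t)) * (f t - Polynomial.smult c (g t))))"
    by (intro sum_nonneg pint_sq_nonneg)
  also have "\<dots> = (\<Sum>t\<in>A. pint (f t * f t) - 2 * c * pint (f t * g t) + c\<^sup>2 * pint (g t * g t))"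
  proof (rule sum.cong[OF refl])
    fix t
    have "(f t - Polynomial.smult c (g t)) * (f t - Polynomial.smult c (g t))
      = f t * f t - Polynomial.smult (2 * c) (f t * g t) + Polynomial.smult (c\<^sup>2) (g t * g t)"
      by (rule real_poly_eqI) (simp add: algebra_simps power2_eq_square)
    then show "pint ((f t - Polynomial.smult c (g t)) * (f t - Polynomial.smult c (g t)))
      = pint (f t * f t) - 2 * c * pint (f t * g t) + c\<^sup>2 * pint (g t * g t)"
      by (simp add: pint_add pint_diff pint_smult)
  qed
  also have "\<dots> = (\<Sum>t\<in>A. pint (f t * f t)) - 2 * c * (\<Sum>t\<in>A. pint (f t * g t)) + c\<^sup>2 * (\<Sum>t\<in>A. pint (g t * g t))"
    by (simp add: sum.distrib sum_subtractf sum_distrib_left)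
  finally show "0 \<le> \<dots>" .
qed (auto intro!: sum_nonneg pint_sq_nonneg)

lemma pint_Cauchy_Schwarz: "pint (f * g) \<le> sqrt (pint (f * f)) * sqrt (pint (g * g))"
  using sum_pint_Cauchy_Schwarz[of "\<lambda>_. f" "\<lambda>_. g" "{()}"] by simp

lemma pint_Cauchy_Schwarz_sq: "(pint (f * g))\<^sup>2 \<le> pint (f * f) * pint (g * g)"
proof -
  have "\<bar>pint (f * g)\<bar> \<le> sqrt (pint (f * f)) * sqrt (pint (g * g))"
    using pint_Cauchy_Schwarz[of f g] pint_Cauchy_Schwarz[of "- f" g] pint_smult[of "-1" "f * g"] by simp
  then have "\<bar>pint (f * g)\<bar>\<^sup>2 \<le> (sqrt (pint (f * f)) * sqrt (pint (g * g)))\<^sup>2" by (intro power_mono) auto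
  then show ?thesis by (simp add: power_mult_distrib pint_sq_nonneg)
qed

subsection \<open>Legendre polynomials\<close>

text \<open>At a root of p the product p^n q vanishes to order n, and the n-th derivative keeps only
  the term in which every factor p is differentiated once. For p = x^2 - 1 this yields the end
  values of the Legendre polynomials and kills the boundary terms below.\<close>

lemma higher_pderiv_power_root:
  fixes p q :: "real poly"
  assumes "poly p a = 0"
  shows "m \<le> n \<Longrightarrow> poly ((pderiv ^^ m) (p ^ n * q)) a = (if m = n then fact n * poly (pderiv p) a ^ n * poly q a else 0)"
proof (induction m arbitrary: n q)
  case 0
  then show ?case using assms by (auto simp: power_0_left)
next
  case (Suc m)
  then obtain n' where n: "n = Suc n'" "m \<le> n'" by (cases n) auto
  define r where "r = Polynomial.smult (real (Suc n')) (pderiv p * q) + p * pderiv q"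
  have "pderiv (p ^ n * q) = p ^ n' * r" unfolding n r_def pderiv_mult pderiv_power_Suc
    by (rule real_poly_eqI) (simp add: algebra_simps)
  then have "poly ((pderiv ^^ Suc m) (p ^ n * q)) a = poly ((pderiv ^^ m) (p ^ n' * r)) a"
    by (simp add: funpow_Suc_right del: funpow.simps)
  also have "\<dots> = (if m = n' then fact n' * poly (pderiv p) a ^ n' * poly r a else 0)" by (rule Suc.IH[OF n(2)])
  finally show ?case unfolding n r_def using assms by (simp add: algebra_simps)
qed

lemma legendre_0: "legendre 0 = 1"
  unfolding legendre_def by simp

lemma legendre_1: "legendre 1 = [:0, 1:]"
  unfolding legendre_def by (simp add: pderiv_pCons)

lemma legendre_Suc0: "legendre (Suc 0) = [:0, 1:]"
  using legendre_1 by simp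

lemma poly_legendre_1: "poly (legendre n) 1 = 1"
  using higher_pderiv_power_root[of "[:-1, 0, 1:]" 1 n n 1] unfolding legendre_def by (simp add: pderiv_pCons)

lemma poly_legendre_minus_1: "poly (legendre n) (-1) = (-1) ^ n"
  using higher_pderiv_power_root[of "[:-1, 0, 1:]" "-1" n n 1] unfolding legendre_def
  by (simp add: pderiv_pCons power_minus[of 2])

text \<open>Integration by parts m times; up to order n - 1 the derivatives of (x^2 - 1)^n vanish at
  both ends.\<close>

lemma pint_higher_pderiv_orthogonal:
  fixes q :: "real poly"
  shows "m \<le> n \<Longrightarrow> pint ((pderiv ^^ m) ([:-1, 0, 1:] ^ n) * q) = (-1) ^ m * pint ([:-1, 0, 1:] ^ n * (pderiv ^^ m) q)"
proof (induction m arbitrary: q)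
  case (Suc m)
  have z: "poly ((pderiv ^^ m) ([:-1, 0, 1:] ^ n)) a = 0" if "a = 1 \<or> a = -1" for a :: real
    using higher_pderiv_power_root[of "[:-1, 0, 1:]" a m n 1] that Suc.prems by auto
  have "pint ((pderiv ^^ Suc m) ([:-1, 0, 1:] ^ n) * q) = - pint ((pderiv ^^ m) ([:-1, 0, 1:] ^ n) * pderiv q)"
    using pint_by_parts[of "(pderiv ^^ m) ([:-1, 0, 1:] ^ n)" q] z by simp
  also have "\<dots> = - ((-1) ^ m * pint ([:-1, 0, 1:] ^ n * (pderiv ^^ m) (pderiv q)))" using Suc by simp
  finally show ?case by (simp add: funpow_Suc_right del: funpow.simps)
qed simp

lemma higher_pderiv_degree_0:
  fixes q :: "real poly"
  shows "Polynomial.degree q < n \<Longrightarrow> (pderiv ^^ n) q = 0"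
proof (induction n arbitrary: q)
  case (Suc n)
  show ?case
  proof (cases "Polynomial.degree q = 0")
    case True
    then have "pderiv q = 0" by (simp add: pderiv_eq_0_iff)
    then show ?thesis by (simp add: funpow_Suc_right higher_pderiv_0 del: funpow.simps)
  next
    case False
    then have "Polynomial.degree (pderiv q) < n" using Suc.prems by (simp add: degree_pderiv)
    then show ?thesis using Suc.IH by (simp add: funpow_Suc_right del: funpow.simps)
  qed
qed simp

lemma legendre_orthogonal:
  assumes "Polynomial.degree q < n" shows "pint (legendre n * q) = 0"
  unfolding legendre_def using pint_higher_pderiv_orthogonal[of n n q] higher_pderiv_degree_0[OF assms]
  by (simp add: pint_smult)

text \<open>Two of the n + 3 derivatives are carried out explicitly on (x^2 - 1)^(n + 2), and the
  factor x^2 that appears is written as (x^2 - 1) + 1. Norms, end slopes, degrees and the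
  antiderivatives of the Legendre polynomials all follow from this relation.\<close>

lemma pderiv_legendre:
  "pderiv (legendre (Suc (Suc n))) = Polynomial.smult (real (2 * n + 3)) (legendre (Suc n)) + pderiv (legendre n)"
proof -
  define x2 :: "real poly" where "x2 = [:-1, 0, 1:]"
  let ?N = "Suc (Suc n)"
  have d: "pderiv x2 = [:0, 2:]" unfolding x2_def by (simp add: pderiv_pCons)
  have xx: "[:0, 1:] * [:0, 1:] = x2 + 1" unfolding x2_def by (simp add: one_pCons)
  have d1: "pderiv (x2 ^ ?N) = Polynomial.smult (2 * real ?N) ([:0, 1:] * x2 ^ Suc n)"
    unfolding pderiv_power_Suc d by (simp add: algebra_simps)
  have d2: "pderiv ([:0, 1:] * x2 ^ Suc n) = Polynomial.smult (real (2 * n + 3)) (x2 ^ Suc n) + Polynomial.smult (real (2 * n + 2)) (x2 ^ n)"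
  proof -
    have "pderiv ([:0, 1:] * x2 ^ Suc n) = x2 ^ Suc n + Polynomial.smult (2 * real (Suc n)) (([:0, 1:] * [:0, 1:]) * x2 ^ n)"
      unfolding pderiv_mult pderiv_power_Suc d by (simp add: pderiv_pCons algebra_simps one_pCons)
    also have "\<dots> = x2 ^ Suc n + Polynomial.smult (2 * real (Suc n)) (x2 ^ Suc n + x2 ^ n)" unfolding xx by (simp add: algebra_simps)
    also have "\<dots> = Polynomial.smult (real (2 * n + 3)) (x2 ^ Suc n) + Polynomial.smult (real (2 * n + 2)) (x2 ^ n)"
      by (rule real_poly_eqI) (simp add: algebra_simps)
    finally show ?thesis .
  qed
  have "pderiv ((pderiv ^^ ?N) (x2 ^ ?N)) = (pderiv ^^ Suc n) (pderiv (pderiv (x2 ^ ?N)))"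
    by (simp add: funpow_swap1)
  also have "\<dots> = Polynomial.smult (2 * real ?N) (Polynomial.smult (real (2 * n + 3)) ((pderiv ^^ Suc n) (x2 ^ Suc n)) + Polynomial.smult (real (2 * n + 2)) (pderiv ((pderiv ^^ n) (x2 ^ n))))"
    unfolding d1 pderiv_smult d2 higher_pderiv_smult higher_pderiv_add by simp
  finally have e: "pderiv ((pderiv ^^ ?N) (x2 ^ ?N)) = \<dots>" .
  have c1: "1 / (2 ^ ?N * fact ?N) * (2 * real ?N * real (2 * n + 3)) = real (2 * n + 3) * (1 / (2 ^ Suc n * fact (Suc n)))"
    by (simp add: divide_simps) (simp add: algebra_simps)
  have c2: "1 / (2 ^ ?N * fact ?N) * (2 * real ?N * real (2 * n + 2)) = 1 / (2 ^ n * fact n)"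
    by (simp add: divide_simps) (simp add: algebra_simps)
  show ?thesis unfolding legendre_def x2_def[symmetric] pderiv_smult e
    using c1 c2 by (simp only: smult_add_right smult_smult mult.assoc[symmetric])
qed

lemma degree_legendre_le: "Polynomial.degree (legendre n) \<le> n"
proof (induction n rule: less_induct)
  case (less n)
  consider "n = 0" | "n = 1" | m where "n = Suc (Suc m)" by (metis One_nat_def not0_implies_Suc)
  then show ?case
  proof cases
    case 3
    have "Polynomial.degree (pderiv (legendre n)) \<le> Suc m"
      unfolding 3 pderiv_legendre
      using less[of "Suc m"] less[of m] 3 by (intro degree_add_le) (auto simp: degree_pderiv intro: order_trans[OF degree_smult_le])
    then show ?thesis unfolding degree_pderiv 3 by simp
  qed (auto simp: legendre_0 legendre_1 legendre_Suc0)
qed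

lemma legendre_orthogonal_neq: "m \<noteq> n \<Longrightarrow> pint (legendre n * legendre m) = 0"
proof -
  assume "m \<noteq> n"
  then consider "m < n" | "n < m" by linarith
  then show ?thesis
  proof cases
    case 1 then show ?thesis using legendre_orthogonal[of "legendre m" n] degree_legendre_le[of m] by simp
  next
    case 2 then show ?thesis using legendre_orthogonal[of "legendre n" m] degree_legendre_le[of n] by (simp add: mult.commute)
  qed
qed

text \<open>The relation above expresses 2 n + 1 times L_n through derivatives of its neighbours.
  Tested with L_n, the lower neighbour drops out by degree and the upper one leaves, after
  integration by parts, only the boundary value 2.\<close>

lemma legendre_norm: "pint (legendre n * legendre n) = 2 / (2 * real n + 1)"
proof (cases n)
  case 0
  have "pint (pderiv [:0, 1:]) = 2" unfolding pint_pderiv by simp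
  then show ?thesis using 0 by (simp add: legendre_0 pderiv_pCons one_pCons)
next
  case (Suc m)
  have "real (2 * m + 3) * pint (legendre n * legendre n) + pint (pderiv (legendre m) * legendre n) = pint (pderiv (legendre (Suc n)) * legendre n)"
    unfolding Suc pderiv_legendre by (simp add: distrib_right pint_add pint_smult)
  moreover have "pint (pderiv (legendre m) * legendre n) = 0"
    using legendre_orthogonal[of "pderiv (legendre m)" n] degree_legendre_le[of m] Suc by (simp add: degree_pderiv mult.commute)
  moreover have "pint (pderiv (legendre (Suc n)) * legendre n) = 2"
  proof -
    have "pint (legendre (Suc n) * pderiv (legendre n)) = 0"
      using legendre_orthogonal[of "pderiv (legendre n)" "Suc n"] degree_legendre_le[of n] by (simp add: degree_pderiv)
    then show ?thesis unfolding pint_by_parts poly_legendre_1 poly_legendre_minus_1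
      by (simp add: power_add[symmetric] mult_2[symmetric])
  qed
  ultimately show ?thesis using Suc by (simp add: field_simps)
qed

lemma poly_pderiv_legendre_1: "poly (pderiv (legendre n)) 1 = real n * (real n + 1) / 2"
proof (induction n rule: less_induct)
  case (less n)
  consider "n = 0" | "n = 1" | m where "n = Suc (Suc m)" by (metis One_nat_def not0_implies_Suc)
  then show ?case
  proof cases
    case 3
    then show ?thesis using less[of m] by (simp add: pderiv_legendre poly_legendre_1 field_simps)
  qed (auto simp: legendre_0 legendre_Suc0 pderiv_pCons)
qed

lemma poly_pderiv_legendre_minus_1: "poly (pderiv (legendre n)) (-1) = (-1) ^ Suc n * (real n * (real n + 1) / 2)"
proof (induction n rule: less_induct)
  case (less n)
  consider "n = 0" | "n = 1" | m where "n = Suc (Suc m)" by (metis One_nat_def not0_implies_Suc)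
  then show ?case
  proof cases
    case 3
    then show ?thesis using less[of m] by (simp add: pderiv_legendre poly_legendre_minus_1 field_simps)
  qed (auto simp: legendre_0 legendre_Suc0 pderiv_pCons)
qed

text \<open>After one integration by parts the second derivative has degree below n, so only the
  boundary terms remain. This is the exact gradient energy of a basis function.\<close>

lemma pint_pderiv_legendre_sq: "pint (pderiv (legendre n) * pderiv (legendre n)) = real n * (real n + 1)"
proof -
  have "pint (legendre n * pderiv (pderiv (legendre n))) = 0"
  proof (cases n)
    case 0
    then show ?thesis by (simp add: legendre_0)
  next
    case (Suc m)
    have "Polynomial.degree (pderiv (pderiv (legendre n))) < n" using degree_legendre_le[of n] Suc by (simp add: degree_pderiv)
    then show ?thesis by (rule legendre_orthogonal)
  qed
  then have e: "pint (pderiv (legendre n) * pderiv (legendre n)) = poly (legendre n) 1 * poly (pderiv (legendre n)) 1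
      - poly (legendre n) (-1) * poly (pderiv (legendre n)) (-1)"
    using pint_by_parts[of "legendre n" "pderiv (legendre n)"] by simp
  have m: "(-1) ^ n * ((-1) ^ Suc n * c) = - c" for c :: real by (cases "even n") auto
  show ?thesis
    unfolding e poly_legendre_1 poly_legendre_minus_1 poly_pderiv_legendre_1 poly_pderiv_legendre_minus_1 m by simp
qed

definition lcoef :: "real poly \<Rightarrow> nat \<Rightarrow> real" where
  "lcoef q s = (2 * real s + 1) / 2 * pint (q * legendre s)"

lemma lcoef_sum_legendre:
  assumes "s \<le> k" shows "lcoef (\<Sum>j\<le>k. Polynomial.smult (c j) (legendre j)) s = c s"
proof -
  have "pint ((\<Sum>j\<le>k. Polynomial.smult (c j) (legendre j)) * legendre s) = (\<Sum>j\<le>k. if j = s then c s * (2 / (2 * real s + 1)) else 0)"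
    unfolding sum_distrib_right pint_sum
    by (rule sum.cong[OF refl]) (auto simp: pint_smult legendre_norm legendre_orthogonal_neq)
  then show ?thesis using assms unfolding lcoef_def by (simp add: field_simps)
qed

lemma legendre_expansion_exists:
  "Polynomial.degree q \<le> k \<Longrightarrow> \<exists>c. q = (\<Sum>j\<le>k. Polynomial.smult (c j) (legendre j))"
proof (induction k arbitrary: q)
  case 0
  then obtain a where "q = [:a:]" by (auto elim: degree_eq_zeroE)
  then show ?case by (intro exI[of _ "\<lambda>_. a"]) (simp add: legendre_0)
next
  case (Suc k)
  have ne: "Polynomial.coeff (legendre (Suc k)) (Suc k) \<noteq> 0"
  proof
    assume "Polynomial.coeff (legendre (Suc k)) (Suc k) = 0"
    then have "Polynomial.degree (legendre (Suc k)) < Suc k"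
      using degree_legendre_le[of "Suc k"]
      by (metis One_nat_def degree_0 le_neq_implies_less leading_coeff_0_iff zero_less_Suc)
    then have "pint (legendre (Suc k) * legendre (Suc k)) = 0" by (rule legendre_orthogonal)
    then show False using legendre_norm[of "Suc k"] by simp
  qed
  define a where "a = Polynomial.coeff q (Suc k) / Polynomial.coeff (legendre (Suc k)) (Suc k)"
  define r where "r = q - Polynomial.smult a (legendre (Suc k))"
  have "Polynomial.degree r \<le> k"
  proof (rule degree_le, intro allI impI)
    fix i assume "k < i"
    then consider "i = Suc k" | "Suc k < i" by linarith
    then show "Polynomial.coeff r i = 0"
    proof cases
      case 1 then show ?thesis unfolding r_def a_def using ne by simp
    next
      case 2
      then show ?thesis unfolding r_def using Suc.prems degree_legendre_le[of "Suc k"] by (simp add: coeff_eq_0)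
    qed
  qed
  then obtain c where c: "r = (\<Sum>j\<le>k. Polynomial.smult (c j) (legendre j))" using Suc.IH by blast
  have "q = (\<Sum>j\<le>Suc k. Polynomial.smult ((c(Suc k := a)) j) (legendre j))"
    using c unfolding r_def by (simp add: algebra_simps)
  then show ?case by blast
qed

lemma legendre_expansion:
  assumes "Polynomial.degree q \<le> k" shows "q = (\<Sum>j\<le>k. Polynomial.smult (lcoef q j) (legendre j))"
proof -
  obtain c where c: "q = (\<Sum>j\<le>k. Polynomial.smult (c j) (legendre j))" using legendre_expansion_exists[OF assms] by blast
  have "lcoef q j = c j" if "j \<le> k" for j using lcoef_sum_legendre[OF that, of c] c by simp
  then show ?thesis using c by simp
qed

lemma pint_legendre_sums:
  "pint ((\<Sum>j\<in>A. Polynomial.smult (c j) (legendre j)) * (\<Sum>j\<in>A. Polynomial.smult (d j) (legendre j)))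
    = (\<Sum>j\<in>A. c j * d j * (2 / (2 * real j + 1)))" if "finite A"
proof -
  have "pint ((\<Sum>j\<in>A. Polynomial.smult (c j) (legendre j)) * (\<Sum>j\<in>A. Polynomial.smult (d j) (legendre j)))
    = (\<Sum>i\<in>A. \<Sum>j\<in>A. c i * d j * pint (legendre i * legendre j))"
    by (simp add: sum_product pint_sum pint_smult ac_simps)
  also have "\<dots> = (\<Sum>i\<in>A. \<Sum>j\<in>A. if j = i then c i * d i * (2 / (2 * real i + 1)) else 0)"
    by (intro sum.cong refl) (auto simp: legendre_norm legendre_orthogonal_neq)
  finally show ?thesis using that by simp
qed

lemma sum_odd: "(\<Sum>s\<le>k. (2 * real s + 1) / 2) = (real k + 1)\<^sup>2 / 2"
  by (induction k) (auto simp: power2_eq_square field_simps)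

lemma trace_inverse_inequality:
  assumes "Polynomial.degree q \<le> k" and x: "x = 1 \<or> x = -1"
  shows "(poly q x)\<^sup>2 \<le> (real k + 1)\<^sup>2 / 2 * pint (q * q)"
proof -
  have "poly q x = poly (\<Sum>s\<le>k. Polynomial.smult (lcoef q s) (legendre s)) x" using legendre_expansion[OF assms(1)] by simp
  also have "\<dots> = (\<Sum>s\<le>k. lcoef q s * poly (legendre s) x)" by (simp add: poly_sum)
  \<comment> \<open>The weights make the second factor of Cauchy-Schwarz the squared norm of q, by
    orthogonality. As L_s is 1 or -1 at the ends, the first factor is the sum of (2 s + 1) / 2, that
    is (k + 1)^2 / 2.\<close>
  also have "\<dots> = (\<Sum>s\<le>k. (sqrt ((2 * real s + 1) / 2) * poly (legendre s) x) * (sqrt (2 / (2 * real s + 1)) * lcoef q s))"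
  proof (rule sum.cong[OF refl])
    fix s
    have "sqrt ((2 * real s + 1) / 2) * sqrt (2 / (2 * real s + 1)) = 1" unfolding real_sqrt_mult[symmetric] by simp
    moreover have "(A * P) * (B * L) = (A * B) * (L * P)" for A B P L :: real by simp
    ultimately show "lcoef q s * poly (legendre s) x = (sqrt ((2 * real s + 1) / 2) * poly (legendre s) x) * (sqrt (2 / (2 * real s + 1)) * lcoef q s)"
      by simp
  qed
  finally have "(poly q x)\<^sup>2 \<le> (\<Sum>s\<le>k. (sqrt ((2 * real s + 1) / 2) * poly (legendre s) x)\<^sup>2) * (\<Sum>s\<le>k. (sqrt (2 / (2 * real s + 1)) * lcoef q s)\<^sup>2)"
    using Cauchy_Schwarz_ineq_sum[of "\<lambda>s. sqrt ((2 * real s + 1) / 2) * poly (legendre s) x" "\<lambda>s. sqrt (2 / (2 * real s + 1)) * lcoef q s" "{..k}"] by simp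
  also have "(\<Sum>s\<le>k. (sqrt ((2 * real s + 1) / 2) * poly (legendre s) x)\<^sup>2) = (real k + 1)\<^sup>2 / 2"
  proof -
    have "(poly (legendre s) x)\<^sup>2 = 1" for s using x by (auto simp: poly_legendre_1 poly_legendre_minus_1 power_mult[symmetric] mult.commute[of _ 2] power_mult)
    then show ?thesis unfolding sum_odd[symmetric] by (simp add: power_mult_distrib)
  qed
  also have "(\<Sum>s\<le>k. (sqrt (2 / (2 * real s + 1)) * lcoef q s)\<^sup>2) = pint (q * q)"
  proof -
    have "pint (q * q) = (\<Sum>s\<le>k. lcoef q s * lcoef q s * (2 / (2 * real s + 1)))"
      using pint_legendre_sums[of "{..k}" "lcoef q" "lcoef q"] legendre_expansion[OF assms(1)] by simp
    also have "\<dots> = (\<Sum>s\<le>k. (sqrt (2 / (2 * real s + 1)) * lcoef q s)\<^sup>2)"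
    proof (rule sum.cong[OF refl])
      fix s
      have "(sqrt (2 / (2 * real s + 1)))\<^sup>2 = 2 / (2 * real s + 1)" by simp
      then show "lcoef q s * lcoef q s * (2 / (2 * real s + 1)) = (sqrt (2 / (2 * real s + 1)) * lcoef q s)\<^sup>2"
        unfolding power_mult_distrib by (simp add: power2_eq_square)
    qed
    finally show ?thesis by simp
  qed
  finally show ?thesis .
qed

subsection \<open>The interior penalty form on a line\<close>

text \<open>Traces from outside the line count as 0, so one formula covers all nodes. At the left
  end this is minus the jump of the form, just as the slope below is minus the outward normal
  derivative there. Each term of the form contains two such factors, so the signs cancel.\<close>

definition node_jump :: "nat \<Rightarrow> (nat \<Rightarrow> real poly) \<Rightarrow> nat \<Rightarrow> real" where
  "node_jump n u v = (if v > 0 then poly (u (v - 1)) 1 else 0) - (if v < n then poly (u v) (-1) else 0)"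

definition node_slope :: "nat \<Rightarrow> (nat \<Rightarrow> real poly) \<Rightarrow> nat \<Rightarrow> real" where
  "node_slope n u v = (if v = 0 then poly (pderiv (u 0)) (-1)
     else if v = n then poly (pderiv (u (n - 1))) 1
     else (poly (pderiv (u (v - 1))) 1 + poly (pderiv (u v)) (-1)) / 2)"

text \<open>All cells are mapped to \<open>[-1, 1]\<close>, so \<open>line_form\<close> and \<open>line_norm2\<close> are \<open>h\<close> times the form and the
  squared norm on cells of length \<open>h\<close>, whereas \<open>line_inner\<close> is \<open>2 / h\<close> times the inner product.\<close>

definition line_form :: "nat \<Rightarrow> real \<Rightarrow> nat \<Rightarrow> (nat \<Rightarrow> real poly) \<Rightarrow> (nat \<Rightarrow> real poly) \<Rightarrow> real" where
  "line_form n \<alpha> p u v = 2 * (\<Sum>t<n. pint (pderiv (u t) * pderiv (v t)))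
     - 2 * (\<Sum>x\<le>n. node_slope n u x * node_jump n v x)
     - 2 * (\<Sum>x\<le>n. node_slope n v x * node_jump n u x)
     + \<alpha> * (real p)\<^sup>2 * (\<Sum>x\<le>n. node_jump n u x * node_jump n v x)"

definition line_norm2 :: "nat \<Rightarrow> nat \<Rightarrow> (nat \<Rightarrow> real poly) \<Rightarrow> real" where
  "line_norm2 n p u = 2 * (\<Sum>t<n. pint (pderiv (u t) * pderiv (u t))) + (real p)\<^sup>2 * (\<Sum>x\<le>n. (node_jump n u x)\<^sup>2)"

definition line_inner :: "nat \<Rightarrow> (nat \<Rightarrow> real poly) \<Rightarrow> (nat \<Rightarrow> real poly) \<Rightarrow> real" where
  "line_inner n u v = (\<Sum>t<n. pint (u t * v t))"

lemma node_jump_add: "node_jump n (\<lambda>t. u t + v t) x = node_jump n u x + node_jump n v x"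
  unfolding node_jump_def by simp

lemma node_jump_smult: "node_jump n (\<lambda>t. Polynomial.smult c (u t)) x = c * node_jump n u x"
  unfolding node_jump_def by (simp add: algebra_simps)

lemma node_slope_add: "node_slope n (\<lambda>t. u t + v t) x = node_slope n u x + node_slope n v x"
  unfolding node_slope_def by (simp add: pderiv_add add_divide_distrib)

lemma node_slope_smult: "node_slope n (\<lambda>t. Polynomial.smult c (u t)) x = c * node_slope n u x"
  unfolding node_slope_def by (simp add: pderiv_smult algebra_simps)

lemma line_form_commute: "line_form n \<alpha> p u v = line_form n \<alpha> p v u"
  unfolding line_form_def by (simp add: mult.commute)

lemma line_form_add: "line_form n \<alpha> p (\<lambda>t. u t + v t) w = line_form n \<alpha> p u w + line_form n \<alpha> p v w"
  unfolding line_form_def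
  by (simp add: node_jump_add node_slope_add pderiv_add distrib_right distrib_left pint_add sum.distrib)

lemma line_form_smult: "line_form n \<alpha> p (\<lambda>t. Polynomial.smult c (u t)) w = c * line_form n \<alpha> p u w"
proof -
  have 1: "(\<Sum>t<n. pint (pderiv (Polynomial.smult c (u t)) * pderiv (w t))) = c * (\<Sum>t<n. pint (pderiv (u t) * pderiv (w t)))"
    by (simp add: pderiv_smult pint_smult sum_distrib_left)
  have 2: "(\<Sum>x\<le>n. node_slope n (\<lambda>t. Polynomial.smult c (u t)) x * node_jump n w x) = c * (\<Sum>x\<le>n. node_slope n u x * node_jump n w x)"
    by (simp add: node_slope_smult sum_distrib_left mult.assoc)
  have 3: "(\<Sum>x\<le>n. node_slope n w x * node_jump n (\<lambda>t. Polynomial.smult c (u t)) x) = c * (\<Sum>x\<le>n. node_slope n w x * node_jump n u x)"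
    by (simp add: node_jump_smult sum_distrib_left ac_simps)
  have 4: "(\<Sum>x\<le>n. node_jump n (\<lambda>t. Polynomial.smult c (u t)) x * node_jump n w x) = c * (\<Sum>x\<le>n. node_jump n u x * node_jump n w x)"
    by (simp add: node_jump_smult sum_distrib_left ac_simps)
  show ?thesis unfolding line_form_def 1 2 3 4 by (simp add: algebra_simps)
qed

lemma line_form_diff: "line_form n \<alpha> p (\<lambda>t. u t - v t) w = line_form n \<alpha> p u w - line_form n \<alpha> p v w"
  using line_form_add[of n \<alpha> p u "\<lambda>t. Polynomial.smult (-1) (v t)" w] by (simp add: line_form_smult[of n \<alpha> p "-1", simplified])

lemma line_form_diff_right: "line_form n \<alpha> p w (\<lambda>t. u t - v t) = line_form n \<alpha> p w u - line_form n \<alpha> p w v"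
  by (simp add: line_form_commute[of n \<alpha> p w] line_form_diff)

lemma line_inner_commute: "line_inner n u v = line_inner n v u"
  unfolding line_inner_def by (simp add: mult.commute)

lemma line_inner_nonneg: "0 \<le> line_inner n u u"
  unfolding line_inner_def by (intro sum_nonneg pint_sq_nonneg)

lemma line_inner_Cauchy_Schwarz: "line_inner n u v \<le> sqrt (line_inner n u u) * sqrt (line_inner n v v)"
  unfolding line_inner_def by (rule sum_pint_Cauchy_Schwarz)

lemma line_inner_Cauchy_Schwarz_abs: "\<bar>line_inner n u v\<bar> \<le> sqrt (line_inner n u u) * sqrt (line_inner n v v)"
proof -
  have "line_inner n (\<lambda>t. - u t) v = - line_inner n u v" "line_inner n (\<lambda>t. - u t) (\<lambda>t. - u t) = line_inner n u u"
    unfolding line_inner_def using pint_smult[of "-1"] by (simp_all add: sum_negf)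
  then show ?thesis using line_inner_Cauchy_Schwarz[of n u v] line_inner_Cauchy_Schwarz[of n "\<lambda>t. - u t" v] by simp
qed

lemma line_norm2_nonneg: "0 \<le> line_norm2 n p u"
  unfolding line_norm2_def by (intro add_nonneg_nonneg mult_nonneg_nonneg sum_nonneg pint_sq_nonneg) auto

lemma line_norm2_parts:
  assumes "p \<ge> 1"
  shows "line_inner n (\<lambda>t. pderiv (u t)) (\<lambda>t. pderiv (u t)) \<le> line_norm2 n p u"
    and "sqrt (\<Sum>x\<le>n. (node_jump n u x)\<^sup>2) \<le> sqrt (line_norm2 n p u) / real p"
proof -
  have a: "0 \<le> line_inner n (\<lambda>t. pderiv (u t)) (\<lambda>t. pderiv (u t))" by (rule line_inner_nonneg)
  have b: "0 \<le> (\<Sum>x\<le>n. (node_jump n u x)\<^sup>2)" by (intro sum_nonneg) auto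
  have N: "line_norm2 n p u = 2 * line_inner n (\<lambda>t. pderiv (u t)) (\<lambda>t. pderiv (u t)) + (real p)\<^sup>2 * (\<Sum>x\<le>n. (node_jump n u x)\<^sup>2)"
    unfolding line_norm2_def line_inner_def ..
  show "line_inner n (\<lambda>t. pderiv (u t)) (\<lambda>t. pderiv (u t)) \<le> line_norm2 n p u"
    unfolding N using a b by simp
  have "(real p)\<^sup>2 * (\<Sum>x\<le>n. (node_jump n u x)\<^sup>2) \<le> line_norm2 n p u" unfolding N using a by simp
  then have "sqrt ((real p)\<^sup>2 * (\<Sum>x\<le>n. (node_jump n u x)\<^sup>2)) \<le> sqrt (line_norm2 n p u)" by (rule real_sqrt_le_mono)
  then have "real p * sqrt (\<Sum>x\<le>n. (node_jump n u x)\<^sup>2) \<le> sqrt (line_norm2 n p u)" by (simp add: real_sqrt_mult)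
  then show "sqrt (\<Sum>x\<le>n. (node_jump n u x)\<^sup>2) \<le> sqrt (line_norm2 n p u) / real p"
    using assms by (simp add: pos_le_divide_eq mult.commute)
qed

lemma sum_Cauchy_Schwarz_sqrt:
  fixes a b :: "'i \<Rightarrow> real"
  shows "\<bar>\<Sum>i\<in>A. a i * b i\<bar> \<le> sqrt (\<Sum>i\<in>A. (a i)\<^sup>2) * sqrt (\<Sum>i\<in>A. (b i)\<^sup>2)"
proof -
  have "sqrt ((\<Sum>i\<in>A. a i * b i)\<^sup>2) \<le> sqrt ((\<Sum>i\<in>A. (a i)\<^sup>2) * (\<Sum>i\<in>A. (b i)\<^sup>2))"
    by (intro real_sqrt_le_mono Cauchy_Schwarz_ineq_sum)
  then show ?thesis by (simp add: real_sqrt_mult)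
qed

text \<open>Rearranges a sum over nodes into a sum over cells, so that nodal terms can cancel
  against the boundary terms of integration by parts in each cell.\<close>

lemma sum_node_jump:
  assumes "n \<ge> 1"
  shows "(\<Sum>x\<le>n. d x * node_jump n v x) = (\<Sum>t<n. d (Suc t) * poly (v t) 1 - d t * poly (v t) (-1))"
proof -
  have "(\<Sum>x\<le>n. d x * node_jump n v x)
     = (\<Sum>x\<le>n. if x > 0 then d x * poly (v (x - 1)) 1 else 0) - (\<Sum>x\<le>n. if x < n then d x * poly (v x) (-1) else 0)"
    unfolding node_jump_def sum_subtractf[symmetric] by (rule sum.cong[OF refl]) (simp add: algebra_simps)
  also have "(\<Sum>x\<le>n. if x > 0 then d x * poly (v (x - 1)) 1 else 0) = (\<Sum>t<n. d (Suc t) * poly (v t) 1)"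
    by (subst sum.atMost_shift) simp
  also have "(\<Sum>x\<le>n. if x < n then d x * poly (v x) (-1) else 0) = (\<Sum>t<n. d t * poly (v t) (-1))"
    by (simp add: lessThan_Suc_atMost[symmetric])
  finally show ?thesis by (simp add: sum_subtractf)
qed

subsection \<open>The dual problem on a line\<close>

definition anti0 :: "real poly \<Rightarrow> real poly" where
  "anti0 p = anti p - [:poly (anti p) (-1):]"

lemma pderiv_anti0: "pderiv (anti0 p) = p"
  unfolding anti0_def by (simp add: pderiv_diff pderiv_anti pderiv_pCons)

lemma anti0_minus_1: "poly (anti0 p) (-1) = 0"
  unfolding anti0_def by simp

lemma anti0_unique:
  assumes "pderiv q = p" "poly q (-1) = 0" shows "anti0 p = q"
proof (rule real_poly_eqI)
  fix x
  show "poly (anti0 p) x = poly q x"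
    using poly_diff_of_pderiv_eq[of "anti0 p" q x "-1"] assms by (simp add: pderiv_anti0 anti0_minus_1)
qed

lemma anti0_add: "anti0 (p + q) = anti0 p + anti0 q"
  by (rule anti0_unique) (simp_all add: pderiv_add pderiv_anti0 anti0_minus_1)

lemma anti0_smult: "anti0 (Polynomial.smult c p) = Polynomial.smult c (anti0 p)"
  by (rule anti0_unique) (simp_all add: pderiv_smult pderiv_anti0 anti0_minus_1)

text \<open>The derivative at node t of the solution of - z'' = g with zero value and slope at the
  left end of the line. The next definition is its value at node t; the factor 2 there is the cell
  length.\<close>

definition sol_slope :: "(nat \<Rightarrow> real poly) \<Rightarrow> nat \<Rightarrow> real" where
  "sol_slope g t = - (\<Sum>s<t. poly (anti0 (g s)) 1)"

definition sol_value :: "(nat \<Rightarrow> real poly) \<Rightarrow> nat \<Rightarrow> real" where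
  "sol_value g t = (\<Sum>s<t. 2 * sol_slope g s - poly (anti0 (anti0 (g s))) 1)"

text \<open>The solution of \<open>- z'' = g\<close> with homogeneous Dirichlet conditions on a line of \<open>n\<close> cells of length 2:
  a Cauchy problem is solved from the left, and a multiple of the global coordinate is subtracted.\<close>

definition line_sol :: "nat \<Rightarrow> (nat \<Rightarrow> real poly) \<Rightarrow> nat \<Rightarrow> real poly" where
  "line_sol n g t = [:sol_value g t:] + Polynomial.smult (sol_slope g t) [:1, 1:] - anti0 (anti0 (g t))
     - Polynomial.smult (sol_value g n / (2 * real n)) [:1 + 2 * real t, 1:]"

lemma pderiv_line_sol:
  "pderiv (line_sol n g t) = [:sol_slope g t - sol_value g n / (2 * real n):] - anti0 (g t)"
  unfolding line_sol_def
  by (simp add: pderiv_add pderiv_diff pderiv_smult pderiv_anti0 pderiv_pCons)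

lemma pderiv2_line_sol: "pderiv (pderiv (line_sol n g t)) = - g t"
  unfolding pderiv_line_sol by (simp add: pderiv_diff pderiv_anti0 pderiv_pCons)

lemma line_sol_traces:
  "poly (line_sol n g t) (-1) = sol_value g t - sol_value g n / (2 * real n) * (2 * real t)"
  "poly (line_sol n g t) 1 = sol_value g (Suc t) - sol_value g n / (2 * real n) * (2 * real (Suc t))"
  "poly (pderiv (line_sol n g t)) (-1) = sol_slope g t - sol_value g n / (2 * real n)"
  "poly (pderiv (line_sol n g t)) 1 = sol_slope g (Suc t) - sol_value g n / (2 * real n)"
proof -
  define c where "c = sol_value g n / (2 * real n)"
  have L: "line_sol n g t = [:sol_value g t:] + Polynomial.smult (sol_slope g t) [:1, 1:] - anti0 (anti0 (g t)) - Polynomial.smult c [:1 + 2 * real t, 1:]"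
    unfolding line_sol_def c_def ..
  have v: "sol_value g (Suc t) = sol_value g t + (2 * sol_slope g t - poly (anti0 (anti0 (g t))) 1)"
    and s: "sol_slope g (Suc t) = sol_slope g t - poly (anti0 (g t)) 1"
    by (simp_all add: sol_value_def sol_slope_def)
  show "poly (line_sol n g t) (-1) = sol_value g t - sol_value g n / (2 * real n) * (2 * real t)"
    "poly (line_sol n g t) 1 = sol_value g (Suc t) - sol_value g n / (2 * real n) * (2 * real (Suc t))"
    "poly (pderiv (line_sol n g t)) (-1) = sol_slope g t - sol_value g n / (2 * real n)"
    "poly (pderiv (line_sol n g t)) 1 = sol_slope g (Suc t) - sol_value g n / (2 * real n)"
    unfolding pderiv_line_sol c_def[symmetric] v s by (simp_all add: L anti0_minus_1 algebra_simps)
qed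

lemma line_sol_add: "line_sol n (\<lambda>t. f t + g t) t = line_sol n f t + line_sol n g t"
proof -
  have s: "sol_slope (\<lambda>t. f t + g t) t = sol_slope f t + sol_slope g t" for t
    unfolding sol_slope_def by (simp add: anti0_add sum.distrib)
  have v: "sol_value (\<lambda>t. f t + g t) t = sol_value f t + sol_value g t" for t
    unfolding sol_value_def s by (simp add: anti0_add sum.distrib[symmetric] algebra_simps)
  show ?thesis unfolding line_sol_def s v
    by (rule real_poly_eqI) (simp add: anti0_add algebra_simps add_divide_distrib)
qed

lemma line_sol_smult: "line_sol n (\<lambda>t. Polynomial.smult c (g t)) t = Polynomial.smult c (line_sol n g t)"
proof -
  have s: "sol_slope (\<lambda>t. Polynomial.smult c (g t)) t = c * sol_slope g t" for t
    unfolding sol_slope_def by (simp add: anti0_smult sum_distrib_left)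
  have v: "sol_value (\<lambda>t. Polynomial.smult c (g t)) t = c * sol_value g t" for t
    unfolding sol_value_def s by (simp add: anti0_smult sum_distrib_left algebra_simps)
  show ?thesis unfolding line_sol_def s v
    by (rule real_poly_eqI) (simp add: anti0_smult algebra_simps)
qed

text \<open>The solution is continuously differentiable across nodes and zero at both ends, so its
  jumps vanish and its average slopes are genuine slopes, which cancel the boundary terms of
  cellwise integration by parts. The identity holds for every piecewise polynomial v, of any
  degree.\<close>

lemma line_sol_consistency:
  assumes n: "n \<ge> 1"
  shows "line_form n \<alpha> p (line_sol n g) v = 2 * line_inner n g v"
proof -
  define z where "z = line_sol n g"
  define d where "d x = sol_slope g x - sol_value g n / (2 * real n)" for x
  have nn: "sol_value g n - sol_value g n / (2 * real n) * (2 * real n) = 0" using n by simp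
  have jump: "node_jump n z x = 0" if "x \<le> n" for x
  proof -
    have "poly (z (x - 1)) 1 = sol_value g x - sol_value g n / (2 * real n) * (2 * real x)" if "x > 0"
      using line_sol_traces(2)[of n g "x - 1"] that unfolding z_def by simp
    moreover have "poly (z x) (-1) = sol_value g x - sol_value g n / (2 * real n) * (2 * real x)"
      unfolding z_def by (rule line_sol_traces(1))
    moreover have "sol_value g 0 = 0" unfolding sol_value_def by simp
    ultimately show ?thesis using that nn unfolding node_jump_def
      by (cases "x = n") (auto simp: not_less)
  qed
  have slope: "node_slope n z x = d x" if "x \<le> n" for x
  proof -
    have "poly (pderiv (z (x - 1))) 1 = d x" if "x > 0"
      using line_sol_traces(4)[of n g "x - 1"] that unfolding z_def d_def by simp
    moreover have "poly (pderiv (z x)) (-1) = d x" unfolding z_def d_def by (rule line_sol_traces(3))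
    ultimately show ?thesis using that n unfolding node_slope_def by auto
  qed
  have parts: "pint (pderiv (z t) * pderiv (v t)) = d (Suc t) * poly (v t) 1 - d t * poly (v t) (-1) + pint (g t * v t)" for t
  proof -
    have "pint (pderiv (v t) * pderiv (z t)) = poly (v t) 1 * poly (pderiv (z t)) 1 - poly (v t) (-1) * poly (pderiv (z t)) (-1) - pint (v t * pderiv (pderiv (z t)))"
      by (rule pint_by_parts)
    also have "pint (v t * pderiv (pderiv (z t))) = - pint (g t * v t)"
      unfolding z_def pderiv2_line_sol using pint_smult[of "-1" "g t * v t"] by (simp add: mult.commute)
    also have "poly (pderiv (z t)) 1 = d (Suc t)" unfolding z_def d_def by (rule line_sol_traces(4))
    also have "poly (pderiv (z t)) (-1) = d t" unfolding z_def d_def by (rule line_sol_traces(3))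
    finally show ?thesis by (simp add: mult.commute)
  qed
  have s1: "(\<Sum>x\<le>n. node_slope n z x * node_jump n v x) = (\<Sum>t<n. d (Suc t) * poly (v t) 1 - d t * poly (v t) (-1))"
    unfolding sum_node_jump[OF n, symmetric] by (rule sum.cong[OF refl]) (simp add: slope)
  have s2: "(\<Sum>x\<le>n. node_slope n v x * node_jump n z x) = 0" "(\<Sum>x\<le>n. node_jump n z x * node_jump n v x) = 0"
    by (auto intro!: sum.neutral simp: jump)
  show ?thesis
    unfolding line_form_def z_def[symmetric] s1 s2 parts line_inner_def sum.distrib by simp
qed

subsection \<open>Truncation of the Legendre series of the derivative\<close>

text \<open>The integrated Legendre polynomial: for j >= 1 the antiderivative of L_j that vanishes
  at both ends.\<close>

definition antileg :: "nat \<Rightarrow> real poly" where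
  "antileg j = Polynomial.smult (1 / (2 * real j + 1)) (legendre (Suc j) - legendre (j - 1))"

lemma pderiv_antileg: "j \<ge> 1 \<Longrightarrow> pderiv (antileg j) = legendre j"
  by (cases j) (auto simp: antileg_def pderiv_smult pderiv_diff pderiv_legendre algebra_simps)

lemma antileg_ends:
  assumes "j \<ge> 1" shows "poly (antileg j) 1 = 0" "poly (antileg j) (-1) = 0"
  using assms by (cases j; simp add: antileg_def poly_legendre_1 poly_legendre_minus_1)+

lemma pint_diff_sq: "pint ((a - b) * (a - b)) = pint (a * a) - 2 * pint (a * b) + pint (b * b)"
proof -
  have "(a - b) * (a - b) = a * a - Polynomial.smult 2 (a * b) + b * b"
    by (rule real_poly_eqI) (simp add: algebra_simps)
  then show ?thesis by (simp add: pint_add pint_diff pint_smult)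
qed

lemma pint_antileg_sq: "j \<ge> 1 \<Longrightarrow> pint (antileg j * antileg j) \<le> 4 / ((2 * real j + 1)\<^sup>2 * (2 * real j - 1))"
proof -
  assume j: "j \<ge> 1"
  let ?a = "1 / (2 * real j + 1)"
  have "pint (antileg j * antileg j) = ?a\<^sup>2 * pint ((legendre (Suc j) - legendre (j - 1)) * (legendre (Suc j) - legendre (j - 1)))"
    unfolding antileg_def by (simp add: pint_smult power2_eq_square)
  also have "pint ((legendre (Suc j) - legendre (j - 1)) * (legendre (Suc j) - legendre (j - 1)))
     = 2 / (2 * real j + 3) + 2 / (2 * real j - 1)"
    using j legendre_orthogonal_neq[of "j - 1" "Suc j"] unfolding pint_diff_sq legendre_norm
    by (simp add: of_nat_diff algebra_simps)
  also have "?a\<^sup>2 * (2 / (2 * real j + 3) + 2 / (2 * real j - 1)) \<le> ?a\<^sup>2 * (4 / (2 * real j - 1))"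
  proof (rule mult_left_mono)
    have "2 / (2 * real j + 3) \<le> 2 / (2 * real j - 1)" using j by (intro divide_left_mono) auto
    then show "2 / (2 * real j + 3) + 2 / (2 * real j - 1) \<le> 4 / (2 * real j - 1)" by simp
  qed simp
  finally show ?thesis by (simp add: power_divide)
qed

text \<open>For data of degree at most k the derivative of the solution has degree at most k + 1.
  Removing its modes k - 1, k and k + 1 leaves degree k - 2, hence a function of degree k - 1. As
  the removed functions vanish at the ends of each cell, all nodal values are kept.\<close>

definition tail :: "nat \<Rightarrow> real poly \<Rightarrow> real poly" where
  "tail k z = (\<Sum>j\<in>{k - 1, k, Suc k}. Polynomial.smult (lcoef (pderiv z) j) (antileg j))"

lemma lcoef_add: "lcoef (p + q) j = lcoef p j + lcoef q j"
  by (simp only: lcoef_def distrib_right pint_add distrib_left)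

lemma lcoef_smult: "lcoef (Polynomial.smult c p) j = c * lcoef p j"
  unfolding lcoef_def by (simp add: pint_smult)

lemma tail_add: "tail k (y + z) = tail k y + tail k z"
  unfolding tail_def by (simp add: pderiv_add lcoef_add smult_add_left sum.distrib del: sum.insert)

lemma tail_smult: "tail k (Polynomial.smult c z) = Polynomial.smult c (tail k z)"
  unfolding tail_def by (simp add: pderiv_smult lcoef_smult smult_sum2 del: sum.insert)

lemma pderiv_tail:
  assumes "k \<ge> 2"
  shows "pderiv (tail k z) = (\<Sum>j\<in>{k - 1, k, Suc k}. Polynomial.smult (lcoef (pderiv z) j) (legendre j))"
proof -
  have "pderiv (tail k z) = (\<Sum>j\<in>{k - 1, k, Suc k}. pderiv (Polynomial.smult (lcoef (pderiv z) j) (antileg j)))"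
    unfolding tail_def by (rule higher_pderiv_sum[of 1, simplified])
  also have "\<dots> = (\<Sum>j\<in>{k - 1, k, Suc k}. Polynomial.smult (lcoef (pderiv z) j) (legendre j))"
    by (rule sum.cong[OF refl]) (use assms in \<open>auto simp: pderiv_smult pderiv_antileg\<close>)
  finally show ?thesis .
qed

lemma tail_ends:
  assumes "k \<ge> 2" shows "poly (tail k z) 1 = 0" "poly (tail k z) (-1) = 0"
  using assms by (auto simp: tail_def poly_sum antileg_ends intro!: sum.neutral)

lemma sum3_power2: "(a + b + c)\<^sup>2 \<le> 3 * (a\<^sup>2 + b\<^sup>2 + (c::real)\<^sup>2)"
proof -
  have "3 * (a\<^sup>2 + b\<^sup>2 + c\<^sup>2) - (a + b + c)\<^sup>2 = (a - b)\<^sup>2 + (b - c)\<^sup>2 + (a - c)\<^sup>2"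
    by (simp add: power2_eq_square algebra_simps)
  then show ?thesis by (metis add_nonneg_nonneg diff_ge_0_iff_ge zero_le_power2)
qed

lemma tail_bounds:
  assumes k: "k \<ge> 2" and z: "pderiv (pderiv z) = - g" and g: "Polynomial.degree g \<le> k"
  shows "Polynomial.degree (z - tail k z) \<le> k - 1"
    and "pint (pderiv (tail k z) * pderiv (tail k z)) \<le> 12 / (real k)\<^sup>2 * pint (g * g)"
    and "x = 1 \<or> x = -1 \<Longrightarrow> (poly (pderiv (tail k z)) x)\<^sup>2 \<le> 18 / real k * pint (g * g)"
    and "pint (tail k z * tail k z) \<le> 144 / (real k) ^ 4 * pint (g * g)"
proof -
  define f where "f j = lcoef (pderiv z) j" for j
  define G where "G = pint (g * g)"
  have G: "0 \<le> G" unfolding G_def by (rule pint_sq_nonneg)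
  have kk: "real k \<ge> 2" using k by simp
  let ?T = "{k - 1, k, Suc k}"
  have T1: "j \<ge> 1 \<and> real k / 2 \<le> 2 * real j - 1 \<and> real k \<le> 2 * real j + 1" if "j \<in> ?T" for j
    using that k by (auto simp: of_nat_diff)
  have T3: "k - 1 \<noteq> k" "k - 1 \<noteq> Suc k" "k \<noteq> Suc k" using k by auto
  have sumT: "(\<Sum>j\<in>?T. h j) = h (k - 1) + h k + h (Suc k)" for h :: "nat \<Rightarrow> real"
    using T3 by (simp add: add.assoc del: One_nat_def)
  have sumTp: "(\<Sum>j\<in>?T. h j) = h (k - 1) + h k + h (Suc k)" for h :: "nat \<Rightarrow> real poly"
    using T3 by (simp add: add.assoc del: One_nat_def)
  \<comment> \<open>The coefficient of z' against L_j is, by parts, the integral of g against the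
    integrated Legendre polynomial, whose squared norm decays like j^-3. With the normalization (2 j
    + 1) / 2 this gives 1 / k, from which all the powers of k in the lemma follow.\<close>
  have fj: "(f j)\<^sup>2 \<le> 2 / real k * G" if "j \<in> ?T" for j
  proof -
    have j: "j \<ge> 1" "real k / 2 \<le> 2 * real j - 1" using T1[OF that] by auto
    have pos: "2 * real j - 1 > 0" using j kk by linarith
    have "pint (pderiv z * legendre j) = pint (antileg j * g)"
    proof -
      have "pint (pderiv (antileg j) * pderiv z) = - pint (antileg j * pderiv (pderiv z))"
        unfolding pint_by_parts antileg_ends[OF j(1)] by simp
      also have "\<dots> = pint (antileg j * g)" unfolding z using pint_smult[of "-1" "antileg j * g"] by simp
      finally show ?thesis using j by (simp add: pderiv_antileg mult.commute)
    qed
    then have "(f j)\<^sup>2 = (2 * real j + 1)\<^sup>2 / 4 * (pint (antileg j * g))\<^sup>2"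
      unfolding f_def lcoef_def by (simp add: power_mult_distrib power_divide)
    also have "\<dots> \<le> (2 * real j + 1)\<^sup>2 / 4 * (pint (antileg j * antileg j) * G)"
      unfolding G_def by (intro mult_left_mono pint_Cauchy_Schwarz_sq) auto
    also have "\<dots> \<le> (2 * real j + 1)\<^sup>2 / 4 * (4 / ((2 * real j + 1)\<^sup>2 * (2 * real j - 1)) * G)"
      by (intro mult_left_mono mult_right_mono pint_antileg_sq j G) auto
    also have "\<dots> = 1 / (2 * real j - 1) * G"
    proof -
      have "(2 * real j + 1)\<^sup>2 \<noteq> 0" by (simp add: add_nonneg_eq_0_iff)
      then show ?thesis by simp
    qed
    also have "\<dots> \<le> 1 / (real k / 2) * G"
      by (intro mult_right_mono divide_left_mono j G) (use pos kk in auto)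
    finally show ?thesis by simp
  qed
  have dt: "pderiv (tail k z) = (\<Sum>j\<in>?T. Polynomial.smult (f j) (legendre j))"
    unfolding f_def by (rule pderiv_tail[OF k])
  show "Polynomial.degree (z - tail k z) \<le> k - 1"
  proof -
    have "Polynomial.degree (pderiv z) \<le> Suc k"
    proof -
      have "Polynomial.degree (pderiv (pderiv z)) \<le> k" unfolding z using g by simp
      then show ?thesis unfolding degree_pderiv[of "pderiv z"] by simp
    qed
    then have "pderiv z = (\<Sum>j\<le>Suc k. Polynomial.smult (f j) (legendre j))" unfolding f_def by (rule legendre_expansion)
    also have "{..Suc k} = {..k - 2} \<union> ?T" using k by auto
    also have "(\<Sum>j\<in>{..k - 2} \<union> ?T. Polynomial.smult (f j) (legendre j))
       = (\<Sum>j\<le>k - 2. Polynomial.smult (f j) (legendre j)) + (\<Sum>j\<in>?T. Polynomial.smult (f j) (legendre j))"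
      by (rule sum.union_disjoint) (use k in auto)
    finally have "pderiv (z - tail k z) = (\<Sum>j\<le>k - 2. Polynomial.smult (f j) (legendre j))"
      unfolding pderiv_diff dt by simp
    moreover have "Polynomial.degree (\<Sum>j\<le>k - 2. Polynomial.smult (f j) (legendre j)) \<le> k - 2"
      by (rule degree_sum_le) (auto intro: order_trans[OF degree_smult_le] order_trans[OF degree_legendre_le])
    ultimately have "Polynomial.degree (pderiv (z - tail k z)) \<le> k - 2" by simp
    then show ?thesis using k unfolding degree_pderiv by linarith
  qed
  have sumf: "f (k - 1) ^ 2 + f k ^ 2 + f (Suc k) ^ 2 \<le> 6 / real k * G"
    using fj[of "k - 1"] fj[of k] fj[of "Suc k"] by simp
  show "pint (pderiv (tail k z) * pderiv (tail k z)) \<le> 12 / (real k)\<^sup>2 * G"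
  proof -
    have "pint (pderiv (tail k z) * pderiv (tail k z)) = (\<Sum>j\<in>?T. f j * f j * (2 / (2 * real j + 1)))"
      unfolding dt by (rule pint_legendre_sums) simp
    also have "\<dots> \<le> (\<Sum>j\<in>?T. (f j)\<^sup>2 * (2 / real k))"
    proof (rule sum_mono)
      fix j assume "j \<in> ?T"
      then have "2 / (2 * real j + 1) \<le> 2 / real k" using T1[of j] kk by (intro divide_left_mono) auto
      then show "f j * f j * (2 / (2 * real j + 1)) \<le> (f j)\<^sup>2 * (2 / real k)"
        unfolding power2_eq_square by (intro mult_left_mono) auto
    qed
    also have "\<dots> = (f (k - 1) ^ 2 + f k ^ 2 + f (Suc k) ^ 2) * (2 / real k)" unfolding sumT by (simp only: distrib_right)
    also have "\<dots> \<le> (6 / real k * G) * (2 / real k)" using sumf kk by (intro mult_right_mono) auto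
    also have "\<dots> = 12 / (real k)\<^sup>2 * G" by (simp add: power2_eq_square)
    finally show ?thesis .
  qed
  show "(poly (pderiv (tail k z)) x)\<^sup>2 \<le> 18 / real k * G" if x: "x = 1 \<or> x = -1"
  proof -
    have l: "(poly (legendre j) x)\<^sup>2 = 1" for j
      using x by (auto simp: poly_legendre_1 poly_legendre_minus_1 power_mult[symmetric] mult.commute[of _ 2] power_mult)
    have "poly (pderiv (tail k z)) x = (\<Sum>j\<in>?T. f j * poly (legendre j) x)" unfolding dt by (simp add: poly_sum)
    also have "\<dots> = f (k - 1) * poly (legendre (k - 1)) x + f k * poly (legendre k) x + f (Suc k) * poly (legendre (Suc k)) x"
      by (rule sumT)
    finally have "(poly (pderiv (tail k z)) x)\<^sup>2 \<le> 3 * (f (k - 1) ^ 2 + f k ^ 2 + f (Suc k) ^ 2)"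
      using sum3_power2[of "f (k - 1) * poly (legendre (k - 1)) x" "f k * poly (legendre k) x" "f (Suc k) * poly (legendre (Suc k)) x"]
      by (simp add: power_mult_distrib l)
    also have "\<dots> \<le> 3 * (6 / real k * G)" using sumf by (intro mult_left_mono) auto
    finally show ?thesis by simp
  qed
  show "pint (tail k z * tail k z) \<le> 144 / (real k) ^ 4 * G"
  proof -
    have aj: "pint (Polynomial.smult (f j) (antileg j) * Polynomial.smult (f j) (antileg j)) \<le> (f j)\<^sup>2 * (8 / real k ^ 3)" if "j \<in> ?T" for j
    proof -
      have t: "j \<ge> 1" "real k / 2 \<le> 2 * real j - 1" "real k \<le> 2 * real j + 1" using T1[OF that] by auto
      have "pint (antileg j * antileg j) \<le> 4 / ((2 * real j + 1)\<^sup>2 * (2 * real j - 1))" by (rule pint_antileg_sq[OF t(1)])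
      also have "\<dots> \<le> 4 / ((real k)\<^sup>2 * (real k / 2))"
        by (intro divide_left_mono mult_mono power_mono t mult_pos_pos) (use kk t in auto)
      also have "\<dots> = 8 / real k ^ 3" by (simp add: power3_eq_cube power2_eq_square)
      finally have "(f j)\<^sup>2 * pint (antileg j * antileg j) \<le> (f j)\<^sup>2 * (8 / real k ^ 3)" by (rule mult_left_mono) simp
      then show ?thesis by (simp add: pint_smult power2_eq_square mult.assoc)
    qed
    define q where "q j = Polynomial.smult (f j) (antileg j)" for j
    have tq: "tail k z = q (k - 1) + q k + q (Suc k)" unfolding tail_def q_def f_def by (rule sumTp)
    have "pint (tail k z * tail k z) \<le> 3 * (pint (q (k - 1) * q (k - 1)) + pint (q k * q k) + pint (q (Suc k) * q (Suc k)))"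
    proof -
      have "3 * (a * a + b * b + c * c) - (a + b + c) * (a + b + c) = (a - b) * (a - b) + (b - c) * (b - c) + (a - c) * (a - c)"
        for a b c :: "real poly" by (simp add: algebra_simps)
      moreover have "3 * p = Polynomial.smult 3 p" for p :: "real poly" by (rule real_poly_eqI) simp
      ultimately have "3 * (pint (a * a) + pint (b * b) + pint (c * c)) - pint ((a + b + c) * (a + b + c))
         = pint ((a - b) * (a - b)) + pint ((b - c) * (b - c)) + pint ((a - c) * (a - c))" for a b c
        by (metis pint_add pint_diff pint_smult)
      then show ?thesis unfolding tq
        using pint_sq_nonneg[of "q (k - 1) - q k"] pint_sq_nonneg[of "q k - q (Suc k)"] pint_sq_nonneg[of "q (k - 1) - q (Suc k)"]
        by (smt (verit))
    qed
    also have "\<dots> \<le> 3 * ((f (k - 1))\<^sup>2 * (8 / real k ^ 3) + (f k)\<^sup>2 * (8 / real k ^ 3) + (f (Suc k))\<^sup>2 * (8 / real k ^ 3))"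
      using aj[of "k - 1"] aj[of k] aj[of "Suc k"] unfolding q_def by simp
    also have "\<dots> = 24 / real k ^ 3 * (f (k - 1) ^ 2 + f k ^ 2 + f (Suc k) ^ 2)" by (simp add: algebra_simps add_divide_distrib)
    also have "\<dots> \<le> 24 / real k ^ 3 * (6 / real k * G)" using sumf by (intro mult_left_mono) auto
    also have "\<dots> = 144 / (real k) ^ 4 * G" by (simp add: power_eq_if)
    finally show ?thesis .
  qed
qed

lemma sum_node_slope_sq:
  assumes "n \<ge> 1"
  shows "(\<Sum>x\<le>n. (node_slope n u x)\<^sup>2) \<le> (\<Sum>t<n. (poly (pderiv (u t)) 1)\<^sup>2 + (poly (pderiv (u t)) (-1))\<^sup>2)"
proof -
  let ?a = "\<lambda>t. (poly (pderiv (u t)) 1)\<^sup>2" and ?b = "\<lambda>t. (poly (pderiv (u t)) (-1))\<^sup>2"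
  have "(\<Sum>x\<le>n. (node_slope n u x)\<^sup>2) \<le> (\<Sum>x\<le>n. (if x > 0 then ?a (x - 1) else 0) + (if x < n then ?b x else 0))"
  proof (rule sum_mono)
    fix x assume "x \<in> {..n}"
    have "((c + d) / 2)\<^sup>2 \<le> c\<^sup>2 + d\<^sup>2" for c d :: real
    proof -
      have "c\<^sup>2 + d\<^sup>2 - ((c + d) / 2)\<^sup>2 = ((c - d) / 2)\<^sup>2 + (c\<^sup>2 + d\<^sup>2) / 2" by (simp add: power2_eq_square field_simps)
      then show ?thesis by (smt (verit) sum_power2_ge_zero zero_le_power2 divide_nonneg_pos)
    qed
    then show "(node_slope n u x)\<^sup>2 \<le> (if x > 0 then ?a (x - 1) else 0) + (if x < n then ?b x else 0)"
      using \<open>x \<in> {..n}\<close> assms unfolding node_slope_def by auto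
  qed
  also have "\<dots> = (\<Sum>t<n. ?a t) + (\<Sum>t<n. ?b t)"
  proof -
    have "(\<Sum>x\<le>n. if x > 0 then ?a (x - 1) else 0) = (\<Sum>t<n. ?a t)" by (subst sum.atMost_shift) simp
    moreover have "(\<Sum>x\<le>n. if x < n then ?b x else 0) = (\<Sum>t<n. ?b t)" by (simp add: lessThan_Suc_atMost[symmetric])
    ultimately show ?thesis by (simp add: sum.distrib)
  qed
  finally show ?thesis by (simp add: sum.distrib)
qed

section \<open>Energy estimates for the removed part of the solution\<close>

context
  fixes n k p :: nat and g z e :: "nat \<Rightarrow> real poly"
  assumes n: "n \<ge> 1" and k: "k \<ge> 2" and kp: "k \<le> p"
    and zg: "\<And>t. pderiv (pderiv (z t)) = - g t" and dg: "\<And>t. Polynomial.degree (g t) \<le> k"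
    and e: "\<And>t. e t = tail k (z t)"
begin

lemma tail_no_jump: "node_jump n e x = 0"
  unfolding node_jump_def e using tail_ends[OF k] by simp

lemma line_inner_pderiv_tail:
  "line_inner n (\<lambda>t. pderiv (e t)) (\<lambda>t. pderiv (e t)) \<le> 12 / (real k)\<^sup>2 * line_inner n g g"
  unfolding line_inner_def sum_distrib_left e by (intro sum_mono tail_bounds(2)[OF k zg dg])

lemma line_inner_tail: "line_inner n e e \<le> 144 / (real k) ^ 4 * line_inner n g g"
  unfolding line_inner_def sum_distrib_left e by (intro sum_mono tail_bounds(4)[OF k zg dg])

text \<open>As e has no jumps, the penalty and one of the two flux terms vanish. The remaining one
  pairs slopes of order k^(-1/2) with jumps which the norm controls with factor 1 / p, and k <= p
  makes 1 / (sqrt k p) at most 1 / k.\<close>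

lemma line_form_tail:
  "\<bar>line_form n \<alpha> p e v\<bar> \<le> 24 / real k * sqrt (line_inner n g g) * sqrt (line_norm2 n p v)"
proof -
  define G where "G = sqrt (line_inner n g g)"
  define N where "N = sqrt (line_norm2 n p v)"
  have G: "0 \<le> G" "G\<^sup>2 = line_inner n g g" unfolding G_def using line_inner_nonneg by auto
  have N: "0 \<le> N" unfolding N_def using line_norm2_nonneg by simp
  have k0: "real k > 0" and p0: "real p \<ge> real k" using k kp by auto
  have "line_form n \<alpha> p e v = 2 * line_inner n (\<lambda>t. pderiv (e t)) (\<lambda>t. pderiv (v t)) - 2 * (\<Sum>x\<le>n. node_slope n e x * node_jump n v x)"
    unfolding line_form_def line_inner_def by (simp add: tail_no_jump)
  moreover have "\<bar>line_inner n (\<lambda>t. pderiv (e t)) (\<lambda>t. pderiv (v t))\<bar> \<le> 4 / real k * G * N"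
  proof -
    have "\<bar>line_inner n (\<lambda>t. pderiv (e t)) (\<lambda>t. pderiv (v t))\<bar>
      \<le> sqrt (line_inner n (\<lambda>t. pderiv (e t)) (\<lambda>t. pderiv (e t))) * sqrt (line_inner n (\<lambda>t. pderiv (v t)) (\<lambda>t. pderiv (v t)))"
      by (rule line_inner_Cauchy_Schwarz_abs)
    also have "\<dots> \<le> sqrt ((4 / real k * G)\<^sup>2) * N"
    proof (intro mult_mono real_sqrt_le_mono)
      have "12 / (real k)\<^sup>2 * G\<^sup>2 \<le> 16 / (real k)\<^sup>2 * G\<^sup>2" by (intro mult_right_mono divide_right_mono) auto
      then show "line_inner n (\<lambda>t. pderiv (e t)) (\<lambda>t. pderiv (e t)) \<le> (4 / real k * G)\<^sup>2"
        using line_inner_pderiv_tail unfolding G(2) by (simp add: power_mult_distrib power_divide G(2))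
      show "sqrt (line_inner n (\<lambda>t. pderiv (v t)) (\<lambda>t. pderiv (v t))) \<le> N"
        unfolding N_def by (intro real_sqrt_le_mono line_norm2_parts) (use k kp in simp)
    qed (auto simp: line_inner_nonneg)
    also have "sqrt ((4 / real k * G)\<^sup>2) = 4 / real k * G" using G by simp
    finally show ?thesis .
  qed
  moreover have "\<bar>\<Sum>x\<le>n. node_slope n e x * node_jump n v x\<bar> \<le> 6 / real k * G * N"
  proof -
    have "\<bar>\<Sum>x\<le>n. node_slope n e x * node_jump n v x\<bar> \<le> sqrt (\<Sum>x\<le>n. (node_slope n e x)\<^sup>2) * sqrt (\<Sum>x\<le>n. (node_jump n v x)\<^sup>2)"
      by (rule sum_Cauchy_Schwarz_sqrt)
    also have "\<dots> \<le> (6 / sqrt (real k) * G) * (N / real p)"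
    proof (intro mult_mono)
      have "(\<Sum>x\<le>n. (node_slope n e x)\<^sup>2) \<le> (\<Sum>t<n. (poly (pderiv (e t)) 1)\<^sup>2 + (poly (pderiv (e t)) (-1))\<^sup>2)"
        by (rule sum_node_slope_sq[OF n])
      also have "\<dots> \<le> (\<Sum>t<n. 36 / real k * pint (g t * g t))"
      proof (rule sum_mono)
        fix t
        show "(poly (pderiv (e t)) 1)\<^sup>2 + (poly (pderiv (e t)) (-1))\<^sup>2 \<le> 36 / real k * pint (g t * g t)"
          using tail_bounds(3)[OF k zg dg, of 1 t] tail_bounds(3)[OF k zg dg, of "-1" t] unfolding e by simp
      qed
      also have "\<dots> = (6 / sqrt (real k) * G)\<^sup>2"
        using k0 by (simp add: power_mult_distrib power_divide G(2) line_inner_def sum_distrib_left sum_divide_distrib)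
      finally have "sqrt (\<Sum>x\<le>n. (node_slope n e x)\<^sup>2) \<le> sqrt ((6 / sqrt (real k) * G)\<^sup>2)" by (rule real_sqrt_le_mono)
      then show "sqrt (\<Sum>x\<le>n. (node_slope n e x)\<^sup>2) \<le> 6 / sqrt (real k) * G" using G k0 by simp
      show "sqrt (\<Sum>x\<le>n. (node_jump n v x)\<^sup>2) \<le> N / real p" unfolding N_def by (rule line_norm2_parts) (use k kp in simp)
    qed (use G k0 in \<open>auto intro: sum_nonneg\<close>)
    also have "\<dots> = 6 / (sqrt (real k) * real p) * (G * N)" by simp
    also have "\<dots> \<le> 6 / real k * (G * N)"
    proof (intro mult_right_mono divide_left_mono)
      have "1 * real k \<le> sqrt (real k) * real p" using k p0 by (intro mult_mono) auto
      then show "real k \<le> sqrt (real k) * real p" by simp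
    qed (use G N k0 p0 in auto)
    finally show ?thesis by (simp add: mult.assoc)
  qed
  ultimately have "\<bar>line_form n \<alpha> p e v\<bar> \<le> 2 * (4 / real k * G * N) + 2 * (6 / real k * G * N)" by linarith
  also have "\<dots> = 20 / real k * G * N" by (simp add: field_simps)
  also have "\<dots> \<le> 24 / real k * G * N" using G N k0 by (intro mult_right_mono divide_right_mono) auto
  finally show ?thesis unfolding G_def N_def .
qed

end

lemma quadratic_inequality_bound:
  fixes X G a b :: real
  assumes "X\<^sup>2 \<le> a * G * X + b\<^sup>2 * G\<^sup>2" "0 \<le> X" "0 \<le> G" "0 \<le> a" "0 \<le> b"
  shows "X \<le> (a + b) * G"
proof (rule ccontr)
  assume "\<not> X \<le> (a + b) * G"
  then have gt: "X > (a + b) * G" by simp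
  have X: "X > 0" using gt assms by (smt (verit) mult_nonneg_nonneg)
  have "b * G \<le> X" using gt assms by (smt (verit) mult_nonneg_nonneg distrib_right)
  then have "b * G * (b * G) \<le> b * G * X" using assms by (intro mult_left_mono) auto
  then have "X\<^sup>2 \<le> ((a + b) * G) * X" using assms(1) by (simp add: power2_eq_square algebra_simps)
  also have "\<dots> < X * X" using gt X by (intro mult_strict_right_mono)
  finally show False by (simp add: power2_eq_square)
qed

text \<open>Takes the data g instead of the discrete solution u that is to be approximated: the
  truncated exact solution with the same data. Since the solution is given by an explicit formula,
  the map is visibly linear and has a matrix.\<close>

definition line_interp :: "nat \<Rightarrow> nat \<Rightarrow> (nat \<Rightarrow> real poly) \<Rightarrow> nat \<Rightarrow> real poly" where
  "line_interp n k g t = line_sol n g t - tail k (line_sol n g t)"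

lemma line_interp_add: "line_interp n k (\<lambda>t. f t + g t) t = line_interp n k f t + line_interp n k g t"
  unfolding line_interp_def line_sol_add tail_add by simp

lemma line_interp_smult: "line_interp n k (\<lambda>t. Polynomial.smult c (g t)) t = Polynomial.smult c (line_interp n k g t)"
  unfolding line_interp_def line_sol_smult tail_smult by (simp add: smult_diff_right)

text \<open>Schatz' argument: the form is only known to satisfy a Garding inequality, so the mean square of the
  error is bounded first, by duality, and then absorbed for small \<open>h / k\<close>.\<close>

lemma line_approximation:
  assumes n: "n \<ge> 1" and k: "k \<ge> 2" and kp: "k \<le> p" and c: "c > 0" and C: "C \<ge> 0"
    and garding: "\<And>u. (\<And>t. Polynomial.degree (u t) \<le> k) \<Longrightarrow> c * line_norm2 n p u \<le> line_form n \<alpha> p u u + C * h\<^sup>2 * line_inner n u u"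
    and small: "C * h\<^sup>2 * 288 \<le> c / 2 * (real k)\<^sup>2"
    and du: "\<And>t. Polynomial.degree (u t) \<le> k" and dg: "\<And>t. Polynomial.degree (g t) \<le> k"
    and ug: "\<And>v. (\<And>t. Polynomial.degree (v t) \<le> k) \<Longrightarrow> line_form n \<alpha> p u v = 2 * line_inner n g v"
  defines "y \<equiv> \<lambda>t. u t - line_interp n k g t" and "K \<equiv> 48 / c + 4"
  shows "Polynomial.degree (line_interp n k g t) \<le> k - 1"
    and "sqrt (line_inner n y y) \<le> (12 * K + 60) / (real k)\<^sup>2 * sqrt (line_inner n g g)"
    and "line_form n \<alpha> p y y \<le> 24 * K / (real k)\<^sup>2 * line_inner n g g"
proof -
  have deg: "Polynomial.degree (line_interp n k f t) \<le> k - 1" if "Polynomial.degree (f t) \<le> k" for f t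
    unfolding line_interp_def by (rule tail_bounds(1)[OF k, of "line_sol n f t" "f t", OF pderiv2_line_sol that])
  show "Polynomial.degree (line_interp n k g t) \<le> k - 1" by (rule deg[of g t, OF dg])
  have dy: "Polynomial.degree (y t) \<le> k" for t
    unfolding y_def using du[of t] deg[of g t, OF dg] k by (intro degree_diff_le) auto
  have k0: "real k > 0" using k by simp
  define G where "G = sqrt (line_inner n g g)"
  define Y where "Y = sqrt (line_inner n y y)"
  define N where "N = sqrt (line_norm2 n p y)"
  have G: "0 \<le> G" "G\<^sup>2 = line_inner n g g" unfolding G_def using line_inner_nonneg by auto
  have Y: "0 \<le> Y" "Y\<^sup>2 = line_inner n y y" unfolding Y_def using line_inner_nonneg by auto
  have N: "0 \<le> N" "N\<^sup>2 = line_norm2 n p y" unfolding N_def using line_norm2_nonneg by auto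
  define z where "z = line_sol n g"
  define e where "e = (\<lambda>t. tail k (z t))"
  have z2: "pderiv (pderiv (z t)) = - g t" for t unfolding z_def by (rule pderiv2_line_sol)
  \<comment> \<open>Here u - z is the Galerkin error, orthogonal to all functions of degree k. Hence
    y and the explicit function e have the same form against such functions, and bounds for e carry
    over.\<close>
  have y: "y = (\<lambda>t. (u t - z t) + e t)" unfolding y_def line_interp_def z_def e_def by auto
  have orth: "line_form n \<alpha> p (\<lambda>t. u t - z t) v = 0" if "\<And>t. Polynomial.degree (v t) \<le> k" for v
    unfolding line_form_diff ug[OF that] z_def line_sol_consistency[OF n] by simp
  have fe: "line_form n \<alpha> p y v = line_form n \<alpha> p e v" if "\<And>t. Polynomial.degree (v t) \<le> k" for v
    unfolding y line_form_add orth[OF that] by simp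
  have ebound: "\<bar>line_form n \<alpha> p e v\<bar> \<le> 24 / real k * G * sqrt (line_norm2 n p v)" for v
    unfolding G_def by (rule line_form_tail[OF n k kp z2 dg]) (simp add: e_def)
  \<comment> \<open>The exact solution of the dual problem with the error y as data, and its removed
    part.\<close>
  define \<zeta> where "\<zeta> = line_sol n y"
  define \<epsilon> where "\<epsilon> = (\<lambda>t. tail k (\<zeta> t))"
  have \<zeta>2: "pderiv (pderiv (\<zeta> t)) = - y t" for t unfolding \<zeta>_def by (rule pderiv2_line_sol)
  have \<epsilon>bound: "\<bar>line_form n \<alpha> p \<epsilon> v\<bar> \<le> 24 / real k * Y * sqrt (line_norm2 n p v)" for v
    unfolding Y_def by (rule line_form_tail[OF n k kp \<zeta>2 dy]) (simp add: \<epsilon>_def)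
  have d\<zeta>: "Polynomial.degree (\<zeta> t - \<epsilon> t) \<le> k" for t
    using deg[of y t, OF dy] unfolding line_interp_def \<zeta>_def \<epsilon>_def by linarith
  have \<epsilon>e: "\<bar>line_form n \<alpha> p \<epsilon> e\<bar> \<le> 24 / (real k)\<^sup>2 * Y * G"
  proof -
    have "line_form n \<alpha> p \<epsilon> e = 2 * line_inner n (\<lambda>t. pderiv (\<epsilon> t)) (\<lambda>t. pderiv (e t))"
      unfolding line_form_def line_inner_def
      using tail_no_jump[OF n k kp \<zeta>2 dy, of \<epsilon>] tail_no_jump[OF n k kp z2 dg, of e] by (simp add: \<epsilon>_def e_def)
    moreover have "\<bar>line_inner n (\<lambda>t. pderiv (\<epsilon> t)) (\<lambda>t. pderiv (e t))\<bar> \<le> sqrt (12 / (real k)\<^sup>2 * Y\<^sup>2) * sqrt (12 / (real k)\<^sup>2 * G\<^sup>2)"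
    proof -
      have "sqrt (line_inner n (\<lambda>t. pderiv (\<epsilon> t)) (\<lambda>t. pderiv (\<epsilon> t))) \<le> sqrt (12 / (real k)\<^sup>2 * Y\<^sup>2)"
        unfolding Y(2) by (intro real_sqrt_le_mono line_inner_pderiv_tail[OF n k kp \<zeta>2 dy]) (simp add: \<epsilon>_def)
      moreover have "sqrt (line_inner n (\<lambda>t. pderiv (e t)) (\<lambda>t. pderiv (e t))) \<le> sqrt (12 / (real k)\<^sup>2 * G\<^sup>2)"
        unfolding G(2) by (intro real_sqrt_le_mono line_inner_pderiv_tail[OF n k kp z2 dg]) (simp add: e_def)
      ultimately show ?thesis
        by (intro order_trans[OF line_inner_Cauchy_Schwarz_abs] mult_mono) (auto simp: line_inner_nonneg)
    qed
    moreover have "sqrt (12 / (real k)\<^sup>2 * Y\<^sup>2) * sqrt (12 / (real k)\<^sup>2 * G\<^sup>2) = 12 / (real k)\<^sup>2 * Y * G"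
    proof -
      have "sqrt (12 / (real k)\<^sup>2 * Y\<^sup>2) * sqrt (12 / (real k)\<^sup>2 * G\<^sup>2) = sqrt ((12 / (real k)\<^sup>2 * Y * G)\<^sup>2)"
        unfolding real_sqrt_mult[symmetric] by (rule arg_cong[where f = sqrt]) (simp add: power2_eq_square)
      then show ?thesis using Y G by simp
    qed
    ultimately show ?thesis by (simp add: mult.assoc)
  qed
  have ye: "\<bar>line_inner n y e\<bar> \<le> 12 / (real k)\<^sup>2 * Y * G"
  proof -
    have "sqrt (line_inner n e e) \<le> sqrt ((12 / (real k)\<^sup>2 * G)\<^sup>2)"
    proof (rule real_sqrt_le_mono)
      have "line_inner n e e \<le> 144 / (real k) ^ 4 * G\<^sup>2"
        unfolding G(2) by (rule line_inner_tail[OF n k kp z2 dg]) (simp add: e_def)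
      also have "\<dots> = (12 / (real k)\<^sup>2 * G)\<^sup>2" by (simp add: power_mult_distrib power_divide)
      finally show "line_inner n e e \<le> (12 / (real k)\<^sup>2 * G)\<^sup>2" .
    qed
    then have "sqrt (line_inner n e e) \<le> 12 / (real k)\<^sup>2 * G" using G by simp
    then have "Y * sqrt (line_inner n e e) \<le> Y * (12 / (real k)\<^sup>2 * G)" using Y by (intro mult_left_mono)
    moreover have "\<bar>line_inner n y e\<bar> \<le> Y * sqrt (line_inner n e e)"
      unfolding Y_def by (rule line_inner_Cauchy_Schwarz_abs)
    ultimately show ?thesis by (simp add: ac_simps)
  qed
  \<comment> \<open>Duality: y is not itself orthogonal to the discrete space, so replacing y by e
    against the discrete function \<zeta> - \<epsilon> leaves the terms 2 (y, e) and the form of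
    \<epsilon> and e, each of order G / k^2 times Y.\<close>
  have Ybound: "Y \<le> 12 / real k * N + 36 / (real k)\<^sup>2 * G"
  proof -
    have "2 * Y\<^sup>2 = line_form n \<alpha> p \<zeta> y" unfolding Y(2) \<zeta>_def line_sol_consistency[OF n] ..
    also have "\<dots> = line_form n \<alpha> p \<epsilon> y + line_form n \<alpha> p (\<lambda>t. \<zeta> t - \<epsilon> t) y" unfolding line_form_diff by simp
    also have "line_form n \<alpha> p (\<lambda>t. \<zeta> t - \<epsilon> t) y = line_form n \<alpha> p e (\<lambda>t. \<zeta> t - \<epsilon> t)"
      unfolding line_form_commute[of n \<alpha> p "\<lambda>t. \<zeta> t - \<epsilon> t" y] by (rule fe[OF d\<zeta>])
    also have "\<dots> = line_form n \<alpha> p \<zeta> e - line_form n \<alpha> p \<epsilon> e"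
      unfolding line_form_diff_right by (simp add: line_form_commute)
    also have "line_form n \<alpha> p \<zeta> e = 2 * line_inner n y e" unfolding \<zeta>_def by (rule line_sol_consistency[OF n])
    finally have "2 * Y\<^sup>2 \<le> 24 / real k * Y * N + (2 * (12 / (real k)\<^sup>2 * Y * G) + 24 / (real k)\<^sup>2 * Y * G)"
    proof -
      assume eq: "2 * Y\<^sup>2 = line_form n \<alpha> p \<epsilon> y + (2 * line_inner n y e - line_form n \<alpha> p \<epsilon> e)"
      have "line_form n \<alpha> p \<epsilon> y \<le> 24 / real k * Y * N" using \<epsilon>bound[of y] unfolding N_def by simp
      moreover have "line_inner n y e \<le> 12 / (real k)\<^sup>2 * Y * G" using ye by simp
      moreover have "- line_form n \<alpha> p \<epsilon> e \<le> 24 / (real k)\<^sup>2 * Y * G" using \<epsilon>e by simp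
      ultimately show ?thesis unfolding eq by argo
    qed
    also have "\<dots> \<le> Y * (2 * (12 / real k * N + 36 / (real k)\<^sup>2 * G))"
    proof -
      have "48 / (real k)\<^sup>2 * (Y * G) \<le> 72 / (real k)\<^sup>2 * (Y * G)" using Y G by (intro mult_right_mono divide_right_mono) auto
      then show ?thesis by (simp add: algebra_simps)
    qed
    finally have "Y * (2 * Y) \<le> Y * (2 * (12 / real k * N + 36 / (real k)\<^sup>2 * G))" by (simp add: power2_eq_square algebra_simps)
    moreover have "0 \<le> 12 / real k * N + 36 / (real k)\<^sup>2 * G" using N G by simp
    ultimately show ?thesis using Y(1) mult_left_le_imp_le[of Y "2 * Y"] by (cases "Y = 0") auto
  qed
  \<comment> \<open>The Garding term is absorbed: 288 = 2 * 12^2 comes from squaring the bound on Y,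
    and \<open>small\<close> makes its share of N^2 at most half of the coercive one.\<close>
  have Nbound: "N \<le> K * (G / real k)"
  proof -
    have f: "line_form n \<alpha> p y y \<le> 24 / real k * G * N" using fe[OF dy] ebound[of y] unfolding N_def by simp
    have Y2: "Y\<^sup>2 \<le> 288 / (real k)\<^sup>2 * N\<^sup>2 + 2592 / (real k) ^ 4 * G\<^sup>2"
    proof -
      have "(a + b)\<^sup>2 \<le> 2 * a\<^sup>2 + 2 * b\<^sup>2" for a b :: real
        using sum_squares_bound[of a b] by (simp add: power2_sum)
      then have "(12 / real k * N + 36 / (real k)\<^sup>2 * G)\<^sup>2 \<le> 2 * (12 / real k * N)\<^sup>2 + 2 * (36 / (real k)\<^sup>2 * G)\<^sup>2" .
      also have "\<dots> = 288 / (real k)\<^sup>2 * N\<^sup>2 + 2592 / (real k) ^ 4 * G\<^sup>2" by (simp add: power_mult_distrib power_divide)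
      finally show ?thesis using power_mono[OF Ybound Y(1), of 2] by linarith
    qed
    have "c * N\<^sup>2 \<le> 24 / real k * G * N + C * h\<^sup>2 * Y\<^sup>2" using garding[of y, OF dy] f unfolding N(2) Y(2) by linarith
    also have "C * h\<^sup>2 * Y\<^sup>2 \<le> C * h\<^sup>2 * (288 / (real k)\<^sup>2 * N\<^sup>2 + 2592 / (real k) ^ 4 * G\<^sup>2)"
      using Y2 C by (intro mult_left_mono) auto
    also have "\<dots> = C * h\<^sup>2 * 288 / (real k)\<^sup>2 * (N\<^sup>2 + 9 * (G / real k)\<^sup>2)"
      using k0 by (simp add: field_simps power2_eq_square power_eq_if)
    also have "\<dots> \<le> c / 2 * (N\<^sup>2 + 9 * (G / real k)\<^sup>2)"
      using small k0 by (intro mult_right_mono) (auto simp: pos_divide_le_eq)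
    finally have "c / 2 * N\<^sup>2 \<le> c / 2 * ((48 / c) * (G / real k) * N + 9 * (G / real k)\<^sup>2)"
      using c by (simp add: field_simps)
    then have "N\<^sup>2 \<le> (48 / c) * (G / real k) * N + 3\<^sup>2 * (G / real k)\<^sup>2" using c by simp
    then have "N \<le> (48 / c + 3) * (G / real k)"
      by (rule quadratic_inequality_bound) (use N G c in auto)
    also have "\<dots> \<le> K * (G / real k)" unfolding K_def using G by (intro mult_right_mono) auto
    finally show ?thesis .
  qed
  show "line_form n \<alpha> p y y \<le> 24 * K / (real k)\<^sup>2 * line_inner n g g"
  proof -
    have "line_form n \<alpha> p y y \<le> 24 / real k * G * N" using fe[OF dy] ebound[of y] unfolding N_def by simp
    also have "\<dots> \<le> 24 / real k * G * (K * (G / real k))" using Nbound G by (intro mult_left_mono) auto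
    also have "\<dots> = 24 * K / (real k)\<^sup>2 * G\<^sup>2" by (simp add: power2_eq_square)
    finally show ?thesis unfolding G(2) .
  qed
  show "sqrt (line_inner n y y) \<le> (12 * K + 60) / (real k)\<^sup>2 * sqrt (line_inner n g g)"
  proof -
    have "Y \<le> 12 / real k * (K * (G / real k)) + 36 / (real k)\<^sup>2 * G"
      using Ybound Nbound k0 by (smt (verit) divide_nonneg_pos mult_left_mono)
    also have "\<dots> = (12 * K + 36) / (real k)\<^sup>2 * G" by (simp add: power2_eq_square algebra_simps add_divide_distrib)
    also have "\<dots> \<le> (12 * K + 60) / (real k)\<^sup>2 * G" using G by (intro mult_right_mono divide_right_mono) auto
    finally show ?thesis unfolding Y_def G_def .
  qed
qed

subsection \<open>Discrete Poincare inequality and bubbles on a line\<close>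

text \<open>The global coordinate X has derivative 1, vanishes at the left end and is at most 2 n;
  integrating X' u^2 by parts yields nodal jumps of u^2 and a gradient term. The jumps cost a trace
  inverse inequality, but its factor p cancels the weight 1 / p with which the norm controls jumps,
  so the constant depends on n only.\<close>

lemma line_poincare:
  assumes n: "n \<ge> 1" and p: "p \<ge> 1" and du: "\<And>t. Polynomial.degree (u t) \<le> p"
  shows "line_inner n u u \<le> 144 * (real n)\<^sup>2 * line_norm2 n p u"
proof -
  define X where "X t = [:1 + 2 * real t, 1:]" for t
  define L where "L = sqrt (line_inner n u u)"
  define N where "N = sqrt (line_norm2 n p u)"
  have L: "0 \<le> L" "L\<^sup>2 = line_inner n u u" unfolding L_def using line_inner_nonneg by auto
  have N: "0 \<le> N" "N\<^sup>2 = line_norm2 n p u" unfolding N_def using line_norm2_nonneg by auto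
  have "line_inner n u u = (\<Sum>t<n. (2 * real (Suc t) * poly (u t) 1) * poly (u t) 1 - (2 * real t * poly (u t) (-1)) * poly (u t) (-1))
      - 2 * (\<Sum>t<n. pint ((X t * u t) * pderiv (u t)))"
  proof -
    have "pint (u t * u t) = (2 * real (Suc t) * poly (u t) 1) * poly (u t) 1 - (2 * real t * poly (u t) (-1)) * poly (u t) (-1)
        - 2 * pint ((X t * u t) * pderiv (u t))" for t
    proof -
      have "pint (u t * u t) = pint (pderiv (X t) * (u t * u t))" unfolding X_def by (simp add: pderiv_pCons one_pCons[symmetric])
      also have "\<dots> = poly (X t) 1 * poly (u t * u t) 1 - poly (X t) (-1) * poly (u t * u t) (-1) - pint (X t * pderiv (u t * u t))"
        by (rule pint_by_parts)
      also have "X t * pderiv (u t * u t) = Polynomial.smult 2 ((X t * u t) * pderiv (u t))"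
        unfolding pderiv_mult by (rule real_poly_eqI) (simp add: algebra_simps)
      finally show ?thesis by (simp add: pint_smult X_def algebra_simps)
    qed
    then show ?thesis unfolding line_inner_def by (simp add: sum_subtractf sum_distrib_left)
  qed
  moreover have "\<bar>\<Sum>t<n. (2 * real (Suc t) * poly (u t) 1) * poly (u t) 1 - (2 * real t * poly (u t) (-1)) * poly (u t) (-1)\<bar>
     \<le> 8 * real n * (N * L)"
  proof -
    \<comment> \<open>The sum of the two traces: the jump of u^2 at a node is m times the jump of
      u.\<close>
    define m where "m x = (if x > 0 then poly (u (x - 1)) 1 else 0) + (if x < n then poly (u x) (-1) else 0)" for x
    have "(\<Sum>t<n. (2 * real (Suc t) * poly (u t) 1) * poly (u t) 1 - (2 * real t * poly (u t) (-1)) * poly (u t) (-1))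
       = (\<Sum>x\<le>n. (2 * real x * m x) * node_jump n u x)"
    proof -
      have "(\<Sum>x\<le>n. (2 * real x * m x) * node_jump n u x)
        = (\<Sum>x\<le>n. if x > 0 then 2 * real x * (poly (u (x - 1)) 1)\<^sup>2 else 0) - (\<Sum>x\<le>n. if x < n then 2 * real x * (poly (u x) (-1))\<^sup>2 else 0)"
        unfolding node_jump_def m_def sum_subtractf[symmetric]
        by (rule sum.cong[OF refl]) (simp add: power2_eq_square algebra_simps)
      also have "(\<Sum>x\<le>n. if x > 0 then 2 * real x * (poly (u (x - 1)) 1)\<^sup>2 else 0) = (\<Sum>t<n. 2 * real (Suc t) * (poly (u t) 1)\<^sup>2)"
        by (subst sum.atMost_shift) simp
      also have "(\<Sum>x\<le>n. if x < n then 2 * real x * (poly (u x) (-1))\<^sup>2 else 0) = (\<Sum>t<n. 2 * real t * (poly (u t) (-1))\<^sup>2)"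
        by (simp add: lessThan_Suc_atMost[symmetric])
      finally show ?thesis by (simp add: sum_subtractf power2_eq_square mult.assoc)
    qed
    also have "\<bar>\<dots>\<bar> \<le> sqrt (\<Sum>x\<le>n. (2 * real x * m x)\<^sup>2) * sqrt (\<Sum>x\<le>n. (node_jump n u x)\<^sup>2)"
      by (rule sum_Cauchy_Schwarz_sqrt)
    also have "\<dots> \<le> (4 * real n * (2 * real p) * L) * (N / real p)"
    proof (intro mult_mono)
      have "(\<Sum>x\<le>n. (2 * real x * m x)\<^sup>2) \<le> (\<Sum>x\<le>n. 8 * (real n)\<^sup>2 * ((if x > 0 then (poly (u (x - 1)) 1)\<^sup>2 else 0) + (if x < n then (poly (u x) (-1))\<^sup>2 else 0)))"
      proof (rule sum_mono)
        fix x assume x: "x \<in> {..n}"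
        let ?r = "(if x > 0 then (poly (u (x - 1)) 1)\<^sup>2 else 0) + (if x < n then (poly (u x) (-1))\<^sup>2 else 0)"
        have "(a + b)\<^sup>2 \<le> 2 * (a\<^sup>2 + b\<^sup>2)" for a b :: real using sum_squares_bound[of a b] by (simp add: power2_sum)
        then have "(m x)\<^sup>2 \<le> 2 * ?r" unfolding m_def by (auto split: if_splits)
        moreover have "(2 * real x)\<^sup>2 \<le> 4 * (real n)\<^sup>2" using x by (simp add: power_mult_distrib power_mono)
        ultimately have "(2 * real x)\<^sup>2 * (m x)\<^sup>2 \<le> (4 * (real n)\<^sup>2) * (2 * ?r)" by (intro mult_mono) auto
        then show "(2 * real x * m x)\<^sup>2 \<le> 8 * (real n)\<^sup>2 * ?r" by (simp only: power_mult_distrib)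
      qed
      also have "\<dots> = 8 * (real n)\<^sup>2 * ((\<Sum>t<n. (poly (u t) 1)\<^sup>2) + (\<Sum>t<n. (poly (u t) (-1))\<^sup>2))"
      proof -
        have "(\<Sum>x\<le>n. if x > 0 then (poly (u (x - 1)) 1)\<^sup>2 else 0) = (\<Sum>t<n. (poly (u t) 1)\<^sup>2)" by (subst sum.atMost_shift) simp
        moreover have "(\<Sum>x\<le>n. if x < n then (poly (u x) (-1))\<^sup>2 else 0) = (\<Sum>t<n. (poly (u t) (-1))\<^sup>2)" by (simp add: lessThan_Suc_atMost[symmetric])
        ultimately show ?thesis by (simp only: sum_distrib_left[symmetric] sum.distrib)
      qed
      also have "\<dots> \<le> 8 * (real n)\<^sup>2 * ((2 * real p)\<^sup>2 * line_inner n u u)"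
      proof (intro mult_left_mono)
        have "(poly (u t) 1)\<^sup>2 + (poly (u t) (-1))\<^sup>2 \<le> (2 * real p)\<^sup>2 * pint (u t * u t)" for t
        proof -
          have "(poly (u t) 1)\<^sup>2 + (poly (u t) (-1))\<^sup>2 \<le> (real p + 1)\<^sup>2 * pint (u t * u t)"
            using trace_inverse_inequality[OF du, of 1 t] trace_inverse_inequality[OF du, of "-1" t] by simp
          also have "\<dots> \<le> (2 * real p)\<^sup>2 * pint (u t * u t)" using p by (intro mult_right_mono power_mono pint_sq_nonneg) auto
          finally show ?thesis .
        qed
        then show "(\<Sum>t<n. (poly (u t) 1)\<^sup>2) + (\<Sum>t<n. (poly (u t) (-1))\<^sup>2) \<le> (2 * real p)\<^sup>2 * line_inner n u u"
          unfolding line_inner_def sum_distrib_left sum.distrib[symmetric] by (intro sum_mono)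
      qed simp
      also have "\<dots> \<le> (4 * real n * (2 * real p) * L)\<^sup>2"
        unfolding L(2)[symmetric] by (simp add: power_mult_distrib mult_right_mono)
      finally have "sqrt (\<Sum>x\<le>n. (2 * real x * m x)\<^sup>2) \<le> sqrt ((4 * real n * (2 * real p) * L)\<^sup>2)" by (rule real_sqrt_le_mono)
      then show "sqrt (\<Sum>x\<le>n. (2 * real x * m x)\<^sup>2) \<le> 4 * real n * (2 * real p) * L" using L by simp
      show "sqrt (\<Sum>x\<le>n. (node_jump n u x)\<^sup>2) \<le> N / real p" unfolding N_def by (rule line_norm2_parts[OF p])
    qed (use L in \<open>auto intro: sum_nonneg\<close>)
    also have "\<dots> = 8 * real n * (N * L)" using p by simp
    finally show ?thesis .
  qed
  moreover have "\<bar>\<Sum>t<n. pint ((X t * u t) * pderiv (u t))\<bar> \<le> 2 * real n * (N * L)"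
  proof -
    have "\<bar>\<Sum>t<n. pint ((X t * u t) * pderiv (u t))\<bar> \<le> sqrt (line_inner n (\<lambda>t. X t * u t) (\<lambda>t. X t * u t)) * sqrt (line_inner n (\<lambda>t. pderiv (u t)) (\<lambda>t. pderiv (u t)))"
      using line_inner_Cauchy_Schwarz_abs[of n "\<lambda>t. X t * u t" "\<lambda>t. pderiv (u t)"] unfolding line_inner_def .
    also have "\<dots> \<le> (2 * real n * L) * N"
    proof (intro mult_mono)
      have "line_inner n (\<lambda>t. X t * u t) (\<lambda>t. X t * u t) \<le> 4 * (real n)\<^sup>2 * line_inner n u u"
        unfolding line_inner_def sum_distrib_left
      proof (rule sum_mono)
        fix t assume t: "t \<in> {..<n}"
        have "0 \<le> pint (Polynomial.smult (4 * (real n)\<^sup>2) (u t * u t) - (X t * u t) * (X t * u t))"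
        proof (rule pint_nonneg)
          fix x :: real assume x: "-1 \<le> x" "x \<le> 1"
          have "real t + 1 \<le> real n" using t by auto
          then have "0 \<le> 1 + 2 * real t + x" "1 + 2 * real t + x \<le> 2 * real n" using x by auto
          then have "(1 + 2 * real t + x)\<^sup>2 \<le> (2 * real n)\<^sup>2" by (intro power_mono) auto
          then have "(1 + 2 * real t + x)\<^sup>2 * (poly (u t) x)\<^sup>2 \<le> (2 * real n)\<^sup>2 * (poly (u t) x)\<^sup>2" by (intro mult_right_mono) auto
          then show "0 \<le> poly (Polynomial.smult (4 * (real n)\<^sup>2) (u t * u t) - (X t * u t) * (X t * u t)) x"
            unfolding X_def by (simp add: power_mult_distrib power2_eq_square algebra_simps)
        qed
        then show "pint ((X t * u t) * (X t * u t)) \<le> 4 * (real n)\<^sup>2 * pint (u t * u t)" by (simp add: pint_diff pint_smult)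
      qed
      also have "\<dots> = (2 * real n * L)\<^sup>2" unfolding L(2)[symmetric] by (simp add: power_mult_distrib)
      finally have "sqrt (line_inner n (\<lambda>t. X t * u t) (\<lambda>t. X t * u t)) \<le> sqrt ((2 * real n * L)\<^sup>2)" by (rule real_sqrt_le_mono)
      then show "sqrt (line_inner n (\<lambda>t. X t * u t) (\<lambda>t. X t * u t)) \<le> 2 * real n * L" using L by simp
      show "sqrt (line_inner n (\<lambda>t. pderiv (u t)) (\<lambda>t. pderiv (u t))) \<le> N"
        unfolding N_def by (intro real_sqrt_le_mono line_norm2_parts p)
    qed (use L in \<open>auto simp: line_inner_nonneg\<close>)
    finally show ?thesis by (simp add: ac_simps)
  qed
  ultimately have "L\<^sup>2 \<le> 8 * real n * (N * L) + 2 * (2 * real n * (N * L))" unfolding L(2) by linarith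
  then have "L * L \<le> L * (12 * real n * N)" by (simp add: power2_eq_square algebra_simps)
  then have "L \<le> 12 * real n * N" using L(1) N(1) mult_left_le_imp_le[of L L] by (cases "L = 0") auto
  then have "L\<^sup>2 \<le> (12 * real n * N)\<^sup>2" using L by (intro power_mono) auto
  then show ?thesis unfolding L(2) power_mult_distrib N(2) by simp
qed

text \<open>The parabola x (2 n - x) over the whole line, with x = 1 + 2 t + \<xi> in cell t. It is
  continuous, vanishes at both ends and lies in the discrete spaces of degree at least 2.\<close>

definition bubble :: "nat \<Rightarrow> nat \<Rightarrow> real poly" where
  "bubble n t = pcompose [:0, 2 * real n, -1:] [:1 + 2 * real t, 1:]"

lemma sum_pint_pcompose: "(\<Sum>t<n. pint (pcompose (pderiv q) [:1 + 2 * real t, 1:])) = poly q (2 * real n) - poly q 0"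
proof -
  have "pint (pcompose (pderiv q) [:1 + 2 * real t, 1:]) = poly q (2 * real (Suc t)) - poly q (2 * real t)" for t
  proof -
    have "pderiv (pcompose q [:1 + 2 * real t, 1:]) = pcompose (pderiv q) [:1 + 2 * real t, 1:]"
      by (simp add: pderiv_pcompose pderiv_pCons one_pCons[symmetric])
    then have "pint (pcompose (pderiv q) [:1 + 2 * real t, 1:]) = pint (pderiv (pcompose q [:1 + 2 * real t, 1:]))" by simp
    also have "\<dots> = poly q (2 * real (Suc t)) - poly q (2 * real t)"
      unfolding pint_pderiv by (simp add: poly_pcompose algebra_simps)
    finally show ?thesis .
  qed
  then show ?thesis by (induction n) auto
qed

lemma degree_bubble: "Polynomial.degree (bubble n t) \<le> 2"
  unfolding bubble_def by (rule order_trans[OF degree_pcompose_le]) simp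

lemma bubble_inner: "line_inner n (bubble n) (bubble n) = 16 / 15 * real n ^ 5"
proof -
  define q :: "real poly" where "q = [:0, 0, 0, 4 * (real n)\<^sup>2 / 3, - real n, 1/5:]"
  have "pderiv q = [:0, 2 * real n, -1:] * [:0, 2 * real n, -1:]"
    unfolding q_def by (simp add: pderiv_pCons power2_eq_square)
  then have "bubble n t * bubble n t = pcompose (pderiv q) [:1 + 2 * real t, 1:]" for t
    unfolding bubble_def by (simp only: pcompose_mult)
  then have "line_inner n (bubble n) (bubble n) = poly q (2 * real n) - poly q 0"
    unfolding line_inner_def by (simp add: sum_pint_pcompose)
  also have "\<dots> = 16 / 15 * real n ^ 5" unfolding q_def by (simp add: power_eq_if algebra_simps)
  finally show ?thesis .
qed

text \<open>Without jumps, the penalty and hence \<alpha> and p drop out. Together with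
  \<open>bubble_inner\<close>, the ratio of energy to mean square depends only on the length of the
  line, which keeps the Garding constant independent of h and p.\<close>

lemma bubble_form:
  assumes "n \<ge> 1" shows "line_form n \<alpha> p (bubble n) (bubble n) = 16 / 3 * real n ^ 3"
proof -
  define q :: "real poly" where "q = [:0, 4 * (real n)\<^sup>2, - 4 * real n, 4/3:]"
  have jump: "node_jump n (bubble n) x = 0" if "x \<le> n" for x
    using that unfolding node_jump_def bubble_def by (auto simp: poly_pcompose of_nat_diff algebra_simps)
  have "pderiv q = [:2 * real n, -2:] * [:2 * real n, -2:]"
    unfolding q_def by (simp add: pderiv_pCons power2_eq_square)
  moreover have "pderiv (bubble n t) = pcompose [:2 * real n, -2:] [:1 + 2 * real t, 1:]" for t
    unfolding bubble_def by (simp add: pderiv_pcompose pderiv_pCons one_pCons[symmetric])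
  ultimately have "pderiv (bubble n t) * pderiv (bubble n t) = pcompose (pderiv q) [:1 + 2 * real t, 1:]" for t
    by (simp only: pcompose_mult)
  then have "line_form n \<alpha> p (bubble n) (bubble n) = 2 * (poly q (2 * real n) - poly q 0)"
    unfolding line_form_def by (simp add: sum_pint_pcompose jump)
  also have "\<dots> = 16 / 3 * real n ^ 3" unfolding q_def by (simp add: power_eq_if algebra_simps)
  finally show ?thesis .
qed

subsection \<open>Matrices in the normalized Legendre basis\<close>

definition line_index :: "nat \<Rightarrow> nat \<Rightarrow> (nat \<times> nat) set" where
  "line_index n k = {..<n} \<times> {..k}"

text \<open>Scaled to be orthonormal in mean square on cells of length h. With mass matrices equal
  to the identity, the d-dimensional form becomes a sum of lifted line matrices.\<close>

definition line_basis :: "real \<Rightarrow> nat \<times> nat \<Rightarrow> nat \<Rightarrow> real poly" where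
  "line_basis h m t = (if t = fst m then Polynomial.smult (sqrt ((2 * real (snd m) + 1) / h)) (legendre (snd m)) else 0)"

definition line_expand :: "nat \<Rightarrow> nat \<Rightarrow> real \<Rightarrow> (nat \<times> nat \<Rightarrow> real) \<Rightarrow> nat \<Rightarrow> real poly" where
  "line_expand n k h u t = (\<Sum>m\<in>line_index n k. Polynomial.smult (u m) (line_basis h m t))"

definition line_coef :: "real \<Rightarrow> (nat \<Rightarrow> real poly) \<Rightarrow> nat \<times> nat \<Rightarrow> real" where
  "line_coef h w m = lcoef (w (fst m)) (snd m) * sqrt (h / (2 * real (snd m) + 1))"

definition line_mat :: "nat \<Rightarrow> real \<Rightarrow> real \<Rightarrow> nat \<Rightarrow> nat \<times> nat \<Rightarrow> nat \<times> nat \<Rightarrow> real" where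
  "line_mat n h \<alpha> p m m' = line_form n \<alpha> p (line_basis h m) (line_basis h m') / h"

lemma finite_line_index [simp]: "finite (line_index n k)"
  unfolding line_index_def by simp

lemma line_expand_eq:
  assumes "t < n"
  shows "line_expand n k h u t = (\<Sum>s\<le>k. Polynomial.smult (u (t, s) * sqrt ((2 * real s + 1) / h)) (legendre s))"
proof -
  have "line_expand n k h u t = (\<Sum>t'<n. \<Sum>s\<le>k. Polynomial.smult (u (t', s)) (line_basis h (t', s) t))"
    unfolding line_expand_def line_index_def by (simp add: sum.cartesian_product)
  also have "\<dots> = (\<Sum>t'<n. if t' = t then (\<Sum>s\<le>k. Polynomial.smult (u (t, s) * sqrt ((2 * real s + 1) / h)) (legendre s)) else 0)"
    by (rule sum.cong[OF refl]) (auto simp: line_basis_def)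
  finally show ?thesis using assms by simp
qed

lemma degree_line_expand: "Polynomial.degree (line_expand n k h u t) \<le> k"
  unfolding line_expand_def
  by (rule degree_sum_le)
    (auto simp: line_index_def line_basis_def intro: order_trans[OF degree_smult_le] order_trans[OF degree_legendre_le])

lemma line_expand_coef:
  assumes "t < n" "Polynomial.degree (w t) \<le> k" "h > 0"
  shows "line_expand n k h (line_coef h w) t = w t"
proof -
  have "sqrt (h / (2 * real s + 1)) * sqrt ((2 * real s + 1) / h) = 1" for s
    unfolding real_sqrt_mult[symmetric] using assms(3) by simp
  then have "line_expand n k h (line_coef h w) t = (\<Sum>s\<le>k. Polynomial.smult (lcoef (w t) s) (legendre s))"
    unfolding line_expand_eq[OF assms(1)] line_coef_def by (simp add: mult.assoc)
  then show ?thesis using legendre_expansion[OF assms(2)] by simp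
qed

lemma line_inner_expand:
  assumes "h > 0"
  shows "line_inner n (line_expand n k h u) (line_expand n k h v) = 2 / h * inner_on (line_index n k) u v"
proof -
  have "line_inner n (line_expand n k h u) (line_expand n k h v) = (\<Sum>t<n. \<Sum>s\<le>k. 2 / h * (u (t, s) * v (t, s)))"
    unfolding line_inner_def
  proof (rule sum.cong[OF refl])
    fix t assume "t \<in> {..<n}"
    then have t: "t < n" by simp
    have "pint (line_expand n k h u t * line_expand n k h v t)
      = (\<Sum>s\<le>k. (u (t, s) * sqrt ((2 * real s + 1) / h)) * (v (t, s) * sqrt ((2 * real s + 1) / h)) * (2 / (2 * real s + 1)))"
      unfolding line_expand_eq[OF t] by (rule pint_legendre_sums) simp
    also have "\<dots> = (\<Sum>s\<le>k. 2 / h * (u (t, s) * v (t, s)))"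
    proof (rule sum.cong[OF refl])
      fix s
      have sq: "sqrt ((2 * real s + 1) / h) * sqrt ((2 * real s + 1) / h) = (2 * real s + 1) / h" using assms by simp
      have "(sqrt ((2 * real s + 1) / h) * sqrt ((2 * real s + 1) / h)) * (2 / (2 * real s + 1)) = 2 / h"
      proof -
        have "w / h * (2 / w) = 2 / h" if "w > 0" for w :: real using that by simp
        moreover have "2 * real s + 1 > 0" by simp
        ultimately show ?thesis unfolding sq by blast
      qed
      moreover have "(a * q) * (b * q) * r = ((q * q) * r) * (a * b)" for a b q r :: real by simp
      ultimately show "(u (t, s) * sqrt ((2 * real s + 1) / h)) * (v (t, s) * sqrt ((2 * real s + 1) / h)) * (2 / (2 * real s + 1)) = 2 / h * (u (t, s) * v (t, s))"
        by presburger
    qed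
    finally show "pint (line_expand n k h u t * line_expand n k h v t) = (\<Sum>s\<le>k. 2 / h * (u (t, s) * v (t, s)))" .
  qed
  also have "\<dots> = 2 / h * (\<Sum>t<n. \<Sum>s\<le>k. u (t, s) * v (t, s))" unfolding sum_distrib_left ..
  finally show ?thesis unfolding inner_on_def line_index_def by (simp add: sum.cartesian_product)
qed

lemma line_form_0: "line_form n \<alpha> p (\<lambda>t. 0) v = 0"
  using line_form_smult[of n \<alpha> p 0 "\<lambda>t. 0" v] by simp

lemma line_form_sum:
  "line_form n \<alpha> p (\<lambda>t. \<Sum>m\<in>A. Polynomial.smult (u m) (b m t)) v = (\<Sum>m\<in>A. u m * line_form n \<alpha> p (b m) v)"
  by (induction A rule: infinite_finite_induct) (auto simp: line_form_0 line_form_add line_form_smult)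

lemma line_form_expand:
  assumes "h > 0"
  shows "line_form n \<alpha> p (line_expand n k h u) (line_expand n k h v)
    = h * inner_on (line_index n k) u (mat_app (line_index n k) (line_mat n h \<alpha> p) v)"
proof -
  have "line_form n \<alpha> p (line_expand n k h u) (line_expand n k h v)
    = (\<Sum>m\<in>line_index n k. u m * (\<Sum>m'\<in>line_index n k. v m' * line_form n \<alpha> p (line_basis h m) (line_basis h m')))"
    unfolding line_expand_def[abs_def] line_form_sum
    by (rule sum.cong[OF refl], subst line_form_commute, subst line_form_sum) (simp add: line_form_commute)
  also have "\<dots> = h * inner_on (line_index n k) u (mat_app (line_index n k) (line_mat n h \<alpha> p) v)"
    unfolding inner_on_def mat_app_def line_mat_def using assms by (simp add: sum_distrib_left ac_simps)
  finally show ?thesis .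
qed

lemma line_mat_symmetric: "line_mat n h \<alpha> p m m' = line_mat n h \<alpha> p m' m"
  unfolding line_mat_def by (simp add: line_form_commute)

lemma node_jump_cong: "(\<And>t. t < n \<Longrightarrow> u t = u' t) \<Longrightarrow> x \<le> n \<Longrightarrow> node_jump n u x = node_jump n u' x"
  unfolding node_jump_def by auto

lemma node_slope_cong: "n \<ge> 1 \<Longrightarrow> (\<And>t. t < n \<Longrightarrow> u t = u' t) \<Longrightarrow> x \<le> n \<Longrightarrow> node_slope n u x = node_slope n u' x"
  unfolding node_slope_def by auto

lemma line_form_cong:
  assumes "n \<ge> 1" "\<And>t. t < n \<Longrightarrow> u t = u' t" "\<And>t. t < n \<Longrightarrow> v t = v' t"
  shows "line_form n \<alpha> p u v = line_form n \<alpha> p u' v'"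
proof -
  have j: "node_jump n u x = node_jump n u' x" "node_jump n v x = node_jump n v' x" if "x \<le> n" for x
    using node_jump_cong[of n u u' x] node_jump_cong[of n v v' x] assms that by auto
  have s: "node_slope n u x = node_slope n u' x" "node_slope n v x = node_slope n v' x" if "x \<le> n" for x
    using node_slope_cong[of n u u' x] node_slope_cong[of n v v' x] assms that by auto
  show ?thesis unfolding line_form_def using assms(2,3) by (simp add: j s)
qed

lemma line_norm2_cong:
  assumes "\<And>t. t < n \<Longrightarrow> u t = u' t" shows "line_norm2 n p u = line_norm2 n p u'"
proof -
  have j: "node_jump n u x = node_jump n u' x" if "x \<le> n" for x
    using node_jump_cong[of n u u' x] assms that by auto
  show ?thesis unfolding line_norm2_def using assms by (simp add: j)
qed

lemma line_inner_cong:
  "(\<And>t. t < n \<Longrightarrow> u t = u' t) \<Longrightarrow> (\<And>t. t < n \<Longrightarrow> v t = v' t) \<Longrightarrow> line_inner n u v = line_inner n u' v'"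
  unfolding line_inner_def by auto

lemma lcoef_0: "Polynomial.degree q < s \<Longrightarrow> lcoef q s = 0"
  unfolding lcoef_def using legendre_orthogonal[of q s] by (simp add: mult.commute)

lemma line_expand_add: "line_expand n k h (\<lambda>m. u m + v m) t = line_expand n k h u t + line_expand n k h v t"
  unfolding line_expand_def by (simp add: smult_add_left sum.distrib)

lemma line_expand_smult: "line_expand n k h (\<lambda>m. c * u m) t = Polynomial.smult c (line_expand n k h u t)"
  unfolding line_expand_def by (simp add: smult_sum2)

lemma line_expand_diff: "line_expand n k h (\<lambda>m. u m - v m) t = line_expand n k h u t - line_expand n k h v t"
  unfolding line_expand_def by (simp add: smult_diff_left sum_subtractf)

lemma linear_map_matrix:
  fixes F :: "('a \<Rightarrow> real) \<Rightarrow> 'b \<Rightarrow> real"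
  assumes add: "\<And>u v x. F (\<lambda>m. u m + v m) x = F u x + F v x" and scale: "\<And>c u x. F (\<lambda>m. c * u m) x = c * F u x"
    and fin: "finite A"
  shows "F (\<lambda>m. \<Sum>a\<in>A. c a * b a m) x = (\<Sum>a\<in>A. F (b a) x * c a)"
  using fin
proof (induction A)
  case empty
  have "F (\<lambda>m. 0 * (0::real)) x = 0 * F (\<lambda>m. 0) x" by (rule scale)
  then show ?case by simp
next
  case (insert a A)
  then show ?case by (simp add: add scale mult.commute)
qed

text \<open>\<open>J0\<close> is the matrix of the map sending u first to its data S u and then to
  the interpolant of these data; that the interpolant has degree at most k - 1 means that its rows
  with degree index k or more vanish. \<open>line_approximation\<close> supplies the two accuracy
  hypotheses of \<open>regularized_approximation\<close>, and J is J0 composed with the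
  resolvent.\<close>

lemma line_discretization:
  assumes n: "n \<ge> 1" and k: "k \<ge> 2" and kp: "k \<le> p" and c: "c > 0" and C: "C \<ge> 0" and h: "h > 0"
    and garding: "\<And>u. (\<And>t. Polynomial.degree (u t) \<le> k) \<Longrightarrow> c * line_norm2 n p u \<le> line_form n \<alpha> p u u + C * h\<^sup>2 * line_inner n u u"
    and small: "C * h\<^sup>2 * 288 \<le> c / 2 * (real k)\<^sup>2" and hk: "h \<le> real k"
  defines "I \<equiv> line_index n k" and "S \<equiv> line_mat n h \<alpha> p" and "\<delta> \<equiv> h / real k" and "C0 \<equiv> 2 * C + 1"
    and "D \<equiv> 2 + (12 * (48 / c + 4) + 60) * (1 + (2 * C + 1))\<^sup>2"
  shows "\<exists>B J. (\<forall>i\<in>I. \<forall>j\<in>I. B i j = B j i) \<and>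
    (\<forall>u. \<forall>i\<in>I. mat_app I B (mat_app I B u) i = mat_app I S u i + C0 * u i) \<and>
    (\<forall>u. nrm I (mat_app I J u) \<le> D * nrm I u) \<and>
    (\<forall>u. nrm I (mat_app I B (mat_app I J u)) \<le> D * nrm I (mat_app I B u)) \<and>
    (\<forall>u. nrm I (\<lambda>i. u i - mat_app I J u i) \<le> D * \<delta> * nrm I (mat_app I B u)) \<and>
    (\<forall>u. nrm I (mat_app I B (\<lambda>i. u i - mat_app I J u i)) \<le> D * \<delta> * nrm I (mat_app I B (mat_app I B u))) \<and>
    (\<forall>m m'. snd m \<ge> k \<longrightarrow> J m m' = 0)"
proof -
  define K where "K = 48 / c + 4"
  define K1 where "K1 = 12 * K + 60"
  have K: "K \<ge> 4" unfolding K_def using c by simp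
  have k0: "real k > 0" using k by simp
  let ?E = "line_expand n k h"
  have fin: "finite I" unfolding I_def by simp
  have inner: "inner_on I u v = h / 2 * line_inner n (?E u) (?E v)" for u v
    unfolding line_inner_expand[OF h] I_def using h by simp
  have form: "inner_on I u (mat_app I S v) = line_form n \<alpha> p (?E u) (?E v) / h" for u v
    unfolding line_form_expand[OF h] I_def S_def using h by simp
  \<comment> \<open>The factor h^2 / 4 converts between the scalings: the line form is h times the
    matrix form, while twice the line inner product is 4 / h times the Euclidean one.\<close>
  define g where "g u = ?E (\<lambda>m. h\<^sup>2 / 4 * mat_app I S u m)" for u
  define F where "F u = line_coef h (line_interp n k (g u))" for u
  have dg: "Polynomial.degree (g u t) \<le> k" for u t unfolding g_def by (rule degree_line_expand)
  have g_inner: "line_inner n (g u) (?E v) = h / 2 * inner_on I (mat_app I S u) v" for u v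
    unfolding g_def line_inner_expand[OF h] inner_on_scale I_def[symmetric] using h by (simp add: power2_eq_square)
  have gg: "line_inner n (g u) (g u) = h ^ 3 / 8 * inner_on I (mat_app I S u) (mat_app I S u)" for u
    unfolding g_def line_inner_expand[OF h] inner_on_scale I_def[symmetric] using h by (simp add: power2_eq_square power3_eq_cube)
  have ug: "line_form n \<alpha> p (?E u) v = 2 * line_inner n (g u) v" if dv: "\<And>t. Polynomial.degree (v t) \<le> k" for u v
  proof -
    define v' where "v' = line_coef h v"
    have v': "?E v' t = v t" if "t < n" for t unfolding v'_def by (rule line_expand_coef[OF that dv h])
    have "line_form n \<alpha> p (?E u) v = line_form n \<alpha> p (?E v') (?E u)"
      unfolding line_form_commute[of n \<alpha> p "?E u" v] by (rule line_form_cong[OF n]) (simp_all add: v')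
    also have "\<dots> = h * inner_on I v' (mat_app I S u)" using form[of v' u] h by (simp add: field_simps)
    also have "\<dots> = 2 * line_inner n (g u) (?E v')" unfolding g_inner by (simp add: inner_on_commute)
    also have "line_inner n (g u) (?E v') = line_inner n (g u) v" by (rule line_inner_cong) (simp_all add: v')
    finally show ?thesis .
  qed
  have approx: "Polynomial.degree (line_interp n k (g u) t) \<le> k - 1"
    "sqrt (line_inner n (\<lambda>t. ?E u t - line_interp n k (g u) t) (\<lambda>t. ?E u t - line_interp n k (g u) t))
       \<le> (12 * K + 60) / (real k)\<^sup>2 * sqrt (line_inner n (g u) (g u))"
    "line_form n \<alpha> p (\<lambda>t. ?E u t - line_interp n k (g u) t) (\<lambda>t. ?E u t - line_interp n k (g u) t)
       \<le> 24 * K / (real k)\<^sup>2 * line_inner n (g u) (g u)" for u t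
    by (rule line_approximation[OF n k kp c C garding small degree_line_expand dg ug, folded K_def]; blast)+
  define J0 where "J0 m m' = F (\<lambda>x. if x = m' then 1 else 0) m" for m m'
  have g_add: "g (\<lambda>m. u m + v m) t = g u t + g v t" for u v t
    unfolding g_def line_expand_add[symmetric] by (simp add: mat_app_add distrib_left)
  have g_scale: "g (\<lambda>m. c * u m) t = Polynomial.smult c (g u t)" for c u t
    unfolding g_def line_expand_smult[symmetric] by (simp add: mat_app_scale ac_simps)
  have F_add: "F (\<lambda>m. u m + v m) x = F u x + F v x" for u v x
    unfolding F_def line_coef_def g_add[abs_def] line_interp_add lcoef_add by (simp add: distrib_right)
  have F_scale: "F (\<lambda>m. c * u m) x = c * F u x" for c u x
    unfolding F_def line_coef_def g_scale[abs_def] line_interp_smult lcoef_smult by simp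
  have J0: "mat_app I J0 u m = F u m" for u m
  proof -
    have "F u m = F (\<lambda>x. \<Sum>m'\<in>I. u m' * (if x = m' then 1 else 0)) m"
    proof -
      have "mat_app I S u = mat_app I S (\<lambda>x. \<Sum>m'\<in>I. u m' * (if x = m' then 1 else 0))"
        by (rule ext, rule mat_app_cong) (use fin in \<open>simp add: if_distrib cong: if_cong\<close>)
      then show ?thesis unfolding F_def g_def by simp
    qed
    also have "\<dots> = (\<Sum>m'\<in>I. J0 m m' * u m')" unfolding J0_def by (rule linear_map_matrix[OF F_add F_scale fin])
    finally show ?thesis unfolding mat_app_def ..
  qed
  have J0_zero: "J0 m m' = 0" if "snd m \<ge> k" for m m'
  proof -
    have "Polynomial.degree (line_interp n k (g (\<lambda>x. if x = m' then 1 else 0)) (fst m)) < snd m"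
      using approx(1)[of "\<lambda>x. if x = m' then 1 else 0" "fst m"] that k by linarith
    then show ?thesis unfolding J0_def F_def line_coef_def by (simp add: lcoef_0)
  qed
  define y where "y u = (\<lambda>t. ?E u t - line_interp n k (g u) t)" for u
  have yE: "?E (\<lambda>i. u i - mat_app I J0 u i) t = y u t" if "t < n" for u t
  proof -
    have "Polynomial.degree (line_interp n k (g u) t) \<le> k" using approx(1)[of u t] by linarith
    then have "?E (F u) t = line_interp n k (g u) t" unfolding F_def by (intro line_expand_coef[OF that _ h])
    then show ?thesis unfolding y_def line_expand_diff J0 by simp
  qed
  have nS: "nrm I (mat_app I S u) = sqrt (inner_on I (mat_app I S u) (mat_app I S u))" for u unfolding nrm_def ..
  have approx0: "nrm I (\<lambda>i. u i - mat_app I J0 u i) \<le> K1 * \<delta>\<^sup>2 * nrm I (mat_app I S u)" for u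
  proof -
    have "inner_on I (\<lambda>i. u i - mat_app I J0 u i) (\<lambda>i. u i - mat_app I J0 u i) = h / 2 * line_inner n (y u) (y u)"
      unfolding inner by (rule arg_cong[where f = "\<lambda>z. h / 2 * z"], rule line_inner_cong) (simp_all add: yE)
    then have "nrm I (\<lambda>i. u i - mat_app I J0 u i) = sqrt (h / 2) * sqrt (line_inner n (y u) (y u))"
      unfolding nrm_def by (simp only: real_sqrt_mult)
    also have "\<dots> \<le> sqrt (h / 2) * (K1 / (real k)\<^sup>2 * sqrt (line_inner n (g u) (g u)))"
      using approx(2)[of u] h unfolding y_def K1_def by (intro mult_left_mono) auto
    also have "\<dots> = K1 / (real k)\<^sup>2 * (sqrt (h / 2) * sqrt (h ^ 3 / 8)) * nrm I (mat_app I S u)"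
      unfolding gg nS by (simp add: real_sqrt_mult[symmetric] mult.assoc)
    also have "sqrt (h / 2) * sqrt (h ^ 3 / 8) = h\<^sup>2 / 4"
    proof -
      have "sqrt (h / 2) * sqrt (h ^ 3 / 8) = sqrt ((h\<^sup>2 / 4)\<^sup>2)"
        unfolding real_sqrt_mult[symmetric] by (rule arg_cong[where f = sqrt]) (simp add: power2_eq_square power3_eq_cube)
      then show ?thesis by simp
    qed
    also have "K1 / (real k)\<^sup>2 * (h\<^sup>2 / 4) * nrm I (mat_app I S u) \<le> K1 * \<delta>\<^sup>2 * nrm I (mat_app I S u)"
    proof (rule mult_right_mono)
      have "K1 * \<delta>\<^sup>2 / 4 \<le> K1 * \<delta>\<^sup>2" unfolding K1_def using K by simp
      then show "K1 / (real k)\<^sup>2 * (h\<^sup>2 / 4) \<le> K1 * \<delta>\<^sup>2" unfolding \<delta>_def by (simp add: power_divide)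
    qed (rule nrm_nonneg)
    finally show ?thesis .
  qed
  have approx1: "let y = \<lambda>i. u i - mat_app I J0 u i in inner_on I y (mat_app I S y) \<le> (K1 * \<delta> * nrm I (mat_app I S u))\<^sup>2" for u
    unfolding Let_def
  proof -
    let ?y = "\<lambda>i. u i - mat_app I J0 u i"
    have "inner_on I ?y (mat_app I S ?y) = line_form n \<alpha> p (y u) (y u) / h"
      unfolding form by (rule arg_cong[where f = "\<lambda>z. z / h"], rule line_form_cong[OF n]) (simp_all add: yE)
    also have "\<dots> \<le> 24 * K / (real k)\<^sup>2 * line_inner n (g u) (g u) / h"
      using approx(3)[of u] h unfolding y_def by (intro divide_right_mono) auto
    also have "\<dots> = 3 * K * \<delta>\<^sup>2 * (nrm I (mat_app I S u))\<^sup>2"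
      unfolding gg nrm_sq \<delta>_def using h by (simp add: power_divide power2_eq_square power3_eq_cube)
    also have "\<dots> \<le> K1\<^sup>2 * \<delta>\<^sup>2 * (nrm I (mat_app I S u))\<^sup>2"
    proof (intro mult_right_mono)
      have "3 * K \<le> 12 * K * (12 * K)" using K by simp
      also have "\<dots> \<le> K1\<^sup>2" unfolding K1_def power2_eq_square using K by (intro mult_mono) auto
      finally show "3 * K \<le> K1\<^sup>2" .
    qed auto
    finally show "inner_on I ?y (mat_app I S ?y) \<le> (K1 * \<delta> * nrm I (mat_app I S u))\<^sup>2" by (simp add: power_mult_distrib)
  qed
  have ge1: "inner_on I u u \<le> inner_on I u (mat_app I S u) + C0 * inner_on I u u" for u
  proof -
    have "0 \<le> c * line_norm2 n p (?E u)" using c line_norm2_nonneg by simp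
    also have "\<dots> \<le> line_form n \<alpha> p (?E u) (?E u) + C * h\<^sup>2 * line_inner n (?E u) (?E u)"
      by (rule garding[OF degree_line_expand])
    finally have "0 \<le> (line_form n \<alpha> p (?E u) (?E u) + C * h\<^sup>2 * line_inner n (?E u) (?E u)) / h" using h by simp
    then have "0 \<le> inner_on I u (mat_app I S u) + 2 * C * inner_on I u u"
      unfolding form inner[of u u] using h by (simp add: add_divide_distrib power2_eq_square)
    then show ?thesis unfolding C0_def by (simp add: algebra_simps)
  qed
  have \<delta>: "0 < \<delta>" "\<delta> \<le> 1" unfolding \<delta>_def using h k0 hk by auto
  have sym: "S i j = S j i" for i j unfolding S_def by (rule line_mat_symmetric)
  have pre: "C0 \<ge> 0" "K1 \<ge> 0" unfolding C0_def K1_def using C K by auto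
  obtain B R where BR: "\<forall>i\<in>I. \<forall>j\<in>I. B i j = B j i"
    "\<forall>u. \<forall>i\<in>I. mat_app I B (mat_app I B u) i = mat_app I S u i + C0 * u i"
    "\<forall>u. nrm I (mat_app I J0 (mat_app I R u)) \<le> (2 + K1 * (1 + C0)\<^sup>2) * nrm I u"
    "\<forall>u. nrm I (mat_app I B (mat_app I J0 (mat_app I R u))) \<le> (2 + K1 * (1 + C0)\<^sup>2) * nrm I (mat_app I B u)"
    "\<forall>u. nrm I (\<lambda>i. u i - mat_app I J0 (mat_app I R u) i) \<le> (2 + K1 * (1 + C0)\<^sup>2) * \<delta> * nrm I (mat_app I B u)"
    "\<forall>u. nrm I (mat_app I B (\<lambda>i. u i - mat_app I J0 (mat_app I R u) i)) \<le> (2 + K1 * (1 + C0)\<^sup>2) * \<delta> * nrm I (mat_app I B (mat_app I B u))"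
    using regularized_approximation[of I S C0 K1 \<delta> J0, OF fin sym pre \<delta> ge1 approx0 approx1] by blast
  define J where "J m m' = (\<Sum>j\<in>I. J0 m j * R j m')" for m m'
  have J: "mat_app I J u = mat_app I J0 (mat_app I R u)" for u
  proof
    fix i
    have "mat_app I J u i = (\<Sum>m'\<in>I. \<Sum>j\<in>I. J0 i j * (R j m' * u m'))"
      unfolding mat_app_def J_def sum_distrib_right by (simp add: mult.assoc)
    also have "\<dots> = (\<Sum>j\<in>I. \<Sum>m'\<in>I. J0 i j * (R j m' * u m'))" by (rule sum.swap)
    finally show "mat_app I J u i = mat_app I J0 (mat_app I R u) i" unfolding mat_app_def sum_distrib_left .
  qed
  have D: "D = 2 + K1 * (1 + C0)\<^sup>2" unfolding D_def K1_def K_def C0_def ..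
  have JH: "\<forall>m m'. snd m \<ge> k \<longrightarrow> J m m' = 0" unfolding J_def by (simp add: J0_zero)
  show ?thesis
    by (rule exI[of _ B], rule exI[of _ J]) (use BR JH in \<open>simp add: J D\<close>)
qed

subsection \<open>The interior penalty form of tensor products\<close>

text \<open>Lebesgue measure on the vector space is the image of a product measure indexed by the
  basis vectors; reindexing these by coordinates reduces the claim to integrals of products over
  product measures.\<close>

lemma has_bochner_integral_lborel_cart_prod:
  fixes g :: "'d::finite \<Rightarrow> real \<Rightarrow> real"
  assumes g: "\<And>i. has_bochner_integral lborel (g i) (c i)"
  shows "has_bochner_integral (lborel :: (real ^ 'd) measure) (\<lambda>x. \<Prod>i\<in>UNIV. g i (x $ i)) (\<Prod>i\<in>UNIV. c i)"
proof -
  interpret product_sigma_finite "\<lambda>_ :: real ^ 'd. lborel :: real measure" by standard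
  define G where "G f = (\<Prod>b\<in>Basis. g (axis_index b) (f b))" for f :: "real ^ 'd \<Rightarrow> real"
  define \<Phi> where "\<Phi> f = (\<Sum>b\<in>Basis. f b *\<^sub>R b)" for f :: "real ^ 'd \<Rightarrow> real"
  have Basis: "(Basis :: (real ^ 'd) set) = range (\<lambda>i. axis i 1)" by (auto simp: Basis_vec_def)
  have inj: "inj (\<lambda>i :: 'd. axis i (1 :: real))" by (auto simp: inj_def axis_eq_axis)
  have re: "(\<Prod>b\<in>(Basis :: (real ^ 'd) set). F (axis_index b) b) = (\<Prod>i\<in>UNIV. F i (axis i 1))" for F :: "'d \<Rightarrow> real ^ 'd \<Rightarrow> real"
    unfolding Basis by (simp add: prod.reindex[OF inj] axis_index_axis)
  have gi: "integrable lborel (g i)" "integral\<^sup>L lborel (g i) = c i" for i using g[of i] by (simp_all add: has_bochner_integral_iff)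
  have meas: "g i \<in> borel_measurable borel" for i using gi(1)[of i] by (simp add: borel_measurable_integrable)
  have G: "integrable (\<Pi>\<^sub>M b\<in>Basis. lborel) G" "integral\<^sup>L (\<Pi>\<^sub>M b\<in>Basis. lborel) G = (\<Prod>i\<in>UNIV. c i)"
  proof -
    show "integrable (\<Pi>\<^sub>M b\<in>Basis. lborel) G" unfolding G_def by (rule product_integrable_prod) (auto simp: gi)
    have "integral\<^sup>L (\<Pi>\<^sub>M b\<in>Basis. lborel) G = (\<Prod>b\<in>(Basis :: (real ^ 'd) set). integral\<^sup>L lborel (g (axis_index b)))"
      unfolding G_def by (rule product_integral_prod) (auto simp: gi)
    then show "integral\<^sup>L (\<Pi>\<^sub>M b\<in>Basis. lborel) G = (\<Prod>i\<in>UNIV. c i)" using re[of "\<lambda>i b. c i"] by (simp add: gi)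
  qed
  have \<Phi>c: "\<Phi> f $ i = f (axis i 1)" for f i
  proof -
    have "\<Phi> f = (\<Sum>i\<in>UNIV. f (axis i 1) *\<^sub>R axis i 1)" unfolding \<Phi>_def Basis by (simp add: sum.reindex[OF inj])
    then have "\<Phi> f $ i = (\<Sum>k\<in>UNIV. f (axis k 1) * (axis k 1 $ i))" by simp
    also have "\<dots> = (\<Sum>k\<in>UNIV. if k = i then f (axis i 1) else 0)" by (rule sum.cong) (auto simp: axis_def)
    finally show ?thesis by simp
  qed
  have comp: "(\<Prod>i\<in>UNIV. g i (\<Phi> f $ i)) = G f" for f unfolding G_def \<Phi>c using re[of "\<lambda>i b. g i (f b)"] by simp
  have m\<Phi>: "\<Phi> \<in> measurable (\<Pi>\<^sub>M b\<in>Basis. lborel) borel" unfolding \<Phi>_def by measurable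
  have mF: "(\<lambda>x :: real ^ 'd. \<Prod>i\<in>UNIV. g i (x $ i)) \<in> borel_measurable borel"
  proof (rule borel_measurable_prod)
    fix i :: 'd
    have "(\<lambda>x :: real ^ 'd. x $ i) \<in> borel_measurable borel"
      by (intro borel_measurable_continuous_onI continuous_intros)
    then show "(\<lambda>x :: real ^ 'd. g i (x $ i)) \<in> borel_measurable borel" using meas[of i] by (rule measurable_compose)
  qed
  have "integrable (lborel :: (real ^ 'd) measure) (\<lambda>x. \<Prod>i\<in>UNIV. g i (x $ i))"
    unfolding lborel_eq[where 'a = "real ^ 'd"] \<Phi>_def[symmetric]
    by (subst integrable_distr_eq[OF m\<Phi> mF]) (simp add: comp G)
  moreover have "integral\<^sup>L (lborel :: (real ^ 'd) measure) (\<lambda>x. \<Prod>i\<in>UNIV. g i (x $ i)) = (\<Prod>i\<in>UNIV. c i)"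
    unfolding lborel_eq[where 'a = "real ^ 'd"] \<Phi>_def[symmetric]
    by (subst integral_distr[OF m\<Phi> mF]) (simp add: comp G)
  ultimately show ?thesis by (simp add: has_bochner_integral_iff)
qed

text \<open>The bridge between Lebesgue integrals and the algebraic \<open>pint\<close>; h / 2 is
  the Jacobian of the map from the reference interval.\<close>

lemma has_bochner_integral_poly_cell:
  fixes a h :: real
  assumes h: "h > 0"
  shows "has_bochner_integral lborel (\<lambda>x. indicator {a .. a + h} x * poly q (2 * (x - a) / h - 1)) (h / 2 * pint q)"
proof -
  define F where "F x = h / 2 * poly (anti q) (2 * (x - a) / h - 1)" for x
  have "has_bochner_integral lborel (\<lambda>x. poly q (2 * (x - a) / h - 1) * indicator {a .. a + h} x) (F (a + h) - F a)"
  proof (rule has_bochner_integral_FTC_Icc_real)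
    fix x
    have "DERIV (\<lambda>x. poly (anti q) (2 * (x - a) / h - 1)) x :> poly (pderiv (anti q)) (2 * (x - a) / h - 1) * (2 / h)"
      by (rule DERIV_chain2[OF poly_DERIV]) (use h in \<open>auto intro!: derivative_eq_intros\<close>)
    from DERIV_cmult[OF this, of "h / 2"] show "DERIV F x :> poly q (2 * (x - a) / h - 1)"
      unfolding F_def pderiv_anti using h by simp
    show "isCont (\<lambda>x. poly q (2 * (x - a) / h - 1)) x" by (intro continuous_intros) (use h in auto)
  qed (use h in auto)
  moreover have "F (a + h) - F a = h / 2 * pint q" unfolding F_def pint_def using h by (simp add: algebra_simps)
  ultimately show ?thesis by (simp add: mult.commute)
qed

definition pfun :: "'d::finite cartesian_mesh \<Rightarrow> ('d \<Rightarrow> nat) \<Rightarrow> ('d \<Rightarrow> real poly) \<Rightarrow> real ^ 'd \<Rightarrow> real" where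
  "pfun M T q x = (\<Prod>i\<in>UNIV. poly (q i) (to_reference M T x $ i))"

lemma to_reference_nth: "to_reference M T x $ i = 2 * (x $ i - (origin M $ i + edge M * real (T i))) / edge M - 1"
  unfolding to_reference_def by (simp add: algebra_simps)

lemma pfun_mult: "pfun M T q x * pfun M T r x = pfun M T (\<lambda>i. q i * r i) x"
  unfolding pfun_def by (simp add: prod.distrib)

lemma gradient_eqI:
  assumes "GDERIV f x :> D" shows "gradient f x = D"
  unfolding gradient_def
proof (rule the_equality)
  fix D' assume "GDERIV f x :> D'"
  then have "(\<lambda>h. h \<bullet> D') = (\<lambda>h. h \<bullet> D)" using assms unfolding gderiv_def by (rule has_derivative_unique)
  then have "\<forall>h. h \<bullet> D' = h \<bullet> D" by meson
  then show "D' = D" using vector_eq_ldot by blast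
qed (rule assms)

lemma GDERIV_pfun:
  assumes h: "edge M > 0"
  shows "GDERIV (pfun M T q) x :> (\<chi> i. 2 / edge M * pfun M T (q(i := pderiv (q i))) x)"
proof -
  let ?\<xi> = "\<lambda>i. to_reference M T x $ i"
  have f: "((\<lambda>x. poly (q i) (to_reference M T x $ i)) has_derivative (\<lambda>v. poly (pderiv (q i)) (?\<xi> i) * (2 / edge M * v $ i))) (at x)" for i
  proof -
    have "((\<lambda>x. to_reference M T x $ i) has_derivative (\<lambda>v. 2 / edge M * v $ i)) (at x)"
      unfolding to_reference_nth using h by (auto intro!: derivative_eq_intros bounded_linear.has_derivative[OF bounded_linear_vec_nth])
    moreover have "(poly (q i) has_derivative (\<lambda>z. poly (pderiv (q i)) (?\<xi> i) * z)) (at (?\<xi> i))"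
      using poly_DERIV[of "q i" "?\<xi> i"] unfolding has_field_derivative_def .
    ultimately show ?thesis by (rule has_derivative_compose)
  qed
  have "(pfun M T q has_derivative (\<lambda>v. \<Sum>i\<in>UNIV. poly (pderiv (q i)) (?\<xi> i) * (2 / edge M * v $ i) * (\<Prod>j\<in>UNIV - {i}. poly (q j) (?\<xi> j)))) (at x)"
    unfolding pfun_def[abs_def] by (rule has_derivative_prod) (rule f)
  moreover have "(\<lambda>v. \<Sum>i\<in>UNIV. poly (pderiv (q i)) (?\<xi> i) * (2 / edge M * v $ i) * (\<Prod>j\<in>UNIV - {i}. poly (q j) (?\<xi> j)))
    = (\<lambda>v. v \<bullet> (\<chi> i. 2 / edge M * pfun M T (q(i := pderiv (q i))) x))"
  proof
    fix v :: "real ^ 'a"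
    have "pfun M T (q(i := pderiv (q i))) x = poly (pderiv (q i)) (?\<xi> i) * (\<Prod>j\<in>UNIV - {i}. poly (q j) (?\<xi> j))" for i
      unfolding pfun_def by (subst prod.remove[of UNIV i]) auto
    then show "(\<Sum>i\<in>UNIV. poly (pderiv (q i)) (?\<xi> i) * (2 / edge M * v $ i) * (\<Prod>j\<in>UNIV - {i}. poly (q j) (?\<xi> j)))
      = v \<bullet> (\<chi> i. 2 / edge M * pfun M T (q(i := pderiv (q i))) x)"
      unfolding inner_vec_def by (simp add: ac_simps)
  qed
  ultimately show ?thesis unfolding gderiv_def by simp
qed

lemma gradient_sum_pfun:
  assumes h: "edge M > 0"
  shows "gradient (\<lambda>x. \<Sum>n\<in>A. f n * pfun M T (q n) x) x
    = (\<chi> i. \<Sum>n\<in>A. f n * (2 / edge M * pfun M T ((q n)(i := pderiv (q n i))) x))"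
proof -
  have "GDERIV (\<lambda>x. \<Sum>n\<in>A. f n * pfun M T (q n) x) x :> (\<Sum>n\<in>A. f n *\<^sub>R (\<chi> i. 2 / edge M * pfun M T ((q n)(i := pderiv (q n i))) x))"
    unfolding gderiv_def inner_sum_right inner_scaleR_right
    by (intro has_derivative_sum has_derivative_mult_right GDERIV_pfun[OF h, unfolded gderiv_def])
  then have "gradient (\<lambda>x. \<Sum>n\<in>A. f n * pfun M T (q n) x) x = (\<Sum>n\<in>A. f n *\<^sub>R (\<chi> i. 2 / edge M * pfun M T ((q n)(i := pderiv (q n i))) x))"
    by (rule gradient_eqI)
  also have "\<dots> = (\<chi> i. \<Sum>n\<in>A. f n * (2 / edge M * pfun M T ((q n)(i := pderiv (q n i))) x))"
    unfolding Finite_Cartesian_Product.vec_eq_iff by (simp add: mult.assoc)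
  finally show ?thesis .
qed

lemma has_bochner_integral_pfun_cell:
  assumes h: "edge M > 0"
  shows "has_bochner_integral lborel (\<lambda>x. indicator (cell_set M T) x *\<^sub>R pfun M T q x) (\<Prod>i\<in>UNIV. edge M / 2 * pint (q i))"
proof -
  let ?a = "\<lambda>i. origin M $ i + edge M * real (T i)"
  have "has_bochner_integral lborel (\<lambda>x :: real ^ 'a. \<Prod>i\<in>UNIV. indicator {?a i .. ?a i + edge M} (x $ i) * poly (q i) (2 * (x $ i - ?a i) / edge M - 1))
    (\<Prod>i\<in>UNIV. edge M / 2 * pint (q i))"
    by (rule has_bochner_integral_lborel_cart_prod) (rule has_bochner_integral_poly_cell[OF h])
  moreover have "indicator (cell_set M T) x *\<^sub>R pfun M T q x
    = (\<Prod>i\<in>UNIV. indicator {?a i .. ?a i + edge M} (x $ i) * poly (q i) (2 * (x $ i - ?a i) / edge M - 1))" for x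
  proof -
    have "(indicator (cell_set M T) x :: real) = (\<Prod>i\<in>UNIV. indicator {?a i .. ?a i + edge M} (x $ i))"
    proof (cases "x \<in> cell_set M T")
      case True
      then show ?thesis unfolding cell_set_def by (simp add: mem_box_cart indicator_def distrib_left add.assoc)
    next
      case False
      then obtain i where "x $ i \<notin> {?a i .. ?a i + edge M}"
        unfolding cell_set_def mem_box_cart by (auto simp: distrib_left add.assoc)
      then have "indicator {?a i .. ?a i + edge M} (x $ i) = (0::real)" by simp
      then have "(\<Prod>i\<in>UNIV. indicator {?a i .. ?a i + edge M} (x $ i)) = (0::real)" by (intro prod_zero bexI[of _ i]) auto
      then show ?thesis using False by simp
    qed
    then show ?thesis unfolding pfun_def to_reference_nth by (simp add: prod.distrib)
  qed
  ultimately show ?thesis by simp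
qed

lemma sum_cells_prod: "(\<Sum>T\<in>cells M. \<Prod>i\<in>UNIV. F i (T i)) = (\<Prod>i\<in>UNIV. \<Sum>t<cells_along M i. F i t)" for F :: "'d::finite \<Rightarrow> nat \<Rightarrow> real"
proof -
  have "cells M = PiE UNIV (\<lambda>i. {..<cells_along M i})" unfolding cells_def by auto
  then show ?thesis by (simp add: prod_sum_PiE)
qed

text \<open>The i-th component of the gradient differentiates the i-th factor only, and the sum over
  cells of a product of one-dimensional integrals is the product of sums along the lines. The factor
  2 / h is (2 / h)^2 from the two derivatives times the Jacobian h / 2 in direction i.\<close>

lemma cells_part:
  fixes b :: "'n \<Rightarrow> 'd::finite \<Rightarrow> nat \<Rightarrow> real poly" and A :: "'n set"
  assumes h: "edge M > 0"
  defines "comb \<equiv> \<lambda>f T x. \<Sum>n\<in>A. f n * pfun M T (\<lambda>i. b n i (T i)) x"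
  shows "(\<Sum>T\<in>cells M. set_lebesgue_integral lborel (cell_set M T) (\<lambda>x. gradient (comb f T) x \<bullet> gradient (comb g T) x))
    = (\<Sum>n\<in>A. \<Sum>n'\<in>A. f n * g n' * (\<Sum>i\<in>UNIV. 2 / edge M * (\<Sum>t<cells_along M i. pint (pderiv (b n i t) * pderiv (b n' i t)))
        * (\<Prod>j\<in>UNIV - {i}. edge M / 2 * line_inner (cells_along M j) (b n j) (b n' j))))"
proof -
  let ?h = "edge M"
  define Q where "Q n i T = (\<lambda>j. b n j (T j))(i := pderiv (b n i (T i)))" for n i and T :: "'d \<Rightarrow> nat"
  have grad: "gradient (comb f T) x = (\<chi> i. \<Sum>n\<in>A. f n * (2 / ?h * pfun M T (Q n i T) x))" for f T x
    unfolding comb_def Q_def by (rule gradient_sum_pfun[OF h])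
  have cell: "set_lebesgue_integral lborel (cell_set M T) (\<lambda>x. gradient (comb f T) x \<bullet> gradient (comb g T) x)
    = (\<Sum>i\<in>UNIV. \<Sum>n\<in>A. \<Sum>n'\<in>A. f n * g n' * (2 / ?h)\<^sup>2 * (\<Prod>j\<in>UNIV. ?h / 2 * pint (Q n i T j * Q n' i T j)))" for T
    unfolding set_lebesgue_integral_def
  proof (rule has_bochner_integral_integral_eq)
    have "has_bochner_integral lborel (\<lambda>x. \<Sum>i\<in>UNIV. \<Sum>n\<in>A. \<Sum>n'\<in>A. (f n * g n' * (2 / ?h)\<^sup>2) * (indicator (cell_set M T) x *\<^sub>R pfun M T (\<lambda>j. Q n i T j * Q n' i T j) x))
      (\<Sum>i\<in>UNIV. \<Sum>n\<in>A. \<Sum>n'\<in>A. (f n * g n' * (2 / ?h)\<^sup>2) * (\<Prod>j\<in>UNIV. ?h / 2 * pint (Q n i T j * Q n' i T j)))"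
      by (intro has_bochner_integral_sum has_bochner_integral_mult_right has_bochner_integral_pfun_cell[OF h])
    moreover have "(\<Sum>i\<in>UNIV. \<Sum>n\<in>A. \<Sum>n'\<in>A. (f n * g n' * (2 / ?h)\<^sup>2) * (indicator (cell_set M T) x *\<^sub>R pfun M T (\<lambda>j. Q n i T j * Q n' i T j) x))
      = indicator (cell_set M T) x *\<^sub>R (gradient (comb f T) x \<bullet> gradient (comb g T) x)" for x
    proof -
      have "gradient (comb f T) x \<bullet> gradient (comb g T) x
        = (\<Sum>i\<in>UNIV. \<Sum>n\<in>A. \<Sum>n'\<in>A. (f n * (2 / ?h * pfun M T (Q n i T) x)) * (g n' * (2 / ?h * pfun M T (Q n' i T) x)))"
        unfolding grad inner_vec_def by (simp add: sum_product)
      then show ?thesis unfolding pfun_mult[symmetric] real_scaleR_def sum_distrib_left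
        by (simp add: sum_distrib_left) (intro sum.cong refl, simp add: power2_eq_square)
    qed
    ultimately show "has_bochner_integral lborel (\<lambda>x. indicator (cell_set M T) x *\<^sub>R (gradient (comb f T) x \<bullet> gradient (comb g T) x))
      (\<Sum>i\<in>UNIV. \<Sum>n\<in>A. \<Sum>n'\<in>A. f n * g n' * (2 / ?h)\<^sup>2 * (\<Prod>j\<in>UNIV. ?h / 2 * pint (Q n i T j * Q n' i T j)))" by simp
  qed
  have sumT: "(2 / ?h)\<^sup>2 * (\<Sum>T\<in>cells M. \<Prod>j\<in>UNIV. ?h / 2 * pint (Q n i T j * Q n' i T j))
    = 2 / ?h * (\<Sum>t<cells_along M i. pint (pderiv (b n i t) * pderiv (b n' i t)))
        * (\<Prod>j\<in>UNIV - {i}. ?h / 2 * line_inner (cells_along M j) (b n j) (b n' j))" for n n' i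
  proof -
    define F where "F j t = (if j = i then ?h / 2 * pint (pderiv (b n i t) * pderiv (b n' i t)) else ?h / 2 * pint (b n j t * b n' j t))" for j t
    have "(\<Prod>j\<in>UNIV. ?h / 2 * pint (Q n i T j * Q n' i T j)) = (\<Prod>j\<in>UNIV. F j (T j))" for T
      by (rule prod.cong) (auto simp: F_def Q_def)
    then have "(\<Sum>T\<in>cells M. \<Prod>j\<in>UNIV. ?h / 2 * pint (Q n i T j * Q n' i T j)) = (\<Prod>j\<in>UNIV. \<Sum>t<cells_along M j. F j t)"
      by (simp add: sum_cells_prod)
    also have "\<dots> = (\<Sum>t<cells_along M i. F i t) * (\<Prod>j\<in>UNIV - {i}. \<Sum>t<cells_along M j. F j t)"
      by (rule prod.remove) auto
    also have "(\<Prod>j\<in>UNIV - {i}. \<Sum>t<cells_along M j. F j t) = (\<Prod>j\<in>UNIV - {i}. ?h / 2 * line_inner (cells_along M j) (b n j) (b n' j))"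
      by (rule prod.cong) (auto simp: F_def line_inner_def sum_distrib_left)
    also have "(\<Sum>t<cells_along M i. F i t) = ?h / 2 * (\<Sum>t<cells_along M i. pint (pderiv (b n i t) * pderiv (b n' i t)))"
      by (simp add: F_def sum_distrib_left)
    finally have e: "(\<Sum>T\<in>cells M. \<Prod>j\<in>UNIV. ?h / 2 * pint (Q n i T j * Q n' i T j))
      = ?h / 2 * (\<Sum>t<cells_along M i. pint (pderiv (b n i t) * pderiv (b n' i t)))
        * (\<Prod>j\<in>UNIV - {i}. ?h / 2 * line_inner (cells_along M j) (b n j) (b n' j))" .
    have "(2 / ?h)\<^sup>2 * (?h / 2 * X * Y) = 2 / ?h * X * Y" for X Y using h by (simp add: power2_eq_square)
    then show ?thesis unfolding e .
  qed
  have "(\<Sum>T\<in>cells M. set_lebesgue_integral lborel (cell_set M T) (\<lambda>x. gradient (comb f T) x \<bullet> gradient (comb g T) x))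
    = (\<Sum>T\<in>cells M. \<Sum>n\<in>A. \<Sum>n'\<in>A. \<Sum>i\<in>UNIV. f n * g n' * (2 / ?h)\<^sup>2 * (\<Prod>j\<in>UNIV. ?h / 2 * pint (Q n i T j * Q n' i T j)))"
    unfolding cell
    by (rule sum.cong[OF refl], subst sum.swap, rule sum.cong[OF refl], rule sum.swap)
  also have "\<dots> = (\<Sum>n\<in>A. \<Sum>n'\<in>A. \<Sum>i\<in>UNIV. \<Sum>T\<in>cells M. f n * g n' * (2 / ?h)\<^sup>2 * (\<Prod>j\<in>UNIV. ?h / 2 * pint (Q n i T j * Q n' i T j)))"
    by (subst sum.swap, rule sum.cong[OF refl], subst sum.swap, rule sum.cong[OF refl], rule sum.swap)
  also have "\<dots> = (\<Sum>n\<in>A. \<Sum>n'\<in>A. f n * g n' * (\<Sum>i\<in>UNIV. (2 / ?h)\<^sup>2 * (\<Sum>T\<in>cells M. \<Prod>j\<in>UNIV. ?h / 2 * pint (Q n i T j * Q n' i T j))))"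
    by (simp add: sum_distrib_left mult.assoc)
  finally show ?thesis unfolding sumT .
qed

lemma has_bochner_integral_face_prod:
  fixes q :: "'d::finite \<Rightarrow> real poly"
  assumes h: "edge M > 0"
  shows "has_bochner_integral (PiM (UNIV - {i}) (\<lambda>_. lborel))
     (\<lambda>y. indicator (PiE (UNIV - {i}) (\<lambda>j. {origin M $ j + edge M * real (c j) .. origin M $ j + edge M * (real (c j) + 1)})) y *\<^sub>R
        (\<Prod>j\<in>UNIV - {i}. poly (q j) (2 * (y j - (origin M $ j + edge M * real (c j))) / edge M - 1)))
     (\<Prod>j\<in>UNIV - {i}. edge M / 2 * pint (q j))"
proof -
  interpret product_sigma_finite "\<lambda>_ :: 'd. lborel :: real measure" by standard
  let ?a = "\<lambda>j. origin M $ j + edge M * real (c j)"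
  let ?g = "\<lambda>j x. indicator {?a j .. ?a j + edge M} x * poly (q j) (2 * (x - ?a j) / edge M - 1)"
  have g: "integrable lborel (?g j)" "integral\<^sup>L lborel (?g j) = edge M / 2 * pint (q j)" for j
    using has_bochner_integral_poly_cell[OF h, of "?a j" "q j"] by (simp_all add: has_bochner_integral_iff)
  have "integrable (PiM (UNIV - {i}) (\<lambda>_. lborel)) (\<lambda>y. \<Prod>j\<in>UNIV - {i}. ?g j (y j))"
    by (rule product_integrable_prod) (simp, rule g(1))
  moreover have "integral\<^sup>L (PiM (UNIV - {i}) (\<lambda>_. lborel)) (\<lambda>y. \<Prod>j\<in>UNIV - {i}. ?g j (y j)) = (\<Prod>j\<in>UNIV - {i}. integral\<^sup>L lborel (?g j))"
    by (rule product_integral_prod) (simp, rule g(1))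
  ultimately have "has_bochner_integral (PiM (UNIV - {i}) (\<lambda>_. lborel)) (\<lambda>y. \<Prod>j\<in>UNIV - {i}. ?g j (y j)) (\<Prod>j\<in>UNIV - {i}. edge M / 2 * pint (q j))"
    unfolding has_bochner_integral_iff g(2) by blast
  moreover have "(\<Prod>j\<in>UNIV - {i}. ?g j (y j)) = indicator (PiE (UNIV - {i}) (\<lambda>j. {?a j .. origin M $ j + edge M * (real (c j) + 1)})) y *\<^sub>R
        (\<Prod>j\<in>UNIV - {i}. poly (q j) (2 * (y j - ?a j) / edge M - 1))"
    if "y \<in> space (PiM (UNIV - {i}) (\<lambda>_. lborel))" for y
  proof -
    \<comment> \<open>Membership in the box also demands a fixed value at the coordinate i, which a
      product of indicators cannot test. It is automatic for points of the product space.\<close>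
    have ext: "y \<in> extensional (UNIV - {i})" using that by (simp add: space_PiM PiE_def)
    have ab: "?a j + edge M = origin M $ j + edge M * (real (c j) + 1)" for j by (simp add: distrib_left)
    have "(\<Prod>j\<in>UNIV - {i}. indicator {?a j .. ?a j + edge M} (y j)) = (indicator (PiE (UNIV - {i}) (\<lambda>j. {?a j .. origin M $ j + edge M * (real (c j) + 1)})) y :: real)"
    proof (cases "\<forall>j\<in>UNIV - {i}. y j \<in> {?a j .. ?a j + edge M}")
      case True
      then have "y \<in> PiE (UNIV - {i}) (\<lambda>j. {?a j .. origin M $ j + edge M * (real (c j) + 1)})"
        using ext unfolding ab by (auto simp: PiE_def)
      moreover have "(\<Prod>j\<in>UNIV - {i}. indicator {?a j .. ?a j + edge M} (y j)) = (1::real)"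
        by (rule prod.neutral) (use True in auto)
      ultimately show ?thesis by simp
    next
      case False
      then obtain j where j: "j \<in> UNIV - {i}" "y j \<notin> {?a j .. ?a j + edge M}" by blast
      then have "(indicator {?a j .. ?a j + edge M} (y j) :: real) = 0" by simp
      then have "(\<Prod>j\<in>UNIV - {i}. indicator {?a j .. ?a j + edge M} (y j)) = (0::real)"
        by (intro prod_zero bexI[of _ j]) (use j in auto)
      moreover have "y \<notin> PiE (UNIV - {i}) (\<lambda>j. {?a j .. origin M $ j + edge M * (real (c j) + 1)})"
        using j unfolding ab by (auto simp: PiE_def Pi_def)
      ultimately show ?thesis by simp
    qed
    then show ?thesis by (simp add: prod.distrib)
  qed
  ultimately show ?thesis
    by (rule has_bochner_integral_cong[OF refl _ refl, THEN iffD1, rotated])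
qed

text \<open>The faces orthogonal to direction i form a grid with nodes 0 to the number of cells in
  direction i and cells in the other directions, so the sum factorizes for each i.\<close>

lemma sum_faces_prod:
  fixes \<phi> :: "'d::finite \<Rightarrow> nat \<Rightarrow> real"
  shows "(\<Sum>(i, c)\<in>faces M. \<phi> i (c i) * (\<Prod>j\<in>UNIV - {i}. \<psi> j (c j)))
    = (\<Sum>i\<in>UNIV. (\<Sum>x\<le>cells_along M i. \<phi> i x) * (\<Prod>j\<in>UNIV - {i}. \<Sum>t<cells_along M j. \<psi> j t))"
proof -
  define S where "S i = PiE UNIV (\<lambda>j. if j = i then {..cells_along M i} else {..<cells_along M j})" for i
  have fin: "finite (S i)" for i unfolding S_def by (rule finite_PiE) auto
  have "faces M = Sigma UNIV S"
    unfolding faces_def S_def by (auto simp: PiE_iff split: if_splits)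
  then have "(\<Sum>(i, c)\<in>faces M. \<phi> i (c i) * (\<Prod>j\<in>UNIV - {i}. \<psi> j (c j))) = (\<Sum>i\<in>UNIV. \<Sum>c\<in>S i. \<phi> i (c i) * (\<Prod>j\<in>UNIV - {i}. \<psi> j (c j)))"
    using fin by (simp add: sum.Sigma)
  also have "\<dots> = (\<Sum>i\<in>UNIV. (\<Sum>x\<le>cells_along M i. \<phi> i x) * (\<Prod>j\<in>UNIV - {i}. \<Sum>t<cells_along M j. \<psi> j t))"
  proof (rule sum.cong[OF refl])
    fix i
    define F where "F j t = (if j = i then \<phi> i t else \<psi> j t)" for j t
    have "\<phi> i (c i) * (\<Prod>j\<in>UNIV - {i}. \<psi> j (c j)) = (\<Prod>j\<in>UNIV. F j (c j))" for c
      by (subst prod.remove[of UNIV i]) (auto simp: F_def)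
    then have "(\<Sum>c\<in>S i. \<phi> i (c i) * (\<Prod>j\<in>UNIV - {i}. \<psi> j (c j))) = (\<Prod>j\<in>UNIV. \<Sum>t\<in>(if j = i then {..cells_along M i} else {..<cells_along M j}). F j t)"
      unfolding S_def by (simp add: prod_sum_PiE)
    also have "\<dots> = (\<Sum>x\<le>cells_along M i. \<phi> i x) * (\<Prod>j\<in>UNIV - {i}. \<Sum>t<cells_along M j. \<psi> j t)"
      by (subst prod.remove[of UNIV i]) (auto simp: F_def)
    finally show "(\<Sum>c\<in>S i. \<phi> i (c i) * (\<Prod>j\<in>UNIV - {i}. \<psi> j (c j))) = (\<Sum>x\<le>cells_along M i. \<phi> i x) * (\<Prod>j\<in>UNIV - {i}. \<Sum>t<cells_along M j. \<psi> j t)" .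
  qed
  finally show ?thesis .
qed

context
  fixes b :: "'n \<Rightarrow> 'd::finite \<Rightarrow> nat \<Rightarrow> real poly" and A :: "'n set" and M :: "'d cartesian_mesh"
  assumes h: "edge M > 0" and N: "\<And>i. cells_along M i > 0"
begin

definition comb :: "('n \<Rightarrow> real) \<Rightarrow> 'd broken" where
  "comb f T x = (\<Sum>n\<in>A. f n * pfun M T (\<lambda>i. b n i (T i)) x)"

definition face_point :: "'d \<Rightarrow> ('d \<Rightarrow> nat) \<Rightarrow> ('d \<Rightarrow> real) \<Rightarrow> real ^ 'd" where
  "face_point i c y = (\<chi> j. if j = i then origin M $ i + edge M * real (c i) else y j)"

text \<open>The factor of a trace that varies along the face. It is common to both neighbouring
  cells, which differ only in direction i, so jumps and averages reduce to those at a node of a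
  line.\<close>

definition tangential :: "'d \<Rightarrow> ('d \<Rightarrow> nat) \<Rightarrow> 'n \<Rightarrow> ('d \<Rightarrow> real) \<Rightarrow> real" where
  "tangential i c n y = (\<Prod>j\<in>UNIV - {i}. poly (b n j (c j)) (2 * (y j - (origin M $ j + edge M * real (c j))) / edge M - 1))"

lemma pfun_face_right:
  assumes "\<And>j. j \<noteq> i \<Longrightarrow> q j = b n j (c j)"
  shows "pfun M c q (face_point i c y) = poly (q i) (-1) * tangential i c n y"
  unfolding pfun_def tangential_def
  by (subst prod.remove[of UNIV i]) (auto simp: to_reference_nth face_point_def assms intro!: prod.cong)

lemma pfun_face_left:
  assumes "\<And>j. j \<noteq> i \<Longrightarrow> q j = b n j (c j)" and "c i > 0"
  shows "pfun M (c(i := c i - 1)) q (face_point i c y) = poly (q i) 1 * tangential i c n y"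
proof -
  have "2 * (origin M $ i + edge M * real (c i) - (origin M $ i + edge M * real (c i - 1))) / edge M - 1 = 1"
    using h assms(2) by (simp add: of_nat_diff Suc_leI algebra_simps)
  then show ?thesis unfolding pfun_def tangential_def
    by (subst prod.remove[of UNIV i]) (auto simp: to_reference_nth face_point_def assms intro!: prod.cong)
qed

text \<open>Corrects the orientation on the left boundary, where the normal is outward and the jump
  is the trace itself, whereas \<open>node_slope\<close> and \<open>node_jump\<close> are oriented
  as at inner nodes. It squares to 1 in each product.\<close>

definition face_sign :: "'d \<Rightarrow> ('d \<Rightarrow> nat) \<Rightarrow> real" where
  "face_sign i c = (if c i = 0 then -1 else 1)"

lemma face_jump_comb:
  assumes "(i, c) \<in> faces M"
  shows "face_jump M (i, c) (\<lambda>T. comb f T (face_point i c y))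
    = face_sign i c * (\<Sum>n\<in>A. f n * node_jump (cells_along M i) (b n i) (c i) * tangential i c n y)"
proof -
  have r: "comb f c (face_point i c y) = (\<Sum>n\<in>A. f n * (poly (b n i (c i)) (-1) * tangential i c n y))"
    unfolding comb_def by (rule sum.cong[OF refl], subst pfun_face_right) auto
  have l: "comb f (c(i := c i - 1)) (face_point i c y) = (\<Sum>n\<in>A. f n * (poly (b n i (c i - 1)) 1 * tangential i c n y))" if "c i > 0"
    unfolding comb_def by (rule sum.cong[OF refl], subst pfun_face_left) (use that in auto)
  consider "c i = 0" | "c i = cells_along M i" "c i > 0" | "c i > 0" "c i < cells_along M i"
    using assms unfolding faces_def by fastforce
  then show ?thesis
  proof cases
    case 1
    then show ?thesis using r N[of i] unfolding face_jump_def face_sign_def node_jump_def by (simp add: sum_negf mult.assoc)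
  next
    case 2
    then show ?thesis using l[OF 2(2)] unfolding face_jump_def face_sign_def node_jump_def by (simp add: mult.assoc)
  next
    case 3
    then show ?thesis using r l[OF 3(1)] unfolding face_jump_def face_sign_def node_jump_def
      by (simp add: sum_subtractf[symmetric] algebra_simps)
  qed
qed

lemma face_average_comb:
  assumes "(i, c) \<in> faces M"
  shows "face_average M (i, c) (\<lambda>T. gradient (comb f T) (face_point i c y)) \<bullet> face_normal (i, c)
    = face_sign i c * (\<Sum>n\<in>A. f n * (2 / edge M * node_slope (cells_along M i) (b n i) (c i)) * tangential i c n y)"
proof -
  let ?s = "2 / edge M"
  have normal: "D \<bullet> face_normal (i, c) = face_sign i c * (D $ i)" for D :: "real ^ 'd"
    unfolding face_normal_def face_sign_def by (simp add: inner_axis)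
  have grad: "gradient (comb f T) x $ i = (\<Sum>n\<in>A. f n * (?s * pfun M T ((\<lambda>j. b n j (T j))(i := pderiv (b n i (T i)))) x))" for T x
    unfolding comb_def[abs_def] gradient_sum_pfun[OF h] by simp
  have r: "gradient (comb f c) (face_point i c y) $ i = (\<Sum>n\<in>A. f n * (?s * (poly (pderiv (b n i (c i))) (-1) * tangential i c n y)))"
    unfolding grad by (rule sum.cong[OF refl], subst pfun_face_right) auto
  have l: "gradient (comb f (c(i := c i - 1))) (face_point i c y) $ i = (\<Sum>n\<in>A. f n * (?s * (poly (pderiv (b n i (c i - 1))) 1 * tangential i c n y)))" if "c i > 0"
    unfolding grad by (rule sum.cong[OF refl], subst pfun_face_left) (use that in auto)
  consider "c i = 0" | "c i = cells_along M i" "c i > 0" | "c i > 0" "c i < cells_along M i"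
    using assms unfolding faces_def by fastforce
  then show ?thesis
  proof cases
    case 1
    then show ?thesis unfolding normal using r unfolding face_average_def node_slope_def by (simp add: mult.assoc)
  next
    case 2
    then show ?thesis unfolding normal using l[OF 2(2)] unfolding face_average_def node_slope_def by (simp add: mult.assoc)
  next
    case 3
    have "(1/2) * ((\<Sum>n\<in>A. f n * (?s * (poly (pderiv (b n i (c i - 1))) 1 * tangential i c n y))) + (\<Sum>n\<in>A. f n * (?s * (poly (pderiv (b n i (c i))) (-1) * tangential i c n y))))
      = (\<Sum>n\<in>A. f n * (?s * node_slope (cells_along M i) (b n i) (c i)) * tangential i c n y)"
      unfolding sum.distrib[symmetric] sum_distrib_left
      by (rule sum.cong[OF refl]) (use 3 h in \<open>simp add: node_slope_def field_simps\<close>)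
    then show ?thesis unfolding normal using r l[OF 3(1)] 3 unfolding face_average_def by simp
  qed
qed

lemma face_integral_products:
  assumes F: "\<And>y. F (face_point i c y) = face_sign i c * (\<Sum>n\<in>A. f n * u n * tangential i c n y)"
    and G: "\<And>y. G (face_point i c y) = face_sign i c * (\<Sum>n\<in>A. g n * v n * tangential i c n y)"
  shows "face_integral M (i, c) (\<lambda>x. F x * G x)
    = (\<Sum>n\<in>A. \<Sum>n'\<in>A. f n * g n' * ((u n * v n') * (\<Prod>j\<in>UNIV - {i}. edge M / 2 * pint (b n j (c j) * b n' j (c j)))))"
proof -
  let ?P = "PiE (UNIV - {i}) (\<lambda>j. {origin M $ j + edge M * real (c j) .. origin M $ j + edge M * (real (c j) + 1)})"
  let ?\<mu> = "PiM (UNIV - {i}) (\<lambda>_ :: 'd. lborel :: real measure)"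
  have tt: "tangential i c n y * tangential i c n' y
      = (\<Prod>j\<in>UNIV - {i}. poly (b n j (c j) * b n' j (c j)) (2 * (y j - (origin M $ j + edge M * real (c j))) / edge M - 1))" for n n' y
    unfolding tangential_def by (simp add: prod.distrib)
  have "has_bochner_integral ?\<mu>
     (\<lambda>y. \<Sum>n\<in>A. \<Sum>n'\<in>A. (f n * g n' * (u n * v n')) * (indicator ?P y *\<^sub>R
        (\<Prod>j\<in>UNIV - {i}. poly (b n j (c j) * b n' j (c j)) (2 * (y j - (origin M $ j + edge M * real (c j))) / edge M - 1))))
     (\<Sum>n\<in>A. \<Sum>n'\<in>A. (f n * g n' * (u n * v n')) * (\<Prod>j\<in>UNIV - {i}. edge M / 2 * pint (b n j (c j) * b n' j (c j))))"
    by (intro has_bochner_integral_sum has_bochner_integral_mult_right has_bochner_integral_face_prod[OF h])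
  moreover have "(\<Sum>n\<in>A. \<Sum>n'\<in>A. (f n * g n' * (u n * v n')) * (indicator ?P y *\<^sub>R
        (\<Prod>j\<in>UNIV - {i}. poly (b n j (c j) * b n' j (c j)) (2 * (y j - (origin M $ j + edge M * real (c j))) / edge M - 1))))
     = indicator ?P y *\<^sub>R (F (face_point i c y) * G (face_point i c y))" for y
  proof -
    have "F (face_point i c y) * G (face_point i c y) = (\<Sum>n\<in>A. f n * u n * tangential i c n y) * (\<Sum>n\<in>A. g n * v n * tangential i c n y)"
      unfolding F G face_sign_def by simp
    also have "\<dots> = (\<Sum>n\<in>A. \<Sum>n'\<in>A. (f n * u n * tangential i c n y) * (g n' * v n' * tangential i c n' y))"
      by (rule sum_product)
    finally show ?thesis unfolding tt[symmetric] real_scaleR_def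
      by (simp add: sum_distrib_left) (intro sum.cong refl, simp)
  qed
  ultimately have "has_bochner_integral ?\<mu> (\<lambda>y. indicator ?P y *\<^sub>R (F (face_point i c y) * G (face_point i c y)))
     (\<Sum>n\<in>A. \<Sum>n'\<in>A. (f n * g n' * (u n * v n')) * (\<Prod>j\<in>UNIV - {i}. edge M / 2 * pint (b n j (c j) * b n' j (c j))))" by simp
  then show ?thesis
    unfolding face_integral_def set_lebesgue_integral_def face_point_def
    by (simp add: has_bochner_integral_integral_eq mult.assoc)
qed

lemma faces_part:
  assumes F: "\<And>i c y. (i, c) \<in> faces M \<Longrightarrow> F (i, c) (face_point i c y) = face_sign i c * (\<Sum>n\<in>A. f n * u n i (c i) * tangential i c n y)"
    and G: "\<And>i c y. (i, c) \<in> faces M \<Longrightarrow> G (i, c) (face_point i c y) = face_sign i c * (\<Sum>n\<in>A. g n * v n i (c i) * tangential i c n y)"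
  shows "(\<Sum>E\<in>faces M. face_integral M E (\<lambda>x. F E x * G E x))
    = (\<Sum>n\<in>A. \<Sum>n'\<in>A. f n * g n' * (\<Sum>i\<in>UNIV. (\<Sum>x\<le>cells_along M i. u n i x * v n' i x)
        * (\<Prod>j\<in>UNIV - {i}. edge M / 2 * line_inner (cells_along M j) (b n j) (b n' j))))"
proof -
  have "(\<Sum>E\<in>faces M. face_integral M E (\<lambda>x. F E x * G E x))
    = (\<Sum>E\<in>faces M. \<Sum>n\<in>A. \<Sum>n'\<in>A. f n * g n' * (case E of (i, c) \<Rightarrow> (u n i (c i) * v n' i (c i)) * (\<Prod>j\<in>UNIV - {i}. edge M / 2 * pint (b n j (c j) * b n' j (c j)))))"
  proof (rule sum.cong[OF refl])
    fix E assume "E \<in> faces M"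
    then obtain i c where E: "E = (i, c)" "(i, c) \<in> faces M" by (cases E) auto
    show "face_integral M E (\<lambda>x. F E x * G E x) = (\<Sum>n\<in>A. \<Sum>n'\<in>A. f n * g n' * (case E of (i, c) \<Rightarrow> (u n i (c i) * v n' i (c i)) * (\<Prod>j\<in>UNIV - {i}. edge M / 2 * pint (b n j (c j) * b n' j (c j)))))"
      unfolding E(1) prod.case by (rule face_integral_products[OF F[OF E(2)] G[OF E(2)]])
  qed
  also have "\<dots> = (\<Sum>n\<in>A. \<Sum>n'\<in>A. f n * g n' * (\<Sum>(i, c)\<in>faces M. (u n i (c i) * v n' i (c i)) * (\<Prod>j\<in>UNIV - {i}. edge M / 2 * pint (b n j (c j) * b n' j (c j)))))"
    unfolding sum_distrib_left
    by (subst sum.swap, rule sum.cong[OF refl], rule sum.swap)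
  finally show ?thesis
    unfolding sum_faces_prod[of "\<lambda>i x. u _ i x * v _ i x" "\<lambda>j t. edge M / 2 * pint (b _ j t * b _ j t)"]
    by (simp add: line_inner_def sum_distrib_left)
qed

end

text \<open>The polarization of \<open>line_norm2\<close>, needed to expand the broken norm of a
  linear combination of basis products.\<close>

definition line_energy :: "nat \<Rightarrow> nat \<Rightarrow> (nat \<Rightarrow> real poly) \<Rightarrow> (nat \<Rightarrow> real poly) \<Rightarrow> real" where
  "line_energy n p u v = 2 * (\<Sum>t<n. pint (pderiv (u t) * pderiv (v t)))
     + (real p)\<^sup>2 * (\<Sum>x\<le>n. node_jump n u x * node_jump n v x)"

lemma line_energy_refl: "line_energy n p u u = line_norm2 n p u"
  unfolding line_energy_def line_norm2_def by (simp add: power2_eq_square)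

lemma line_energy_commute: "line_energy n p u v = line_energy n p v u"
  unfolding line_energy_def by (simp add: mult.commute)

lemma line_energy_add: "line_energy n p (\<lambda>t. u t + v t) w = line_energy n p u w + line_energy n p v w"
  unfolding line_energy_def by (simp add: node_jump_add pderiv_add distrib_right pint_add sum.distrib algebra_simps)

lemma line_energy_smult: "line_energy n p (\<lambda>t. Polynomial.smult c (u t)) w = c * line_energy n p u w"
  unfolding line_energy_def
  by (simp add: node_jump_smult pderiv_smult pint_smult sum_distrib_left distrib_left ac_simps)

lemma line_energy_sum:
  "line_energy n p (\<lambda>t. \<Sum>m\<in>A. Polynomial.smult (u m) (b m t)) v = (\<Sum>m\<in>A. u m * line_energy n p (b m) v)"
proof (induction A rule: infinite_finite_induct)
  case empty
  show ?case using line_energy_smult[of n p 0 "\<lambda>t. 0" v] by simp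
next
  case (infinite A)
  then show ?case using line_energy_smult[of n p 0 "\<lambda>t. 0" v] by simp
qed (simp add: line_energy_add line_energy_smult)

definition energy_mat :: "nat \<Rightarrow> real \<Rightarrow> nat \<Rightarrow> nat \<times> nat \<Rightarrow> nat \<times> nat \<Rightarrow> real" where
  "energy_mat n h p m m' = line_energy n p (line_basis h m) (line_basis h m') / h"

lemma energy_mat_quadratic:
  assumes "h > 0"
  shows "inner_on (line_index n k) u (mat_app (line_index n k) (energy_mat n h p) u) = line_norm2 n p (line_expand n k h u) / h"
proof -
  have "line_energy n p (line_expand n k h u) (line_expand n k h u)
    = (\<Sum>m\<in>line_index n k. u m * (\<Sum>m'\<in>line_index n k. u m' * line_energy n p (line_basis h m) (line_basis h m')))"
    unfolding line_expand_def[abs_def] line_energy_sum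
    by (rule sum.cong[OF refl], subst line_energy_commute, subst line_energy_sum) (simp add: line_energy_commute)
  then show ?thesis unfolding inner_on_def mat_app_def energy_mat_def line_energy_refl using assms
    by (simp add: sum_divide_distrib sum_distrib_left ac_simps)
qed

lemma line_mat_quadratic:
  assumes "h > 0"
  shows "inner_on (line_index n k) u (mat_app (line_index n k) (line_mat n h \<alpha> p) u) = line_form n \<alpha> p (line_expand n k h u) (line_expand n k h u) / h"
  unfolding line_form_expand[OF assms] using assms by simp

lemma line_basis_inner:
  assumes h: "h > 0" and m: "m \<in> line_index n k" "m' \<in> line_index n k"
  shows "h / 2 * line_inner n (line_basis h m) (line_basis h m') = (if m = m' then 1 else 0)"
proof -
  have e: "line_expand n k h (\<lambda>x. if x = m then 1 else 0) = line_basis h m" if "m \<in> line_index n k" for m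
  proof
    fix t
    have "line_expand n k h (\<lambda>x. if x = m then 1 else 0) t = (\<Sum>x\<in>line_index n k. if x = m then line_basis h m t else 0)"
      unfolding line_expand_def by (rule sum.cong) auto
    then show "line_expand n k h (\<lambda>x. if x = m then 1 else 0) t = line_basis h m t" using that by simp
  qed
  have "h / 2 * line_inner n (line_basis h m) (line_basis h m')
    = inner_on (line_index n k) (\<lambda>x. if x = m then 1 else 0) (\<lambda>x. if x = m' then 1 else 0)"
    unfolding e[OF m(1), symmetric] e[OF m(2), symmetric] line_inner_expand[OF h] using h by simp
  also have "\<dots> = (\<Sum>x\<in>line_index n k. if x = m then (if m = m' then 1 else 0) else 0)"
    unfolding inner_on_def by (rule sum.cong) auto
  finally show ?thesis using m by simp
qed

context
  fixes b :: "'n \<Rightarrow> 'd::finite \<Rightarrow> nat \<Rightarrow> real poly" and A :: "'n set" and M :: "'d cartesian_mesh"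
  assumes h: "edge M > 0" and N: "\<And>i. cells_along M i > 0"
begin

abbreviation (input) cross_inner :: "'n \<Rightarrow> 'n \<Rightarrow> 'd \<Rightarrow> real" where
  "cross_inner n n' i \<equiv> \<Prod>j\<in>UNIV - {i}. edge M / 2 * line_inner (cells_along M j) (b n j) (b n' j)"

lemma jumps_part:
  "(\<Sum>F\<in>faces M. face_integral M F (\<lambda>x. face_jump M F (\<lambda>T. comb b A M f T x) * face_jump M F (\<lambda>T. comb b A M g T x)))
   = (\<Sum>n\<in>A. \<Sum>n'\<in>A. f n * g n' * (\<Sum>i\<in>UNIV. (\<Sum>x\<le>cells_along M i. node_jump (cells_along M i) (b n i) x * node_jump (cells_along M i) (b n' i) x)
        * cross_inner n n' i))"
  by (rule faces_part[OF h N]) (rule face_jump_comb[OF h N], assumption)+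

lemma slopes_part:
  "(\<Sum>F\<in>faces M. face_integral M F (\<lambda>x. (face_average M F (\<lambda>T. gradient (comb b A M f T) x) \<bullet> face_normal F) * face_jump M F (\<lambda>T. comb b A M g T x)))
   = (\<Sum>n\<in>A. \<Sum>n'\<in>A. f n * g n' * (\<Sum>i\<in>UNIV. (\<Sum>x\<le>cells_along M i. (2 / edge M * node_slope (cells_along M i) (b n i) x) * node_jump (cells_along M i) (b n' i) x)
        * cross_inner n n' i))"
  by (rule faces_part[OF h N]) (rule face_average_comb[OF h N] face_jump_comb[OF h N], assumption)+

lemma dg_form_comb:
  "dg_form M \<alpha> p (comb b A M f) (comb b A M g)
   = (\<Sum>n\<in>A. \<Sum>n'\<in>A. f n * g n' * (\<Sum>i\<in>UNIV. line_form (cells_along M i) \<alpha> p (b n i) (b n' i) / edge M * cross_inner n n' i))"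
proof -
  have fin: "cross_inner n n' i = cross_inner n' n i" for n n' i by (simp add: line_inner_commute)
  have sw: "(\<Sum>n\<in>A. \<Sum>n'\<in>A. g n * f n' * (\<Sum>i\<in>UNIV. (\<Sum>x\<le>cells_along M i. (2 / edge M * node_slope (cells_along M i) (b n i) x) * node_jump (cells_along M i) (b n' i) x) * cross_inner n n' i))
    = (\<Sum>n\<in>A. \<Sum>n'\<in>A. f n * g n' * (\<Sum>i\<in>UNIV. (\<Sum>x\<le>cells_along M i. (2 / edge M * node_slope (cells_along M i) (b n' i) x) * node_jump (cells_along M i) (b n i) x) * cross_inner n n' i))"
    by (subst sum.swap) (simp only: fin mult.commute[of "g _" "f _"])
  have cells: "(\<Sum>T\<in>cells M. set_lebesgue_integral lborel (cell_set M T) (\<lambda>x. gradient (comb b A M f T) x \<bullet> gradient (comb b A M g T) x))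
    = (\<Sum>n\<in>A. \<Sum>n'\<in>A. f n * g n' * (\<Sum>i\<in>UNIV. 2 / edge M * (\<Sum>t<cells_along M i. pint (pderiv (b n i t) * pderiv (b n' i t))) * cross_inner n n' i))"
    unfolding comb_def[OF h N, abs_def] by (rule cells_part[OF h])
  have line: "line_form (cells_along M i) \<alpha> p (b n i) (b n' i) / edge M * X
    = 2 / edge M * (\<Sum>t<cells_along M i. pint (pderiv (b n i t) * pderiv (b n' i t))) * X
      - (\<Sum>x\<le>cells_along M i. (2 / edge M * node_slope (cells_along M i) (b n i) x) * node_jump (cells_along M i) (b n' i) x) * X
      - (\<Sum>x\<le>cells_along M i. (2 / edge M * node_slope (cells_along M i) (b n' i) x) * node_jump (cells_along M i) (b n i) x) * X
      + \<alpha> * (real p)\<^sup>2 / edge M * ((\<Sum>x\<le>cells_along M i. node_jump (cells_along M i) (b n i) x * node_jump (cells_along M i) (b n' i) x) * X)" for n n' i X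
    unfolding line_form_def mult.assoc[of "2 / edge M"] sum_distrib_left[symmetric] using h by (simp add: field_simps)
  show ?thesis
    unfolding dg_form_def cells slopes_part sw sum_distrib_left[symmetric] jumps_part line
    by (simp add: sum.distrib sum_subtractf sum_distrib_left right_diff_distrib distrib_left ac_simps)
qed

lemma dg_norm_comb:
  "(dg_norm M p (comb b A M f))\<^sup>2
   = (\<Sum>n\<in>A. \<Sum>n'\<in>A. f n * f n' * (\<Sum>i\<in>UNIV. line_energy (cells_along M i) p (b n i) (b n' i) / edge M * cross_inner n n' i))"
proof -
  have cells: "(\<Sum>T\<in>cells M. set_lebesgue_integral lborel (cell_set M T) (\<lambda>x. (norm (gradient (comb b A M f T) x))\<^sup>2))
    = (\<Sum>n\<in>A. \<Sum>n'\<in>A. f n * f n' * (\<Sum>i\<in>UNIV. 2 / edge M * (\<Sum>t<cells_along M i. pint (pderiv (b n i t) * pderiv (b n' i t))) * cross_inner n n' i))"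
    unfolding power2_norm_eq_inner comb_def[OF h N, abs_def] by (rule cells_part[OF h])
  have nn: "0 \<le> (\<Sum>T\<in>cells M. set_lebesgue_integral lborel (cell_set M T) (\<lambda>x. (norm (gradient (v T) x))\<^sup>2))
     + (real p)\<^sup>2 / edge M * (\<Sum>F\<in>faces M. face_integral M F (\<lambda>x. (face_jump M F (\<lambda>T. v T x))\<^sup>2))" for v
    unfolding set_lebesgue_integral_def face_integral_def using h
    by (intro add_nonneg_nonneg mult_nonneg_nonneg sum_nonneg integral_nonneg) (auto split: prod.splits intro!: integral_nonneg)
  have line: "line_energy (cells_along M i) p (b n i) (b n' i) / edge M * X
    = 2 / edge M * (\<Sum>t<cells_along M i. pint (pderiv (b n i t) * pderiv (b n' i t))) * X
      + (real p)\<^sup>2 / edge M * ((\<Sum>x\<le>cells_along M i. node_jump (cells_along M i) (b n i) x * node_jump (cells_along M i) (b n' i) x) * X)" for n n' i X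
    unfolding line_energy_def using h by (simp add: field_simps)
  show ?thesis
    unfolding dg_norm_def real_sqrt_pow2[OF nn]
    unfolding cells power2_eq_square[of "face_jump _ _ _"] jumps_part line
    by (simp add: sum.distrib sum_distrib_left distrib_left ac_simps)
qed

end

section \<open>Forms which act in one direction of a grid at a time\<close>

lemma sum_grid_line:
  fixes F :: "('d::finite \<Rightarrow> 'a) \<Rightarrow> real"
  assumes fin: "\<And>i. finite (I i)" and n: "n \<in> grid I"
  shows "(\<Sum>n'\<in>grid I. F n' * (\<Prod>j\<in>UNIV - {i}. if n j = n' j then 1 else 0)) = (\<Sum>m\<in>I i. F (n(i := m)))"
proof -
  let ?L = "(\<lambda>m. n(i := m)) ` I i"
  have inj: "inj_on (\<lambda>m. n(i := m)) (I i)" by (rule inj_onI) (metis fun_upd_same)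
  have sub: "?L \<subseteq> grid I" using n by (auto intro: grid_upd)
  have one: "(\<Prod>j\<in>UNIV - {i}. if n j = n' j then 1 else 0) = (1::real)" if "n' \<in> ?L" for n'
    by (rule prod.neutral) (use that in \<open>auto split: if_splits\<close>)
  have zero: "(\<Prod>j\<in>UNIV - {i}. if n j = n' j then 1 else 0) = (0::real)" if "n' \<in> grid I - ?L" for n'
  proof -
    have "\<exists>j. j \<noteq> i \<and> n j \<noteq> n' j"
    proof (rule ccontr)
      assume "\<nexists>j. j \<noteq> i \<and> n j \<noteq> n' j"
      then have "n' = n(i := n' i)" by (auto simp: fun_eq_iff)
      moreover have "n' i \<in> I i" using that by (simp add: grid_def)
      ultimately show False using that by blast
    qed
    then obtain j where j: "j \<noteq> i" "n j \<noteq> n' j" by blast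
    then show ?thesis by (intro prod_zero) auto
  qed
  have "(\<Sum>n'\<in>grid I. F n' * (\<Prod>j\<in>UNIV - {i}. if n j = n' j then 1 else 0)) = (\<Sum>n'\<in>?L. F n' * (\<Prod>j\<in>UNIV - {i}. if n j = n' j then 1 else 0))"
    by (rule sum.mono_neutral_right) (use sub zero finite_grid[OF fin] in auto)
  also have "\<dots> = (\<Sum>n'\<in>?L. F n')" by (rule sum.cong) (auto simp: one)
  also have "\<dots> = (\<Sum>m\<in>I i. F (n(i := m)))" by (simp add: sum.reindex[OF inj])
  finally show ?thesis .
qed

definition tensor_form :: "('d::finite \<Rightarrow> 'a set) \<Rightarrow> ('d \<Rightarrow> 'a \<Rightarrow> 'a \<Rightarrow> real) \<Rightarrow> (('d \<Rightarrow> 'a) \<Rightarrow> real) \<Rightarrow> (('d \<Rightarrow> 'a) \<Rightarrow> real) \<Rightarrow> real" where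
  "tensor_form I S f g = inner_on (grid I) f (\<lambda>n. \<Sum>l\<in>UNIV. lift I l (S l) g n)"

lemma tensor_form_eq_sum: "tensor_form I S f g = (\<Sum>l\<in>UNIV. inner_on (grid I) f (lift I l (S l) g))"
  unfolding tensor_form_def inner_on_def sum_distrib_left by (rule sum.swap)

lemma tensor_form_kernel:
  fixes S :: "'d::finite \<Rightarrow> 'a \<Rightarrow> 'a \<Rightarrow> real"
  assumes fin: "\<And>i. finite (I i)"
    and X: "\<And>j x y. x \<in> I j \<Longrightarrow> y \<in> I j \<Longrightarrow> X j x y = (if x = y then 1 else 0)"
  shows "(\<Sum>n\<in>grid I. \<Sum>n'\<in>grid I. f n * g n' * (\<Sum>i\<in>UNIV. S i (n i) (n' i) * (\<Prod>j\<in>UNIV - {i}. X j (n j) (n' j))))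
    = tensor_form I S f g"
proof -
  have "(\<Sum>n'\<in>grid I. f n * g n' * (\<Sum>i\<in>UNIV. S i (n i) (n' i) * (\<Prod>j\<in>UNIV - {i}. X j (n j) (n' j))))
    = f n * (\<Sum>l\<in>UNIV. lift I l (S l) g n)" if n: "n \<in> grid I" for n
  proof -
    have "(\<Sum>n'\<in>grid I. f n * g n' * (\<Sum>i\<in>UNIV. S i (n i) (n' i) * (\<Prod>j\<in>UNIV - {i}. X j (n j) (n' j))))
      = (\<Sum>n'\<in>grid I. \<Sum>i\<in>UNIV. f n * ((S i (n i) (n' i) * g n') * (\<Prod>j\<in>UNIV - {i}. if n j = n' j then 1 else 0)))"
    proof (rule sum.cong[OF refl])
      fix n' assume n': "n' \<in> grid I"
      have "(\<Prod>j\<in>UNIV - {i}. X j (n j) (n' j)) = (\<Prod>j\<in>UNIV - {i}. if n j = n' j then 1 else 0)" for i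
        by (rule prod.cong[OF refl]) (use n n' in \<open>simp add: X grid_def\<close>)
      then show "f n * g n' * (\<Sum>i\<in>UNIV. S i (n i) (n' i) * (\<Prod>j\<in>UNIV - {i}. X j (n j) (n' j)))
        = (\<Sum>i\<in>UNIV. f n * ((S i (n i) (n' i) * g n') * (\<Prod>j\<in>UNIV - {i}. if n j = n' j then 1 else 0)))"
        unfolding sum_distrib_left by (intro sum.cong refl) (simp add: ac_simps)
    qed
    also have "\<dots> = (\<Sum>i\<in>UNIV. f n * (\<Sum>n'\<in>grid I. (S i (n i) (n' i) * g n') * (\<Prod>j\<in>UNIV - {i}. if n j = n' j then 1 else 0)))"
      unfolding sum_distrib_left by (rule sum.swap)
    also have "\<dots> = f n * (\<Sum>l\<in>UNIV. lift I l (S l) g n)"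
      unfolding sum_grid_line[OF fin n] lift_def sum_distrib_left by simp
    finally show ?thesis .
  qed
  then show ?thesis unfolding tensor_form_def inner_on_def by simp
qed

lemma lift_mono:
  fixes f :: "('d::finite \<Rightarrow> 'a) \<Rightarrow> real"
  assumes fin: "finite (I i)"
    and le: "\<And>u. inner_on (I i) u (mat_app (I i) T u) \<le> inner_on (I i) u (mat_app (I i) T' u)"
  shows "inner_on (grid I) f (lift I i T f) \<le> inner_on (grid I) f (lift I i T' f)"
  unfolding inner_on_def[of "grid I"]
proof (rule sum_grid_slice_mono[where i = i and I = I and F = "\<lambda>n. f n * lift I i T f n" and G = "\<lambda>n. f n * lift I i T' f n", OF fin])
  fix n assume "n \<in> grid I"
  show "(\<Sum>m\<in>I i. f (n(i := m)) * lift I i T f (n(i := m))) \<le> (\<Sum>m\<in>I i. f (n(i := m)) * lift I i T' f (n(i := m)))"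
    unfolding lift_slice using le[of "\<lambda>m. f (n(i := m))"] unfolding inner_on_def .
qed

lemma inner_on_lift_prod:
  fixes v :: "'d::finite \<Rightarrow> 'a \<Rightarrow> real"
  assumes fin: "\<And>i. finite (I i)"
  shows "inner_on (grid I) (\<lambda>n. \<Prod>j\<in>UNIV. v j (n j)) (lift I l T (\<lambda>n. \<Prod>j\<in>UNIV. v j (n j)))
    = inner_on (I l) (v l) (mat_app (I l) T (v l)) * (\<Prod>j\<in>UNIV - {l}. inner_on (I j) (v j) (v j))"
proof -
  define G where "G j x = (if j = l then v l x * mat_app (I l) T (v l) x else v j x * v j x)" for j x
  have split: "(\<Prod>j\<in>UNIV. F j) = F l * (\<Prod>j\<in>UNIV - {l}. F j)" for F :: "'d \<Rightarrow> real"
    by (rule prod.remove) auto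
  have l: "lift I l T (\<lambda>n. \<Prod>j\<in>UNIV. v j (n j)) n = mat_app (I l) T (v l) (n l) * (\<Prod>j\<in>UNIV - {l}. v j (n j))" for n
    unfolding lift_def mat_app_def split[of "\<lambda>j. v j ((n(l := _)) j)"] sum_distrib_right
    by (intro sum.cong refl) (simp add: ac_simps)
  have "(\<Prod>j\<in>UNIV. v j (n j)) * lift I l T (\<lambda>n. \<Prod>j\<in>UNIV. v j (n j)) n = (\<Prod>j\<in>UNIV. G j (n j))" for n
    unfolding l split[of "\<lambda>j. v j (n j)"] split[of "\<lambda>j. G j (n j)"]
    by (simp add: G_def prod.distrib)
  then have "inner_on (grid I) (\<lambda>n. \<Prod>j\<in>UNIV. v j (n j)) (lift I l T (\<lambda>n. \<Prod>j\<in>UNIV. v j (n j))) = (\<Sum>n\<in>PiE UNIV I. \<Prod>j\<in>UNIV. G j (n j))"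
    unfolding inner_on_def grid_PiE by simp
  also have "\<dots> = (\<Prod>j\<in>UNIV. \<Sum>x\<in>I j. G j x)" by (rule prod_sum_PiE[symmetric]) (auto simp: fin)
  also have "\<dots> = inner_on (I l) (v l) (mat_app (I l) T (v l)) * (\<Prod>j\<in>UNIV - {l}. inner_on (I j) (v j) (v j))"
    unfolding split[of "\<lambda>j. \<Sum>x\<in>I j. G j x"] by (simp add: G_def inner_on_def)
  finally show ?thesis .
qed

abbreviation (input) dofs :: "'d::finite cartesian_mesh \<Rightarrow> nat \<Rightarrow> 'd \<Rightarrow> (nat \<times> nat) set" where
  "dofs M k \<equiv> \<lambda>i. line_index (cells_along M i) k"

abbreviation (input) stiffness :: "'d::finite cartesian_mesh \<Rightarrow> real \<Rightarrow> nat \<Rightarrow> 'd \<Rightarrow> nat \<times> nat \<Rightarrow> nat \<times> nat \<Rightarrow> real" where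
  "stiffness M \<alpha> p \<equiv> \<lambda>i. line_mat (cells_along M i) (edge M) \<alpha> p"

subsection \<open>Approximation property\<close>

definition mesh_fun :: "'d::finite cartesian_mesh \<Rightarrow> nat \<Rightarrow> (('d \<Rightarrow> nat \<times> nat) \<Rightarrow> real) \<Rightarrow> 'd broken" where
  "mesh_fun M k f = comb (\<lambda>n i. line_basis (edge M) (n i)) (grid (dofs M k)) M f"

text \<open>The factor between the given basis, in which the level matrices are written, and the
  orthonormal one, in which the analysis takes place.\<close>

definition basis_scale :: "'d::finite cartesian_mesh \<Rightarrow> ('d \<Rightarrow> nat \<times> nat) \<Rightarrow> real" where
  "basis_scale M n = (\<Prod>i\<in>UNIV. sqrt ((2 * real (snd (n i)) + 1) / edge M))"

text \<open>Regroups a pair of multi-indices, cell and degree, into one pair of cell and degree for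
  each direction, which is a point of the tensor grid.\<close>

definition dof_of :: "('d \<Rightarrow> nat) \<times> ('d \<Rightarrow> nat) \<Rightarrow> 'd \<Rightarrow> nat \<times> nat" where
  "dof_of b i = (fst b i, snd b i)"

lemma inj_dof_of: "inj dof_of"
proof (rule injI)
  fix x y :: "('d \<Rightarrow> nat) \<times> ('d \<Rightarrow> nat)" assume "dof_of x = dof_of y"
  then have "dof_of x i = dof_of y i" for i by simp
  then show "x = y" by (simp add: dof_of_def prod_eq_iff fun_eq_iff)
qed

lemma bij_betw_dof_of: "bij_betw dof_of (basis_index M k) (grid (dofs M k))"
proof -
  have "dof_of ` basis_index M k = grid (dofs M k)"
  proof (intro equalityI subsetI)
    fix n assume n: "n \<in> grid (dofs M k)"
    have "n = dof_of (\<lambda>i. fst (n i), \<lambda>i. snd (n i))" by (simp add: dof_of_def fun_eq_iff)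
    moreover have "(\<lambda>i. fst (n i), \<lambda>i. snd (n i)) \<in> basis_index M k"
      using n by (auto simp: grid_def line_index_def basis_index_def cells_def mem_Times_iff)
    ultimately show "n \<in> dof_of ` basis_index M k" by blast
  qed (auto simp: grid_def line_index_def basis_index_def cells_def dof_of_def)
  then show ?thesis using inj_on_subset[OF inj_dof_of subset_UNIV] unfolding bij_betw_def by blast
qed

lemma finite_dofs: "finite (grid (dofs M k))"
  by (rule finite_grid) simp

lemma finite_basis_index: "finite (basis_index M k)"
  using bij_betw_finite[OF bij_betw_dof_of] finite_dofs by blast

context
  fixes M :: "'d::finite cartesian_mesh"
  assumes h: "edge M > 0" and N: "\<And>i. cells_along M i > 0"
begin

lemma basis_scale_pos: "basis_scale M n > 0"
  unfolding basis_scale_def using h by (intro prod_pos) (auto intro!: divide_pos_pos)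

lemma pfun_line_basis:
  "pfun M T (\<lambda>i. line_basis (edge M) (dof_of b i) (T i)) x = basis_scale M (dof_of b) * basis_fun M b T x"
proof (cases "T = fst b")
  case True
  then show ?thesis unfolding pfun_def basis_scale_def basis_fun_def dof_of_def line_basis_def
    by (simp add: case_prod_beta prod.distrib)
next
  case False
  then obtain i where i: "T i \<noteq> fst b i" by auto
  have "poly (line_basis (edge M) (dof_of b i) (T i)) (to_reference M T x $ i) = 0" using i by (simp add: line_basis_def dof_of_def)
  then have "pfun M T (\<lambda>i. line_basis (edge M) (dof_of b i) (T i)) x = 0" unfolding pfun_def by (intro prod_zero) auto
  then show ?thesis using False by (simp add: basis_fun_def case_prod_beta)
qed

lemma mesh_fun_eq:
  "mesh_fun M k f T x = (\<Sum>b\<in>basis_index M k. (f (dof_of b) * basis_scale M (dof_of b)) * basis_fun M b T x)"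
proof -
  have "mesh_fun M k f T x = (\<Sum>n\<in>grid (dofs M k). f n * pfun M T (\<lambda>i. line_basis (edge M) (n i) (T i)) x)"
    unfolding mesh_fun_def comb_def[OF h N] ..
  also have "\<dots> = (\<Sum>b\<in>basis_index M k. f (dof_of b) * pfun M T (\<lambda>i. line_basis (edge M) (dof_of b i) (T i)) x)"
    by (rule sum.reindex_bij_betw[OF bij_betw_dof_of, symmetric])
  finally show ?thesis unfolding pfun_line_basis by (simp add: mult.assoc)
qed

lemma mesh_fun_in_broken_space:
  assumes "k \<le> p" shows "mesh_fun M k f \<in> broken_space M p"
proof -
  define \<gamma> where "\<gamma> b = (if b \<in> basis_index M k then f (dof_of b) * basis_scale M (dof_of b) else 0)" for b
  have sub: "basis_index M k \<subseteq> basis_index M p" using assms unfolding basis_index_def by (auto intro: order_trans)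
  have "mesh_fun M k f = (\<lambda>T x. \<Sum>b\<in>basis_index M p. \<gamma> b * basis_fun M b T x)"
  proof (intro ext)
    fix T x
    have "(\<Sum>b\<in>basis_index M p. \<gamma> b * basis_fun M b T x) = (\<Sum>b\<in>basis_index M k. \<gamma> b * basis_fun M b T x)"
      by (rule sum.mono_neutral_right) (use sub finite_basis_index in \<open>auto simp: \<gamma>_def\<close>)
    then show "mesh_fun M k f T x = (\<Sum>b\<in>basis_index M p. \<gamma> b * basis_fun M b T x)"
      unfolding mesh_fun_eq by (simp add: \<gamma>_def)
  qed
  then show ?thesis unfolding broken_space_def by blast
qed

lemma basis_fun_eq_mesh_fun:
  assumes "b \<in> basis_index M k"
  shows "basis_fun M b = mesh_fun M k (\<lambda>n. if n = dof_of b then 1 / basis_scale M n else 0)"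
proof (intro ext)
  fix T x
  have "(if dof_of b' = dof_of b then 1 / basis_scale M (dof_of b') else 0) * basis_scale M (dof_of b') * basis_fun M b' T x
     = (if b' = b then basis_fun M b T x else 0)" for b'
    using inj_eq[OF inj_dof_of, of b' b] basis_scale_pos[of "dof_of b'"] by auto
  then show "basis_fun M b T x = mesh_fun M k (\<lambda>n. if n = dof_of b then 1 / basis_scale M n else 0) T x"
    unfolding mesh_fun_eq using assms by (simp add: finite_basis_index)
qed

lemma dg_form_mesh_fun:
  "dg_form M \<alpha> p (mesh_fun M k f) (mesh_fun M k g) = tensor_form (dofs M k) (stiffness M \<alpha> p) f g"
  unfolding mesh_fun_def dg_form_comb[OF h N] line_mat_def[symmetric]
  by (rule tensor_form_kernel) (simp, rule line_basis_inner[OF h])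

lemma dg_norm_mesh_fun:
  "(dg_norm M p (mesh_fun M k f))\<^sup>2 = tensor_form (dofs M k) (\<lambda>i. energy_mat (cells_along M i) (edge M) p) f f"
  unfolding mesh_fun_def dg_norm_comb[OF h N] energy_mat_def[symmetric]
  by (rule tensor_form_kernel) (simp, rule line_basis_inner[OF h])

lemma tensor_form_lift_nonneg:
  "0 \<le> inner_on (grid (dofs M k)) f (lift (dofs M k) i (energy_mat (cells_along M i) (edge M) p) f)"
proof -
  have "inner_on (grid (dofs M k)) f (lift (dofs M k) i (\<lambda>x y. 0) f)
    \<le> inner_on (grid (dofs M k)) f (lift (dofs M k) i (energy_mat (cells_along M i) (edge M) p) f)"
  proof (rule lift_mono)
    fix u
    have "inner_on (dofs M k i) u (mat_app (dofs M k i) (\<lambda>x y. 0) u) = 0" by (simp add: inner_on_def mat_app_def)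
    then show "inner_on (dofs M k i) u (mat_app (dofs M k i) (\<lambda>x y. 0) u)
      \<le> inner_on (dofs M k i) u (mat_app (dofs M k i) (energy_mat (cells_along M i) (edge M) p) u)"
      unfolding energy_mat_quadratic[OF h] using h by (simp add: line_norm2_nonneg)
  qed simp
  then show ?thesis by (simp add: lift_def inner_on_def)
qed

text \<open>Only the full form is known to be coercive; the test function is the product of \<open>u\<close> with
  a global quadratic bubble in each of the other directions.\<close>

lemma line_garding:
  assumes k: "2 \<le> k" "k \<le> p" and c: "c > 0"
    and coer: "\<And>v. v \<in> broken_space M p \<Longrightarrow> c * (dg_norm M p v)\<^sup>2 \<le> dg_form M \<alpha> p v v"
    and du: "\<And>t. Polynomial.degree (u t) \<le> k"
  shows "c * line_norm2 (cells_along M i) p u \<le> line_form (cells_along M i) \<alpha> p u u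
    + (\<Sum>j\<in>UNIV. 5 / (edge M * real (cells_along M j))\<^sup>2) * (edge M)\<^sup>2 * line_inner (cells_along M i) u u"
proof -
  let ?h = "edge M" and ?N = "cells_along M"
  let ?I = "dofs M k" and ?S = "stiffness M \<alpha> p" and ?E = "\<lambda>i. energy_mat (?N i) ?h p"
  define v where "v j = (if j = i then line_coef ?h u else line_coef ?h (bubble (?N j)))" for j
  define q where "q j = inner_on (?I j) (v j) (v j)" for j
  define r where "r = (\<Prod>j\<in>UNIV - {i}. q j)"
  define f where "f n = (\<Prod>j\<in>UNIV. v j (n j))" for n
  have ex: "line_expand (?N i) k ?h (v i) t = u t" if "t < ?N i" for t
    unfolding v_def using line_expand_coef[OF that, of u k ?h] du h by simp
  have exb: "line_expand (?N j) k ?h (v j) t = bubble (?N j) t" if "t < ?N j" "j \<noteq> i" for t j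
    unfolding v_def using line_expand_coef[OF that(1), of "bubble (?N j)" k ?h] order_trans[OF degree_bubble k(1)] that h by simp
  have N1: "?N j \<ge> 1" for j using N[of j] by simp
  have qi: "q i = ?h / 2 * line_inner (?N i) u u"
    using line_inner_expand[OF h, of "?N i" k "v i" "v i"] line_inner_cong[of "?N i" _ u _ u, OF ex ex] h unfolding q_def by simp
  have qj: "q j = 8 / 15 * ?h * real (?N j) ^ 5" if "j \<noteq> i" for j
  proof -
    have "2 / ?h * q j = 16 / 15 * real (?N j) ^ 5"
      unfolding q_def line_inner_expand[OF h, symmetric] bubble_inner[symmetric] by (rule line_inner_cong) (use exb that in auto)
    then show ?thesis using h by (simp add: field_simps)
  qed
  have qpos: "q j > 0" if "j \<noteq> i" for j unfolding qj[OF that] using h N by simp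
  have rpos: "r > 0" unfolding r_def by (rule prod_pos) (use qpos in auto)
  have Si: "inner_on (?I i) (v i) (mat_app (?I i) (?S i) (v i)) = line_form (?N i) \<alpha> p u u / ?h"
    unfolding line_mat_quadratic[OF h] using line_form_cong[OF N1 ex ex] by simp
  \<comment> \<open>The Rayleigh quotient of the bubble: 16/3 N^3 / h divided by 8/15 h N^5.\<close>
  have Sj: "inner_on (?I j) (v j) (mat_app (?I j) (?S j) (v j)) = 10 / (?h * real (?N j))\<^sup>2 * q j" if "j \<noteq> i" for j
  proof -
    have "inner_on (?I j) (v j) (mat_app (?I j) (?S j) (v j)) = 16 / 3 * real (?N j) ^ 3 / ?h"
    proof -
      have "line_form (?N j) \<alpha> p (line_expand (?N j) k ?h (v j)) (line_expand (?N j) k ?h (v j)) = line_form (?N j) \<alpha> p (bubble (?N j)) (bubble (?N j))"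
        by (rule line_form_cong[OF N1]) (use exb that in auto)
      also have "\<dots> = 16 / 3 * real (?N j) ^ 3" by (rule bubble_form[OF N1])
      finally show ?thesis unfolding line_mat_quadratic[OF h] by (rule arg_cong)
    qed
    also have "\<dots> = 10 / (?h * real (?N j))\<^sup>2 * q j"
      unfolding qj[OF that] using h N[of j] by (simp add: field_simps power2_eq_square power3_eq_cube numeral_eq_Suc)
    finally show ?thesis .
  qed
  have Ei: "inner_on (?I i) (v i) (mat_app (?I i) (?E i) (v i)) = line_norm2 (?N i) p u / ?h"
    unfolding energy_mat_quadratic[OF h] using line_norm2_cong[of "?N i" _ u, OF ex] by simp
  have "c * (line_norm2 (?N i) p u / ?h * r) = c * inner_on (grid ?I) f (lift ?I i (?E i) f)"
    unfolding f_def by (subst inner_on_lift_prod) (simp_all add: Ei q_def[symmetric] r_def)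
  also have "\<dots> \<le> c * tensor_form ?I ?E f f"
    unfolding tensor_form_eq_sum using c
    by (intro mult_left_mono member_le_sum[of i UNIV "\<lambda>l. inner_on (grid ?I) f (lift ?I l (?E l) f)"]) (auto intro: tensor_form_lift_nonneg)
  also have "\<dots> \<le> tensor_form ?I ?S f f"
    using coer[OF mesh_fun_in_broken_space[OF k(2)]] unfolding dg_norm_mesh_fun dg_form_mesh_fun .
  also have "\<dots> = (\<Sum>l\<in>UNIV. inner_on (?I l) (v l) (mat_app (?I l) (?S l) (v l)) * (\<Prod>j\<in>UNIV - {l}. q j))"
    unfolding tensor_form_eq_sum f_def by (subst inner_on_lift_prod) (simp_all add: q_def)
  also have "\<dots> = line_form (?N i) \<alpha> p u u / ?h * r + (\<Sum>l\<in>UNIV - {i}. 10 / (?h * real (?N l))\<^sup>2 * (q i * r))"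
  proof -
    have "(\<Prod>j\<in>UNIV. q j) = q l * (\<Prod>j\<in>UNIV - {l}. q j)" for l by (rule prod.remove) auto
    then have "q l * (\<Prod>j\<in>UNIV - {l}. q j) = q i * r" for l unfolding r_def by metis
    then have "inner_on (?I l) (v l) (mat_app (?I l) (?S l) (v l)) * (\<Prod>j\<in>UNIV - {l}. q j) = 10 / (?h * real (?N l))\<^sup>2 * (q i * r)" if "l \<noteq> i" for l
      unfolding Sj[OF that] by (simp only: mult.assoc)
    then show ?thesis by (subst sum.remove[of UNIV i]) (auto simp: Si r_def)
  qed
  \<comment> \<open>The nonnegative term l = i is added so that the constant is the same for all
    directions.\<close>
  also have "\<dots> \<le> line_form (?N i) \<alpha> p u u / ?h * r + (\<Sum>l\<in>UNIV. 10 / (?h * real (?N l))\<^sup>2 * (q i * r))"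
  proof -
    have "q i \<ge> 0" unfolding q_def by (rule inner_on_nonneg)
    then show ?thesis using rpos by (intro add_left_mono sum_mono2) auto
  qed
  also have "(\<Sum>l\<in>UNIV. 10 / (?h * real (?N l))\<^sup>2 * (q i * r)) = (\<Sum>j\<in>UNIV. 5 / (?h * real (?N j))\<^sup>2) * ?h * line_inner (?N i) u u * r"
    unfolding sum_distrib_right qi by (rule sum.cong) auto
  finally have "(c * line_norm2 (?N i) p u) * (r / ?h) \<le> (line_form (?N i) \<alpha> p u u
    + (\<Sum>j\<in>UNIV. 5 / (?h * real (?N j))\<^sup>2) * ?h\<^sup>2 * line_inner (?N i) u u) * (r / ?h)"
    using h by (simp add: field_simps power2_eq_square)
  then show ?thesis by (rule mult_right_le_imp_le) (use rpos h in auto)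
qed

text \<open>A single direction suffices: the other parts of the broken norm are nonnegative, and the
  inequality on lines holds slice by slice. As h times the number of cells is a side of the box, the
  constant depends on the domain and on c only.\<close>

lemma tensor_poincare:
  assumes k: "1 \<le> k" "k \<le> p" and c: "c > 0"
    and coer: "\<And>v. v \<in> broken_space M p \<Longrightarrow> c * (dg_norm M p v)\<^sup>2 \<le> dg_form M \<alpha> p v v"
  shows "c / (72 * (edge M * real (cells_along M i))\<^sup>2) * inner_on (grid (dofs M k)) f f \<le> tensor_form (dofs M k) (stiffness M \<alpha> p) f f"
proof -
  let ?h = "edge M" and ?N = "cells_along M"
  let ?I = "dofs M k" and ?E = "\<lambda>i. energy_mat (?N i) ?h p"
  let ?s = "1 / (72 * (?h * real (?N i))\<^sup>2)"
  have "?s * inner_on (grid ?I) f f = inner_on (grid ?I) f (lift ?I i (\<lambda>x y. if x = y then ?s else 0) f)"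
  proof -
    have "lift ?I i (\<lambda>x y. if x = y then ?s else 0) f n = ?s * f n" if "n \<in> grid ?I" for n
    proof -
      have "lift ?I i (\<lambda>x y. if x = y then ?s else 0) f n = (\<Sum>m\<in>?I i. if m = n i then ?s * f n else 0)"
        unfolding lift_def by (rule sum.cong) auto
      then show ?thesis using that by (simp add: grid_def)
    qed
    then show ?thesis unfolding inner_on_def sum_distrib_left by simp
  qed
  also have "\<dots> \<le> inner_on (grid ?I) f (lift ?I i (?E i) f)"
  proof (rule lift_mono)
    fix u
    have "mat_app (?I i) (\<lambda>x y. if x = y then ?s else 0) u m = ?s * u m" if "m \<in> ?I i" for m
    proof -
      have "mat_app (?I i) (\<lambda>x y. if x = y then ?s else 0) u m = (\<Sum>x\<in>?I i. if x = m then ?s * u m else 0)"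
        unfolding mat_app_def by (rule sum.cong) auto
      then show ?thesis using that by simp
    qed
    then have "inner_on (?I i) u (mat_app (?I i) (\<lambda>x y. if x = y then ?s else 0) u) = ?s * inner_on (?I i) u u"
      unfolding inner_on_def sum_distrib_left by simp
    also have "\<dots> = ?s * (?h / 2 * line_inner (?N i) (line_expand (?N i) k ?h u) (line_expand (?N i) k ?h u))"
      unfolding line_inner_expand[OF h] using h by simp
    also have "\<dots> \<le> ?s * (?h / 2 * (144 * (real (?N i))\<^sup>2 * line_norm2 (?N i) p (line_expand (?N i) k ?h u)))"
      using h N[of i] k by (intro mult_left_mono line_poincare) (auto intro: order_trans[OF degree_line_expand])
    also have "\<dots> = line_norm2 (?N i) p (line_expand (?N i) k ?h u) / ?h"
      using h N[of i] by (simp add: power2_eq_square)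
    also have "\<dots> = inner_on (?I i) u (mat_app (?I i) (?E i) u)" by (rule energy_mat_quadratic[OF h, symmetric])
    finally show "inner_on (?I i) u (mat_app (?I i) (\<lambda>x y. if x = y then ?s else 0) u) \<le> inner_on (?I i) u (mat_app (?I i) (?E i) u)" .
  qed simp
  also have "\<dots> \<le> tensor_form ?I ?E f f"
    unfolding tensor_form_eq_sum
    by (intro member_le_sum[of i UNIV "\<lambda>l. inner_on (grid ?I) f (lift ?I l (?E l) f)"]) (auto intro: tensor_form_lift_nonneg)
  finally have "c * (?s * inner_on (grid ?I) f f) \<le> c * tensor_form ?I ?E f f" using c by (intro mult_left_mono) auto
  also have "\<dots> \<le> tensor_form ?I (stiffness M \<alpha> p) f f"
    using coer[OF mesh_fun_in_broken_space[OF k(2)]] unfolding dg_norm_mesh_fun dg_form_mesh_fun .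
  finally show ?thesis by simp
qed

text \<open>Two regimes. If h / k is small relative to the Garding constant, the line
  discretizations exist in every direction and duality applies, with constant \<open>K1\<close>.
  Otherwise h / k is bounded below, and the Poincare inequality alone gives the bound, with constant
  \<open>K2\<close>. The final constant is the sum of both.\<close>

lemma approximation_property:
  fixes i\<^sub>0 :: 'd
  assumes k: "2 \<le> k" "k \<le> p" and c: "c > 0"
    and coer: "\<And>v. v \<in> broken_space M p \<Longrightarrow> c * (dg_norm M p v)\<^sup>2 \<le> dg_form M \<alpha> p v v"
    and w: "\<And>g. (\<And>n i. snd (n i) \<ge> k \<Longrightarrow> g n = 0) \<Longrightarrow> tensor_form (dofs M k) (stiffness M \<alpha> p) w g = 0"
  defines "G \<equiv> \<Sum>j\<in>UNIV. 5 / (edge M * real (cells_along M j))\<^sup>2" and "cP \<equiv> c / (72 * (edge M * real (cells_along M i\<^sub>0))\<^sup>2)"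
  shows "nrm (grid (dofs M k)) w \<le> ((real CARD('d))\<^sup>2 * (2 + (12 * (48 / c + 4) + 60) * (1 + (2 * G + 1))\<^sup>2) ^ CARD('d) * (1 + real CARD('d) * (2 * G + 1) / cP)
      + (1 + sqrt (576 * G / c)) / sqrt cP) * (edge M / real k) * sqrt (tensor_form (dofs M k) (stiffness M \<alpha> p) w w)"
proof -
  let ?h = "edge M" and ?I = "dofs M k" and ?S = "stiffness M \<alpha> p"
  let ?a = "sqrt (tensor_form ?I ?S w w)"
  define \<delta> where "\<delta> = ?h / real k"
  define D where "D = 2 + (12 * (48 / c + 4) + 60) * (1 + (2 * G + 1))\<^sup>2"
  define K1 where "K1 = (real CARD('d))\<^sup>2 * D ^ CARD('d) * (1 + real CARD('d) * (2 * G + 1) / cP)"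
  define K2 where "K2 = (1 + sqrt (576 * G / c)) / sqrt cP"
  have G: "G \<ge> 0" unfolding G_def by (intro sum_nonneg) auto
  have cP: "cP > 0" unfolding cP_def using c h N[of i\<^sub>0] by simp
  have D: "D \<ge> 1" unfolding D_def using c by (simp add: add_increasing2)
  have \<delta>: "\<delta> > 0" unfolding \<delta>_def using h k by simp
  have pd: "cP * inner_on (grid ?I) f f \<le> tensor_form ?I ?S f f" for f
    unfolding cP_def by (rule tensor_poincare[OF _ k(2) c]) (use k in simp, rule coer)
  have a0: "tensor_form ?I ?S w w \<ge> 0"
    by (rule order_trans[OF _ pd]) (use cP inner_on_nonneg[of "grid ?I" w] in simp)
  have K12: "K1 \<ge> 0" "K2 \<ge> 0" unfolding K1_def K2_def using G cP c D by auto
  have "nrm (grid ?I) w \<le> K1 * \<delta> * ?a \<or> nrm (grid ?I) w \<le> K2 * \<delta> * ?a"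
  proof (cases "G * ?h\<^sup>2 * 288 \<le> c / 2 * (real k)\<^sup>2 \<and> ?h \<le> real k")
    case True
    define P where "P i B J \<longleftrightarrow> (\<forall>x\<in>?I i. \<forall>y\<in>?I i. B x y = B y x) \<and>
      (\<forall>u. \<forall>x\<in>?I i. mat_app (?I i) B (mat_app (?I i) B u) x = mat_app (?I i) (?S i) u x + (2 * G + 1) * u x) \<and>
      (\<forall>u. nrm (?I i) (mat_app (?I i) J u) \<le> D * nrm (?I i) u) \<and>
      (\<forall>u. nrm (?I i) (mat_app (?I i) B (mat_app (?I i) J u)) \<le> D * nrm (?I i) (mat_app (?I i) B u)) \<and>
      (\<forall>u. nrm (?I i) (\<lambda>x. u x - mat_app (?I i) J u x) \<le> D * \<delta> * nrm (?I i) (mat_app (?I i) B u)) \<and>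
      (\<forall>u. nrm (?I i) (mat_app (?I i) B (\<lambda>x. u x - mat_app (?I i) J u x)) \<le> D * \<delta> * nrm (?I i) (mat_app (?I i) B (mat_app (?I i) B u))) \<and>
      (\<forall>m m'. snd m \<ge> k \<longrightarrow> J m m' = 0)" for i B J
    have "\<exists>B J. P i B J" for i
      unfolding P_def D_def \<delta>_def
    proof (rule line_discretization)
      fix u :: "nat \<Rightarrow> real poly" assume du: "\<And>t. Polynomial.degree (u t) \<le> k"
      show "c * line_norm2 (cells_along M i) p u \<le> line_form (cells_along M i) \<alpha> p u u + G * ?h\<^sup>2 * line_inner (cells_along M i) u u"
        unfolding G_def by (rule line_garding[OF k c]) (rule coer, assumption, rule du)
    qed (use N[of i] k c G h True in auto)
    then have "\<forall>i. \<exists>B. \<exists>J. P i B J" by iprover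
    from choice[OF this] obtain B where "\<forall>i. \<exists>J. P i (B i) J" by iprover
    from choice[OF this] obtain J where P: "\<forall>i. P i (B i) (J i)" by iprover
    note Q = spec[OF P, unfolded P_def]
    have "nrm (grid ?I) w \<le> (real CARD('d))\<^sup>2 * D ^ CARD('d) * (1 + real CARD('d) * (2 * G + 1) / cP) * \<delta> * ?a"
      unfolding tensor_form_def
    proof (rule tensor_duality[where B = B and J = J and H = "\<lambda>i. {m. snd m \<ge> k}"])
      show "line_mat (cells_along M i) ?h \<alpha> p x y = line_mat (cells_along M i) ?h \<alpha> p y x" for i x y
        by (rule line_mat_symmetric)
      show "cP * inner_on (grid ?I) f f \<le> inner_on (grid ?I) f (\<lambda>n. \<Sum>l\<in>UNIV. lift ?I l (?S l) f n)" for f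
        using pd[of f] unfolding tensor_form_def .
      show "inner_on (grid ?I) w (\<lambda>n. \<Sum>l\<in>UNIV. lift ?I l (?S l) g n) = 0"
        if "\<forall>n. (\<exists>i. n i \<in> {m. k \<le> snd m}) \<longrightarrow> g n = 0" for g
        using w[of g] that unfolding tensor_form_def by blast
    next
      fix i u
      note Qi = Q[of i, THEN conjunct1] Q[of i, THEN conjunct2, THEN conjunct1]
        Q[of i, THEN conjunct2, THEN conjunct2]
      show "nrm (?I i) (mat_app (?I i) (J i) u) \<le> D * nrm (?I i) u"
        using Qi(3)[THEN conjunct1] by iprover
      show "nrm (?I i) (mat_app (?I i) (B i) (mat_app (?I i) (J i) u)) \<le> D * nrm (?I i) (mat_app (?I i) (B i) u)"
        using Qi(3)[THEN conjunct2, THEN conjunct1] by iprover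
      show "nrm (?I i) (\<lambda>x. u x - mat_app (?I i) (J i) u x) \<le> D * \<delta> * nrm (?I i) (mat_app (?I i) (B i) u)"
        using Qi(3)[THEN conjunct2, THEN conjunct2, THEN conjunct1] by iprover
      show "nrm (?I i) (mat_app (?I i) (B i) (\<lambda>x. u x - mat_app (?I i) (J i) u x)) \<le> D * \<delta> * nrm (?I i) (mat_app (?I i) (B i) (mat_app (?I i) (B i) u))"
        using Qi(3)[THEN conjunct2, THEN conjunct2, THEN conjunct2, THEN conjunct1] by iprover
      show "mat_app (?I i) (B i) (mat_app (?I i) (B i) u) m = mat_app (?I i) (?S i) u m + (2 * G + 1) * u m" if "m \<in> ?I i" for m
        using Qi(2) that by blast
      show "B i x y = B i y x" if "x \<in> ?I i" "y \<in> ?I i" for x y using Qi(1) that by blast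
      show "J i m k' = 0" if "m \<in> {m. k \<le> snd m}" for m k'
        using Qi(3)[THEN conjunct2, THEN conjunct2, THEN conjunct2, THEN conjunct2] that by blast
    qed (use D G cP \<delta> in auto)
    then show ?thesis unfolding K1_def by blast
  next
    case False
    \<comment> \<open>The failed case condition means h > k or 576 G h^2 > c k^2, where 576 = 2 *
      288. Each puts a lower bound on \<delta> = h / k.\<close>
    have one: "1 \<le> \<delta> * (1 + sqrt (576 * G / c))"
    proof (cases "?h \<le> real k")
      case True
      then have "c * (real k)\<^sup>2 < 576 * G * ?h\<^sup>2" using False by simp
      then have "1 < 576 * G / c * \<delta>\<^sup>2" unfolding \<delta>_def using c k by (simp add: field_simps)
      then have "1 < sqrt (576 * G / c * \<delta>\<^sup>2)" by simp
      also have "\<dots> = \<delta> * sqrt (576 * G / c)" unfolding real_sqrt_mult using \<delta> by simp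
      finally show ?thesis using \<delta> by (simp add: distrib_left)
    next
      case False
      then have "1 \<le> \<delta>" unfolding \<delta>_def using k by simp
      moreover have "0 \<le> \<delta> * sqrt (576 * G / c)" using \<delta> G c by simp
      ultimately show ?thesis by (simp add: distrib_left)
    qed
    have "sqrt cP * nrm (grid ?I) w \<le> ?a"
      unfolding nrm_def real_sqrt_mult[symmetric] using pd[of w] by simp
    then have "nrm (grid ?I) w \<le> 1 * (?a / sqrt cP)" using cP by (simp add: field_simps)
    also have "\<dots> \<le> \<delta> * (1 + sqrt (576 * G / c)) * (?a / sqrt cP)" using one a0 cP by (intro mult_right_mono) auto
    finally show ?thesis unfolding K2_def by (simp add: ac_simps)
  qed
  moreover have "K1 * \<delta> * ?a \<le> (K1 + K2) * \<delta> * ?a" "K2 * \<delta> * ?a \<le> (K1 + K2) * \<delta> * ?a"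
    using K12 \<delta> a0 by (auto intro!: mult_right_mono)
  ultimately have "nrm (grid ?I) w \<le> (K1 + K2) * \<delta> * ?a" by linarith
  then show ?thesis unfolding K1_def K2_def D_def \<delta>_def .
qed

end

text \<open>On the diagonal the values are explicit: an unscaled Legendre function has traces 1 or
  -1, end slopes of modulus S / 2 and gradient energy S = s (s + 1) <= 2 p^2, so its form is O(p^2).
  The normalization contributes one factor 2 s + 1, of order k, instead of the k^2 of a general
  inverse estimate.\<close>

lemma line_mat_diagonal:
  assumes h: "h > 0" and \<alpha>: "\<alpha> \<ge> 0" and k: "k \<le> p" "p \<ge> 1" and m: "m \<in> line_index n k"
  shows "line_mat n h \<alpha> p m m \<le> (24 + 4 * \<alpha>) * (real p)\<^sup>2 * (real k + 1) / h\<^sup>2"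
proof -
  define t s where "t = fst m" and "s = snd m"
  have t: "t < n" and s: "s \<le> k" using m unfolding line_index_def t_def s_def by auto
  define v where "v = (\<lambda>t'. if t' = t then legendre s else 0)"
  define S where "S = real s * (real s + 1)"
  have S: "0 \<le> S" "S \<le> 2 * (real p)\<^sup>2"
  proof -
    show "0 \<le> S" unfolding S_def by simp
    have "real s * (real s + 1) \<le> real p * (2 * real p)" using s k by (intro mult_mono) auto
    then show "S \<le> 2 * (real p)\<^sup>2" unfolding S_def by (simp add: power2_eq_square)
  qed
  have "line_basis h m = (\<lambda>t'. Polynomial.smult (sqrt ((2 * real s + 1) / h)) (v t'))"
    unfolding line_basis_def v_def t_def s_def by auto
  then have "line_form n \<alpha> p (line_basis h m) (line_basis h m) = sqrt ((2 * real s + 1) / h) * (sqrt ((2 * real s + 1) / h) * line_form n \<alpha> p v v)"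
    by (simp only: line_form_smult line_form_commute[of n \<alpha> p v "\<lambda>t'. Polynomial.smult (sqrt ((2 * real s + 1) / h)) (v t')"])
  also have "\<dots> = (2 * real s + 1) / h * line_form n \<alpha> p v v"
    unfolding mult.assoc[symmetric] using h by simp
  finally have e: "line_form n \<alpha> p (line_basis h m) (line_basis h m) = (2 * real s + 1) / h * line_form n \<alpha> p v v" .
  have jump: "\<bar>node_jump n v x\<bar> \<le> (if x \<in> {t, Suc t} then 1 else 0)" for x
    using t by (auto simp: node_jump_def v_def poly_legendre_1 poly_legendre_minus_1 power_abs)
  have slope: "\<bar>node_slope n v x\<bar> \<le> S / 2" for x
    using t S by (auto simp: node_slope_def v_def S_def poly_pderiv_legendre_1 poly_pderiv_legendre_minus_1 abs_mult power_abs)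
  have two: "(\<Sum>x\<le>n. if x \<in> {t, Suc t} then y else 0) = 2 * y" for y :: real
  proof -
    have "(\<Sum>x\<le>n. if x \<in> {t, Suc t} then y else 0) = (\<Sum>x\<in>{t, Suc t}. y)"
      using t by (intro sum.mono_neutral_cong_right) auto
    then show ?thesis by simp
  qed
  have "- (node_slope n v x * node_jump n v x) \<le> (if x \<in> {t, Suc t} then S / 2 else 0)" for x
  proof -
    have "- (node_slope n v x * node_jump n v x) \<le> \<bar>node_slope n v x\<bar> * \<bar>node_jump n v x\<bar>"
      unfolding abs_mult[symmetric] by simp
    also have "\<dots> \<le> S / 2 * (if x \<in> {t, Suc t} then 1 else 0)" using S by (intro mult_mono slope jump) auto
    finally show ?thesis by (cases "x \<in> {t, Suc t}") (simp_all only: if_True if_False mult_1_right mult_zero_right)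
  qed
  then have "(\<Sum>x\<le>n. - (node_slope n v x * node_jump n v x)) \<le> (\<Sum>x\<le>n. if x \<in> {t, Suc t} then S / 2 else 0)" by (rule sum_mono)
  then have b1: "- (\<Sum>x\<le>n. node_slope n v x * node_jump n v x) \<le> S" unfolding two by (simp add: sum_negf)
  have "node_jump n v x * node_jump n v x \<le> (if x \<in> {t, Suc t} then 1 else 0)" for x
  proof -
    have "node_jump n v x * node_jump n v x = \<bar>node_jump n v x\<bar> * \<bar>node_jump n v x\<bar>" by simp
    also have "\<dots> \<le> (if x \<in> {t, Suc t} then 1 else 0) * (if x \<in> {t, Suc t} then 1 else 0)"
      by (intro mult_mono jump) auto
    finally show ?thesis by (cases "x \<in> {t, Suc t}") (simp_all only: if_True if_False mult_1_right mult_zero_right)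
  qed
  then have "(\<Sum>x\<le>n. node_jump n v x * node_jump n v x) \<le> (\<Sum>x\<le>n. if x \<in> {t, Suc t} then 1 else 0)" by (rule sum_mono)
  then have b2: "(\<Sum>x\<le>n. node_jump n v x * node_jump n v x) \<le> 2" unfolding two by simp
  have "(\<Sum>t'<n. pint (pderiv (v t') * pderiv (v t'))) = (\<Sum>t'<n. if t' = t then S else 0)"
    by (rule sum.cong) (auto simp: v_def S_def pint_pderiv_legendre_sq)
  then have b3: "(\<Sum>t'<n. pint (pderiv (v t') * pderiv (v t'))) = S" using t by simp
  have "\<alpha> * (real p)\<^sup>2 * (\<Sum>x\<le>n. node_jump n v x * node_jump n v x) \<le> \<alpha> * (real p)\<^sup>2 * 2"
    using \<alpha> b2 by (intro mult_left_mono) auto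
  then have "line_form n \<alpha> p v v \<le> 6 * S + \<alpha> * (real p)\<^sup>2 * 2"
    unfolding line_form_def b3 using b1 by simp
  also have "\<dots> \<le> (12 + 2 * \<alpha>) * (real p)\<^sup>2" using S by (simp add: algebra_simps)
  finally have b: "line_form n \<alpha> p v v \<le> (12 + 2 * \<alpha>) * (real p)\<^sup>2" .
  have "(2 * real s + 1) / h * line_form n \<alpha> p v v \<le> (2 * (real k + 1)) / h * ((12 + 2 * \<alpha>) * (real p)\<^sup>2)"
  proof -
    have "(2 * real s + 1) / h * line_form n \<alpha> p v v \<le> (2 * real s + 1) / h * ((12 + 2 * \<alpha>) * (real p)\<^sup>2)"
      using b h by (intro mult_left_mono) auto
    also have "\<dots> \<le> (2 * (real k + 1)) / h * ((12 + 2 * \<alpha>) * (real p)\<^sup>2)"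
      using s h \<alpha> by (intro mult_right_mono divide_right_mono) auto
    finally show ?thesis .
  qed
  then have "line_mat n h \<alpha> p m m \<le> (2 * (real k + 1)) / h * ((12 + 2 * \<alpha>) * (real p)\<^sup>2) / h"
    unfolding line_mat_def e using h by (intro divide_right_mono) auto
  also have "\<dots> = (24 + 4 * \<alpha>) * (real p)\<^sup>2 * (real k + 1) / h\<^sup>2" using h by (simp add: field_simps power2_eq_square)
  finally show ?thesis .
qed

subsection \<open>The level matrices\<close>

definition tensor_kernel :: "('d::finite \<Rightarrow> 'a \<Rightarrow> 'a \<Rightarrow> real) \<Rightarrow> ('d \<Rightarrow> 'a) \<Rightarrow> ('d \<Rightarrow> 'a) \<Rightarrow> real" where
  "tensor_kernel S n n' = (\<Sum>i\<in>UNIV. S i (n i) (n' i) * (\<Prod>j\<in>UNIV - {i}. if n j = n' j then 1 else 0))"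

lemma tensor_form_kernel_eq:
  assumes "\<And>i. finite (I i)"
  shows "tensor_form I S f g = (\<Sum>n\<in>grid I. \<Sum>n'\<in>grid I. f n * g n' * tensor_kernel S n n')"
  unfolding tensor_kernel_def by (rule tensor_form_kernel[symmetric, OF assms]) simp

lemma tensor_kernel_diag: "tensor_kernel S n n = (\<Sum>i\<in>UNIV. S i (n i) (n i))"
  unfolding tensor_kernel_def by simp

lemma tensor_kernel_commute:
  assumes "\<And>i x y. S i x y = S i y x" shows "tensor_kernel S n n' = tensor_kernel S n' n"
proof -
  have "(if n j = n' j then 1 else 0) = (if n' j = n j then 1 else (0::real))" for j by auto
  then show ?thesis unfolding tensor_kernel_def using assms by simp
qed

lemma inherited_mat_carrier: "inherited_mat M \<alpha> p e k \<in> carrier_mat (level_dim M k) (level_dim M k)"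
  unfolding inherited_mat_def by simp

lemma prolongation_carrier: "prolongation M e k \<in> carrier_mat (level_dim M k) (level_dim M (k - 1))"
  unfolding prolongation_def by simp

context
  fixes M :: "'d::finite cartesian_mesh" and \<alpha> :: real and p :: nat and e :: "nat \<Rightarrow> nat \<Rightarrow> ('d \<Rightarrow> nat) \<times> ('d \<Rightarrow> nat)"
  assumes h: "edge M > 0" and N: "\<And>i. cells_along M i > 0" and ord: "basis_orderings M p e"
begin

text \<open>Coefficients in the orthonormal basis indexed by the tensor grid, of the function with
  coefficient vector v in the given basis.\<close>

definition coords :: "nat \<Rightarrow> real vec \<Rightarrow> ('d \<Rightarrow> nat \<times> nat) \<Rightarrow> real" where
  "coords k v n = vec_index v (inv_into {..<level_dim M k} (\<lambda>r. dof_of (e k r)) n) / basis_scale M n"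

lemma bij_e: "k \<in> {1..p} \<Longrightarrow> bij_betw (e k) {..<level_dim M k} (basis_index M k)"
  using ord unfolding basis_orderings_def by blast

lemma bij_dof: assumes "k \<in> {1..p}" shows "bij_betw (\<lambda>r. dof_of (e k r)) {..<level_dim M k} (grid (dofs M k))"
  using bij_betw_trans[OF bij_e[OF assms] bij_betw_dof_of] by (simp add: comp_def)

lemma coords_dof:
  assumes "k \<in> {1..p}" "r < level_dim M k" shows "coords k v (dof_of (e k r)) = vec_index v r / basis_scale M (dof_of (e k r))"
  unfolding coords_def using inv_into_f_f[OF bij_betw_imp_inj_on[OF bij_dof[OF assms(1)]], of r] assms(2) by simp

lemma inherited_mat_entry:
  assumes k: "k \<in> {1..p}" and rs: "r < level_dim M k" "s < level_dim M k"
  shows "inherited_mat M \<alpha> p e k $$ (r, s) = tensor_kernel (stiffness M \<alpha> p) (dof_of (e k r)) (dof_of (e k s)) / (basis_scale M (dof_of (e k r)) * basis_scale M (dof_of (e k s)))"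
proof -
  have b: "e k r \<in> basis_index M k" "e k s \<in> basis_index M k" using bij_betwE[OF bij_e[OF k]] rs by auto
  have g: "dof_of (e k r) \<in> grid (dofs M k)" "dof_of (e k s) \<in> grid (dofs M k)" using bij_betwE[OF bij_dof[OF k]] rs by auto
  have "inherited_mat M \<alpha> p e k $$ (r, s) = dg_form M \<alpha> p (basis_fun M (e k r)) (basis_fun M (e k s))"
    unfolding inherited_mat_def using rs by simp
  also have "\<dots> = (\<Sum>n\<in>grid (dofs M k). \<Sum>n'\<in>grid (dofs M k).
      (if n = dof_of (e k r) then 1 / basis_scale M n else 0) * (if n' = dof_of (e k s) then 1 / basis_scale M n' else 0) * tensor_kernel (stiffness M \<alpha> p) n n')"
    unfolding basis_fun_eq_mesh_fun[OF h N b(1)] basis_fun_eq_mesh_fun[OF h N b(2)] dg_form_mesh_fun[OF h N]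
    by (rule tensor_form_kernel_eq) simp
  also have "\<dots> = (\<Sum>n\<in>grid (dofs M k). if n = dof_of (e k r) then (\<Sum>n'\<in>grid (dofs M k).
      if n' = dof_of (e k s) then 1 / basis_scale M (dof_of (e k r)) * (1 / basis_scale M (dof_of (e k s))) * tensor_kernel (stiffness M \<alpha> p) (dof_of (e k r)) (dof_of (e k s)) else 0) else 0)"
    by (intro sum.cong refl) (auto intro!: sum.cong)
  also have "\<dots> = 1 / basis_scale M (dof_of (e k r)) * (1 / basis_scale M (dof_of (e k s))) * tensor_kernel (stiffness M \<alpha> p) (dof_of (e k r)) (dof_of (e k s))"
    using g by (simp add: finite_dofs)
  finally show ?thesis by simp
qed

lemma mform_inherited_mat:
  assumes k: "k \<in> {1..p}" and v: "v \<in> carrier_vec (level_dim M k)" "w \<in> carrier_vec (level_dim M k)"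
  shows "mform (inherited_mat M \<alpha> p e k) v w = tensor_form (dofs M k) (stiffness M \<alpha> p) (coords k v) (coords k w)"
proof -
  let ?K = "tensor_kernel (stiffness M \<alpha> p)"
  have "mform (inherited_mat M \<alpha> p e k) v w = (\<Sum>r<level_dim M k. \<Sum>s<level_dim M k. vec_index v r * (inherited_mat M \<alpha> p e k $$ (r, s) * vec_index w s))"
    unfolding mform_inner_on[OF inherited_mat_carrier v] inner_on_def mat_app_def by (simp add: sum_distrib_left)
  also have "\<dots> = (\<Sum>r<level_dim M k. \<Sum>s<level_dim M k. coords k v (dof_of (e k r)) * coords k w (dof_of (e k s)) * ?K (dof_of (e k r)) (dof_of (e k s)))"
    by (intro sum.cong refl) (simp add: inherited_mat_entry[OF k] coords_dof[OF k])
  also have "\<dots> = (\<Sum>r<level_dim M k. \<Sum>n'\<in>grid (dofs M k). coords k v (dof_of (e k r)) * coords k w n' * ?K (dof_of (e k r)) n')"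
    by (rule sum.cong[OF refl], rule sum.reindex_bij_betw[OF bij_dof[OF k]])
  also have "\<dots> = (\<Sum>n\<in>grid (dofs M k). \<Sum>n'\<in>grid (dofs M k). coords k v n * coords k w n' * ?K n n')"
    by (rule sum.reindex_bij_betw[OF bij_dof[OF k], of "\<lambda>n. \<Sum>n'\<in>grid (dofs M k). coords k v n * coords k w n' * ?K n n'"])
  finally show ?thesis by (simp add: tensor_form_kernel_eq)
qed

lemma inner_on_coords:
  assumes k: "k \<in> {1..p}"
  shows "inner_on (grid (dofs M k)) (coords k v) (coords k v) = (\<Sum>r<level_dim M k. (vec_index v r / basis_scale M (dof_of (e k r)))\<^sup>2)"
proof -
  have "(\<Sum>r<level_dim M k. (vec_index v r / basis_scale M (dof_of (e k r)))\<^sup>2) = (\<Sum>r<level_dim M k. (coords k v (dof_of (e k r)))\<^sup>2)"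
    by (intro sum.cong refl) (simp add: coords_dof[OF k])
  also have "\<dots> = (\<Sum>n\<in>grid (dofs M k). (coords k v n)\<^sup>2)"
    by (rule sum.reindex_bij_betw[OF bij_dof[OF k], of "\<lambda>n. (coords k v n)\<^sup>2"])
  finally show ?thesis unfolding inner_on_def by (simp add: power2_eq_square)
qed

text \<open>The quadratic form of the diagonal part does not change under a diagonal rescaling of
  the basis, so it may be estimated in the orthonormal one.\<close>

lemma mform_diag_part_le:
  assumes k: "k \<in> {1..p}" and \<alpha>: "\<alpha> \<ge> 0" and v: "v \<in> carrier_vec (level_dim M k)"
  shows "mform (diag_part (inherited_mat M \<alpha> p e k)) v v
    \<le> real CARD('d) * ((24 + 4 * \<alpha>) * (real p)\<^sup>2 * (real k + 1) / (edge M)\<^sup>2) * inner_on (grid (dofs M k)) (coords k v) (coords k v)"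
proof -
  let ?c = "real CARD('d) * ((24 + 4 * \<alpha>) * (real p)\<^sup>2 * (real k + 1) / (edge M)\<^sup>2)"
  have "mform (diag_part (inherited_mat M \<alpha> p e k)) v v = (\<Sum>r<level_dim M k. inherited_mat M \<alpha> p e k $$ (r, r) * vec_index v r * vec_index v r)"
    by (rule mform_diag_part[OF inherited_mat_carrier v v])
  also have "\<dots> = (\<Sum>r<level_dim M k. tensor_kernel (stiffness M \<alpha> p) (dof_of (e k r)) (dof_of (e k r)) * (vec_index v r / basis_scale M (dof_of (e k r)))\<^sup>2)"
    by (intro sum.cong refl) (simp add: inherited_mat_entry[OF k] power2_eq_square)
  also have "\<dots> \<le> (\<Sum>r<level_dim M k. ?c * (vec_index v r / basis_scale M (dof_of (e k r)))\<^sup>2)"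
  proof (intro sum_mono mult_right_mono)
    fix r assume "r \<in> {..<level_dim M k}"
    then have g: "dof_of (e k r) \<in> grid (dofs M k)" using bij_betwE[OF bij_dof[OF k]] by auto
    have "tensor_kernel (stiffness M \<alpha> p) (dof_of (e k r)) (dof_of (e k r)) \<le> (\<Sum>i\<in>(UNIV :: 'd set). (24 + 4 * \<alpha>) * (real p)\<^sup>2 * (real k + 1) / (edge M)\<^sup>2)"
      unfolding tensor_kernel_diag
      by (rule sum_mono, rule line_mat_diagonal) (use h \<alpha> k g in \<open>auto simp: grid_def\<close>)
    then show "tensor_kernel (stiffness M \<alpha> p) (dof_of (e k r)) (dof_of (e k r)) \<le> ?c" by simp
  qed simp
  finally show ?thesis unfolding inner_on_coords[OF k] sum_distrib_left .
qed

lemma spd_inherited_mat: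
  assumes k: "k \<in> {1..p}" and c: "c > 0"
    and coer: "\<And>v. v \<in> broken_space M p \<Longrightarrow> c * (dg_norm M p v)\<^sup>2 \<le> dg_form M \<alpha> p v v"
  shows "spd (level_dim M k) (inherited_mat M \<alpha> p e k)"
  unfolding spd_def
proof (intro conjI allI impI ballI)
  show "inherited_mat M \<alpha> p e k \<in> carrier_mat (level_dim M k) (level_dim M k)" by (rule inherited_mat_carrier)
  show "inherited_mat M \<alpha> p e k $$ (i, j) = inherited_mat M \<alpha> p e k $$ (j, i)" if "i < level_dim M k" "j < level_dim M k" for i j
    using that by (simp add: inherited_mat_entry[OF k] mult.commute tensor_kernel_commute[where n = "dof_of (e k i)", OF line_mat_symmetric])
  fix v :: "real vec" assume v: "v \<in> carrier_vec (level_dim M k)" "v \<noteq> 0\<^sub>v (level_dim M k)"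
  define i :: 'd where "i = undefined"
  have "inner_on (grid (dofs M k)) (coords k v) (coords k v) \<noteq> 0"
  proof
    assume "inner_on (grid (dofs M k)) (coords k v) (coords k v) = 0"
    then have "(vec_index v r / basis_scale M (dof_of (e k r)))\<^sup>2 = 0" if "r < level_dim M k" for r
      unfolding inner_on_coords[OF k] using that by (subst (asm) sum_nonneg_eq_0_iff) auto
    then have "vec_index v r = 0" if "r < level_dim M k" for r using that basis_scale_pos[OF h N, of "dof_of (e k r)"] by force
    then have "v = 0\<^sub>v (level_dim M k)" using v(1) by (intro eq_vecI) auto
    then show False using v(2) by blast
  qed
  then have "0 < inner_on (grid (dofs M k)) (coords k v) (coords k v)"
    using inner_on_nonneg[of "grid (dofs M k)" "coords k v"] by linarith
  then have "0 < c / (72 * (edge M * real (cells_along M i))\<^sup>2) * inner_on (grid (dofs M k)) (coords k v) (coords k v)"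
    using c h N[of i] by simp
  also have "\<dots> \<le> mform (inherited_mat M \<alpha> p e k) v v"
    unfolding mform_inherited_mat[OF k v(1) v(1)]
    by (rule tensor_poincare[OF h N _ _ c]) (use k in simp, use k in simp, rule coer)
  finally show "mform (inherited_mat M \<alpha> p e k) v v > 0" .
qed

lemma basis_index_subset: "basis_index M (k - 1) \<subseteq> basis_index M k"
  unfolding basis_index_def by (auto intro: order_trans)

lemma prolongation_entry:
  assumes "k \<in> {1..p}" "k - 1 \<in> {1..p}" "s < level_dim M (k - 1)" "r < level_dim M k"
  shows "prolongation M e k $$ (r, s) = (if r = inv_into {..<level_dim M k} (e k) (e (k - 1) s) then 1 else 0)"
    and "inv_into {..<level_dim M k} (e k) (e (k - 1) s) < level_dim M k" and "e k (inv_into {..<level_dim M k} (e k) (e (k - 1) s)) = e (k - 1) s"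
proof -
  have "e (k - 1) s \<in> basis_index M k"
    using bij_betwE[OF bij_e[OF assms(2)]] assms(3) basis_index_subset by blast
  then have i: "e (k - 1) s \<in> e k ` {..<level_dim M k}" using bij_betw_imp_surj_on[OF bij_e[OF assms(1)]] by simp
  show "inv_into {..<level_dim M k} (e k) (e (k - 1) s) < level_dim M k" using inv_into_into[OF i] by simp
  show e: "e k (inv_into {..<level_dim M k} (e k) (e (k - 1) s)) = e (k - 1) s" by (rule f_inv_into_f[OF i])
  have "e k r = e (k - 1) s \<longleftrightarrow> r = inv_into {..<level_dim M k} (e k) (e (k - 1) s)"
    using e bij_betw_imp_inj_on[OF bij_e[OF assms(1)]] assms(4) by (metis inv_into_f_f lessThan_iff)
  then show "prolongation M e k $$ (r, s) = (if r = inv_into {..<level_dim M k} (e k) (e (k - 1) s) then 1 else 0)"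
    unfolding prolongation_def using assms by simp
qed

text \<open>The bases are nested and every level uses the form with the same penalty, so the coarse
  matrix is literally a submatrix of the fine one, and P selects its rows and columns.\<close>

lemma galerkin:
  assumes k: "k \<in> {1..p}" "k - 1 \<in> {1..p}"
  shows "inherited_mat M \<alpha> p e (k - 1) = (prolongation M e k)\<^sup>T * (inherited_mat M \<alpha> p e k * prolongation M e k)"
proof (rule eq_matI)
  let ?P = "prolongation M e k"
  define j where "j s = inv_into {..<level_dim M k} (e k) (e (k - 1) s)" for s
  note P = prolongation_carrier[where M = M and e = e and k = k] and Ac = inherited_mat_carrier[where M = M and \<alpha> = \<alpha> and p = p and e = e and k = k]
  show "dim_row (inherited_mat M \<alpha> p e (k - 1)) = dim_row (?P\<^sup>T * (inherited_mat M \<alpha> p e k * ?P))" "dim_col (inherited_mat M \<alpha> p e (k - 1)) = dim_col (?P\<^sup>T * (inherited_mat M \<alpha> p e k * ?P))"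
    using P Ac inherited_mat_carrier[where M = M and \<alpha> = \<alpha> and p = p and e = e and k = "k - 1"] by auto
  fix s t assume "s < dim_row (?P\<^sup>T * (inherited_mat M \<alpha> p e k * ?P))" "t < dim_col (?P\<^sup>T * (inherited_mat M \<alpha> p e k * ?P))"
  then have st: "s < level_dim M (k - 1)" "t < level_dim M (k - 1)" using P Ac by auto
  have pe: "?P $$ (r, s) = (if r = j s then 1 else 0)" if "r < level_dim M k" "s < level_dim M (k - 1)" for r s
    unfolding j_def using prolongation_entry(1)[OF k that(2,1)] .
  have j: "j s < level_dim M k" "e k (j s) = e (k - 1) s" if "s < level_dim M (k - 1)" for s
  proof -
    have "level_dim M k > 0" using bij_e[OF k(1)] bij_betwE[OF bij_e[OF k(2)]] that basis_index_subset[of k]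
      by (metis bij_betw_imp_surj_on emptyE gr0I image_empty lessThan_0 lessThan_iff subsetD)
    then show "j s < level_dim M k" "e k (j s) = e (k - 1) s" unfolding j_def using prolongation_entry(2,3)[OF k that] by auto
  qed
  have AP: "(inherited_mat M \<alpha> p e k * ?P) $$ (r, t) = inherited_mat M \<alpha> p e k $$ (r, j t)" if "r < level_dim M k" for r
  proof -
    have "(inherited_mat M \<alpha> p e k * ?P) $$ (r, t) = (\<Sum>r'<level_dim M k. inherited_mat M \<alpha> p e k $$ (r, r') * ?P $$ (r', t))"
      using that st P Ac by (auto simp: scalar_prod_def atLeast0LessThan intro!: sum.cong)
    also have "\<dots> = (\<Sum>r'<level_dim M k. if r' = j t then inherited_mat M \<alpha> p e k $$ (r, j t) else 0)"
      by (rule sum.cong) (use pe st in auto)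
    finally show ?thesis using j(1)[OF st(2)] by simp
  qed
  have "(?P\<^sup>T * (inherited_mat M \<alpha> p e k * ?P)) $$ (s, t) = (\<Sum>r<level_dim M k. ?P $$ (r, s) * (inherited_mat M \<alpha> p e k * ?P) $$ (r, t))"
    using st P Ac by (auto simp: scalar_prod_def atLeast0LessThan intro!: sum.cong)
  also have "\<dots> = (\<Sum>r<level_dim M k. if r = j s then inherited_mat M \<alpha> p e k $$ (j s, j t) else 0)"
    by (rule sum.cong) (use pe st AP in auto)
  also have "\<dots> = inherited_mat M \<alpha> p e k $$ (j s, j t)" using j(1)[OF st(1)] by simp
  also have "\<dots> = inherited_mat M \<alpha> p e (k - 1) $$ (s, t)" unfolding inherited_mat_def using st j by simp
  finally show "inherited_mat M \<alpha> p e (k - 1) $$ (s, t) = (?P\<^sup>T * (inherited_mat M \<alpha> p e k * ?P)) $$ (s, t)" by simp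
qed

text \<open>Every grid vector that vanishes wherever some degree is k comes from the range of P.
  Thus orthogonality to that range becomes the hypothesis on w in
  \<open>approximation_property\<close>.\<close>

lemma coords_prolongation:
  assumes k: "k \<in> {2..p}" and g: "\<And>n i. snd (n i) \<ge> k \<Longrightarrow> g n = 0"
  obtains z where "z \<in> carrier_vec (level_dim M (k - 1))" "\<And>n. n \<in> grid (dofs M k) \<Longrightarrow> coords k (prolongation M e k *\<^sub>v z) n = g n"
proof
  let ?P = "prolongation M e k"
  define z where "z = Matrix.vec (level_dim M (k - 1)) (\<lambda>s. g (dof_of (e (k - 1) s)) * basis_scale M (dof_of (e (k - 1) s)))"
  show z: "z \<in> carrier_vec (level_dim M (k - 1))" unfolding z_def by simp
  have k': "k \<in> {1..p}" "k - 1 \<in> {1..p}" using k by auto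
  fix n assume "n \<in> grid (dofs M k)"
  then have "n \<in> (\<lambda>r. dof_of (e k r)) ` {..<level_dim M k}" using bij_betw_imp_surj_on[OF bij_dof[OF k'(1)]] by simp
  then obtain r where r: "r < level_dim M k" "n = dof_of (e k r)" by auto
  have b: "e k r \<in> basis_index M k" using bij_betwE[OF bij_e[OF k'(1)]] r by auto
  have "vec_index (?P *\<^sub>v z) r = (\<Sum>s<level_dim M (k - 1). ?P $$ (r, s) * vec_index z s)"
    by (rule mult_mat_vec_index_sum[OF prolongation_carrier z r(1)])
  also have "\<dots> = (\<Sum>s<level_dim M (k - 1). if e k r = e (k - 1) s then g n * basis_scale M n else 0)"
    by (rule sum.cong) (use r in \<open>auto simp: prolongation_def z_def\<close>)
  also have "\<dots> = g n * basis_scale M n"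
  proof (cases "e k r \<in> basis_index M (k - 1)")
    case True
    then have "e k r \<in> e (k - 1) ` {..<level_dim M (k - 1)}" using bij_betw_imp_surj_on[OF bij_e[OF k'(2)]] by simp
    then obtain s where s: "s < level_dim M (k - 1)" "e k r = e (k - 1) s" by auto
    have "e k r = e (k - 1) s' \<longleftrightarrow> s' = s" if "s' < level_dim M (k - 1)" for s'
      using s inj_onD[OF bij_betw_imp_inj_on[OF bij_e[OF k'(2)]], of s s'] that by auto
    then have "(\<Sum>s'<level_dim M (k - 1). if e k r = e (k - 1) s' then g n * basis_scale M n else 0) = (\<Sum>s'<level_dim M (k - 1). if s' = s then g n * basis_scale M n else 0)"
      by (intro sum.cong) auto
    then show ?thesis using s by simp
  next
    case False
    then obtain i where "snd (e k r) i > k - 1" using b unfolding basis_index_def mem_Times_iff by (auto simp: not_le)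
    then have "snd (n i) \<ge> k" unfolding r(2) dof_of_def by simp
    then show ?thesis using g[of n i] by simp
  qed
  finally show "coords k (?P *\<^sub>v z) n = g n"
    using basis_scale_pos[OF h N, of n] unfolding r(2) coords_dof[OF k'(1) r(1)] by simp
qed

end

subsection \<open>Convergence\<close>

lemma power_norm_1:
  assumes "A \<in> carrier_mat n n"
  shows "power_norm A 1 v = sqrt (mform A v v)"
  unfolding power_norm_def mform_def using assms by simp

text \<open>B is j times the ratio of approximation to smoothing at level j: \<kappa> = C1 p^2 / j,
  and q >= m^2 c_lo / (9 p) from 4 m^2 <= (2 m + 1)^2, p + 1 <= 2 p and the 18 of the Chebyshev
  bound. So \<kappa> / (\<kappa> + q) takes the form B / (B + j) with B independent of the
  level.\<close>

lemma W_cycle_contraction: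
  fixes M :: "'d::finite cartesian_mesh" and C1 c_lo :: real
  assumes h: "edge M > 0" and N: "\<And>i. cells_along M i > 0" and ord: "basis_orderings M p e"
    and c: "c > 0" and coer: "\<And>v. v \<in> broken_space M p \<Longrightarrow> c * (dg_norm M p v)\<^sup>2 \<le> dg_form M \<alpha> p v v"
    and C1: "C1 > 0" and c_lo: "c_lo > 0" and m: "m \<ge> 1"
    and \<omega>: "\<And>j. j \<in> {2..p} \<Longrightarrow> \<omega> j > 0 \<and>
       \<omega> j * spec_radius (inv_mat (diag_part (inherited_mat M \<alpha> p e j)) * inherited_mat M \<alpha> p e j) \<le> 1 \<and> c_lo / (real p + 1) \<le> \<omega> j"
    and fine: "\<And>j x. j \<in> {2..p} \<Longrightarrow> x \<in> carrier_vec (level_dim M j) \<Longrightarrow>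
       (\<And>z. z \<in> carrier_vec (level_dim M (j - 1)) \<Longrightarrow> mform (inherited_mat M \<alpha> p e j) x (prolongation M e j *\<^sub>v z) = 0) \<Longrightarrow>
       mform (diag_part (inherited_mat M \<alpha> p e j)) x x \<le> C1 * (real p)\<^sup>2 / real j * mform (inherited_mat M \<alpha> p e j) x x"
    and k: "k \<in> {1..p}"
  defines "B \<equiv> 9 * C1 / c_lo * (real p) ^ 3 / (real m)\<^sup>2"
  shows "W_error M \<alpha> p e \<omega> m k \<in> carrier_mat (level_dim M k) (level_dim M k) \<and>
    (\<forall>g\<in>carrier_vec (level_dim M k). sqrt (mform (inherited_mat M \<alpha> p e k) (W_error M \<alpha> p e \<omega> m k *\<^sub>v g) (W_error M \<alpha> p e \<omega> m k *\<^sub>v g))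
      \<le> contraction B k * sqrt (mform (inherited_mat M \<alpha> p e k) g g))"
  using k
proof (induction k)
  case (Suc k)
  have p: "p \<ge> 1" using Suc.prems by simp
  have B: "B > 0" unfolding B_def using C1 c_lo m p by simp
  show ?case
  proof (cases "k = 0")
    case True
    have W: "W_error M \<alpha> p e \<omega> m (Suc k) = 0\<^sub>m (level_dim M (Suc k)) (level_dim M (Suc k))" using True by simp
    have "mform (inherited_mat M \<alpha> p e (Suc k)) (0\<^sub>v (level_dim M (Suc k))) (0\<^sub>v (level_dim M (Suc k))) = 0"
      unfolding mform_def using inherited_mat_carrier[where M = M and \<alpha> = \<alpha> and p = p and e = e and k = "Suc k"] by simp
    moreover have "0\<^sub>m n n *\<^sub>v g = 0\<^sub>v n" if "g \<in> carrier_vec n" for n and g :: "real Matrix.vec"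
      using that by (intro eq_vecI) (auto simp: scalar_prod_def)
    ultimately show ?thesis unfolding W using True by simp
  next
    case False
    define j where "j = Suc k"
    define A where "A = inherited_mat M \<alpha> p e j"
    define A' where "A' = inherited_mat M \<alpha> p e k"
    define P where "P = prolongation M e j"
    define G where "G = smoother M \<alpha> p e \<omega> m j"
    define W where "W = W_error M \<alpha> p e \<omega> m k"
    define \<tau> where "\<tau> = B / (B + real j)"
    define \<gamma> where "\<gamma> = contraction B k"
    have j: "j \<in> {1..p}" "j \<in> {2..p}" "j - 1 \<in> {1..p}" and k: "k \<in> {1..p}" "j - 1 = k" "1 \<le> k"
      using Suc.prems False unfolding j_def by auto
    have A: "spd (level_dim M j) A" unfolding A_def by (rule spd_inherited_mat[OF h N ord j(1) c]) (rule coer)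
    have A': "spd (level_dim M k) A'" unfolding A'_def by (rule spd_inherited_mat[OF h N ord k(1) c]) (rule coer)
    have P: "P \<in> carrier_mat (level_dim M j) (level_dim M k)" unfolding P_def using prolongation_carrier[where M = M and e = e and k = j] k(2) by simp
    have Gal: "A' = P\<^sup>T * (A * P)" unfolding A'_def P_def A_def using galerkin[OF h N ord j(1,3)] k(2) by simp
    have G_eq: "G = poly_at_mat (cheb4 m) (\<omega> j \<cdot>\<^sub>m (inv_mat (diag_part A) * A))" unfolding G_def smoother_def A_def ..
    note om = \<omega>[OF j(2)]
    note smooth = chebyshev_smoother[OF A _ _ m, of "\<omega> j", folded G_eq]
    have om1: "0 < \<omega> j" "\<omega> j * spec_radius (inv_mat (diag_part A) * A) \<le> 1" using om unfolding A_def by auto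
    have IH: "W \<in> carrier_mat (level_dim M k) (level_dim M k)"
      "\<And>g. g \<in> carrier_vec (level_dim M k) \<Longrightarrow> sqrt (mform A' (W *\<^sub>v g) (W *\<^sub>v g)) \<le> \<gamma> * sqrt (mform A' g g)"
      using Suc.IH[OF k(1)] unfolding W_def A'_def \<gamma>_def by auto
    have \<gamma>: "0 \<le> \<gamma>" "\<gamma> \<le> 1" unfolding \<gamma>_def using contraction_range[of B k] B by auto
    have \<tau>: "0 \<le> \<tau>" "\<tau> \<le> 1" unfolding \<tau>_def using B by auto
    have fineG: "mform A (G *\<^sub>v x) (G *\<^sub>v x) \<le> \<tau> * mform A x x"
      if x: "x \<in> carrier_vec (level_dim M j)" and orth: "\<And>z. z \<in> carrier_vec (level_dim M k) \<Longrightarrow> mform A x (P *\<^sub>v z) = 0" for x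
    proof -
      define \<kappa> where "\<kappa> = C1 * (real p)\<^sup>2 / real j"
      define q where "q = (real m)\<^sup>2 * c_lo / (9 * real p)"
      have \<kappa>: "\<kappa> > 0" unfolding \<kappa>_def using C1 p j by simp
      have q: "q > 0" unfolding q_def using c_lo m p by simp
      have "mform (diag_part A) x x \<le> \<kappa> * mform A x x"
        unfolding A_def \<kappa>_def by (rule fine[OF j(2) x]) (use orth k(2) in \<open>auto simp: A_def P_def\<close>)
      then have "mform A (G *\<^sub>v x) (G *\<^sub>v x) \<le> \<kappa> / (\<kappa> + (real (2 * m + 1))\<^sup>2 * \<omega> j / 18) * mform A x x"
        by (rule smooth(4)[OF om1 x \<kappa>])
      also have "\<dots> \<le> \<kappa> / (\<kappa> + q) * mform A x x"
      proof (rule mult_right_mono)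
        have "c_lo / (2 * real p) \<le> c_lo / (real p + 1)" using c_lo p by (intro divide_left_mono) auto
        then have "c_lo / (2 * real p) \<le> \<omega> j" using om by linarith
        moreover have "(2 * real m)\<^sup>2 \<le> (real (2 * m + 1))\<^sup>2" by (intro power_mono) auto
        ultimately have "(2 * real m)\<^sup>2 * (c_lo / (2 * real p)) \<le> (real (2 * m + 1))\<^sup>2 * \<omega> j"
          using c_lo p by (intro mult_mono) auto
        then have "q \<le> (real (2 * m + 1))\<^sup>2 * \<omega> j / 18" unfolding q_def by (simp add: power_mult_distrib field_simps)
        then show "\<kappa> / (\<kappa> + (real (2 * m + 1))\<^sup>2 * \<omega> j / 18) \<le> \<kappa> / (\<kappa> + q)"
          using \<kappa> q by (intro divide_left_mono) auto
        show "0 \<le> mform A x x" by (rule mform_nonneg[OF A x])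
      qed
      also have "\<kappa> / (\<kappa> + q) = \<tau>"
      proof -
        define r where "r = q / real j"
        have r: "r > 0" "q = real j * r" unfolding r_def using q j by auto
        have \<kappa>': "\<kappa> = B * r"
          unfolding r_def \<kappa>_def B_def q_def using c_lo m p j by (simp add: field_simps power2_eq_square power3_eq_cube)
        have "\<kappa> / (\<kappa> + q) = (B * r) / ((B + real j) * r)" unfolding \<kappa>' r(2) distrib_right ..
        also have "\<dots> = B / (B + real j)" using r by simp
        finally show ?thesis unfolding \<tau>_def .
      qed
      finally show ?thesis .
    qed
    have W': "W_error M \<alpha> p e \<omega> m (Suc k) = G * (inv_mat A - P * (1\<^sub>m (level_dim M k) - W ^\<^sub>m 2) * inv_mat A' * P\<^sup>T) * A * G"
      using False unfolding G_def A_def P_def W_def A'_def j_def by (simp add: Let_def)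
    have con: "\<tau> + (1 - \<tau>) * \<gamma>\<^sup>2 = contraction B (Suc k)"
    proof -
      have "1 - \<tau> = real j / (B + real j)" unfolding \<tau>_def using B by (simp add: field_simps)
      then have "\<tau> + (1 - \<tau>) * \<gamma>\<^sup>2 = (B + real j * \<gamma>\<^sup>2) / (B + real j)"
        unfolding \<tau>_def by (simp add: add_divide_distrib)
      then show ?thesis using False by (simp add: \<gamma>_def j_def)
    qed
    note Gc = smooth(1)[OF om1]
    have "G * (inv_mat A - P * (1\<^sub>m (level_dim M k) - W ^\<^sub>m 2) * inv_mat A' * P\<^sup>T) * A * G \<in> carrier_mat (level_dim M j) (level_dim M j)"
      using Gc by (intro carrier_matI) auto
    moreover have "sqrt (mform A (W_error M \<alpha> p e \<omega> m (Suc k) *\<^sub>v g) (W_error M \<alpha> p e \<omega> m (Suc k) *\<^sub>v g)) \<le> contraction B (Suc k) * sqrt (mform A g g)"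
      if g: "g \<in> carrier_vec (level_dim M j)" for g
      unfolding W' con[symmetric]
      by (rule W_cycle_step[OF A A' P Gal Gc IH(1) smooth(2)[OF om1] smooth(3)[OF om1] fineG \<tau> \<gamma> IH(2) g])
    ultimately show ?thesis unfolding W' A_def j_def by blast
  qed
qed simp

theorem theorem5p6:
  fixes \<Omega> :: "(real ^ 'd::finite) set" and a b :: "real ^ 'd" and \<alpha>\<^sub>0 c_lo c_up :: real
  assumes "\<Omega> = box a b" and "\<Omega> \<noteq> {}"
    and "\<alpha>\<^sub>0 > 0" and "uniformly_stable \<Omega> \<alpha>\<^sub>0"
    and "c_lo > 0" and "c_up > 0"
  shows "\<exists>C\<^sub>0 C. C\<^sub>0 > 0 \<and> C > 0 \<and> C / C\<^sub>0 < 1 \<and>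
    (\<forall>(M :: 'd cartesian_mesh) (p :: nat) e (\<omega> :: nat \<Rightarrow> real).
       uniform_mesh_of \<Omega> M \<longrightarrow> basis_orderings M p e \<longrightarrow>
       (\<forall>j\<in>{2..p}. \<omega> j > 0 \<and>
          \<omega> j * spec_radius (inv_mat (diag_part (inherited_mat M \<alpha>\<^sub>0 p e j)) *
                             inherited_mat M \<alpha>\<^sub>0 p e j) \<le> 1 \<and>
          c_lo / (real p + 1) \<le> \<omega> j \<and> \<omega> j \<le> c_up / (real p + 1)) \<longrightarrow>
       (\<forall>k\<in>{2..p}. \<forall>m :: nat. real m \<ge> C\<^sub>0 * (real p)\<^sup>2 / real k \<longrightarrow>
          (\<forall>g\<in>carrier_vec (level_dim M k).
             power_norm (inherited_mat M \<alpha>\<^sub>0 p e k) 1 (W_error M \<alpha>\<^sub>0 p e \<omega> m k *\<^sub>v g)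
               \<le> C * (real p)\<^sup>2 / (real k * real m) *
                  power_norm (inherited_mat M \<alpha>\<^sub>0 p e k) 1 g)))"
proof -
  from assms(4) obtain c where c: "c > 0" and
    coer: "\<And>M p v. uniform_mesh_of \<Omega> M \<Longrightarrow> p \<ge> 1 \<Longrightarrow> v \<in> broken_space M p \<Longrightarrow> c * (dg_norm M p v)\<^sup>2 \<le> dg_form M \<alpha>\<^sub>0 p v v"
    unfolding uniformly_stable_def by blast
  \<comment> \<open>Any direction serves for the Poincare constant.\<close>
  define i\<^sub>0 :: 'd where "i\<^sub>0 = undefined"
  define Gc where "Gc = (\<Sum>j\<in>UNIV. 5 / (b $ j - a $ j)\<^sup>2)"
  define cP where "cP = c / (72 * (b $ i\<^sub>0 - a $ i\<^sub>0)\<^sup>2)"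
  define Ka where "Ka = (real CARD('d))\<^sup>2 * (2 + (12 * (48 / c + 4) + 60) * (1 + (2 * Gc + 1))\<^sup>2) ^ CARD('d) * (1 + real CARD('d) * (2 * Gc + 1) / cP)
      + (1 + sqrt (576 * Gc / c)) / sqrt cP"
  define C1 where "C1 = 2 * real CARD('d) * (24 + 4 * \<alpha>\<^sub>0) * Ka\<^sup>2"
  define K where "K = 9 * C1 / c_lo"
  have ab: "a $ j < b $ j" for j using assms(1,2) unfolding box_ne_empty(2) by (simp add: interval_ne_empty_cart)
  have Gc: "Gc \<ge> 0" unfolding Gc_def by (intro sum_nonneg) auto
  have cP: "cP > 0" unfolding cP_def using c ab[of i\<^sub>0] by simp
  have Ka: "Ka > 0" unfolding Ka_def using Gc cP c by (intro add_nonneg_pos) (auto intro!: divide_pos_pos add_pos_nonneg)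
  have C1: "C1 > 0" unfolding C1_def using Ka assms(3) by simp
  have K: "K > 0" unfolding K_def using C1 assms(5) by simp
  show ?thesis
  \<comment> \<open>The square of the first constant is 400 K, as the recursion for the contraction
    numbers demands; the quotient of the two constants is 16 / 400.\<close>
  proof (rule exI[of _ "20 * sqrt K"], rule exI[of _ "16 * K / (20 * sqrt K)"], intro conjI allI impI ballI)
    show "20 * sqrt K > 0" "16 * K / (20 * sqrt K) > 0" using K by auto
    show "16 * K / (20 * sqrt K) / (20 * sqrt K) < 1" using K by (simp add: field_simps)
    fix M :: "'d cartesian_mesh" and p :: nat and e and \<omega> :: "nat \<Rightarrow> real" and k m :: nat and g :: "real Matrix.vec"
    assume M: "uniform_mesh_of \<Omega> M" and ord: "basis_orderings M p e"
      and \<omega>: "\<forall>j\<in>{2..p}. \<omega> j > 0 \<and>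
          \<omega> j * spec_radius (inv_mat (diag_part (inherited_mat M \<alpha>\<^sub>0 p e j)) * inherited_mat M \<alpha>\<^sub>0 p e j) \<le> 1 \<and>
          c_lo / (real p + 1) \<le> \<omega> j \<and> \<omega> j \<le> c_up / (real p + 1)"
      and k: "k \<in> {2..p}" and m: "20 * sqrt K * (real p)\<^sup>2 / real k \<le> real m" and g: "g \<in> carrier_vec (level_dim M k)"
    have h: "edge M > 0" and N: "\<And>i. cells_along M i > 0"
      and box: "box a b = box (origin M) (\<chi> i. origin M $ i + edge M * real (cells_along M i))"
      using M assms(1) unfolding uniform_mesh_of_def by auto
    \<comment> \<open>Equal nonempty open boxes have equal corners, seen by passing to closures.
      Hence all constants, which involve the mesh only through these products, depend on the domain
      alone.\<close>
    have L: "edge M * real (cells_along M j) = b $ j - a $ j" for j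
    proof -
      have "cbox a b = cbox (origin M) (\<chi> i. origin M $ i + edge M * real (cells_along M i))"
        using closure_box[of a b] closure_box[of "origin M"] box assms(1,2) by metis
      then have "a = origin M \<and> b = (\<chi> i. origin M $ i + edge M * real (cells_along M i))"
        using assms(1,2) box_subset_cbox[of a b] unfolding eq_cbox by blast
      then show ?thesis by simp
    qed
    have p: "p \<ge> 1" using k by simp
    note coerM = coer[OF M p]
    have fine: "mform (diag_part (inherited_mat M \<alpha>\<^sub>0 p e j)) x x \<le> C1 * (real p)\<^sup>2 / real j * mform (inherited_mat M \<alpha>\<^sub>0 p e j) x x"
      if j: "j \<in> {2..p}" and x: "x \<in> carrier_vec (level_dim M j)"
        and orth: "\<And>z. z \<in> carrier_vec (level_dim M (j - 1)) \<Longrightarrow> mform (inherited_mat M \<alpha>\<^sub>0 p e j) x (prolongation M e j *\<^sub>v z) = 0" for j x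
    proof -
      let ?I = "dofs M j" and ?S = "stiffness M \<alpha>\<^sub>0 p"
      define a where "a = tensor_form ?I ?S (coords M e j x) (coords M e j x)"
      have j1: "j \<in> {1..p}" using j by auto
      have a: "mform (inherited_mat M \<alpha>\<^sub>0 p e j) x x = a" unfolding a_def by (rule mform_inherited_mat[OF h N ord j1 x x])
      have a0: "a \<ge> 0" unfolding a[symmetric]
        by (rule mform_nonneg[OF spd_inherited_mat[OF h N ord j1 c] x]) (rule coerM)
      have "nrm (grid ?I) (coords M e j x) \<le> Ka * (edge M / real j) * sqrt a"
        unfolding Ka_def Gc_def cP_def L[symmetric] a_def
      proof (rule approximation_property[OF h N _ _ c])
        fix g :: "('d \<Rightarrow> nat \<times> nat) \<Rightarrow> real" assume "\<And>n i. snd (n i) \<ge> j \<Longrightarrow> g n = 0"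
        then obtain z where z: "z \<in> carrier_vec (level_dim M (j - 1))" "\<And>n. n \<in> grid ?I \<Longrightarrow> coords M e j (prolongation M e j *\<^sub>v z) n = g n"
          using coords_prolongation[OF h N ord j, of g] by blast
        have "tensor_form ?I ?S (coords M e j x) g = tensor_form ?I ?S (coords M e j x) (coords M e j (prolongation M e j *\<^sub>v z))"
          by (simp add: tensor_form_kernel_eq z(2))
        also have "\<dots> = mform (inherited_mat M \<alpha>\<^sub>0 p e j) x (prolongation M e j *\<^sub>v z)"
          by (rule mform_inherited_mat[OF h N ord j1 x, symmetric]) (use prolongation_carrier[where M = M and e = e and k = j] z(1) in simp)
        also have "\<dots> = 0" by (rule orth[OF z(1)])
        finally show "tensor_form ?I ?S (coords M e j x) g = 0" .
      qed (use j coerM in auto)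
      then have "(nrm (grid ?I) (coords M e j x))\<^sup>2 \<le> (Ka * (edge M / real j) * sqrt a)\<^sup>2"
        by (intro power_mono nrm_nonneg)
      then have i: "inner_on (grid ?I) (coords M e j x) (coords M e j x) \<le> Ka\<^sup>2 * ((edge M)\<^sup>2 / (real j)\<^sup>2) * a"
        unfolding nrm_sq power_mult_distrib power_divide using a0 by simp
      have "mform (diag_part (inherited_mat M \<alpha>\<^sub>0 p e j)) x x
        \<le> real CARD('d) * ((24 + 4 * \<alpha>\<^sub>0) * (real p)\<^sup>2 * (real j + 1) / (edge M)\<^sup>2) * inner_on (grid ?I) (coords M e j x) (coords M e j x)"
        by (rule mform_diag_part_le[OF h N ord j1 _ x]) (use assms(3) in simp)
      \<comment> \<open>The h^-2 of the diagonal cancels the h^2 of the approximation property, and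
        (j + 1) / j^2 <= 2 / j leaves the order p^2 / j.\<close>
      also have "\<dots> \<le> real CARD('d) * ((24 + 4 * \<alpha>\<^sub>0) * (real p)\<^sup>2 * (2 * real j) / (edge M)\<^sup>2) * (Ka\<^sup>2 * ((edge M)\<^sup>2 / (real j)\<^sup>2) * a)"
        using i j assms(3) inner_on_nonneg[of "grid ?I" "coords M e j x"] h
        by (intro mult_mono mult_left_mono divide_right_mono) auto
      also have "\<dots> = C1 * (real p)\<^sup>2 / real j * a"
        unfolding C1_def using h j by (simp add: field_simps power2_eq_square)
      finally show ?thesis unfolding a .
    qed
    define T where "T = 20 * sqrt K"
    have T: "T > 0" "T\<^sup>2 = 400 * K" unfolding T_def using K by (auto simp: power_mult_distrib)
    have kp: "real k \<le> real p" "real k > 0" using k by auto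
    have mk: "T * (real p)\<^sup>2 \<le> real m * real k" using m kp unfolding T_def by (simp add: field_simps)
    have mpos: "real m > 0"
    proof -
      have "0 < T * (real p)\<^sup>2" using T p by simp
      then show ?thesis using mk kp by (metis less_le_trans zero_less_mult_pos2)
    qed
    then have m1: "m \<ge> 1" by simp
    define B where "B = 9 * C1 / c_lo * (real p) ^ 3 / (real m)\<^sup>2"
    have BK: "B = K * (real p) ^ 3 / (real m)\<^sup>2" unfolding B_def K_def ..
    have "(T * (real p)\<^sup>2)\<^sup>2 \<le> (real m * real k)\<^sup>2" using mk T by (intro power_mono) auto
    then have "400 * K * (real p) ^ 3 * real p \<le> (real m)\<^sup>2 * (real k)\<^sup>2"
      unfolding power_mult_distrib T by (simp add: power2_eq_square power3_eq_cube ac_simps)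
    \<comment> \<open>One factor k is enlarged to p, so that p cancels and exactly 400 B <= k
      remains.\<close>
    also have "\<dots> \<le> (real m)\<^sup>2 * (real k * real p)" using kp by (intro mult_left_mono) (auto simp: power2_eq_square)
    finally have "400 * K * (real p) ^ 3 \<le> (real m)\<^sup>2 * real k" using p by simp
    then have B400: "400 * B \<le> real k" unfolding BK using mpos by (simp add: field_simps)
    \<comment> \<open>As k <= p, the hypothesis on m implies p / m <= 1 / T. The contraction number
      is of the order (p^2 / (k m)) (p / m), and this factor is traded for the constant.\<close>
    have Tm: "T * real p \<le> real m"
    proof -
      have "T * real p * real p \<le> real m * real p"
        using mk kp mpos by (smt (verit) mult.assoc mult_left_mono power2_eq_square)
      then show ?thesis using p by simp
    qed
    have "16 * B / real k \<le> 16 * K / T * (real p)\<^sup>2 / (real k * real m)"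
    proof -
      have "16 * B / real k = 16 * K * (real p)\<^sup>2 / (real k * real m) * (real p / real m)"
        unfolding BK using mpos kp by (simp add: field_simps power2_eq_square power3_eq_cube)
      also have "\<dots> \<le> 16 * K * (real p)\<^sup>2 / (real k * real m) * (1 / T)"
        using Tm T mpos kp K by (intro mult_left_mono) (auto simp: field_simps)
      finally show ?thesis by (simp add: field_simps)
    qed
    moreover have "contraction B k \<le> 16 * B / real k"
      by (rule contraction_bound) (use B400 BK K k in auto)
    ultimately have con: "contraction B k \<le> 16 * K / T * (real p)\<^sup>2 / (real k * real m)" by linarith
    let ?A = "inherited_mat M \<alpha>\<^sub>0 p e k"
    have k1: "k \<in> {1..p}" using k by auto
    have "W_error M \<alpha>\<^sub>0 p e \<omega> m k \<in> carrier_mat (level_dim M k) (level_dim M k) \<and>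
      (\<forall>g\<in>carrier_vec (level_dim M k). sqrt (mform ?A (W_error M \<alpha>\<^sub>0 p e \<omega> m k *\<^sub>v g) (W_error M \<alpha>\<^sub>0 p e \<omega> m k *\<^sub>v g))
        \<le> contraction B k * sqrt (mform ?A g g))"
      unfolding B_def
    proof (rule W_cycle_contraction[OF h N ord c _ C1 assms(5) m1 _ _ k1])
      show "c * (dg_norm M p v)\<^sup>2 \<le> dg_form M \<alpha>\<^sub>0 p v v" if "v \<in> broken_space M p" for v by (rule coerM[OF that])
      show "\<omega> j > 0 \<and> \<omega> j * spec_radius (inv_mat (diag_part (inherited_mat M \<alpha>\<^sub>0 p e j)) * inherited_mat M \<alpha>\<^sub>0 p e j) \<le> 1 \<and> c_lo / (real p + 1) \<le> \<omega> j"
        if "j \<in> {2..p}" for j using \<omega> that by blast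
    qed (rule fine)
    then have "sqrt (mform ?A (W_error M \<alpha>\<^sub>0 p e \<omega> m k *\<^sub>v g) (W_error M \<alpha>\<^sub>0 p e \<omega> m k *\<^sub>v g)) \<le> contraction B k * sqrt (mform ?A g g)"
      using g by blast
    also have "\<dots> \<le> 16 * K / T * (real p)\<^sup>2 / (real k * real m) * sqrt (mform ?A g g)"
      using con mform_nonneg[OF spd_inherited_mat[OF h N ord k1 c] g] coerM by (intro mult_right_mono) auto
    finally show "power_norm ?A 1 (W_error M \<alpha>\<^sub>0 p e \<omega> m k *\<^sub>v g) \<le> 16 * K / (20 * sqrt K) * (real p)\<^sup>2 / (real k * real m) * power_norm ?A 1 g"
      unfolding power_norm_1[OF inherited_mat_carrier] T_def .
  qed
qed

end
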